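(* There is an absolute constant $\gamma>0$ such that the following holds. Let $p\in(1,\infty)$, $\alpha=1-1/p$ and $\beta<1-1/p$. Let $\sigma_j=j^{-\alpha}(\log(j+1))^{-\beta}$ for $1\le j\le N$, with associated $p$-ellipsoid $\mathcal{E}_p\subset\mathbb{R}^N$. If $p\ge2$, then for all $1\le n<N$ one has $$\mathcal{R}_n(\mathcal{E}_p)\approx\min\left\{1,\ n^{-1/2}(\log(N+1))^{-\beta}(\log(eN/n))^{\alpha}\right\}$$ with probability at least $1-e^{-\gamma n}-2e^{-\gamma pn^{2/p}}$. If $p<2$, then for all $1\le n<N$ one has $$n^{-1/2}(\log(n+1))^{-\beta}\lesssim\mathcal{R}_n(\mathcal{E}_p)\lesssim\min\left\{1,\ n^{-1/2}(\log(N+1))^{-\beta}(\log(eN/n))^{\alpha}\right\}$$ with probability at least $1-3e^{-\gamma n}$. Moreover, there is $c>0$ depending only on $p,\alpha,\beta$ such that for all $1\le n<N$ with $n\le c\,(\log(N+1))^{2(\alpha-\beta)}$, $$\mathbb{P}\left(\mathcal{R}_n(\mathcal{E}_p)\approx1\right)\ge1-2e^{-2n}.$$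
   Context: $\mathcal{E}_p=\{x\in\mathbb{R}^N:\sum_{i=1}^N(|x_i|/\sigma_i)^p\le1\}$. The $n$-th random radius is $\mathcal{R}_n(\mathcal{E}_p)=\max_{y\in E_n\cap\mathcal{E}_p}|y|$, where $|\cdot|$ is the Euclidean norm and $E_n$ is a random $n$-codimensional linear subspace of $\mathbb{R}^N$ distributed according to the normalized Haar measure on the Grassmannian. $a\lesssim b$ means $a\le Cb$ for a constant $C>0$ depending only on $p,\alpha,\beta$ (in particular independent of $n$ and $N$); $a\approx b$ means $a\lesssim b$ and $b\lesssim a$. The paper's range "$n\lesssim X$" is expressed as $n\le cX$. *)

theory Defs
  imports "HOL-Analysis.Analysis" "HOL-Library.Function_Algebras"
begin

text \<open>
  The dimension \<open>N\<close> is quantified inside the statement, so it cannot be a type.  Vectors are real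
  sequences with pointwise operations, and \<open>\<real>\<^sup>N\<close> is the subspace of sequences supported on
  \<open>{1..N}\<close>.  The instance makes \<^const>\<open>subspace\<close>, \<^const>\<open>linear\<close> and \<^const>\<open>dim\<close> available.
\<close>

instantiation "fun" :: (type, real_vector) real_vector
begin

definition scaleR_fun :: "real \<Rightarrow> ('a \<Rightarrow> 'b) \<Rightarrow> 'a \<Rightarrow> 'b"
  where "scaleR_fun c f = (\<lambda>i. c *\<^sub>R f i)"

instance
  by standard (simp_all add: scaleR_fun_def fun_eq_iff algebra_simps)

end

definition euclidean :: "nat \<Rightarrow> (nat \<Rightarrow> real) set"
  where "euclidean N = {x. \<forall>i. i \<notin> {1..N} \<longrightarrow> x i = 0}"

definition enorm :: "nat \<Rightarrow> (nat \<Rightarrow> real) \<Rightarrow> real"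
  where "enorm N x = L2_set x {1..N}"

definition grassmannian :: "nat \<Rightarrow> nat \<Rightarrow> (nat \<Rightarrow> real) set set"
  where "grassmannian N n = {E. E \<subseteq> euclidean N \<and> subspace E \<and> dim E + n = N}"

text \<open>
  \<open>gap N E F\<close> is the usual gap metric, i.e.\ the operator norm of the difference of the orthogonal
  projections onto \<open>E\<close> and \<open>F\<close>.
\<close>

definition one_sided_gap :: "nat \<Rightarrow> (nat \<Rightarrow> real) set \<Rightarrow> (nat \<Rightarrow> real) set \<Rightarrow> real"
  where "one_sided_gap N E F = (SUP x\<in>{x\<in>E. enorm N x \<le> 1}. INF y\<in>F. enorm N (x - y))"

definition gap :: "nat \<Rightarrow> (nat \<Rightarrow> real) set \<Rightarrow> (nat \<Rightarrow> real) set \<Rightarrow> real"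
  where "gap N E F = max (one_sided_gap N E F) (one_sided_gap N F E)"

definition grassmannian_open :: "nat \<Rightarrow> nat \<Rightarrow> (nat \<Rightarrow> real) set set \<Rightarrow> bool"
  where "grassmannian_open N n U \<longleftrightarrow> U \<subseteq> grassmannian N n \<and>
    (\<forall>E\<in>U. \<exists>\<epsilon>>0. \<forall>F\<in>grassmannian N n. gap N E F < \<epsilon> \<longrightarrow> F \<in> U)"

definition grassmannian_borel :: "nat \<Rightarrow> nat \<Rightarrow> (nat \<Rightarrow> real) set measure"
  where "grassmannian_borel N n = sigma (grassmannian N n) {U. grassmannian_open N n U}"

text \<open>
  Only the restriction of \<open>T\<close> to \<open>\<real>\<^sup>N\<close> matters; every orthogonal map of \<open>\<real>\<^sup>N\<close> is such a
  restriction.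
\<close>

definition orthogonal_map :: "nat \<Rightarrow> ((nat \<Rightarrow> real) \<Rightarrow> nat \<Rightarrow> real) \<Rightarrow> bool"
  where "orthogonal_map N T \<longleftrightarrow> linear T \<and> T ` euclidean N \<subseteq> euclidean N \<and>
    (\<forall>x\<in>euclidean N. \<forall>y\<in>euclidean N. (\<Sum>i=1..N. T x i * T y i) = (\<Sum>i=1..N. x i * y i))"

text \<open>
  The normalized Haar measure on the Grassmannian is the (unique) Borel probability measure that is
  invariant under the action of the orthogonal group; it is the law of the random subspace.
\<close>

definition haar_grassmannian :: "nat \<Rightarrow> nat \<Rightarrow> (nat \<Rightarrow> real) set measure \<Rightarrow> bool"
  where "haar_grassmannian N n \<mu> \<longleftrightarrow>
    space \<mu> = grassmannian N n \<and> sets \<mu> = sets (grassmannian_borel N n) \<and> emeasure \<mu> (space \<mu>) = 1 \<and>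
    (\<forall>T. orthogonal_map N T \<longrightarrow> (\<forall>A\<in>sets \<mu>. emeasure \<mu> ((\<lambda>E. T ` E) ` A) = emeasure \<mu> A))"

definition ellipsoid :: "nat \<Rightarrow> real \<Rightarrow> (nat \<Rightarrow> real) \<Rightarrow> (nat \<Rightarrow> real) set"
  where "ellipsoid N p \<sigma> = {x\<in>euclidean N. (\<Sum>i=1..N. (\<bar>x i\<bar> / \<sigma> i) powr p) \<le> 1}"

text \<open>The supremum is a maximum, by compactness.\<close>

definition section_radius :: "nat \<Rightarrow> (nat \<Rightarrow> real) set \<Rightarrow> (nat \<Rightarrow> real) set \<Rightarrow> real"
  where "section_radius N K E = (SUP y\<in>E \<inter> K. enorm N y)"

definition semiaxis :: "real \<Rightarrow> real \<Rightarrow> nat \<Rightarrow> real"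
  where "semiaxis \<alpha> \<beta> j = real j powr (-\<alpha>) * ln (real j + 1) powr (-\<beta>)"

definition lesssim_with :: "real \<Rightarrow> real \<Rightarrow> real \<Rightarrow> bool"
  where "lesssim_with C a b \<longleftrightarrow> a \<le> C * b"

definition approx_with :: "real \<Rightarrow> real \<Rightarrow> real \<Rightarrow> bool"
  where "approx_with C a b \<longleftrightarrow> lesssim_with C a b \<and> lesssim_with C b a"

definition upper_rate :: "real \<Rightarrow> real \<Rightarrow> nat \<Rightarrow> nat \<Rightarrow> real"
  where "upper_rate \<alpha> \<beta> n N =
    min 1 (real n powr (-1/2) * ln (real N + 1) powr (-\<beta>) * ln (exp 1 * real N / real n) powr \<alpha>)"

end

theory Submission
  imports Defs "HOL-Probability.Probability"
begin

text \<open>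
  A random subspace is realised, up to an arbitrarily small perturbation, as the kernel of a Gaussian
  \<open>n \<times> N\<close> array: the Haar measure and the law of the kernel are both invariant under rotations, so
  integrating an invariant closeness relation over the product of the two bounds the probability
  of a bad set of subspaces by that of a Gaussian event.

  The engine is a uniform lower bound for \<open>\<Sum>\<^sub>i b\<^sub>i |\<langle>X\<^sub>i, x\<rangle>|\<close> over a set \<open>T\<close>: symmetrisation and contraction, one
  row at a time, compare the supremum over \<open>T\<close> of its centred version with that of the single Gaussian
  form \<open>\<langle>\<Sum>\<^sub>i b\<^sub>i X\<^sub>i, x\<rangle>\<close>.  Applied to the rows and to points of the ellipsoid of fixed norm, it shows that
  the kernel misses all such points, which is the upper bound.

  Applied to the columns and to the unit sphere of \<open>\<real>\<^sup>n\<close>, for \<open>N\<close> much larger than \<open>n\<close>, it shows by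
  duality that the first column is a combination of later columns with small weighted \<open>p\<close>-norm; then
  a large multiple of the first basis vector, suitably corrected, lies in the kernel and in the ellipsoid.
  When \<open>N\<close> and \<open>n\<close> are comparable, a single Gaussian vector in the subspace suffices.
\<close>

text \<open>The Haar measure is given only by its axioms, with nothing to compute with. Hence the
  double count: a closeness relation preserved by rotations has the same mass seen from every
  subspace and every generic array, separability makes this mass positive, and it cancels. The rate
  comes from the dual exponent \<open>q = 1/\<alpha>\<close>: the q-th powers of the axes are j^(-1)
  log(j+1)^(-\<beta> q), their sum over n/1024 < j \<le> N is of order log(N+1)^(-\<beta> q)
  log(eN/n), and its power 1/q over sqrt n is the rate. For the lower bound only indices above
  max(Mn, sqrt N) are used, where log(j+1) and log(N+1) are comparable; their harmonic sum is of
  order log(eN/n) once N exceeds a multiple of n. Otherwise log(eN/n) is bounded, and one vector of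
  size N^(-1/2) log(N+1)^(-\<beta>) is enough. Its p-norm is the only source of the term
  exp(-\<gamma> p n^(2/p)). The value 1/2048 of \<gamma> halves the exponent 1/1024 of the upper
  bound, which leaves room for the failure probability of the lower one.\<close>

section \<open>Euclidean geometry\<close>

definition ip :: "nat \<Rightarrow> (nat \<Rightarrow> real) \<Rightarrow> (nat \<Rightarrow> real) \<Rightarrow> real"
  where "ip N x y = (\<Sum>i=1..N. x i * y i)"

lemma scaleR_fun_apply [simp]: "(c *\<^sub>R f) i = c *\<^sub>R f i"
  by (simp add: scaleR_fun_def)

lemma ip_commute: "ip N x y = ip N y x"
  by (simp add: ip_def mult.commute)

lemma ip_add_left: "ip N (x + y) z = ip N x z + ip N y z"
  by (simp add: ip_def algebra_simps sum.distrib)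

lemma ip_diff_left: "ip N (x - y) z = ip N x z - ip N y z"
  by (simp add: ip_def algebra_simps sum_subtractf)

lemma ip_scale_left: "ip N (c *\<^sub>R x) z = c * ip N x z"
  by (simp add: ip_def algebra_simps sum_distrib_left)

lemma ip_zero_left [simp]: "ip N 0 z = 0" "ip N z 0 = 0"
  by (simp_all add: ip_def)

lemma ip_add_right: "ip N z (x + y) = ip N z x + ip N z y"
  and ip_diff_right: "ip N z (x - y) = ip N z x - ip N z y"
  and ip_scale_right: "ip N z (c *\<^sub>R x) = c * ip N z x"
  by (simp_all add: ip_commute[of N z] ip_add_left ip_diff_left ip_scale_left)

lemma ip_sum_left: "ip N (\<Sum>i\<in>A. f i) z = (\<Sum>i\<in>A. ip N (f i) z)"
proof (induction A rule: infinite_finite_induct)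
  case (insert x A)
  then show ?case using ip_add_left[of N "f x" "sum f A" z] by (metis sum.insert)
qed (metis ip_zero_left(1) sum.infinite, metis ip_zero_left(1) sum.empty)

lemma ip_sum_right: "ip N z (\<Sum>i\<in>A. f i) = (\<Sum>i\<in>A. ip N z (f i))"
  by (simp add: ip_commute[of N z] ip_sum_left)

lemmas ip_simps = ip_add_left ip_add_right ip_diff_left ip_diff_right ip_scale_left ip_scale_right

lemma enorm_sq: "(enorm N x)\<^sup>2 = ip N x x"
  by (simp add: enorm_def L2_set_def ip_def sum_nonneg power2_eq_square)

lemma enorm_nonneg [simp]: "0 \<le> enorm N x"
  by (simp add: enorm_def)

lemma enorm_eq: "enorm N x = sqrt (ip N x x)"
  using enorm_sq[of N x] by (metis enorm_nonneg real_sqrt_unique)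

lemma ip_le: "ip N x y \<le> enorm N x * enorm N y"
proof -
  have "ip N x y \<le> (\<Sum>i=1..N. \<bar>x i\<bar> * \<bar>y i\<bar>)"
    unfolding ip_def by (intro sum_mono) (metis abs_ge_self abs_mult)
  also have "\<dots> \<le> L2_set x {1..N} * L2_set y {1..N}"
    by (rule L2_set_mult_ineq)
  finally show ?thesis by (simp add: enorm_def)
qed

lemma enorm_triangle: "enorm N (x + y) \<le> enorm N x + enorm N y"
  unfolding enorm_def plus_fun_def by (rule L2_set_triangle_ineq)

lemma enorm_zero [simp]: "enorm N 0 = 0"
  by (simp add: enorm_eq)

lemma enorm_scale: "enorm N (c *\<^sub>R x) = \<bar>c\<bar> * enorm N x"
  by (simp add: enorm_eq ip_simps real_sqrt_mult flip: mult.assoc)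

lemma enorm_minus: "enorm N (x - y) = enorm N (y - x)"
  using enorm_scale[of N "-1" "x - y"] by (simp add: scaleR_fun_def fun_eq_iff fun_diff_def)

lemma enorm_uminus [simp]: "enorm N (- x) = enorm N x"
  using enorm_minus[of N 0 x] by simp

lemma abs_ip_le: "\<bar>ip N x y\<bar> \<le> enorm N x * enorm N y"
  using ip_le[of N x y] ip_le[of N "- x" y] by (simp add: ip_def sum_negf)

lemma enorm_diff_le: "\<bar>enorm N x - enorm N y\<bar> \<le> enorm N (x - y)"
  using enorm_triangle[of N "x - y" y] enorm_triangle[of N "y - x" x] enorm_minus[of N x y] by simp

lemma abs_coord_le_enorm: "i \<in> {1..N} \<Longrightarrow> \<bar>x i\<bar> \<le> enorm N x"
  unfolding enorm_def using member_le_L2_set[of "{1..N}" i "\<lambda>i. \<bar>x i\<bar>"] by (simp add: L2_set_def)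

lemma subspace_euclidean: "subspace (euclidean N)"
  by (auto simp: subspace_def euclidean_def)

lemma enorm_eq_0D: "x \<in> euclidean N \<Longrightarrow> enorm N x = 0 \<Longrightarrow> x = 0"
proof (rule ext)
  fix i assume "x \<in> euclidean N" "enorm N x = 0"
  then show "x i = 0 i" using abs_coord_le_enorm[of i N x] by (cases "i \<in> {1..N}") (auto simp: euclidean_def)
qed

lemma enorm_pos: "x \<in> euclidean N \<Longrightarrow> x \<noteq> 0 \<Longrightarrow> 0 < enorm N x"
  using enorm_eq_0D[of x N] enorm_nonneg[of N x] by linarith

section \<open>Coordinate vectors, orthonormal systems, projections\<close>

definition unit :: "nat \<Rightarrow> nat \<Rightarrow> real"
  where "unit j = (\<lambda>i. if i = j then 1 else 0)"

lemma unit_apply: "unit j i = (if i = j then 1 else 0)"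
  by (simp add: unit_def)

lemma unit_in_euclidean: "j \<in> {1..N} \<Longrightarrow> unit j \<in> euclidean N"
  by (auto simp: euclidean_def unit_def)

lemma ip_unit: "j \<in> {1..N} \<Longrightarrow> ip N x (unit j) = x j"
  by (simp add: ip_def unit_def if_distrib cong: if_cong)

lemma euclidean_eq_sum_unit: "x \<in> euclidean N \<Longrightarrow> x = (\<Sum>j=1..N. x j *\<^sub>R unit j)"
proof (rule ext)
  fix i assume x: "x \<in> euclidean N"
  have *: "(\<Sum>j\<in>A. g j) i = (\<Sum>j\<in>A. g j i)" if "finite A" for A and g :: "nat \<Rightarrow> nat \<Rightarrow> real"
    using that by (induction A) auto
  show "x i = (\<Sum>j=1..N. x j *\<^sub>R unit j) i"
    using x by (subst *) (auto simp: unit_apply euclidean_def if_distrib cong: if_cong)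
qed

text \<open>Families are indexed from 0, coordinates from 1. Membership in R^N has to be demanded
  separately, because \<open>ip N\<close> does not see coordinates outside
  \<open>{1..N}\<close>.\<close>

definition orthonormal :: "nat \<Rightarrow> nat \<Rightarrow> (nat \<Rightarrow> nat \<Rightarrow> real) \<Rightarrow> bool"
  where "orthonormal N k f \<longleftrightarrow> (\<forall>i<k. f i \<in> euclidean N) \<and>
    (\<forall>i<k. \<forall>j<k. ip N (f i) (f j) = (if i = j then 1 else 0))"

lemma ip_orthonormal_sum:
  assumes "orthonormal N k f" "j < k"
  shows "ip N (\<Sum>i<k. c i *\<^sub>R f i) (f j) = c j"
proof -
  have "ip N (\<Sum>i<k. c i *\<^sub>R f i) (f j) = (\<Sum>i<k. c i * ip N (f i) (f j))"
    by (simp add: ip_sum_left ip_simps)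
  also have "\<dots> = (\<Sum>i<k. if i = j then c i else 0)"
    using assms by (intro sum.cong) (auto simp: orthonormal_def)
  finally show ?thesis using assms(2) by simp
qed

lemma orthonormal_independent:
  assumes "orthonormal N k f"
  shows "independent (f ` {..<k})" "inj_on f {..<k}" "card (f ` {..<k}) = k"
proof -
  show inj: "inj_on f {..<k}"
  proof (rule inj_onI)
    fix i j assume *: "i \<in> {..<k}" "j \<in> {..<k}" "f i = f j"
    have "ip N (f i) (f i) = 1" "ip N (f i) (f j) = (if i = j then 1 else 0)"
      using assms *(1,2) unfolding orthonormal_def by simp_all
    then show "i = j" unfolding *(3) by (auto split: if_splits)
  qed
  show "card (f ` {..<k}) = k" using inj by (simp add: card_image)
  show "independent (f ` {..<k})"
  proof (rule independent_if_scalars_zero)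
    fix g x assume g: "(\<Sum>x\<in>f ` {..<k}. g x *\<^sub>R x) = 0" and x: "x \<in> f ` {..<k}"
    then obtain j where j: "j < k" "x = f j" by auto
    have "(\<Sum>i<k. g (f i) *\<^sub>R f i) = 0" using g inj by (simp add: sum.reindex)
    then show "g x = 0"
      using ip_orthonormal_sum[OF assms j(1), of "\<lambda>i. g (f i)"] j by simp
  qed simp
qed

lemma span_units: "span (unit ` {1..N}) = euclidean N"
proof (rule span_subspace)
  show "unit ` {1..N} \<subseteq> euclidean N" using unit_in_euclidean by auto
  show "euclidean N \<subseteq> span (unit ` {1..N})"
  proof
    fix x assume "x \<in> euclidean N"
    then have "x = (\<Sum>j=1..N. x j *\<^sub>R unit j)" by (rule euclidean_eq_sum_unit)
    also have "\<dots> \<in> span (unit ` {1..N})"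
      by (intro span_sum span_scale span_base) auto
    finally show "x \<in> span (unit ` {1..N})" .
  qed
qed (rule subspace_euclidean)

lemma orthonormal_le:
  assumes "orthonormal N k f" shows "k \<le> N"
proof -
  have "f ` {..<k} \<subseteq> span (unit ` {1..N})"
    using assms unfolding span_units orthonormal_def by auto
  with independent_span_bound[OF _ orthonormal_independent(1)[OF assms], of "unit ` {1..N}"]
  have "k \<le> card (unit ` {1..N})" using orthonormal_independent(3)[OF assms] by simp
  also have "\<dots> \<le> card {1..N}" by (rule card_image_le) simp
  finally show ?thesis by simp
qed

definition oproj :: "nat \<Rightarrow> nat \<Rightarrow> (nat \<Rightarrow> nat \<Rightarrow> real) \<Rightarrow> (nat \<Rightarrow> real) \<Rightarrow> nat \<Rightarrow> real"
  where "oproj N k f x = (\<Sum>i<k. ip N x (f i) *\<^sub>R f i)"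

lemma oproj_in_span: "oproj N k f x \<in> span (f ` {..<k})"
  unfolding oproj_def by (intro span_sum span_scale span_base) auto

lemma ip_span_zero:
  assumes "z \<in> span S" "\<And>y. y \<in> S \<Longrightarrow> ip N x y = 0"
  shows "ip N x z = 0"
  using assms(1)
proof (induction rule: span_induct_alt)
  case (step c y z)
  then show ?case using assms(2) by (simp only: ip_simps)
next
  case base
  show ?case by (rule ip_zero_left)
qed

lemma ip_oproj_residual:
  assumes "orthonormal N k f" "z \<in> span (f ` {..<k})"
  shows "ip N (x - oproj N k f x) z = 0"
proof (rule ip_span_zero[OF assms(2)])
  fix y assume "y \<in> f ` {..<k}"
  then obtain j where "j < k" "y = f j" by auto
  then show "ip N (x - oproj N k f x) y = 0"
    by (simp only: ip_simps oproj_def ip_orthonormal_sum[OF assms(1)] diff_self)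
qed

text \<open>Lengths of orthonormal families are bounded by \<open>N\<close>, so some extension
  inside \<open>E\<close> is longest. Its span is \<open>E\<close>: a vector outside would leave a
  nonzero residual, whose normalisation extends the family once more.\<close>

lemma orthonormal_extend:
  assumes E: "subspace E" "E \<subseteq> euclidean N" and f: "orthonormal N k f" "f ` {..<k} \<subseteq> E"
  obtains g m where "orthonormal N m g" "k \<le> m" "\<And>i. i < k \<Longrightarrow> g i = f i"
    "span (g ` {..<m}) = E" "dim E = m"
proof -
  define P where "P m \<longleftrightarrow> (\<exists>g. orthonormal N m g \<and> k \<le> m \<and> (\<forall>i<k. g i = f i) \<and> g ` {..<m} \<subseteq> E)" for m
  have "P k" using f by (auto simp: P_def)
  have bd: "\<forall>m. P m \<longrightarrow> m \<le> N" by (auto simp: P_def dest: orthonormal_le)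
  define m where "m = (GREATEST m. P m)"
  have "P m" unfolding m_def using \<open>P k\<close> bd by (blast intro: GreatestI_nat)
  then obtain g where g: "orthonormal N m g" "k \<le> m" "\<forall>i<k. g i = f i" "g ` {..<m} \<subseteq> E"
    by (auto simp: P_def)
  have "\<not> P (Suc m)" using Greatest_le_nat[of P "Suc m" N] bd by (auto simp: m_def)
  have "span (g ` {..<m}) = E"
  proof (rule ccontr)
    assume ne: "span (g ` {..<m}) \<noteq> E"
    have "span (g ` {..<m}) \<subseteq> E" using g(4) E(1) by (simp add: span_minimal)
    with ne obtain x where x: "x \<in> E" "x \<notin> span (g ` {..<m})" by auto
    define y where "y = x - oproj N m g x"
    have yE: "y \<in> E" using x(1) oproj_in_span[of N m g x] \<open>span (g ` {..<m}) \<subseteq> E\<close> E(1)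
      by (auto simp: y_def intro!: subspace_diff)
    have "y \<noteq> 0" using x(2) oproj_in_span[of N m g x] by (auto simp: y_def)
    with yE E(2) have ypos: "0 < enorm N y" by (auto intro: enorm_pos)
    have yo: "ip N y (g i) = 0" if "i < m" for i
      unfolding y_def using that by (intro ip_oproj_residual[OF g(1)] span_base) auto
    define h where "h = g(m := (1 / enorm N y) *\<^sub>R y)"
    have 1: "ip N (h m) (h m) = 1"
      using ypos unfolding h_def fun_upd_same ip_simps by (simp add: power2_eq_square flip: enorm_sq[of N y])
    have "orthonormal N (Suc m) h"
      unfolding orthonormal_def
    proof (intro conjI allI impI)
      fix i assume "i < Suc m"
      then show "h i \<in> euclidean N"
        using g(1) yE E subspace_euclidean by (auto simp: h_def orthonormal_def less_Suc_eq intro!: subspace_scale)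
      fix j assume "j < Suc m"
      show "ip N (h i) (h j) = (if i = j then 1 else 0)"
      proof (cases "i = m \<or> j = m")
        case True
        then show ?thesis using 1 yo \<open>i < Suc m\<close> \<open>j < Suc m\<close> ip_commute[of N "g i" y]
          by (auto simp: h_def ip_simps)
      next
        case False
        then show ?thesis using g(1) \<open>i < Suc m\<close> \<open>j < Suc m\<close> by (auto simp: h_def orthonormal_def)
      qed
    qed
    moreover have "h ` {..<Suc m} \<subseteq> E"
      using g(4) yE E(1) by (auto simp: h_def less_Suc_eq intro: subspace_scale)
    ultimately have "P (Suc m)" unfolding P_def using g(2,3) by (intro exI[of _ h]) (auto simp: h_def)
    with \<open>\<not> P (Suc m)\<close> show False by simp
  qed
  moreover have "dim E = m"
    using orthonormal_independent[OF g(1)] calculation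
    by (metis dim_span dim_eq_card_independent)
  ultimately show ?thesis using that g by auto
qed

lemma orthonormal_basis:
  assumes "subspace E" "E \<subseteq> euclidean N"
  obtains g where "orthonormal N (dim E) g" "span (g ` {..<dim E}) = E"
proof -
  have "orthonormal N 0 (\<lambda>_. 0)" by (simp add: orthonormal_def)
  from orthonormal_extend[OF assms this] that show ?thesis by (metis empty_subsetI image_empty lessThan_0)
qed

lemma dim_euclidean: "dim (euclidean N) = N"
proof -
  have "orthonormal N N (\<lambda>i. unit (Suc i))"
    by (auto simp: orthonormal_def unit_in_euclidean ip_unit) (auto simp: unit_apply)
  then have "independent ((\<lambda>i. unit (Suc i)) ` {..<N})" "card ((\<lambda>i. unit (Suc i)) ` {..<N}) = N"
    by (auto dest: orthonormal_independent)
  moreover have "(\<lambda>i. unit (Suc i)) ` {..<N} = unit ` {1..N}"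
    by (metis image_Suc_lessThan image_image)
  ultimately show ?thesis
    by (metis dim_eq_card_independent dim_span span_units)
qed

section \<open>Subspaces of codimension n as kernels of orthonormal frames\<close>

definition ker :: "nat \<Rightarrow> nat set \<Rightarrow> (nat \<Rightarrow> nat \<Rightarrow> real) \<Rightarrow> (nat \<Rightarrow> real) set"
  where "ker N I f = {x \<in> euclidean N. \<forall>i\<in>I. ip N x (f i) = 0}"

lemma subspace_ker: "subspace (ker N I f)"
  using subspace_euclidean[of N] by (auto simp: ker_def subspace_def ip_simps)

text \<open>Dimension count by contradiction: append an orthonormal basis \<open>g\<close> of the
  kernel to \<open>f\<close>. If the result were not a basis of R^N, a further unit vector
  orthogonal to all of it would lie in the kernel, hence in the span of \<open>g\<close>, and be
  orthogonal to itself.\<close>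

lemma ker_in_grassmannian:
  assumes f: "orthonormal N n f" shows "ker N {..<n} f \<in> grassmannian N n"
proof -
  let ?E = "ker N {..<n} f"
  have E: "subspace ?E" "?E \<subseteq> euclidean N" by (auto simp: subspace_ker, auto simp: ker_def)
  obtain g where g: "orthonormal N (dim ?E) g" "span (g ` {..<dim ?E}) = ?E"
    using orthonormal_basis[OF E] by auto
  define k where "k = dim ?E"
  have gk: "orthonormal N k g" "span (g ` {..<k}) = ?E" using g by (auto simp: k_def)
  define h where "h i = (if i < n then f i else g (i - n))" for i
  have gE: "g i \<in> ?E" if "i < k" for i using gk(2) that by (auto intro: span_base)
  then have fg: "ip N (g i) (f j) = 0" "ip N (f j) (g i) = 0" if "i < k" "j < n" for i j
    using that ip_commute[of N "g i" "f j"] by (auto simp: ker_def)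
  have h: "orthonormal N (n + k) h"
    unfolding orthonormal_def
  proof (intro conjI allI impI)
    fix i assume i: "i < n + k"
    show "h i \<in> euclidean N" using f gk(1) i by (auto simp: h_def orthonormal_def)
    fix j assume j: "j < n + k"
    have "i - n < k" if "\<not> i < n" using that i by auto
    moreover have "j - n < k" if "\<not> j < n" using that j by auto
    ultimately show "ip N (h i) (h j) = (if i = j then 1 else 0)"
      using f gk(1) i j fg by (auto simp: h_def orthonormal_def)
  qed
  have hE: "h ` {..<n + k} \<subseteq> euclidean N" using h by (auto simp: orthonormal_def)
  obtain h' m where h': "orthonormal N m h'" "n + k \<le> m" "\<And>i. i < n + k \<Longrightarrow> h' i = h i"
     "span (h' ` {..<m}) = euclidean N" "dim (euclidean N) = m"
    using orthonormal_extend[OF subspace_euclidean subset_refl h hE] by metis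
  have "m = N" using h'(5) dim_euclidean by simp
  have "n + k = N"
  proof (rule ccontr)
    assume "n + k \<noteq> N"
    with h'(2) \<open>m = N\<close> have lt: "n + k < m" by simp
    let ?x = "h' (n + k)"
    have 0: "ip N ?x (h i) = 0" if "i < n + k" for i
      using h'(1,3) lt that unfolding orthonormal_def by (metis less_trans nat_neq_iff)
    have "ip N ?x (f i) = 0" if "i < n" for i using 0[of i] that by (simp add: h_def)
    then have "?x \<in> ?E" using h'(1) lt by (auto simp: ker_def orthonormal_def)
    then have "?x \<in> span (g ` {..<k})" using gk(2) by simp
    then have "ip N ?x ?x = 0"
    proof (rule ip_span_zero)
      fix z assume "z \<in> g ` {..<k}"
      then obtain i where i: "i < k" "z = g i" by auto
      then show "ip N ?x z = 0" using 0[of "n + i"] by (simp add: h_def)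
    qed
    then show False using h'(1) lt by (auto simp: orthonormal_def)
  qed
  then show ?thesis using E by (auto simp: grassmannian_def k_def)
qed

text \<open>Complete an orthonormal basis of \<open>E\<close> to one of R^N; the \<open>n\<close>
  appended vectors are the normals that cut out \<open>E\<close>.\<close>

lemma grassmannian_ker:
  assumes "E \<in> grassmannian N n"
  obtains f where "orthonormal N n f" "E = ker N {..<n} f"
proof -
  have E: "subspace E" "E \<subseteq> euclidean N" "dim E + n = N" using assms by (auto simp: grassmannian_def)
  define k where "k = dim E"
  obtain g where g: "orthonormal N k g" "span (g ` {..<k}) = E"
    using orthonormal_basis[OF E(1,2)] by (auto simp: k_def)
  have gE: "g ` {..<k} \<subseteq> euclidean N" using g(1) by (auto simp: orthonormal_def)
  obtain h m where h: "orthonormal N m h" "k \<le> m" "\<And>i. i < k \<Longrightarrow> h i = g i"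
     "span (h ` {..<m}) = euclidean N" "dim (euclidean N) = m"
    using orthonormal_extend[OF subspace_euclidean subset_refl g(1) gE] by metis
  have m: "m = N" "m = k + n" using h(5) dim_euclidean E(3) by (auto simp: k_def)
  define f where "f i = h (k + i)" for i
  have f: "orthonormal N n f" using h(1) m by (auto simp: orthonormal_def f_def)
  have "E \<subseteq> ker N {..<n} f"
  proof
    fix x assume x: "x \<in> E"
    have "ip N x (f j) = 0" if "j < n" for j
    proof -
      have "ip N (f j) x = 0"
      proof (rule ip_span_zero)
        show "x \<in> span (g ` {..<k})" using x g(2) by simp
        fix z assume "z \<in> g ` {..<k}"
        then obtain i where i: "i < k" "z = h i" using h(3) by auto
        have "k + j < m" "i < m" "k + j \<noteq> i" using i that m by auto
        then show "ip N (f j) z = 0" using h(1) i(2) unfolding orthonormal_def f_def by simp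
      qed
      then show ?thesis by (simp add: ip_commute)
    qed
    then show "x \<in> ker N {..<n} f" using x E by (auto simp: ker_def)
  qed
  moreover have "ker N {..<n} f \<subseteq> E"
  proof
    fix x assume x: "x \<in> ker N {..<n} f"
    have "x \<in> span (h ` {..<m})" using x h(4) by (auto simp: ker_def)
    then have "ip N (x - oproj N m h x) (x - oproj N m h x) = 0"
      by (intro ip_oproj_residual[OF h(1)] span_diff oproj_in_span)
    moreover have "x - oproj N m h x \<in> euclidean N"
      using \<open>x \<in> span (h ` {..<m})\<close> h(4) oproj_in_span[of N m h x] subspace_euclidean by (auto intro: subspace_diff)
    ultimately have "x - oproj N m h x = 0" by (intro enorm_eq_0D) (simp_all add: enorm_eq)
    then have "x = (\<Sum>i<m. ip N x (h i) *\<^sub>R h i)" by (simp add: oproj_def)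
    also have "\<dots> \<in> E"
    proof (intro subspace_sum[OF E(1)])
      fix i assume i: "i \<in> {..<m}"
      show "ip N x (h i) *\<^sub>R h i \<in> E"
      proof (cases "i < k")
        case True
        then have "h i \<in> E" using g(2) h(3) by (metis imageI lessThan_iff span_base)
        then show ?thesis using E(1) by (rule subspace_scale[rotated])
      next
        case False
        then have "ip N x (f (i - k)) = 0" using x i m by (auto simp: ker_def)
        then have "ip N x (h i) = 0" using False by (simp add: f_def)
        then show ?thesis using E(1) by (simp add: subspace_0)
      qed
    qed
    finally show "x \<in> E" .
  qed
  ultimately show ?thesis using that f by blast
qed

lemma oproj_ker_residual:
  assumes "orthonormal N n f" "x \<in> euclidean N"
  shows "x - oproj N n f x \<in> ker N {..<n} f"
proof -
  have "oproj N n f x \<in> euclidean N"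
    using oproj_in_span[of N n f x] assms(1) span_minimal[OF _ subspace_euclidean, of "f ` {..<n}" N]
    by (auto simp: orthonormal_def)
  then show ?thesis
    using assms ip_oproj_residual[OF assms(1)] subspace_euclidean
    by (auto simp: ker_def intro!: subspace_diff span_base)
qed

lemma pythagoras: "ip N x y = 0 \<Longrightarrow> (enorm N (x + y))\<^sup>2 = (enorm N x)\<^sup>2 + (enorm N y)\<^sup>2"
  by (simp add: enorm_sq ip_simps ip_commute[of N y x])

text \<open>The residual of \<open>x\<close> minus \<open>y\<close> lies in the kernel and is
  orthogonal to the projection, so Pythagoras applies. Distances to kernels thereby become explicit
  norms, hence measurable functions of the frame.\<close>

lemma ker_nearest:
  assumes f: "orthonormal N n f" and x: "x \<in> euclidean N" and y: "y \<in> ker N {..<n} f"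
  shows "enorm N (oproj N n f x) \<le> enorm N (x - y)"
proof -
  let ?p = "oproj N n f x"
  have "ip N (x - ?p - y) z = 0" if "z \<in> span (f ` {..<n})" for z
  proof (rule ip_span_zero[OF that])
    fix z assume "z \<in> f ` {..<n}"
    then show "ip N (x - ?p - y) z = 0"
      using oproj_ker_residual[OF f x] y by (auto simp only: ker_def ip_simps lessThan_iff mem_Collect_eq)
  qed
  then have "ip N (x - ?p - y) ?p = 0" using oproj_in_span by blast
  then have "(enorm N ((x - ?p - y) + ?p))\<^sup>2 = (enorm N (x - ?p - y))\<^sup>2 + (enorm N ?p)\<^sup>2"
    by (rule pythagoras)
  then have "(enorm N ?p)\<^sup>2 \<le> (enorm N (x - y))\<^sup>2" by (simp add: algebra_simps)
  then show ?thesis by (simp add: power2_le_iff_abs_le)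
qed

lemma enorm_residual_le:
  assumes f: "orthonormal N n f"
  shows "enorm N (x - oproj N n f x) \<le> enorm N x"
proof -
  let ?p = "oproj N n f x"
  have "ip N (x - ?p) ?p = 0" by (rule ip_oproj_residual[OF f oproj_in_span])
  then have "(enorm N ((x - ?p) + ?p))\<^sup>2 = (enorm N (x - ?p))\<^sup>2 + (enorm N ?p)\<^sup>2"
    by (rule pythagoras)
  then have "(enorm N (x - ?p))\<^sup>2 \<le> (enorm N x)\<^sup>2" by simp
  then show ?thesis by (simp add: power2_le_iff_abs_le)
qed

section \<open>Rotations acting transitively on frames and on subspaces\<close>

definition reflect :: "nat \<Rightarrow> (nat \<Rightarrow> real) \<Rightarrow> (nat \<Rightarrow> real) \<Rightarrow> nat \<Rightarrow> real"
  where "reflect N w x = x - (2 * ip N x w / ip N w w) *\<^sub>R w"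

lemma reflect_orthogonal:
  assumes "w \<in> euclidean N" shows "orthogonal_map N (reflect N w)"
  unfolding orthogonal_map_def
proof (intro conjI ballI)
  show "linear (reflect N w)"
  proof (rule linearI)
    fix x y :: "nat \<Rightarrow> real" and c :: real
    show "reflect N w (x + y) = reflect N w x + reflect N w y"
      unfolding reflect_def ip_add_left distrib_left add_divide_distrib scaleR_left_distrib by simp
    show "reflect N w (c *\<^sub>R x) = c *\<^sub>R reflect N w x"
      unfolding reflect_def ip_scale_left scaleR_right_diff_distrib scaleR_scaleR by (simp add: mult.left_commute)
  qed
  show "reflect N w ` euclidean N \<subseteq> euclidean N"
    using assms subspace_euclidean by (auto simp: reflect_def intro!: subspace_diff subspace_scale)
  fix x y
  have "ip N (reflect N w x) (reflect N w y) = ip N x y"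
  \<comment> \<open>In the degenerate case \<open>x / 0 = 0\<close> turns the reflection into the
    identity.\<close>
  proof (cases "ip N w w = 0")
    case False
    define a where "a = 2 * ip N x w / ip N w w"
    define b where "b = 2 * ip N y w / ip N w w"
    have *: "a * ip N w w = 2 * ip N x w" "b * ip N w w = 2 * ip N y w"
      using False by (simp_all add: a_def b_def)
    have "ip N (reflect N w x) (reflect N w y) = ip N x y - b * ip N x w - a * ip N y w + a * (b * ip N w w)"
      unfolding reflect_def a_def[symmetric] b_def[symmetric] ip_simps ip_commute[of N w y]
      by (simp add: algebra_simps)
    moreover have "b * (a * ip N w w) = a * (b * ip N w w)" by simp
    ultimately show ?thesis unfolding * by simp
  qed (simp add: reflect_def)
  then show "(\<Sum>i=1..N. reflect N w x i * reflect N w y i) = (\<Sum>i=1..N. x i * y i)"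
    by (simp add: ip_def)
qed

lemma reflect_involution: "reflect N w (reflect N w x) = x"
proof (cases "ip N w w = 0")
  case False
  have "ip N (reflect N w x) w = - ip N x w"
    unfolding reflect_def ip_simps using False by simp
  then show ?thesis unfolding reflect_def[of N w "reflect N w x"] by (simp add: reflect_def[of N w x])
qed (simp add: reflect_def)

lemma orthogonal_map_id: "orthogonal_map N (\<lambda>x. x)"
  by (auto simp: orthogonal_map_def linear_ident)

lemma orthogonal_map_comp:
  assumes "orthogonal_map N S" "orthogonal_map N T" shows "orthogonal_map N (\<lambda>x. S (T x))"
proof -
  have "linear (\<lambda>x. S (T x))"
    using assms linear_compose[of T S] unfolding orthogonal_map_def o_def by blast
  moreover have "T x \<in> euclidean N" if "x \<in> euclidean N" for x
    using assms(2) that unfolding orthogonal_map_def by blast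
  ultimately show ?thesis using assms unfolding orthogonal_map_def by auto
qed

lemma orthogonal_map_ip:
  "orthogonal_map N T \<Longrightarrow> x \<in> euclidean N \<Longrightarrow> y \<in> euclidean N \<Longrightarrow> ip N (T x) (T y) = ip N x y"
  by (auto simp: orthogonal_map_def ip_def)

lemma orthogonal_map_in: "orthogonal_map N T \<Longrightarrow> x \<in> euclidean N \<Longrightarrow> T x \<in> euclidean N"
  by (auto simp: orthogonal_map_def)

text \<open>Unit vectors of equal inner product with everything fixed so far are exchanged by a reflection.\<close>

lemma orthonormal_transitive:
  assumes e: "orthonormal N k e" and f: "orthonormal N k f"
  shows "\<exists>T T'. orthogonal_map N T \<and> orthogonal_map N T' \<and> (\<forall>x. T (T' x) = x) \<and> (\<forall>x. T' (T x) = x) \<and>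
    (\<forall>i<k. T (e i) = f i)"
  using e f
proof (induction k)
  case 0
  show ?case using orthogonal_map_id by (intro exI[of _ "\<lambda>x. x"]) auto
next
  case (Suc k)
  have "orthonormal N k e" "orthonormal N k f" using Suc.prems by (auto simp: orthonormal_def)
  from Suc.IH[OF this] obtain T T' where T: "orthogonal_map N T" "orthogonal_map N T'"
    "\<And>x. T (T' x) = x" "\<And>x. T' (T x) = x" "\<And>i. i < k \<Longrightarrow> T (e i) = f i" by auto
  have eE: "e i \<in> euclidean N" "f i \<in> euclidean N" if "i < Suc k" for i
    using Suc.prems that by (auto simp: orthonormal_def)
  define a where "a = T (e k)"
  define b where "b = f k"
  have ab: "a \<in> euclidean N" "b \<in> euclidean N" using eE T(1) by (auto simp: a_def b_def orthogonal_map_in)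
  have aa: "ip N a a = 1" "ip N b b = 1"
    using Suc.prems eE orthogonal_map_ip[OF T(1)] by (auto simp: a_def b_def orthonormal_def)
  have a0: "ip N (f i) a = 0" "ip N (f i) b = 0" if "i < k" for i
  proof -
    have "ip N (f i) a = ip N (T (e i)) (T (e k))" using T(5) that by (simp add: a_def)
    also have "\<dots> = ip N (e i) (e k)" using that eE by (intro orthogonal_map_ip T) auto
    also have "\<dots> = 0" using Suc.prems that by (auto simp: orthonormal_def)
    finally show "ip N (f i) a = 0" .
    show "ip N (f i) b = 0" using Suc.prems that by (auto simp: orthonormal_def b_def)
  qed
  define w where "w = a - b"
  have w: "w \<in> euclidean N" using ab subspace_euclidean by (auto simp: w_def intro: subspace_diff)
  let ?R = "reflect N w"
  have Rf: "?R (f i) = f i" if "i < k" for i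
    using a0[OF that] by (auto simp: reflect_def w_def ip_simps fun_eq_iff)
  have Ra: "?R a = b"
  proof (cases "ip N w w = 0")
    case True
    then have "w = 0" using w by (intro enorm_eq_0D) (simp_all add: enorm_eq)
    then show ?thesis by (auto simp: reflect_def w_def)
  next
    case False
    moreover have "2 * ip N a w = ip N w w"
      by (simp add: w_def ip_simps aa ip_commute[of N b a])
    ultimately show ?thesis by (simp add: reflect_def) (simp add: w_def fun_eq_iff)
  qed
  show ?case
  proof (intro exI conjI allI impI)
    show "orthogonal_map N (\<lambda>x. ?R (T x))" "orthogonal_map N (\<lambda>x. T' (?R x))"
      using reflect_orthogonal[OF w] T by (auto intro: orthogonal_map_comp)
    show "?R (T (T' (?R x))) = x" "T' (?R (?R (T x))) = x" for x
      by (simp_all add: T reflect_involution)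
    show "?R (T (e i)) = f i" if "i < Suc k" for i
      using that T(5) Rf Ra by (auto simp: less_Suc_eq a_def b_def)
  qed
qed

text \<open>A frame of normals of \<open>E\<close> is rotated into one of \<open>F\<close>. The
  inverse \<open>T'\<close> is returned explicitly because \<open>orthogonal_map\<close> constrains
  \<open>T\<close> only on R^N, whereas later arguments rewrite with \<open>T (T' x) = x\<close> for
  all sequences \<open>x\<close>.\<close>

lemma grassmannian_transitive:
  assumes "E \<in> grassmannian N n" "F \<in> grassmannian N n"
  obtains T T' where "orthogonal_map N T" "orthogonal_map N T'" "\<And>x. T (T' x) = x" "\<And>x. T' (T x) = x"
    "T ` E = F"
proof -
  obtain e where e: "orthonormal N n e" "E = ker N {..<n} e" using assms(1) by (rule grassmannian_ker)
  obtain f where f: "orthonormal N n f" "F = ker N {..<n} f" using assms(2) by (rule grassmannian_ker)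
  obtain T T' where T: "orthogonal_map N T" "orthogonal_map N T'" "\<And>x. T (T' x) = x" "\<And>x. T' (T x) = x"
    "\<And>i. i < n \<Longrightarrow> T (e i) = f i"
    using orthonormal_transitive[OF e(1) f(1)] by auto
  have ipT: "ip N (T x) (f i) = ip N x (e i)" if "x \<in> euclidean N" "i < n" for x i
    using orthogonal_map_ip[OF T(1) that(1), of "e i"] e(1) that T(5) by (auto simp: orthonormal_def)
  have "T x \<in> F" if "x \<in> E" for x
    using that e f ipT T(1) by (auto simp: ker_def orthogonal_map_in)
  moreover have "T' x \<in> E" if "x \<in> F" for x
    using that e f ipT[of "T' x"] T by (auto simp: ker_def orthogonal_map_in)
  then have "F \<subseteq> T ` E" using T(3) by (metis image_eqI subsetI)
  ultimately show ?thesis using that T by blast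
qed

section \<open>Section radii under perturbation of the subspace\<close>

definition edist :: "nat \<Rightarrow> (nat \<Rightarrow> real) \<Rightarrow> (nat \<Rightarrow> real) set \<Rightarrow> real"
  where "edist N x E = (INF y\<in>E. enorm N (x - y))"

text \<open>Homogeneous form of a bound on the one-sided gap, with a nearby point in place of a
  supremum of infima.\<close>

definition near :: "real \<Rightarrow> nat \<Rightarrow> (nat \<Rightarrow> real) set \<Rightarrow> (nat \<Rightarrow> real) set \<Rightarrow> bool"
  where "near \<delta> N E F \<longleftrightarrow> (\<forall>x\<in>E. \<exists>y\<in>F. enorm N (x - y) \<le> \<delta> * enorm N x)"

lemma bdd_below_enorm: "bdd_below ((\<lambda>y. enorm N (f y)) ` E)"
  by (rule bdd_belowI[of _ 0]) auto

lemma edist_le: "y \<in> E \<Longrightarrow> edist N x E \<le> enorm N (x - y)"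
  unfolding edist_def by (intro cINF_lower bdd_below_enorm)

lemma edist_nonneg: "E \<noteq> {} \<Longrightarrow> 0 \<le> edist N x E"
  unfolding edist_def by (intro cINF_greatest) auto

lemma edist_ker:
  assumes f: "orthonormal N n f" and x: "x \<in> euclidean N"
  shows "edist N x (ker N {..<n} f) = enorm N (oproj N n f x)"
proof (rule antisym)
  show "edist N x (ker N {..<n} f) \<le> enorm N (oproj N n f x)"
    using edist_le[OF oproj_ker_residual[OF f x], where N=N and x=x] by simp
  show "enorm N (oproj N n f x) \<le> edist N x (ker N {..<n} f)"
    unfolding edist_def using oproj_ker_residual[OF f x] ker_nearest[OF f x]
    by (intro cINF_greatest) auto
qed

lemma grassmannianD:
  assumes "E \<in> grassmannian N n"
  shows "subspace E" "E \<subseteq> euclidean N" "0 \<in> E"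
  using assms by (auto simp: grassmannian_def subspace_0)

lemma edist_attained:
  assumes E: "E \<in> grassmannian N n" and x: "x \<in> euclidean N"
  obtains y where "y \<in> E" "enorm N (x - y) = edist N x E" "enorm N y \<le> enorm N x"
proof -
  obtain f where f: "orthonormal N n f" "E = ker N {..<n} f" using E by (rule grassmannian_ker)
  show ?thesis
    by (rule that[of "x - oproj N n f x"])
      (use f oproj_ker_residual[OF f(1) x] edist_ker[OF f(1) x] enorm_residual_le[OF f(1)] in auto)
qed

lemma near_iff_edist:
  assumes E: "E \<in> grassmannian N n" and F: "F \<in> grassmannian N m"
  shows "near \<delta> N E F \<longleftrightarrow> (\<forall>x\<in>E. edist N x F \<le> \<delta> * enorm N x)"
proof
  assume "near \<delta> N E F"
  then show "\<forall>x\<in>E. edist N x F \<le> \<delta> * enorm N x"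
    unfolding near_def using edist_le order_trans by blast
next
  assume *: "\<forall>x\<in>E. edist N x F \<le> \<delta> * enorm N x"
  show "near \<delta> N E F" unfolding near_def
  proof
    fix x assume x: "x \<in> E"
    then obtain y where "y \<in> F" "enorm N (x - y) = edist N x F"
      using edist_attained[OF F] grassmannianD(2)[OF E] by blast
    with * x show "\<exists>y\<in>F. enorm N (x - y) \<le> \<delta> * enorm N x" by metis
  qed
qed

lemma edist_near:
  assumes E: "E \<in> grassmannian N n" and near: "near \<delta> N E F" and \<delta>: "0 \<le> \<delta>" and x: "x \<in> euclidean N"
  shows "edist N x F \<le> edist N x E + \<delta> * enorm N x"
proof -
  obtain y where y: "y \<in> E" "enorm N (x - y) = edist N x E" "enorm N y \<le> enorm N x"
    using edist_attained[OF E x] by blast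
  obtain z where z: "z \<in> F" "enorm N (y - z) \<le> \<delta> * enorm N y" using near y(1) by (auto simp: near_def)
  have "edist N x F \<le> enorm N ((x - y) + (y - z))" using edist_le[OF z(1), where N=N and x=x] by (metis diff_add_cancel add_diff_eq)
  also have "\<dots> \<le> enorm N (x - y) + enorm N (y - z)" by (rule enorm_triangle)
  also have "enorm N (y - z) \<le> \<delta> * enorm N x" using z(2) y(3) \<delta> mult_left_mono order_trans by blast
  finally show ?thesis unfolding y(2) by simp
qed

lemma one_sided_gap_near:
  assumes E: "E \<in> grassmannian N n" and F: "F \<in> grassmannian N m" and gap: "one_sided_gap N E F < \<epsilon>"
  shows "near \<epsilon> N E F"
  unfolding near_iff_edist[OF E F]
proof
  fix x assume x: "x \<in> E"
  show "edist N x F \<le> \<epsilon> * enorm N x"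
  proof (cases "x = 0")
    case True
    then show ?thesis using edist_le[OF grassmannianD(3)[OF F], where N=N and x=x] by simp
  next
    case False
    have xN: "x \<in> euclidean N" using x grassmannianD[OF E] by auto
    have pos: "0 < enorm N x" using enorm_pos[OF xN False] .
    define u where "u = (1 / enorm N x) *\<^sub>R x"
    have u: "u \<in> E" "enorm N u = 1" "enorm N x *\<^sub>R u = x" using x grassmannianD(1)[OF E] pos
      by (auto simp: u_def enorm_scale intro: subspace_scale)
    \<comment> \<open>Comparison with the point 0 of \<open>F\<close> bounds the family; for an
      unbounded family the supremum in \<open>one_sided_gap\<close> would carry no
      information.\<close>
    have "edist N v F \<le> 1" if "v \<in> E" "enorm N v \<le> 1" for v
      using edist_le[OF grassmannianD(3)[OF F], where N=N and x=v] that by simp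
    then have bdd: "bdd_above ((\<lambda>x. edist N x F) ` {x \<in> E. enorm N x \<le> 1})"
      by (intro bdd_aboveI[of _ 1]) auto
    have "edist N u F \<le> one_sided_gap N E F"
      unfolding one_sided_gap_def edist_def[symmetric] using u by (intro cSUP_upper bdd) auto
    then have le: "edist N u F \<le> \<epsilon>" using gap by simp
    obtain y where y: "y \<in> F" "enorm N (u - y) = edist N u F"
      using edist_attained[OF F] u(1) grassmannianD(2)[OF E] by blast
    have "edist N x F \<le> enorm N (x - enorm N x *\<^sub>R y)"
      using y(1) grassmannianD(1)[OF F] by (intro edist_le subspace_scale)
    also have "x - enorm N x *\<^sub>R y = enorm N x *\<^sub>R (u - y)" using u(3) by (simp add: scaleR_right_diff_distrib)
    also have "enorm N \<dots> = enorm N x * edist N u F" using y(2) by (simp add: enorm_scale)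
    finally show ?thesis using le pos by (simp add: mult.commute mult_left_mono order_trans)
  qed
qed

lemma gap_near:
  assumes "E \<in> grassmannian N n" "F \<in> grassmannian N n" "gap N E F < \<epsilon>"
  shows "near \<epsilon> N E F" "near \<epsilon> N F E"
  using assms one_sided_gap_near by (auto simp: gap_def)

section \<open>Measurability of distances and section radii\<close>

lemma space_grassmannian_borel [simp]: "space (grassmannian_borel N n) = grassmannian N n"
  unfolding grassmannian_borel_def by (rule space_measure_of) (auto simp: grassmannian_open_def)

lemma grassmannian_open_sets: "grassmannian_open N n U \<Longrightarrow> U \<in> sets (grassmannian_borel N n)"
  unfolding grassmannian_borel_def by (subst sets_measure_of) (auto simp: grassmannian_open_def)

text \<open>Upper semicontinuity is enough: it makes every set where \<open>f < t\<close> open, and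
  these sets determine Borel measurability.\<close>

lemma borel_measurable_grassmannianI:
  fixes f :: "(nat \<Rightarrow> real) set \<Rightarrow> real"
  assumes "\<And>E t. E \<in> grassmannian N n \<Longrightarrow> f E < t \<Longrightarrow>
    \<exists>\<epsilon>>0. \<forall>F\<in>grassmannian N n. near \<epsilon> N E F \<longrightarrow> near \<epsilon> N F E \<longrightarrow> f F < t"
  shows "f \<in> borel_measurable (grassmannian_borel N n)"
proof (rule borel_measurableI_less)
  fix t
  have "grassmannian_open N n {E \<in> grassmannian N n. f E < t}"
    unfolding grassmannian_open_def
  proof (intro conjI ballI)
    fix E assume "E \<in> {E \<in> grassmannian N n. f E < t}"
    then have E: "E \<in> grassmannian N n" "f E < t" by auto
    from assms[OF this] obtain \<epsilon> where "\<epsilon> > 0"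
      "\<forall>F\<in>grassmannian N n. near \<epsilon> N E F \<longrightarrow> near \<epsilon> N F E \<longrightarrow> f F < t" by auto
    then show "\<exists>\<epsilon>>0. \<forall>F\<in>grassmannian N n. gap N E F < \<epsilon> \<longrightarrow> F \<in> {E \<in> grassmannian N n. f E < t}"
      using gap_near[OF E(1)] by (intro exI[of _ \<epsilon>]) auto
  qed auto
  then show "{w \<in> space (grassmannian_borel N n). f w < t} \<in> sets (grassmannian_borel N n)"
    by (simp add: grassmannian_open_sets)
qed

lemma edist_measurable:
  assumes x: "x \<in> euclidean N"
  shows "edist N x \<in> borel_measurable (grassmannian_borel N n)"
proof (rule borel_measurable_grassmannianI)
  fix E t assume E: "E \<in> grassmannian N n" "edist N x E < t"
  define \<epsilon> where "\<epsilon> = (t - edist N x E) / (enorm N x + 1)"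
  have nz: "0 < enorm N x + 1" using enorm_nonneg[of N x] by linarith
  have \<epsilon>: "0 < \<epsilon>" using E(2) nz by (simp add: \<epsilon>_def)
  have "\<epsilon> * enorm N x < t - edist N x E"
  proof -
    have "\<epsilon> * enorm N x < \<epsilon> * (enorm N x + 1)" using \<epsilon> by simp
    also have "\<dots> = t - edist N x E" using nz by (simp add: \<epsilon>_def)
    finally show ?thesis .
  qed
  then have "edist N x F < t" if "near \<epsilon> N E F" for F
    using edist_near[OF E(1) that _ x] \<epsilon> by auto
  then show "\<exists>\<epsilon>>0. \<forall>F\<in>grassmannian N n. near \<epsilon> N E F \<longrightarrow> near \<epsilon> N F E \<longrightarrow> edist N x F < t"
    using \<epsilon> by blast
qed

text \<open>The inner radius \<open>r\<close> absorbs a perturbation of the subspace; the outer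
  radius \<open>D\<close> keeps the supremum in \<open>section_radius\<close> bounded. Only the
  quotient \<open>D / r\<close> enters the perturbation estimate.\<close>

definition convex_body :: "nat \<Rightarrow> (nat \<Rightarrow> real) set \<Rightarrow> real \<Rightarrow> real \<Rightarrow> bool"
  where "convex_body N K r D \<longleftrightarrow> 0 < r \<and> 0 < D \<and> K \<subseteq> euclidean N \<and> convex K \<and>
    (\<forall>z\<in>euclidean N. enorm N z \<le> r \<longrightarrow> z \<in> K) \<and> (\<forall>y\<in>K. enorm N y \<le> D)"

lemma convex_body_0: "convex_body N K r D \<Longrightarrow> 0 \<in> K"
  using subspace_0[OF subspace_euclidean[of N]] unfolding convex_body_def by (metis enorm_zero less_imp_le)

lemma enorm_le_section_radius:
  assumes "convex_body N K r D" "y \<in> E" "y \<in> K"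
  shows "enorm N y \<le> section_radius N K E"
  unfolding section_radius_def using assms
  by (intro cSUP_upper) (auto simp: convex_body_def intro!: bdd_aboveI[of _ D])

lemma section_radius_le:
  assumes "convex_body N K r D" "0 \<in> E" "\<And>y. y \<in> E \<Longrightarrow> y \<in> K \<Longrightarrow> enorm N y \<le> B"
  shows "section_radius N K E \<le> B"
  unfolding section_radius_def using assms convex_body_0[OF assms(1)] by (intro cSUP_least) auto

lemma section_radius_nonneg:
  assumes "convex_body N K r D" "0 \<in> E" shows "0 \<le> section_radius N K E"
  using enorm_le_section_radius[OF assms convex_body_0[OF assms(1)]] by simp

text \<open>For \<open>y\<close> in \<open>F\<close> and \<open>K\<close> take a nearby
  \<open>z\<close> in \<open>E\<close> and put \<open>s = \<epsilon> * D / r\<close>. Then (z - y)/s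
  has norm at most \<open>r\<close> and lies in \<open>K\<close>, so z/(1 + s), a convex combination
  of \<open>y\<close> and (z - y)/s, lies both in \<open>E\<close> and in \<open>K\<close>. The
  factor 1 - \<epsilon> compares the norms of \<open>y\<close> and \<open>z\<close>.\<close>

lemma section_radius_near:
  assumes K: "convex_body N K r D" and E: "E \<in> grassmannian N n" and F: "F \<in> grassmannian N m"
    and near: "near \<epsilon> N F E" and \<epsilon>: "0 < \<epsilon>" "\<epsilon> < 1"
  shows "section_radius N K F \<le> (1 + \<epsilon> * D / r) / (1 - \<epsilon>) * section_radius N K E"
proof (rule section_radius_le[OF K grassmannianD(3)[OF F]])
  fix y assume y: "y \<in> F" "y \<in> K"
  have D: "enorm N y \<le> D" "0 < D" "0 < r" using K y(2) by (auto simp: convex_body_def)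
  obtain z where z: "z \<in> E" "enorm N (y - z) \<le> \<epsilon> * enorm N y" using near y(1) by (auto simp: near_def)
  define s where "s = \<epsilon> * D / r"
  have s: "0 < s" using D \<epsilon> by (simp add: s_def)
  define v where "v = (1 / s) *\<^sub>R (z - y)"
  have zy: "z - y \<in> euclidean N"
    using z(1) y(1) grassmannianD(2)[OF E] grassmannianD(2)[OF F] subspace_euclidean by (auto intro: subspace_diff)
  have "enorm N (z - y) \<le> \<epsilon> * D"
    using z(2) D(1) \<epsilon> enorm_minus[of N y z] by (metis less_le mult_left_mono order_trans)
  then have "enorm N v \<le> r" using s D by (simp add: v_def enorm_scale divide_le_eq) (simp add: s_def)
  then have vK: "v \<in> K" using K zy subspace_euclidean by (auto simp: convex_body_def v_def intro: subspace_scale)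
  have "(1 / (1 + s)) *\<^sub>R y + (s / (1 + s)) *\<^sub>R v \<in> K"
    using K y(2) vK s by (auto simp: convex_body_def field_simps intro!: convexD)
  also have "(1 / (1 + s)) *\<^sub>R y + (s / (1 + s)) *\<^sub>R v = (1 / (1 + s)) *\<^sub>R z"
  proof -
    have "(s / (1 + s)) *\<^sub>R v = (1 / (1 + s)) *\<^sub>R (z - y)" using s by (simp add: v_def)
    then show ?thesis by (simp flip: scaleR_right_distrib)
  qed
  finally have "(1 / (1 + s)) *\<^sub>R z \<in> K" .
  moreover have "(1 / (1 + s)) *\<^sub>R z \<in> E" using z(1) grassmannianD(1)[OF E] by (rule subspace_scale[rotated])
  ultimately have "enorm N ((1 / (1 + s)) *\<^sub>R z) \<le> section_radius N K E"
    using enorm_le_section_radius[OF K] by blast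
  then have "enorm N z \<le> (1 + s) * section_radius N K E"
    using s by (simp add: enorm_scale field_simps)
  moreover have "(1 - \<epsilon>) * enorm N y \<le> enorm N z"
    using z(2) enorm_diff_le[of N y z] by (simp add: algebra_simps)
  ultimately have "(1 - \<epsilon>) * enorm N y \<le> (1 + s) * section_radius N K E" by simp
  then show "enorm N y \<le> (1 + \<epsilon> * D / r) / (1 - \<epsilon>) * section_radius N K E"
    using \<epsilon> by (simp add: s_def pos_le_divide_eq mult.commute)
qed

lemma section_radius_near_tendsto:
  fixes D r R :: real
  shows "((\<lambda>\<epsilon>. (1 + \<epsilon> * D / r) / (1 - \<epsilon>) * R) \<longlongrightarrow> R) (at_right 0)"
proof -
  have "((\<lambda>\<epsilon>. (1 + \<epsilon> * D / r) / (1 - \<epsilon>) * R) \<longlongrightarrow> (1 + 0 * D / r) / (1 - 0) * R) (at_right 0)"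
    by (cases "r = 0") (auto intro!: tendsto_eq_intros)
  then show ?thesis by simp
qed

lemma section_radius_measurable:
  assumes K: "convex_body N K r D"
  shows "section_radius N K \<in> borel_measurable (grassmannian_borel N n)"
proof (rule borel_measurable_grassmannianI)
  fix E t assume E: "E \<in> grassmannian N n" "section_radius N K E < t"
  have "\<forall>\<^sub>F \<epsilon> in at_right 0. (1 + \<epsilon> * D / r) / (1 - \<epsilon>) * section_radius N K E < t"
    using section_radius_near_tendsto E(2) by (rule order_tendstoD)
  moreover have "\<forall>\<^sub>F \<epsilon>::real in at_right 0. 0 < \<epsilon> \<and> \<epsilon> < 1"
    unfolding eventually_at_right_field by (intro exI[of _ 1]) auto
  ultimately have "\<forall>\<^sub>F \<epsilon> in at_right 0. (1 + \<epsilon> * D / r) / (1 - \<epsilon>) * section_radius N K E < t \<and> 0 < \<epsilon> \<and> \<epsilon> < 1"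
    by eventually_elim auto
  then obtain \<epsilon> where \<epsilon>: "(1 + \<epsilon> * D / r) / (1 - \<epsilon>) * section_radius N K E < t" "0 < \<epsilon>" "\<epsilon> < 1"
    using eventually_happens[of _ "at_right (0::real)"] by auto
  then show "\<exists>\<epsilon>>0. \<forall>F\<in>grassmannian N n. near \<epsilon> N E F \<longrightarrow> near \<epsilon> N F E \<longrightarrow> section_radius N K F < t"
    using section_radius_near[OF K E(1)] by (intro exI[of _ \<epsilon>]) (auto intro: le_less_trans)
qed

text \<open>The perturbation \<open>\<epsilon>\<close> depends on the body alone, so one value
  serves all pairs of subspaces. The factor 2 is the whole price of replacing a Haar subspace by a
  nearby kernel.\<close>

lemma section_radius_near_2:
  assumes K: "convex_body N K r D"
  obtains \<epsilon> where "0 < \<epsilon>" "\<epsilon> < 1" "\<And>E F n m. E \<in> grassmannian N n \<Longrightarrow> F \<in> grassmannian N m \<Longrightarrow> near \<epsilon> N F E \<Longrightarrow>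
    section_radius N K F \<le> 2 * section_radius N K E"
proof -
  have "\<forall>\<^sub>F \<epsilon> in at_right 0. (1 + \<epsilon> * D / r) / (1 - \<epsilon>) * 1 < 2"
    using section_radius_near_tendsto[of D r 1] by (rule order_tendstoD) simp
  moreover have "\<forall>\<^sub>F \<epsilon>::real in at_right 0. 0 < \<epsilon> \<and> \<epsilon> < 1"
    unfolding eventually_at_right_field by (intro exI[of _ 1]) auto
  ultimately have "\<forall>\<^sub>F \<epsilon> in at_right 0. (1 + \<epsilon> * D / r) / (1 - \<epsilon>) * 1 < 2 \<and> 0 < \<epsilon> \<and> \<epsilon> < 1"
    by eventually_elim auto
  then obtain \<epsilon> where \<epsilon>: "(1 + \<epsilon> * D / r) / (1 - \<epsilon>) < 2" "0 < \<epsilon>" "\<epsilon> < 1"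
    using eventually_happens[of _ "at_right (0::real)"] by auto
  show ?thesis
  proof (rule that[OF \<epsilon>(2,3)])
    fix E F n m assume EF: "E \<in> grassmannian N n" "F \<in> grassmannian N m" "near \<epsilon> N F E"
    have "section_radius N K F \<le> (1 + \<epsilon> * D / r) / (1 - \<epsilon>) * section_radius N K E"
      by (rule section_radius_near[OF K EF \<epsilon>(2,3)])
    also have "\<dots> \<le> 2 * section_radius N K E"
      using \<epsilon>(1) section_radius_nonneg[OF K grassmannianD(3)[OF EF(1)]] by (intro mult_right_mono) auto
    finally show "section_radius N K F \<le> 2 * section_radius N K E" .
  qed
qed

section \<open>Gaussian vectors and arrays\<close>

abbreviation std_gauss :: "real measure"
  where "std_gauss \<equiv> density lborel (\<lambda>x. ennreal (std_normal_density x))"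

text \<open>One measure on full sequences serves all \<open>N\<close>: statements about R^N look
  only at the coordinates \<open>1..N\<close>, and \<open>zext\<close> discards the rest.\<close>

definition gauss :: "(nat \<Rightarrow> real) measure"
  where "gauss = PiM UNIV (\<lambda>_. std_gauss)"

lemma prob_space_std_gauss: "prob_space std_gauss"
  using prob_space_normal_density[of 1 0] by simp

lemma prob_space_gauss: "prob_space gauss"
  unfolding gauss_def by (intro prob_space_PiM prob_space_std_gauss)

lemma sets_gauss: "sets gauss = sets (PiM UNIV (\<lambda>_. borel :: real measure))"
  unfolding gauss_def by (intro sets_PiM_cong) auto

lemma space_gauss [simp]: "space gauss = UNIV"
  unfolding gauss_def by (simp add: space_PiM)

lemma coord_measurable_gauss: "(\<lambda>g. g i) \<in> borel_measurable gauss"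
proof -
  have "(\<lambda>g. g i) \<in> borel_measurable (PiM UNIV (\<lambda>_. borel :: real measure))" by measurable
  then show ?thesis by (subst measurable_cong_sets[OF sets_gauss refl])
qed

lemma ip_measurable_gauss [measurable]: "(\<lambda>g. ip N g x) \<in> borel_measurable gauss"
  unfolding ip_def by (intro borel_measurable_sum borel_measurable_times coord_measurable_gauss) auto

lemma enorm_measurable_gauss [measurable]: "(\<lambda>g. enorm N g) \<in> borel_measurable gauss"
proof -
  have "(\<lambda>g. ip N g g) \<in> borel_measurable gauss"
    unfolding ip_def by (intro borel_measurable_sum borel_measurable_times coord_measurable_gauss)
  then show ?thesis unfolding enorm_eq by measurable
qed

lemma measurable_to_gauss:
  assumes "\<And>i. (\<lambda>x. f x i) \<in> borel_measurable M"
  shows "f \<in> measurable M gauss"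
proof -
  have "(\<lambda>x i. f x i) \<in> measurable M (PiM UNIV (\<lambda>_. borel))"
    by (rule measurable_PiM_single') (use assms in auto)
  then show ?thesis by (subst measurable_cong_sets[OF refl sets_gauss]) simp
qed

section \<open>Lebesgue measure on the coordinates 1..N and its rotation invariance\<close>

definition leb :: "nat \<Rightarrow> (nat \<Rightarrow> real) measure"
  where "leb N = PiM {1..N} (\<lambda>_. lborel)"

interpretation PL: product_sigma_finite "\<lambda>_::nat. lborel :: real measure"
  unfolding product_sigma_finite_def by (rule allI) (rule sigma_finite_lborel)

lemma sigma_finite_leb: "sigma_finite_measure (leb N)"
  unfolding leb_def by (rule PL.sigma_finite) simp

text \<open>Two truncations are in use: \<open>cut\<close> yields extensional functions, which are
  the points of \<open>leb N\<close>, whereas \<open>zext\<close> yields points of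
  \<open>euclidean N\<close>, on which orthogonal maps act.\<close>

definition cut :: "nat \<Rightarrow> (nat \<Rightarrow> real) \<Rightarrow> nat \<Rightarrow> real"
  where "cut N x = restrict x {1..N}"

definition zext :: "nat \<Rightarrow> (nat \<Rightarrow> real) \<Rightarrow> nat \<Rightarrow> real"
  where "zext N x = (\<lambda>i. if i \<in> {1..N} then x i else 0)"

lemma zext_in: "zext N x \<in> euclidean N"
  by (auto simp: zext_def euclidean_def)

lemma zext_eq: "x \<in> euclidean N \<Longrightarrow> zext N x = x"
  by (auto simp: zext_def euclidean_def)

lemma ip_zext [simp]: "ip N (zext N x) y = ip N x y" "ip N y (zext N x) = ip N y x"
  by (auto simp: ip_def zext_def intro!: sum.cong)

lemma enorm_zext [simp]: "enorm N (zext N x) = enorm N x"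
  by (simp add: enorm_eq)

lemma zext_cut [simp]: "zext N (cut N x) = zext N x"
  by (auto simp: zext_def cut_def)

lemma ip_cut [simp]: "ip N (cut N x) y = ip N x y" "ip N y (cut N x) = ip N y x"
  by (auto simp: ip_def cut_def intro!: sum.cong)

lemma zext_add: "zext N (x + y) = zext N x + zext N y"
  by (auto simp: zext_def fun_eq_iff)

lemma space_leb: "space (leb N) = extensional {1..N}"
  by (auto simp: leb_def space_PiM PiE_def)

lemma coord_measurable_leb: "i \<in> {1..N} \<Longrightarrow> (\<lambda>x. x i) \<in> borel_measurable (leb N)"
proof -
  assume "i \<in> {1..N}"
  then have "(\<lambda>x. x i) \<in> measurable (leb N) lborel"
    unfolding leb_def by (rule measurable_component_singleton)
  then show ?thesis by simp
qed

lemma cut_measurable: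
  assumes "\<And>i. i \<in> {1..N} \<Longrightarrow> (\<lambda>x. f x i) \<in> borel_measurable M"
  shows "(\<lambda>x. cut N (f x)) \<in> measurable M (leb N)"
  unfolding cut_def leb_def using assms by (intro measurable_restrict) simp

lemma zext_coord_measurable [measurable]: "(\<lambda>x. zext N x i) \<in> borel_measurable (leb N)"
  using coord_measurable_leb by (cases "i \<in> {1..N}") (auto simp: zext_def)

lemma leb_coordwise:
  assumes t: "\<And>i. distr lborel lborel (t i) = (lborel :: real measure)" "\<And>i. t i \<in> borel_measurable borel"
  shows "distr (leb N) (leb N) (\<lambda>x. cut N (\<lambda>i. t i (x i))) = leb N" (is "?D = _")
proof -
  have meas: "(\<lambda>x. cut N (\<lambda>i. t i (x i))) \<in> measurable (leb N) (leb N)"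
    by (intro cut_measurable measurable_compose[OF coord_measurable_leb t(2)])
  have "?D = PiM {1..N} (\<lambda>_. lborel)"
  proof (rule PL.PiM_eqI)
    show "sets ?D = sets (Pi\<^sub>M {1..N} (\<lambda>_. lborel))" by (simp add: leb_def)
    fix A :: "nat \<Rightarrow> real set" assume A: "\<And>i. i \<in> {1..N} \<Longrightarrow> A i \<in> sets lborel"
    have vim: "(\<lambda>x. cut N (\<lambda>i. t i (x i))) -` (Pi\<^sub>E {1..N} A) \<inter> space (leb N) = Pi\<^sub>E {1..N} (\<lambda>i. t i -` A i)"
      by (auto simp: space_leb cut_def PiE_def Pi_def extensional_def)
    have Ai: "t i -` A i \<in> sets lborel" if "i \<in> {1..N}" for i
      using measurable_sets[OF t(2), of "A i" i] A[OF that] by simp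
    have "emeasure ?D (Pi\<^sub>E {1..N} A) = emeasure (leb N) (Pi\<^sub>E {1..N} (\<lambda>i. t i -` A i))"
      unfolding vim[symmetric] using A meas by (intro emeasure_distr) (auto simp: leb_def intro!: sets_PiM_I_finite)
    also have "\<dots> = (\<Prod>i\<in>{1..N}. emeasure lborel (t i -` A i))"
      unfolding leb_def using Ai by (intro PL.emeasure_PiM) auto
    also have "\<dots> = (\<Prod>i\<in>{1..N}. emeasure lborel (A i))"
    proof (intro prod.cong refl)
      fix i assume i: "i \<in> {1..N}"
      have "emeasure lborel (A i) = emeasure (distr lborel lborel (t i)) (A i)"
        by (simp add: t)
      also have "\<dots> = emeasure lborel (t i -` A i)"
        using A[OF i] t(2) by (subst emeasure_distr) auto
      finally show "emeasure lborel (t i -` A i) = emeasure lborel (A i)" by simp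
    qed
    finally show "emeasure ?D (Pi\<^sub>E {1..N} A) = (\<Prod>i\<in>{1..N}. emeasure lborel (A i))" .
  qed simp
  then show ?thesis by (simp add: leb_def)
qed

lemma distr_lborel_lborel: "distr M lborel f = distr M borel f"
  by (rule distr_cong) auto

lemma leb_translate: "distr (leb N) (leb N) (\<lambda>x. cut N (x + a)) = leb N"
proof -
  have "distr lborel lborel (\<lambda>x. x + a i) = (lborel :: real measure)" for i
    using lborel_distr_plus[of "a i"] by (simp add: distr_lborel_lborel add.commute[of _ "a i"])
  then have "distr (leb N) (leb N) (\<lambda>x. cut N (\<lambda>i. x i + a i)) = leb N"
    by (rule leb_coordwise) auto
  then show ?thesis by (simp add: plus_fun_def)
qed

lemma leb_reflect: "distr (leb N) (leb N) (\<lambda>x. cut N (- x)) = leb N"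
proof -
  have "distr lborel lborel (\<lambda>x. - x) = (lborel :: real measure)"
    using lborel_distr_uminus by (simp add: distr_lborel_lborel)
  then have "distr (leb N) (leb N) (\<lambda>x. cut N (\<lambda>i. - x i)) = leb N"
    by (rule leb_coordwise) auto
  then show ?thesis by (simp add: fun_Compl_def)
qed

lemma nn_integral_leb_translate:
  assumes "f \<in> borel_measurable (leb N)"
  shows "(\<integral>\<^sup>+x. f (cut N (x + a)) \<partial>leb N) = (\<integral>\<^sup>+x. f x \<partial>leb N)"
proof -
  have "(\<integral>\<^sup>+x. f x \<partial>leb N) = (\<integral>\<^sup>+x. f x \<partial>distr (leb N) (leb N) (\<lambda>x. cut N (x + a)))"
    by (simp only: leb_translate)
  also have "\<dots> = (\<integral>\<^sup>+x. f (cut N (x + a)) \<partial>leb N)"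
    using assms by (intro nn_integral_distr cut_measurable) (auto intro!: borel_measurable_add coord_measurable_leb)
  finally show ?thesis by simp
qed

lemma nn_integral_leb_reflect:
  assumes "f \<in> borel_measurable (leb N)"
  shows "(\<integral>\<^sup>+x. f (cut N (- x)) \<partial>leb N) = (\<integral>\<^sup>+x. f x \<partial>leb N)"
proof -
  have "(\<integral>\<^sup>+x. f x \<partial>leb N) = (\<integral>\<^sup>+x. f x \<partial>distr (leb N) (leb N) (\<lambda>x. cut N (- x)))"
    by (simp only: leb_reflect)
  also have "\<dots> = (\<integral>\<^sup>+x. f (cut N (- x)) \<partial>leb N)"
    using assms by (intro nn_integral_distr cut_measurable) (auto intro!: borel_measurable_uminus coord_measurable_leb)
  finally show ?thesis by simp
qed

lemma linear_zext:
  assumes "linear T"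
  shows "T (zext N x) = (\<Sum>j=1..N. x j *\<^sub>R T (unit j))"
proof -
  have "zext N x = (\<Sum>j=1..N. zext N x j *\<^sub>R unit j)" by (rule euclidean_eq_sum_unit[OF zext_in])
  also have "\<dots> = (\<Sum>j=1..N. x j *\<^sub>R unit j)" by (rule sum.cong) (auto simp: zext_def)
  finally show ?thesis by (simp add: linear_sum[OF assms] linear_scale[OF assms])
qed

lemma sum_fun_apply: "(\<Sum>j\<in>A. g j) i = (\<Sum>j\<in>A. g j i)" for g :: "'b \<Rightarrow> 'a \<Rightarrow> real"
  by (induction A rule: infinite_finite_induct) auto

text \<open>Two translation invariant measures are proportional; comparing them on a rotation invariant
  function shows that they agree.\<close>

lemma leb_rotate:
  assumes T: "orthogonal_map N T" "orthogonal_map N T'" "\<And>x. T (T' x) = x"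
    and f: "f \<in> borel_measurable (leb N)"
  shows "(\<integral>\<^sup>+x. f (cut N (T (zext N x))) \<partial>leb N) = (\<integral>\<^sup>+x. f x \<partial>leb N)"
proof -
  define S where "S x = cut N (T (zext N x))" for x
  have lin: "linear T" "linear T'" using T by (auto simp: orthogonal_map_def)
  have S[measurable]: "S \<in> measurable (leb N) (leb N)"
    unfolding S_def linear_zext[OF lin(1)]
    by (intro cut_measurable) (auto simp: sum_fun_apply intro!: borel_measurable_sum borel_measurable_times coord_measurable_leb)
  interpret L: sigma_finite_measure "leb N" by (rule sigma_finite_leb)
  interpret P: pair_sigma_finite "leb N" "leb N" by standard
  define h where "h x = (\<Prod>i\<in>{1..N}. ennreal (std_normal_density (x i)))" for x :: "nat \<Rightarrow> real"
  have h_meas[measurable]: "h \<in> borel_measurable (leb N)"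
    unfolding h_def by (intro borel_measurable_prod_ennreal measurable_compose[OF coord_measurable_leb]) auto
  have h_norm: "h x = ennreal ((1 / sqrt (2 * pi)) ^ N * exp (- ip N x x / 2))" for x
  proof -
    have "h x = ennreal (\<Prod>i\<in>{1..N}. std_normal_density (x i))"
      unfolding h_def by (intro prod_ennreal) auto
    also have "(\<Prod>i\<in>{1..N}. std_normal_density (x i)) = (1 / sqrt (2 * pi)) ^ N * exp (- ip N x x / 2)"
      unfolding std_normal_density_def prod.distrib ip_def
      by (simp add: sum_divide_distrib sum_negf power2_eq_square flip: exp_sum)
    finally show ?thesis .
  qed
  have h1: "(\<integral>\<^sup>+x. h x \<partial>leb N) = 1"
  proof -
    have "(\<integral>\<^sup>+x. h x \<partial>leb N) = (\<Prod>i\<in>{1..N}. \<integral>\<^sup>+y. ennreal (std_normal_density y) \<partial>lborel)"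
      unfolding h_def leb_def by (rule PL.product_nn_integral_prod) auto
    also have "(\<integral>\<^sup>+y. ennreal (std_normal_density y) \<partial>lborel) = 1"
      using nn_integral_eq_integral[of lborel std_normal_density] by simp
    finally show ?thesis by simp
  qed
  have hS: "h (S x) = h x" for x
    using orthogonal_map_ip[OF T(1) zext_in[of N x] zext_in[of N x]] by (simp add: h_norm S_def)
  \<comment> \<open>Translating by \<open>T' a\<close> before the rotation equals translating by
    \<open>a\<close> after it. Hence the image of Lebesgue measure under \<open>S\<close> is again
    translation invariant.\<close>
  have S_add: "S (cut N (x + T' (zext N a))) = cut N (S x + a)" for x a
  proof -
    have 1: "zext N (T' (zext N a)) = T' (zext N a)"
      by (rule zext_eq[OF orthogonal_map_in[OF T(2) zext_in]])
    have 2: "cut N (y + zext N a) = cut N (cut N y + a)" for y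
      by (auto simp: cut_def zext_def fun_eq_iff)
    have "T (zext N (x + T' (zext N a))) = T (zext N x) + zext N a"
      unfolding zext_add 1 linear_add[OF lin(1)] T(3) ..
    then show ?thesis by (simp only: S_def zext_cut 2)
  qed
  have J_trans: "(\<integral>\<^sup>+x. k (cut N (S x + a)) \<partial>leb N) = (\<integral>\<^sup>+x. k (S x) \<partial>leb N)"
    if [measurable]: "k \<in> borel_measurable (leb N)" for k a
    using nn_integral_leb_translate[of "\<lambda>x. k (S x)" N "T' (zext N a)"] by (simp add: S_add)
  have plus[measurable]: "(\<lambda>(x, y). cut N (x + y)) \<in> measurable (leb N \<Otimes>\<^sub>M leb N) (leb N)"
    and minus[measurable]: "(\<lambda>(x, y). cut N (x - y)) \<in> measurable (leb N \<Otimes>\<^sub>M leb N) (leb N)"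
  proof -
    have "(\<lambda>p. fst p i) \<in> borel_measurable (leb N \<Otimes>\<^sub>M leb N)" "(\<lambda>p. snd p i) \<in> borel_measurable (leb N \<Otimes>\<^sub>M leb N)"
      if "i \<in> {1..N}" for i
      using measurable_compose[OF measurable_fst coord_measurable_leb[OF that]]
        measurable_compose[OF measurable_snd coord_measurable_leb[OF that]] by auto
    then show "(\<lambda>(x, y). cut N (x + y)) \<in> measurable (leb N \<Otimes>\<^sub>M leb N) (leb N)"
      "(\<lambda>(x, y). cut N (x - y)) \<in> measurable (leb N \<Otimes>\<^sub>M leb N) (leb N)"
      unfolding case_prod_beta by (intro cut_measurable; simp)+
  qed
  have meas1: "(\<lambda>(x, y). f (S x) * h (cut N (S x + y))) \<in> borel_measurable (leb N \<Otimes>\<^sub>M leb N)"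
  proof -
    have "(\<lambda>p. (S (fst p), snd p)) \<in> measurable (leb N \<Otimes>\<^sub>M leb N) (leb N \<Otimes>\<^sub>M leb N)" by measurable
    from measurable_compose[OF this plus] have "(\<lambda>p. cut N (S (fst p) + snd p)) \<in> measurable (leb N \<Otimes>\<^sub>M leb N) (leb N)"
      by simp
    from measurable_compose[OF this h_meas] f show ?thesis unfolding case_prod_beta by measurable
  qed
  have meas2: "(\<lambda>(x, y). f (cut N (S x - y)) * h (S x)) \<in> borel_measurable (leb N \<Otimes>\<^sub>M leb N)"
  proof -
    have "(\<lambda>p. (S (fst p), snd p)) \<in> measurable (leb N \<Otimes>\<^sub>M leb N) (leb N \<Otimes>\<^sub>M leb N)" by measurable
    from measurable_compose[OF this minus] have "(\<lambda>p. cut N (S (fst p) - snd p)) \<in> measurable (leb N \<Otimes>\<^sub>M leb N) (leb N)"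
      by simp
    from measurable_compose[OF this f] show ?thesis unfolding case_prod_beta by measurable
  qed
  have shift: "(\<integral>\<^sup>+y. k (cut N (a + y)) \<partial>leb N) = (\<integral>\<^sup>+x. k x \<partial>leb N)" if "k \<in> borel_measurable (leb N)" for k a
    using nn_integral_leb_translate[OF that, of a] by (simp add: add.commute)
  have shift': "(\<integral>\<^sup>+y. k (cut N (a - y)) \<partial>leb N) = (\<integral>\<^sup>+x. k x \<partial>leb N)" if k: "k \<in> borel_measurable (leb N)" for k a
  proof -
    have "(\<lambda>x. cut N (x + a)) \<in> measurable (leb N) (leb N)"
      by (intro cut_measurable) (auto intro!: borel_measurable_add coord_measurable_leb)
    from measurable_compose[OF this k] have "(\<lambda>x. k (cut N (x + a))) \<in> borel_measurable (leb N)" .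
    from nn_integral_leb_reflect[OF this]
    have R: "(\<integral>\<^sup>+x. k (cut N (cut N (- x) + a)) \<partial>leb N) = (\<integral>\<^sup>+x. k (cut N (x + a)) \<partial>leb N)" .
    have "cut N (cut N (- x) + a) = cut N (a - x)" for x
      by (auto simp: cut_def fun_eq_iff)
    then show ?thesis using R nn_integral_leb_translate[OF k, of a] by simp
  qed
  \<comment> \<open>The double integral of f(Sx) h(Sx + y) is evaluated in both orders. Integrating
    over y first gives the left side, as h has mass 1; translating Sx by -y and then integrating
    over y gives the integral of f times that of h(Sx), and h is rotation invariant.\<close>
  have "(\<integral>\<^sup>+x. f (S x) \<partial>leb N) = (\<integral>\<^sup>+x. f (S x) * (\<integral>\<^sup>+y. h (cut N (S x + y)) \<partial>leb N) \<partial>leb N)"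
    by (simp add: shift h1)
  also have "\<dots> = (\<integral>\<^sup>+x. \<integral>\<^sup>+y. f (S x) * h (cut N (S x + y)) \<partial>leb N \<partial>leb N)"
  proof (rule nn_integral_cong, rule nn_integral_cmult[symmetric])
    fix x
    have "(\<lambda>y. cut N (S x + y)) \<in> measurable (leb N) (leb N)"
      by (intro cut_measurable) (auto intro!: borel_measurable_add coord_measurable_leb)
    from measurable_compose[OF this h_meas] show "(\<lambda>y. h (cut N (S x + y))) \<in> borel_measurable (leb N)" .
  qed
  also have "\<dots> = (\<integral>\<^sup>+y. \<integral>\<^sup>+x. f (S x) * h (cut N (S x + y)) \<partial>leb N \<partial>leb N)"
    using P.Fubini'[OF meas1] by simp
  also have "\<dots> = (\<integral>\<^sup>+y. \<integral>\<^sup>+x. f (cut N (S x - y)) * h (S x) \<partial>leb N \<partial>leb N)"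
  proof (rule nn_integral_cong)
    fix y
    define k where "k z = f (cut N (z - y)) * h z" for z
    have "(\<lambda>z. cut N (z - y)) \<in> measurable (leb N) (leb N)"
      by (intro cut_measurable) (auto intro!: borel_measurable_diff coord_measurable_leb)
    from measurable_compose[OF this f] have k: "k \<in> borel_measurable (leb N)" unfolding k_def by measurable
    have "k (cut N (S x + y)) = f (S x) * h (cut N (S x + y))" for x
    proof -
      have "cut N (cut N (S x + y) - y) = S x" by (auto simp: S_def cut_def fun_eq_iff)
      then show ?thesis by (simp add: k_def)
    qed
    then show "(\<integral>\<^sup>+x. f (S x) * h (cut N (S x + y)) \<partial>leb N) = (\<integral>\<^sup>+x. f (cut N (S x - y)) * h (S x) \<partial>leb N)"
      using J_trans[OF k, of y] by (simp add: k_def)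
  qed
  also have "\<dots> = (\<integral>\<^sup>+x. \<integral>\<^sup>+y. f (cut N (S x - y)) * h (S x) \<partial>leb N \<partial>leb N)"
    using P.Fubini'[OF meas2] by simp
  also have "\<dots> = (\<integral>\<^sup>+x. (\<integral>\<^sup>+y. f (cut N (S x - y)) \<partial>leb N) * h (S x) \<partial>leb N)"
  proof (rule nn_integral_cong, rule nn_integral_multc)
    fix x
    have "(\<lambda>y. cut N (S x - y)) \<in> measurable (leb N) (leb N)"
      by (intro cut_measurable) (auto intro!: borel_measurable_diff coord_measurable_leb)
    from measurable_compose[OF this f] show "(\<lambda>y. f (cut N (S x - y))) \<in> borel_measurable (leb N)" .
  qed
  also have "\<dots> = (\<integral>\<^sup>+x. f x \<partial>leb N) * (\<integral>\<^sup>+x. h (S x) \<partial>leb N)"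
    using f by (simp add: shift' nn_integral_cmult)
  also have "(\<integral>\<^sup>+x. h (S x) \<partial>leb N) = 1" by (simp add: hS h1)
  finally show ?thesis by (simp add: S_def)
qed

section \<open>Rotation invariance of Gaussian vectors\<close>

interpretation PG: product_sigma_finite "\<lambda>_::'a. std_gauss"
  unfolding product_sigma_finite_def
  by (rule allI) (rule prob_space_imp_sigma_finite[OF prob_space_std_gauss])

lemma nn_integral_distr':
  assumes "T \<in> measurable M M'" "f \<in> borel_measurable M'"
  shows "(\<integral>\<^sup>+x. f x \<partial>distr M M' T) = (\<integral>\<^sup>+x. f (T x) \<partial>M)"
  using assms by (intro nn_integral_distr) simp_all

lemma nn_integral_gauss_prod:
  assumes "finite J" "\<And>j. j \<in> J \<Longrightarrow> \<psi> j \<in> borel_measurable borel"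
  shows "(\<integral>\<^sup>+g. (\<Prod>j\<in>J. \<psi> j (g j)) \<partial>gauss) = (\<Prod>j\<in>J. \<integral>\<^sup>+y. \<psi> j y \<partial>std_gauss)"
proof -
  have D: "distr gauss (PiM J (\<lambda>_. std_gauss)) (\<lambda>\<omega>. \<lambda>n\<in>J. \<omega> n) = PiM J (\<lambda>_. std_gauss)"
    unfolding gauss_def using distr_PiM_reindex[of UNIV "\<lambda>_. std_gauss" "\<lambda>x. x" J] prob_space_std_gauss by simp
  have "(\<lambda>\<omega>. \<lambda>n\<in>J. \<omega> n) \<in> measurable gauss (PiM J (\<lambda>_. std_gauss))"
    by (intro measurable_restrict) (simp add: coord_measurable_gauss)
  moreover have "(\<lambda>x. \<Prod>j\<in>J. \<psi> j (x j)) \<in> borel_measurable (PiM J (\<lambda>_. std_gauss))"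
  proof (intro borel_measurable_prod_ennreal)
    fix j assume j: "j \<in> J"
    have "(\<lambda>x. x j) \<in> measurable (PiM J (\<lambda>_. std_gauss)) std_gauss"
      by (rule measurable_component_singleton[OF j])
    then have "(\<lambda>x. x j) \<in> borel_measurable (PiM J (\<lambda>_. std_gauss))" by simp
    from measurable_compose[OF this assms(2)[OF j]] show "(\<lambda>x. \<psi> j (x j)) \<in> borel_measurable (PiM J (\<lambda>_. std_gauss))" .
  qed
  ultimately have "(\<integral>\<^sup>+x. (\<Prod>j\<in>J. \<psi> j (x j)) \<partial>distr gauss (PiM J (\<lambda>_. std_gauss)) (\<lambda>\<omega>. \<lambda>n\<in>J. \<omega> n)) =
      (\<integral>\<^sup>+\<omega>. (\<Prod>j\<in>J. \<psi> j ((\<lambda>n\<in>J. \<omega> n) j)) \<partial>gauss)"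
    by (intro nn_integral_distr) simp_all
  then have "(\<integral>\<^sup>+g. (\<Prod>j\<in>J. \<psi> j (g j)) \<partial>gauss) = (\<integral>\<^sup>+x. (\<Prod>j\<in>J. \<psi> j (x j)) \<partial>PiM J (\<lambda>_. std_gauss))"
    unfolding D by (simp cong: prod.cong)
  also have "\<dots> = (\<Prod>j\<in>J. \<integral>\<^sup>+y. \<psi> j y \<partial>std_gauss)"
    using assms by (intro PG.product_nn_integral_prod) simp_all
  finally show ?thesis .
qed

lemma PiM_std_gauss_density:
  "PiM {1..N} (\<lambda>_. std_gauss) = density (leb N) (\<lambda>x. \<Prod>i\<in>{1..N}. ennreal (std_normal_density (x i)))"
proof (rule PG.PiM_eqI[symmetric])
  show "sets (density (leb N) (\<lambda>x. \<Prod>i\<in>{1..N}. ennreal (std_normal_density (x i)))) = sets (PiM {1..N} (\<lambda>_. std_gauss))"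
    by (simp add: leb_def cong: sets_PiM_cong)
  fix A :: "nat \<Rightarrow> real set" assume A: "\<And>i. i \<in> {1..N} \<Longrightarrow> A i \<in> sets std_gauss"
  have h: "(\<lambda>x. \<Prod>i\<in>{1..N}. ennreal (std_normal_density (x i))) \<in> borel_measurable (leb N)"
    by (intro borel_measurable_prod_ennreal measurable_compose[OF coord_measurable_leb]) auto
  have "emeasure (density (leb N) (\<lambda>x. \<Prod>i\<in>{1..N}. ennreal (std_normal_density (x i)))) (Pi\<^sub>E {1..N} A)
    = (\<integral>\<^sup>+x. (\<Prod>i\<in>{1..N}. ennreal (std_normal_density (x i))) * indicator (Pi\<^sub>E {1..N} A) x \<partial>leb N)"
    using A by (intro emeasure_density h) (auto simp: leb_def intro!: sets_PiM_I_finite)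
  also have "\<dots> = (\<integral>\<^sup>+x. (\<Prod>i\<in>{1..N}. ennreal (std_normal_density (x i)) * indicator (A i) (x i)) \<partial>leb N)"
  proof (rule nn_integral_cong)
    fix x assume x: "x \<in> space (leb N)"
    have "(indicator (Pi\<^sub>E {1..N} A) x :: ennreal) = (\<Prod>i\<in>{1..N}. indicator (A i) (x i))"
    proof (cases "x \<in> Pi\<^sub>E {1..N} A")
      case True
      then have "x i \<in> A i" if "i \<in> {1..N}" for i using that by auto
      then show ?thesis using True by (simp add: indicator_def)
    next
      case False
      then have "\<exists>i\<in>{1..N}. x i \<notin> A i" using x unfolding space_leb PiE_iff by blast
      then obtain i where "i \<in> {1..N}" "x i \<notin> A i" by blast
      then have "(\<Prod>i\<in>{1..N}. indicator (A i) (x i)) = (0::ennreal)"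
        by (intro prod_zero) (auto simp: indicator_def)
      then show ?thesis using False by simp
    qed
    then show "(\<Prod>i\<in>{1..N}. ennreal (std_normal_density (x i))) * indicator (Pi\<^sub>E {1..N} A) x =
      (\<Prod>i\<in>{1..N}. ennreal (std_normal_density (x i)) * indicator (A i) (x i))"
      by (simp add: prod.distrib)
  qed
  also have "\<dots> = (\<Prod>i\<in>{1..N}. \<integral>\<^sup>+y. ennreal (std_normal_density y) * indicator (A i) y \<partial>lborel)"
    unfolding leb_def using A by (intro PL.product_nn_integral_prod) auto
  also have "\<dots> = (\<Prod>i\<in>{1..N}. emeasure std_gauss (A i))"
    using A by (intro prod.cong refl emeasure_density[symmetric]) auto
  finally show "emeasure (density (leb N) (\<lambda>x. \<Prod>i\<in>{1..N}. ennreal (std_normal_density (x i)))) (Pi\<^sub>E {1..N} A) =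
    (\<Prod>i\<in>{1..N}. emeasure std_gauss (A i))" .
qed simp

lemma nn_integral_gauss_cut:
  assumes f: "f \<in> borel_measurable (leb N)"
  shows "(\<integral>\<^sup>+g. f (cut N g) \<partial>gauss) = (\<integral>\<^sup>+x. (\<Prod>i\<in>{1..N}. ennreal (std_normal_density (x i))) * f x \<partial>leb N)"
proof -
  have D: "distr gauss (PiM {1..N} (\<lambda>_. std_gauss)) (cut N) = PiM {1..N} (\<lambda>_. std_gauss)"
    unfolding gauss_def cut_def[abs_def]
    using distr_PiM_reindex[of UNIV "\<lambda>_. std_gauss" "\<lambda>x. x" "{1..N}"] prob_space_std_gauss by simp
  have h: "(\<lambda>x. \<Prod>i\<in>{1..N}. ennreal (std_normal_density (x i))) \<in> borel_measurable (leb N)"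
    by (intro borel_measurable_prod_ennreal measurable_compose[OF coord_measurable_leb]) auto
  have s: "sets (PiM {1..N} (\<lambda>_. std_gauss)) = sets (leb N)" unfolding leb_def by (intro sets_PiM_cong) auto
  have c: "cut N \<in> measurable gauss (PiM {1..N} (\<lambda>_. std_gauss))"
    unfolding cut_def[abs_def] by (intro measurable_restrict) (simp add: coord_measurable_gauss)
  have f': "f \<in> borel_measurable (PiM {1..N} (\<lambda>_. std_gauss))"
    unfolding measurable_cong_sets[OF s refl] by (rule f)
  have "(\<integral>\<^sup>+g. f (cut N g) \<partial>gauss) = (\<integral>\<^sup>+x. f x \<partial>distr gauss (PiM {1..N} (\<lambda>_. std_gauss)) (cut N))"
    by (rule nn_integral_distr'[OF c f', symmetric])
  also have "\<dots> = (\<integral>\<^sup>+x. f x \<partial>density (leb N) (\<lambda>x. \<Prod>i\<in>{1..N}. ennreal (std_normal_density (x i))))"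
    unfolding D unfolding PiM_std_gauss_density ..
  also have "\<dots> = (\<integral>\<^sup>+x. (\<Prod>i\<in>{1..N}. ennreal (std_normal_density (x i))) * f x \<partial>leb N)"
    by (rule nn_integral_density[OF h f])
  finally show ?thesis .
qed

lemma prod_density_eq:
  "(\<Prod>i\<in>{1..N}. ennreal (std_normal_density (x i))) = ennreal ((1 / sqrt (2 * pi)) ^ N * exp (- ip N x x / 2))"
proof -
  have "(\<Prod>i\<in>{1..N}. ennreal (std_normal_density (x i))) = ennreal (\<Prod>i\<in>{1..N}. std_normal_density (x i))"
    by (intro prod_ennreal) auto
  also have "(\<Prod>i\<in>{1..N}. std_normal_density (x i)) = (1 / sqrt (2 * pi)) ^ N * exp (- ip N x x / 2)"
    unfolding std_normal_density_def prod.distrib ip_def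
    by (simp add: sum_divide_distrib sum_negf power2_eq_square flip: exp_sum)
  finally show ?thesis .
qed

lemma zext_measurable [measurable]: "zext N \<in> measurable gauss gauss"
proof (rule measurable_to_gauss)
  show "(\<lambda>x. zext N x i) \<in> borel_measurable gauss" for i
    using coord_measurable_gauss by (cases "i \<in> {1..N}") (auto simp: zext_def)
qed

lemma zext_measurable_leb: "zext N \<in> measurable (leb N) gauss"
  by (rule measurable_to_gauss) (rule zext_coord_measurable)

lemma rotate_measurable:
  assumes "orthogonal_map N T"
  shows "(\<lambda>g. T (zext N g)) \<in> measurable gauss gauss"
    "(\<lambda>g. T (zext N g)) \<in> measurable (leb N) gauss"
proof -
  have lin: "linear T" using assms by (auto simp: orthogonal_map_def)
  show "(\<lambda>g. T (zext N g)) \<in> measurable gauss gauss"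
    unfolding linear_zext[OF lin]
    by (rule measurable_to_gauss) (auto simp: sum_fun_apply intro!: borel_measurable_sum borel_measurable_times coord_measurable_gauss)
  show "(\<lambda>g. T (zext N g)) \<in> measurable (leb N) gauss"
    unfolding linear_zext[OF lin]
    by (rule measurable_to_gauss) (auto simp: sum_fun_apply intro!: borel_measurable_sum borel_measurable_times coord_measurable_leb)
qed

text \<open>The Gaussian density with respect to Lebesgue measure is a function of the norm, so
  invariance reduces to \<open>leb_rotate\<close>. Both sides pass through \<open>zext N\<close>,
  since only the first \<open>N\<close> coordinates are rotated.\<close>

lemma nn_integral_gauss_rotate:
  assumes T: "orthogonal_map N T" "orthogonal_map N T'" "\<And>x. T (T' x) = x"
    and f: "f \<in> borel_measurable gauss"
  shows "(\<integral>\<^sup>+g. f (T (zext N g)) \<partial>gauss) = (\<integral>\<^sup>+g. f (zext N g) \<partial>gauss)"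
proof -
  let ?h = "\<lambda>x. \<Prod>i\<in>{1..N}. ennreal (std_normal_density (x i))"
  have h: "?h \<in> borel_measurable (leb N)"
    by (intro borel_measurable_prod_ennreal measurable_compose[OF coord_measurable_leb]) auto
  have fz: "(\<lambda>x. f (zext N x)) \<in> borel_measurable (leb N)"
    by (rule measurable_compose[OF zext_measurable_leb f])
  have fT: "(\<lambda>x. f (T (zext N x))) \<in> borel_measurable (leb N)"
    by (rule measurable_compose[OF rotate_measurable(2)[OF T(1)] f])
  have hS: "?h (cut N (T (zext N x))) = ?h x" for x
    unfolding prod_density_eq using orthogonal_map_ip[OF T(1) zext_in[of N x] zext_in[of N x]] by simp
  have zT: "zext N (T (zext N x)) = T (zext N x)" for x
    by (rule zext_eq[OF orthogonal_map_in[OF T(1) zext_in]])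
  have "(\<integral>\<^sup>+g. f (T (zext N g)) \<partial>gauss) = (\<integral>\<^sup>+x. ?h x * f (T (zext N x)) \<partial>leb N)"
    using nn_integral_gauss_cut[OF fT] unfolding zext_cut .
  also have "\<dots> = (\<integral>\<^sup>+x. ?h (cut N (T (zext N x))) * f (zext N (cut N (T (zext N x)))) \<partial>leb N)"
    unfolding hS zext_cut zT ..
  also have "\<dots> = (\<integral>\<^sup>+x. ?h x * f (zext N x) \<partial>leb N)"
    by (rule leb_rotate[OF T]) (intro borel_measurable_times_ennreal h fz)
  also have "\<dots> = (\<integral>\<^sup>+g. f (zext N g) \<partial>gauss)"
    using nn_integral_gauss_cut[OF fz] unfolding zext_cut by (rule sym)
  finally show ?thesis .
qed

lemma distr_gauss_rotate:
  assumes T: "orthogonal_map N T" "orthogonal_map N T'" "\<And>x. T (T' x) = x"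
  shows "distr gauss gauss (\<lambda>g. T (zext N g)) = distr gauss gauss (zext N)"
proof (rule measure_eqI)
  fix A assume "A \<in> sets (distr gauss gauss (\<lambda>g. T (zext N g)))"
  then have A: "A \<in> sets gauss" by simp
  have i: "indicator A \<in> borel_measurable gauss" using A by simp
  have "emeasure (distr gauss gauss (\<lambda>g. T (zext N g))) A = (\<integral>\<^sup>+g. indicator A g \<partial>distr gauss gauss (\<lambda>g. T (zext N g)))"
    using A by simp
  also have "\<dots> = (\<integral>\<^sup>+g. indicator A (T (zext N g)) \<partial>gauss)"
    by (rule nn_integral_distr'[OF rotate_measurable(1)[OF T(1)] i])
  also have "\<dots> = (\<integral>\<^sup>+g. indicator A (zext N g) \<partial>gauss)"
    by (rule nn_integral_gauss_rotate[OF T i])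
  also have "\<dots> = (\<integral>\<^sup>+g. indicator A g \<partial>distr gauss gauss (zext N))"
    by (rule nn_integral_distr'[OF zext_measurable i, symmetric])
  also have "\<dots> = emeasure (distr gauss gauss (zext N)) A" using A by simp
  finally show "emeasure (distr gauss gauss (\<lambda>g. T (zext N g))) A = emeasure (distr gauss gauss (zext N)) A" .
qed simp

definition array :: "nat set \<Rightarrow> (nat \<Rightarrow> nat \<Rightarrow> real) measure"
  where "array I = PiM I (\<lambda>_. gauss)"

interpretation PA: product_sigma_finite "\<lambda>_::nat. gauss"
  unfolding product_sigma_finite_def
  by (rule allI) (rule prob_space_imp_sigma_finite[OF prob_space_gauss])

lemma prob_space_array: "prob_space (array I)"
  unfolding array_def by (intro prob_space_PiM prob_space_gauss)

lemma row_measurable: "i \<in> I \<Longrightarrow> (\<lambda>X. X i) \<in> measurable (array I) gauss"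
  unfolding array_def by (rule measurable_component_singleton)

lemma array_measurableI:
  "(\<And>i. i \<in> I \<Longrightarrow> f i \<in> measurable M gauss) \<Longrightarrow> (\<lambda>x. \<lambda>i\<in>I. f i x) \<in> measurable M (array I)"
  unfolding array_def by (rule measurable_restrict)

lemma nn_integral_array_rotate:
  assumes I: "finite I" and T: "orthogonal_map N T" "orthogonal_map N T'" "\<And>x. T (T' x) = x"
    and F: "F \<in> borel_measurable (array I)"
  shows "(\<integral>\<^sup>+X. F (\<lambda>i\<in>I. T (zext N (X i))) \<partial>array I) = (\<integral>\<^sup>+X. F (\<lambda>i\<in>I. zext N (X i)) \<partial>array I)"
proof -
  have pp: "product_prob_space (\<lambda>_::nat. gauss)"
    by (intro product_prob_spaceI prob_space_gauss)
  have D: "distr (array I) (array I) (compose I f) = PiM I (\<lambda>i. distr gauss gauss f)"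
    if "f \<in> measurable gauss gauss" for f
    unfolding array_def by (rule distr_PiM_finite_prob_space[OF I pp pp that])
  have eq: "distr (array I) (array I) (compose I (\<lambda>g. T (zext N g))) = distr (array I) (array I) (compose I (zext N))"
    unfolding D[OF rotate_measurable(1)[OF T(1)]] D[OF zext_measurable] distr_gauss_rotate[OF T] ..
  have c: "compose I f \<in> measurable (array I) (array I)" if "f \<in> measurable gauss gauss" for f
    unfolding compose_def using measurable_compose[OF row_measurable that] by (intro array_measurableI)
  have "(\<integral>\<^sup>+X. F (compose I (\<lambda>g. T (zext N g)) X) \<partial>array I) = (\<integral>\<^sup>+X. F (compose I (zext N) X) \<partial>array I)"
    using nn_integral_distr'[OF c[OF rotate_measurable(1)[OF T(1)]] F] nn_integral_distr'[OF c[OF zext_measurable] F] eq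
    by simp
  then show ?thesis by (simp add: compose_def)
qed

section \<open>One-dimensional Gaussian integrals and marginals\<close>

lemma nn_integral_std_gauss:
  assumes "f \<in> borel_measurable borel"
  shows "(\<integral>\<^sup>+y. f y \<partial>std_gauss) = (\<integral>\<^sup>+y. ennreal (std_normal_density y) * f y \<partial>lborel)"
  using assms by (subst nn_integral_density) simp_all

lemma std_gauss_exp_sq:
  assumes s: "s < 1/2"
  shows "(\<integral>\<^sup>+y. ennreal (exp (s * y\<^sup>2)) \<partial>std_gauss) = ennreal (1 / sqrt (1 - 2 * s))"
proof -
  \<comment> \<open>\<open>\<sigma>\<close> is the standard deviation of the normal law obtained by
    tilting the standard one with \<open>exp (s * y\<^sup>2)\<close>.\<close>
  define \<sigma> where "\<sigma> = 1 / sqrt (1 - 2 * s)"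
  have \<sigma>: "0 < \<sigma>" "\<sigma>\<^sup>2 = 1 / (1 - 2 * s)" using s by (auto simp: \<sigma>_def power_divide)
  have eq: "std_normal_density y * exp (s * y\<^sup>2) = \<sigma> * normal_density 0 \<sigma> y" for y
  proof -
    have "- y\<^sup>2 / 2 + s * y\<^sup>2 = - y\<^sup>2 / (2 * \<sigma>\<^sup>2)" using s by (simp add: \<sigma> field_simps)
    then have "exp (- y\<^sup>2 / 2) * exp (s * y\<^sup>2) = exp (- y\<^sup>2 / (2 * \<sigma>\<^sup>2))" by (simp flip: exp_add)
    moreover have "sqrt (2 * pi * \<sigma>\<^sup>2) = sqrt (2 * pi) * \<sigma>" using \<sigma>(1) by (simp add: real_sqrt_mult)
    ultimately show ?thesis using \<sigma>(1) by (simp add: normal_density_def)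
  qed
  have "(\<integral>\<^sup>+y. ennreal (exp (s * y\<^sup>2)) \<partial>std_gauss) = (\<integral>\<^sup>+y. ennreal (\<sigma> * normal_density 0 \<sigma> y) \<partial>lborel)"
    by (subst nn_integral_std_gauss) (auto simp flip: eq ennreal_mult)
  also have "\<dots> = ennreal (\<integral>y. \<sigma> * normal_density 0 \<sigma> y \<partial>lborel)"
    using \<sigma>(1) by (intro nn_integral_eq_integral) auto
  also have "\<dots> = ennreal \<sigma>" using \<sigma>(1) by simp
  finally show ?thesis by (simp add: \<sigma>_def)
qed

lemma std_gauss_abs: "(\<integral>\<^sup>+y. ennreal \<bar>y\<bar> \<partial>std_gauss) = ennreal (sqrt (2 / pi))"
proof -
  have "(\<integral>\<^sup>+y. ennreal \<bar>y\<bar> \<partial>std_gauss) = (\<integral>\<^sup>+y. ennreal (std_normal_density y * \<bar>y\<bar>) \<partial>lborel)"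
    by (subst nn_integral_std_gauss) (auto simp flip: ennreal_mult)
  also have "\<dots> = ennreal (\<integral>y. std_normal_density y * \<bar>y\<bar> \<partial>lborel)"
    using integrable_std_normal_moment_abs[of 1] by (intro nn_integral_eq_integral) auto
  also have "\<dots> = ennreal (sqrt (2 / pi))" using integral_std_normal_moment_abs_odd[of 0] by simp
  finally show ?thesis .
qed

lemma nn_integral_gauss_coord:
  assumes "\<phi> \<in> borel_measurable borel"
  shows "(\<integral>\<^sup>+g. \<phi> (g j) \<partial>gauss) = (\<integral>\<^sup>+y. \<phi> y \<partial>std_gauss)"
  using nn_integral_gauss_prod[of "{j}" "\<lambda>_. \<phi>"] assms by simp

text \<open>A rotation takes \<open>x\<close> to the first coordinate vector, which reduces the
  inner product to a single coordinate.\<close>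

lemma nn_integral_gauss_ip:
  assumes x: "x \<in> euclidean N" "enorm N x = 1" and \<phi>: "\<phi> \<in> borel_measurable borel"
  shows "(\<integral>\<^sup>+g. \<phi> (ip N g x) \<partial>gauss) = (\<integral>\<^sup>+y. \<phi> y \<partial>std_gauss)"
proof -
  have "N \<noteq> 0" using x(2) by (intro notI) (simp add: enorm_def)
  then have 1: "1 \<in> {1..N}" by auto
  have "orthonormal N 1 (\<lambda>_. x)" "orthonormal N 1 (\<lambda>_. unit 1)"
    using x 1 unit_in_euclidean[OF 1] enorm_sq[of N x] ip_unit[OF 1, of "unit 1"] by (auto simp: orthonormal_def unit_apply)
  from orthonormal_transitive[OF this] obtain T T' where T: "orthogonal_map N T" "orthogonal_map N T'"
    "\<And>x. T (T' x) = x" "T x = unit 1" by auto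
  have "ip N (T (zext N g)) (unit 1) = ip N g x" for g
    using orthogonal_map_ip[OF T(1) zext_in[of N g] x(1)] by (simp add: T(4))
  moreover have "(\<lambda>g. \<phi> (ip N g (unit 1))) \<in> borel_measurable gauss"
    using \<phi> by measurable
  ultimately have "(\<integral>\<^sup>+g. \<phi> (ip N g x) \<partial>gauss) = (\<integral>\<^sup>+g. \<phi> (ip N g (unit 1)) \<partial>gauss)"
    using nn_integral_gauss_rotate[OF T(1-3), of "\<lambda>g. \<phi> (ip N g (unit 1))"] by simp
  also have "\<dots> = (\<integral>\<^sup>+g. \<phi> (g 1) \<partial>gauss)" by (simp only: ip_unit[OF 1])
  also have "\<dots> = (\<integral>\<^sup>+y. \<phi> y \<partial>std_gauss)" by (rule nn_integral_gauss_coord[OF \<phi>])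
  finally show ?thesis .
qed

lemma nn_integral_gauss_ip_scaled:
  assumes x: "x \<in> euclidean N" and \<phi>: "\<phi> \<in> borel_measurable borel"
  shows "(\<integral>\<^sup>+g. \<phi> (ip N g x) \<partial>gauss) = (\<integral>\<^sup>+y. \<phi> (enorm N x * y) \<partial>std_gauss)"
proof (cases "x = 0")
  case True
  interpret G: prob_space gauss by (rule prob_space_gauss)
  interpret S: prob_space std_gauss by (rule prob_space_std_gauss)
  show ?thesis using True G.emeasure_space_1 S.emeasure_space_1 by simp
next
  case False
  define u where "u = (1 / enorm N x) *\<^sub>R x"
  have pos: "0 < enorm N x" by (rule enorm_pos[OF x False])
  have u: "u \<in> euclidean N" "enorm N u = 1" using x pos subspace_euclidean
    by (auto simp: u_def enorm_scale intro: subspace_scale)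
  have "ip N g x = enorm N x * ip N g u" for g using pos by (simp add: u_def ip_simps)
  then show ?thesis using nn_integral_gauss_ip[OF u, of "\<lambda>y. \<phi> (enorm N x * y)"] \<phi> by simp
qed

text \<open>The first absolute moment sqrt (2/pi) of a standard normal is rounded down to 1/2; this
  is the centring constant of the symmetrisation below.\<close>

lemma gauss_abs_ip_ge:
  assumes x: "x \<in> euclidean N"
  shows "ennreal (enorm N x / 2) \<le> (\<integral>\<^sup>+g. ennreal \<bar>ip N g x\<bar> \<partial>gauss)"
proof -
  have "(\<integral>\<^sup>+g. ennreal \<bar>ip N g x\<bar> \<partial>gauss) = (\<integral>\<^sup>+y. ennreal (enorm N x) * ennreal \<bar>y\<bar> \<partial>std_gauss)"
    using nn_integral_gauss_ip_scaled[OF x, of "\<lambda>y. ennreal \<bar>y\<bar>"] by (simp add: abs_mult ennreal_mult)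
  also have "\<dots> = ennreal (enorm N x * sqrt (2 / pi))"
    by (subst nn_integral_cmult) (auto simp: std_gauss_abs ennreal_mult)
  also have "enorm N x / 2 \<le> enorm N x * sqrt (2 / pi)"
  proof -
    have "(1/2)\<^sup>2 \<le> 2 / pi" using pi_less_4 by (simp add: field_simps power2_eq_square)
    then have "1 / 2 \<le> sqrt (2 / pi)" by (rule real_le_rsqrt)
    then show ?thesis using mult_left_mono[of "1/2" "sqrt (2/pi)" "enorm N x"] by simp
  qed
  then have "ennreal (enorm N x / 2) \<le> ennreal (enorm N x * sqrt (2 / pi))" by (rule ennreal_leI)
  finally show ?thesis .
qed

lemma gauss_hyperplane_null:
  assumes x: "x \<in> euclidean N" "x \<noteq> 0"
  shows "emeasure gauss {g. ip N g x = 0} = 0"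
proof -
  have S: "{g. ip N g x = 0} \<in> sets gauss" using measurable_sets[OF ip_measurable_gauss[of N x], of "{0}"]
    by (simp add: vimage_def)
  then have "emeasure gauss {g. ip N g x = 0} = (\<integral>\<^sup>+g. indicator {0} (ip N g x) \<partial>gauss)"
    unfolding nn_integral_indicator[OF S, symmetric] by (intro nn_integral_cong) (simp add: indicator_def)
  also have "\<dots> = (\<integral>\<^sup>+y. indicator {0} (enorm N x * y) \<partial>std_gauss)"
    by (rule nn_integral_gauss_ip_scaled[OF x(1)]) auto
  also have "\<dots> = (\<integral>\<^sup>+y. indicator {0} y \<partial>std_gauss)"
    using enorm_pos[OF x] by (intro nn_integral_cong) (auto simp: indicator_def)
  also have "\<dots> = (\<integral>\<^sup>+y. ennreal (std_normal_density y) * indicator {0} y \<partial>lborel)"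
    by (rule nn_integral_std_gauss) auto
  also have "\<dots> = 0"
    by (subst nn_integral_0_iff_AE) (auto simp: indicator_def intro: AE_mp[OF AE_lborel_singleton[of 0]])
  finally show ?thesis .
qed

section \<open>Exchanging rows and columns of an array\<close>

abbreviation big :: "(nat \<times> nat \<Rightarrow> real) measure"
  where "big \<equiv> PiM UNIV (\<lambda>_. std_gauss)"

text \<open>\<open>array I\<close> is a product of products, in which rows and columns play
  different parts. As an image of one family of independent normals indexed by pairs it becomes
  symmetric in the two indices.\<close>

lemma distr_big_array:
  fixes \<phi> :: "nat \<Rightarrow> nat \<Rightarrow> nat \<times> nat"
  assumes I: "finite I" and inj: "\<And>i j i' j'. \<phi> i j = \<phi> i' j' \<Longrightarrow> i = i' \<and> j = j'"
  shows "distr big (array I) (\<lambda>\<omega>. \<lambda>i\<in>I. \<lambda>j. \<omega> (\<phi> i j)) = array I"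
\<comment> \<open>The criterion that turns independence into a product law is applied to a nonempty
  index set; the empty array is a point mass.\<close>
proof (cases "I = {}")
  case True
  interpret B: prob_space big by (intro prob_space_PiM prob_space_std_gauss)
  show ?thesis
  proof (rule measure_eqI)
    fix A assume "A \<in> sets (distr big (array I) (\<lambda>\<omega>. \<lambda>i\<in>I. \<lambda>j. \<omega> (\<phi> i j)))"
    then have A: "A \<in> sets (array I)" by simp
    then have "A \<subseteq> {\<lambda>_. undefined}" using sets.sets_into_space[OF A] True by (auto simp: array_def space_PiM)
    then have "A = {} \<or> A = {\<lambda>_. undefined}" by auto
    moreover have "emeasure (array I) {\<lambda>_. undefined} = 1"
      using prob_space.emeasure_space_1[OF prob_space_array[of I]] True by (simp add: array_def space_PiM)
    moreover have "(\<lambda>\<omega>::nat\<times>nat\<Rightarrow>real. \<lambda>i\<in>I. \<lambda>j. \<omega> (\<phi> i j)) \<in> measurable big (array I)"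
      using True unfolding array_def by (intro measurable_restrict) auto
    ultimately show "emeasure (distr big (array I) (\<lambda>\<omega>. \<lambda>i\<in>I. \<lambda>j. \<omega> (\<phi> i j))) A = emeasure (array I) A"
      using A True B.emeasure_space_1 by (auto simp: emeasure_distr restrict_def)
  qed simp
next
  case False
  interpret B: prob_space big by (intro prob_space_PiM prob_space_std_gauss)
  have comp: "distr big std_gauss (\<lambda>\<omega>. \<omega> p) = std_gauss" for p
    by (rule distr_PiM_component) (auto intro: prob_space_std_gauss)
  have coord: "(\<lambda>\<omega>. \<omega> p) \<in> measurable big std_gauss" for p
    by (rule measurable_component_singleton) simp
  have "B.indep_vars (\<lambda>_. std_gauss) (\<lambda>p \<omega>. \<omega> p) UNIV"
    using distr_PiM_reindex[of "UNIV :: (nat \<times> nat) set" "\<lambda>_. std_gauss" "\<lambda>x. x" UNIV] prob_space_std_gauss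
    by (subst B.indep_vars_iff_distr_eq_PiM'[OF _ coord]) (simp_all add: comp)
  from B.indep_vars_restrict[OF this, of I "\<lambda>i. range (\<phi> i)"]
  have "B.indep_vars (\<lambda>i. PiM (range (\<phi> i)) (\<lambda>_. std_gauss)) (\<lambda>i \<omega>. restrict \<omega> (range (\<phi> i))) I"
    using inj by (auto simp: disjoint_family_on_def dest: inj)
  from B.indep_vars_compose2[OF this, of "\<lambda>i v j. v (\<phi> i j)" "\<lambda>_. gauss"]
  have "B.indep_vars (\<lambda>_. gauss) (\<lambda>i \<omega> j. restrict \<omega> (range (\<phi> i)) (\<phi> i j)) I"
  proof -
    have "(\<lambda>v j. v (\<phi> i j)) \<in> measurable (PiM (range (\<phi> i)) (\<lambda>_. std_gauss)) gauss" for i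
    proof (rule measurable_to_gauss)
      fix j
      have "(\<lambda>v. v (\<phi> i j)) \<in> measurable (PiM (range (\<phi> i)) (\<lambda>_. std_gauss)) std_gauss"
        by (rule measurable_component_singleton) simp
      then show "(\<lambda>v. v (\<phi> i j)) \<in> borel_measurable (PiM (range (\<phi> i)) (\<lambda>_. std_gauss))" by simp
    qed
    then show ?thesis
      using \<open>(\<And>i. i \<in> I \<Longrightarrow> (\<lambda>v j. v (\<phi> i j)) \<in> measurable (PiM (range (\<phi> i)) (\<lambda>_. std_gauss)) gauss) \<Longrightarrow> _\<close>
      by simp
  qed
  then have ind: "B.indep_vars (\<lambda>_. gauss) (\<lambda>i \<omega> j. \<omega> (\<phi> i j)) I" by simp
  have row: "(\<lambda>\<omega> j. \<omega> (\<phi> i j)) \<in> measurable big gauss" for i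
    using coord by (intro measurable_to_gauss) simp
  have "distr big gauss (\<lambda>\<omega> j. \<omega> (\<phi> i j)) = gauss" for i
    using distr_PiM_reindex[of "UNIV :: (nat \<times> nat) set" "\<lambda>_. std_gauss" "\<phi> i" UNIV] inj prob_space_std_gauss
    by (simp add: gauss_def inj_on_def restrict_def)
  then show ?thesis
    using B.indep_vars_iff_distr_eq_PiM'[OF False row] ind by (simp add: array_def)
qed

lemma array_coord_measurable: "i \<in> I \<Longrightarrow> (\<lambda>X. X i j) \<in> borel_measurable (array I)"
  using measurable_compose[OF row_measurable coord_measurable_gauss] by simp

lemma nn_integral_array_transpose:
  assumes I: "finite I" "finite J" and F: "F \<in> borel_measurable (array I)" "G \<in> borel_measurable (array J)"
    and eq: "\<And>a :: nat \<times> nat \<Rightarrow> real. F (\<lambda>i\<in>I. \<lambda>j. a (i, j)) = G (\<lambda>j\<in>J. \<lambda>i. a (i, j))"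
  shows "(\<integral>\<^sup>+X. F X \<partial>array I) = (\<integral>\<^sup>+Y. G Y \<partial>array J)"
proof -
  have coord: "(\<lambda>\<omega>. \<omega> p) \<in> borel_measurable big" for p
    using measurable_component_singleton[of p UNIV "\<lambda>_. std_gauss"] by simp
  have m1: "(\<lambda>\<omega>. \<lambda>i\<in>I. \<lambda>j. \<omega> (i, j)) \<in> measurable big (array I)"
    by (intro array_measurableI measurable_to_gauss coord)
  have m2: "(\<lambda>\<omega>. \<lambda>j\<in>J. \<lambda>i. \<omega> (i, j)) \<in> measurable big (array J)"
    by (intro array_measurableI measurable_to_gauss coord)
  have "(\<integral>\<^sup>+X. F X \<partial>array I) = (\<integral>\<^sup>+X. F X \<partial>distr big (array I) (\<lambda>\<omega>. \<lambda>i\<in>I. \<lambda>j. \<omega> (i, j)))"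
    using distr_big_array[OF I(1), of "\<lambda>i j. (i, j)"] by simp
  also have "\<dots> = (\<integral>\<^sup>+\<omega>. G (\<lambda>j\<in>J. \<lambda>i. \<omega> (i, j)) \<partial>big)"
    unfolding nn_integral_distr'[OF m1 F(1)] eq ..
  also have "\<dots> = (\<integral>\<^sup>+Y. G Y \<partial>distr big (array J) (\<lambda>\<omega>. \<lambda>j\<in>J. \<lambda>i. \<omega> (i, j)))"
    by (rule nn_integral_distr'[OF m2 F(2), symmetric])
  also have "\<dots> = (\<integral>\<^sup>+Y. G Y \<partial>array J)"
    using distr_big_array[OF I(2), of "\<lambda>j i. (i, j)"] by simp
  finally show ?thesis .
qed

text \<open>The weighted column sums are independent centred normals of standard deviation
  \<open>enorm m b\<close>: after transposition the j-th of them is the inner product of one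
  Gaussian row with \<open>b\<close>.\<close>

lemma nn_integral_array_weighted_sum:
  assumes J: "finite J" and \<psi>: "\<And>j. j \<in> J \<Longrightarrow> \<psi> j \<in> borel_measurable borel"
  shows "(\<integral>\<^sup>+X. (\<Prod>j\<in>J. \<psi> j (\<Sum>i=1..m. b i * X i j)) \<partial>array {1..m}) =
    (\<Prod>j\<in>J. \<integral>\<^sup>+y. \<psi> j (enorm m b * y) \<partial>std_gauss)"
proof -
  have "(\<integral>\<^sup>+X. (\<Prod>j\<in>J. \<psi> j (\<Sum>i=1..m. b i * X i j)) \<partial>array {1..m}) =
      (\<integral>\<^sup>+Y. (\<Prod>j\<in>J. \<psi> j (ip m (Y j) b)) \<partial>array J)"
  proof (rule nn_integral_array_transpose[OF _ J])
    show "(\<lambda>X. \<Prod>j\<in>J. \<psi> j (\<Sum>i=1..m. b i * X i j)) \<in> borel_measurable (array {1..m})"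
      by (intro borel_measurable_prod_ennreal measurable_compose[OF _ \<psi>] borel_measurable_sum
          borel_measurable_times array_coord_measurable) auto
    show "(\<lambda>Y. \<Prod>j\<in>J. \<psi> j (ip m (Y j) b)) \<in> borel_measurable (array J)"
      by (intro borel_measurable_prod_ennreal measurable_compose[OF _ \<psi>] measurable_compose[OF row_measurable ip_measurable_gauss])
    show "(\<Prod>j\<in>J. \<psi> j (\<Sum>i=1..m. b i * (\<lambda>i\<in>{1..m}. \<lambda>j. a (i, j)) i j)) =
      (\<Prod>j\<in>J. \<psi> j (ip m ((\<lambda>j\<in>J. \<lambda>i. a (i, j)) j) b))" for a
      by (intro prod.cong refl arg_cong[where f="\<psi> _"]) (simp add: ip_def mult.commute)
  qed simp
  also have "\<dots> = (\<Prod>j\<in>J. \<integral>\<^sup>+g. \<psi> j (ip m g b) \<partial>gauss)"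
    unfolding array_def
    by (intro PA.product_nn_integral_prod J measurable_compose[OF ip_measurable_gauss \<psi>])
  also have "\<dots> = (\<Prod>j\<in>J. \<integral>\<^sup>+y. \<psi> j (enorm m b * y) \<partial>std_gauss)"
  proof (intro prod.cong refl)
    fix j assume "j \<in> J"
    then show "(\<integral>\<^sup>+g. \<psi> j (ip m g b) \<partial>gauss) = (\<integral>\<^sup>+y. \<psi> j (enorm m b * y) \<partial>std_gauss)"
      using nn_integral_gauss_ip_scaled[OF zext_in \<psi>, of j m b] by simp
  qed
  finally show ?thesis .
qed

section \<open>Uniform lower bounds for Gaussian arrays\<close>

text \<open>The tangent to exp at \<open>m\<close>, integrated. The term \<open>exp m * m\<close> is
  moved to the other side, so that no subtraction occurs in \<open>ennreal\<close>.\<close>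

lemma jensen_exp:
  assumes M: "prob_space M" and u: "u \<in> borel_measurable M" "\<And>y. 0 \<le> u y"
    and m: "0 \<le> m" "ennreal m \<le> (\<integral>\<^sup>+y. ennreal (u y) \<partial>M)"
  shows "ennreal (exp m) \<le> (\<integral>\<^sup>+y. ennreal (exp (u y)) \<partial>M)"
proof -
  interpret prob_space M by (rule M)
  have tangent: "exp m + exp m * u y \<le> exp (u y) + exp m * m" for y
  proof -
    have "exp m * (1 + (u y - m)) \<le> exp m * exp (u y - m)"
      by (intro mult_left_mono exp_ge_add_one_self) simp
    then show ?thesis by (simp add: algebra_simps flip: exp_add)
  qed
  have "ennreal (exp m) + ennreal (exp m) * ennreal m \<le> ennreal (exp m) + ennreal (exp m) * (\<integral>\<^sup>+y. ennreal (u y) \<partial>M)"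
    by (intro add_mono mult_mono m) auto
  also have "\<dots> = (\<integral>\<^sup>+y. ennreal (exp m) + ennreal (exp m) * ennreal (u y) \<partial>M)"
    using u by (subst nn_integral_add) (auto simp: nn_integral_cmult emeasure_space_1)
  also have "\<dots> \<le> (\<integral>\<^sup>+y. ennreal (exp (u y)) + ennreal (exp m) * ennreal m \<partial>M)"
    using tangent u(2) m(1)
    by (intro nn_integral_mono) (simp flip: ennreal_mult ennreal_plus)
  also have "\<dots> = (\<integral>\<^sup>+y. ennreal (exp (u y)) \<partial>M) + ennreal (exp m) * ennreal m"
    using u by (subst nn_integral_add) (auto simp: emeasure_space_1)
  finally have "ennreal (exp m) * ennreal m + ennreal (exp m) \<le> ennreal (exp m) * ennreal m + (\<integral>\<^sup>+y. ennreal (exp (u y)) \<partial>M)"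
    by (simp add: add.commute)
  then show ?thesis
    using m(1) by (simp flip: ennreal_mult add: ennreal_add_left_cancel_le)
qed

lemma Max_image_attained:
  fixes f :: "'a \<Rightarrow> real"
  assumes "finite T" "T \<noteq> {}"
  obtains x where "x \<in> T" "Max (f ` T) = f x"
proof -
  have "Max (f ` T) \<in> f ` T" by (rule Max_in) (use assms in auto)
  then obtain x where "x \<in> T" "Max (f ` T) = f x" by blast
  then show ?thesis by (rule that)
qed

text \<open>Either choice of sign pairs the two maximisers on the left with competitors on the right.\<close>

lemma exp_Max_contraction:
  fixes A s :: "'a \<Rightarrow> real" and l :: real
  assumes T: "finite T" "T \<noteq> {}" and l: "0 \<le> l"
  shows "exp (l * Max ((\<lambda>x. A x + \<bar>s x\<bar>) ` T)) + exp (l * Max ((\<lambda>x. A x - \<bar>s x\<bar>) ` T))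
    \<le> exp (l * Max ((\<lambda>x. A x + s x) ` T)) + exp (l * Max ((\<lambda>x. A x - s x) ` T))"
proof -
  define P where "P = Max ((\<lambda>x. A x + s x) ` T)"
  define Q where "Q = Max ((\<lambda>x. A x - s x) ` T)"
  have PQ: "A x + s x \<le> P" "A x - s x \<le> Q" if "x \<in> T" for x
    using T that by (auto simp: P_def Q_def)
  obtain x where x: "x \<in> T" "Max ((\<lambda>x. A x + \<bar>s x\<bar>) ` T) = A x + \<bar>s x\<bar>"
    by (rule Max_image_attained[OF T])
  obtain y where y: "y \<in> T" "Max ((\<lambda>x. A x - \<bar>s x\<bar>) ` T) = A y - \<bar>s y\<bar>"
    by (rule Max_image_attained[OF T])
  have "(A x + \<bar>s x\<bar> \<le> P \<and> A y - \<bar>s y\<bar> \<le> Q) \<or> (A x + \<bar>s x\<bar> \<le> Q \<and> A y - \<bar>s y\<bar> \<le> P)"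
    using PQ[OF x(1)] PQ[OF y(1)] by (cases "s x \<ge> 0"; cases "s y \<ge> 0") auto
  then have "exp (l * (A x + \<bar>s x\<bar>)) + exp (l * (A y - \<bar>s y\<bar>)) \<le> exp (l * P) + exp (l * Q)"
  proof
    assume "A x + \<bar>s x\<bar> \<le> P \<and> A y - \<bar>s y\<bar> \<le> Q"
    then show ?thesis using l by (intro add_mono) (auto intro: mult_left_mono)
  next
    assume "A x + \<bar>s x\<bar> \<le> Q \<and> A y - \<bar>s y\<bar> \<le> P"
    then have "exp (l * (A x + \<bar>s x\<bar>)) + exp (l * (A y - \<bar>s y\<bar>)) \<le> exp (l * Q) + exp (l * P)"
      using l by (intro add_mono) (auto intro: mult_left_mono)
    then show ?thesis by simp
  qed
  then show ?thesis by (simp add: x y P_def Q_def)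
qed

lemma emeasure_gauss_UNIV [simp]: "emeasure gauss UNIV = 1"
  using prob_space.emeasure_space_1[OF prob_space_gauss] by simp

lemma orthogonal_map_uminus: "orthogonal_map N uminus"
proof -
  have "linear (uminus :: (nat \<Rightarrow> real) \<Rightarrow> nat \<Rightarrow> real)"
    by (rule linearI) (auto simp: fun_eq_iff)
  then show ?thesis by (auto simp: orthogonal_map_def euclidean_def)
qed

lemma gauss_symmetric:
  assumes f: "f \<in> borel_measurable gauss" and loc: "\<And>g. f (zext N g) = f g"
  shows "(\<integral>\<^sup>+g. f (- g) \<partial>gauss) = (\<integral>\<^sup>+g. f g \<partial>gauss)"
proof -
  have "- zext N g = zext N (- g)" for g by (auto simp: zext_def fun_eq_iff)
  then have "f (- zext N g) = f (- g)" for g using loc[of "- g"] by simp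
  then show ?thesis
    using nn_integral_gauss_rotate[OF orthogonal_map_uminus orthogonal_map_uminus _ f, of N] by (simp add: loc)
qed

definition expmax :: "'a set \<Rightarrow> real \<Rightarrow> ('a \<Rightarrow> real) \<Rightarrow> ennreal"
  where "expmax T l A = ennreal (exp (l * Max (A ` T)))"

context
  fixes d :: nat and T :: "(nat \<Rightarrow> real) set" and l :: real
  assumes T: "finite T" "T \<noteq> {}" "T \<subseteq> euclidean d" and l: "0 \<le> l"
begin

lemma expmax_measurable:
  assumes "\<And>x. x \<in> T \<Longrightarrow> (\<lambda>y. A y x) \<in> borel_measurable M"
  shows "(\<lambda>y. expmax T l (A y)) \<in> borel_measurable M"
proof -
  have "(\<lambda>y. Max ((\<lambda>x. A y x) ` T)) \<in> borel_measurable M"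
    using borel_measurable_Max[OF T(1), of "\<lambda>x y. A y x" M] assms by simp
  then show ?thesis unfolding expmax_def by measurable
qed

lemma expmax_ge: "x \<in> T \<Longrightarrow> ennreal (exp (l * A x)) \<le> expmax T l A"
  using T l unfolding expmax_def by (intro ennreal_leI) (auto intro: mult_left_mono)

lemma expmax_attained: obtains x where "x \<in> T" "expmax T l A = ennreal (exp (l * A x))"
proof -
  obtain x where "x \<in> T" "Max (A ` T) = A x" by (rule Max_image_attained[OF T(1,2)])
  then show ?thesis by (intro that[of x]) (simp_all add: expmax_def)
qed

text \<open>The number \<open>enorm d x / 2\<close> is at most the mean of |<z, x>| over an
  independent copy z of the row, so Jensen brings z into the exponent. Convexity of exp splits the
  result into half of the maximum for A + 2b|<z, x>| and half of that for A - 2b|<y, x>|.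
  Contraction then removes the absolute values, and the symmetry of the row merges the two
  terms.\<close>

lemma expmax_row:
  assumes b: "0 \<le> b"
  shows "(\<integral>\<^sup>+y. expmax T l (\<lambda>x. A x + (b * (enorm d x / 2) - b * \<bar>ip d y x\<bar>)) \<partial>gauss)
    \<le> (\<integral>\<^sup>+y. expmax T l (\<lambda>x. A x + 2 * (b * ip d y x)) \<partial>gauss)" (is "?L \<le> ?R")
proof -
  interpret G: prob_space gauss by (rule prob_space_gauss)
  let ?f = "\<lambda>y x. b * \<bar>ip d y x\<bar>"
  let ?P = "\<lambda>y. expmax T l (\<lambda>x. A x + \<bar>2 * (b * ip d y x)\<bar>)"
  let ?Q = "\<lambda>y. expmax T l (\<lambda>x. A x - \<bar>2 * (b * ip d y x)\<bar>)"
  let ?h = "ennreal (1/2)"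
  have m[measurable]: "?P \<in> borel_measurable gauss" "?Q \<in> borel_measurable gauss"
    "(\<lambda>y. expmax T l (\<lambda>x. A x + 2 * (b * ip d y x))) \<in> borel_measurable gauss"
    "(\<lambda>y. expmax T l (\<lambda>x. A x - 2 * (b * ip d y x))) \<in> borel_measurable gauss"
    by (intro expmax_measurable; measurable)+
  have step: "expmax T l (\<lambda>x. A x + (b * (enorm d x / 2) - ?f y x)) \<le> ?h * (\<integral>\<^sup>+z. ?P z \<partial>gauss) + ?h * ?Q y" for y
  proof -
    obtain x where x: "x \<in> T" and e: "expmax T l (\<lambda>x. A x + (b * (enorm d x / 2) - ?f y x)) =
        ennreal (exp (l * (A x + (b * (enorm d x / 2) - ?f y x))))"
      by (rule expmax_attained)
    have xd: "x \<in> euclidean d" using x T by auto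
    have "ennreal (l * (b * (enorm d x / 2))) = ennreal (l * b) * ennreal (enorm d x / 2)"
      using l b by (simp flip: ennreal_mult add: mult.assoc)
    also have "\<dots> \<le> ennreal (l * b) * (\<integral>\<^sup>+z. ennreal \<bar>ip d z x\<bar> \<partial>gauss)"
      by (intro mult_left_mono gauss_abs_ip_ge xd) simp
    also have "\<dots> = (\<integral>\<^sup>+z. ennreal (l * ?f z x) \<partial>gauss)"
      using l b by (subst nn_integral_cmult[symmetric]) (auto simp flip: ennreal_mult simp: mult.assoc intro!: nn_integral_cong)
    finally have J: "ennreal (exp (l * (b * (enorm d x / 2)))) \<le> (\<integral>\<^sup>+z. ennreal (exp (l * ?f z x)) \<partial>gauss)"
      using l b by (intro jensen_exp G.prob_space_axioms) auto
    define c where "c = exp (l * (A x - ?f y x))"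
    have "expmax T l (\<lambda>x. A x + (b * (enorm d x / 2) - ?f y x)) = ennreal c * ennreal (exp (l * (b * (enorm d x / 2))))"
      unfolding e c_def by (simp add: algebra_simps flip: ennreal_mult exp_add)
    also have "\<dots> \<le> ennreal c * (\<integral>\<^sup>+z. ennreal (exp (l * ?f z x)) \<partial>gauss)"
      by (intro mult_left_mono J) simp
    also have "\<dots> = (\<integral>\<^sup>+z. ennreal c * ennreal (exp (l * ?f z x)) \<partial>gauss)"
      by (rule nn_integral_cmult[symmetric]) measurable
    also have "\<dots> \<le> (\<integral>\<^sup>+z. ?h * ?P z + ?h * ?Q y \<partial>gauss)"
    proof (rule nn_integral_mono)
      fix z
      define u where "u = l * (A x + \<bar>2 * (b * ip d z x)\<bar>)"
      define v where "v = l * (A x - \<bar>2 * (b * ip d y x)\<bar>)"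
      have "c * exp (l * ?f z x) = exp (u / 2 + v / 2)"
        unfolding c_def u_def v_def using b by (simp add: abs_mult algebra_simps add_divide_distrib diff_divide_distrib flip: exp_add)
      also have "\<dots> \<le> exp u / 2 + exp v / 2"
        using convex_onD[OF exp_convex, of "1/2" u v] by simp
      finally have le: "c * exp (l * ?f z x) \<le> exp u / 2 + exp v / 2" .
      have "ennreal c * ennreal (exp (l * ?f z x)) = ennreal (c * exp (l * ?f z x))"
        by (rule ennreal_mult[symmetric]) (simp_all add: c_def)
      also have "\<dots> \<le> ennreal (exp u / 2 + exp v / 2)" by (rule ennreal_leI[OF le])
      also have "\<dots> = ?h * ennreal (exp u) + ?h * ennreal (exp v)"
      proof -
        have *: "ennreal (a / 2) = ?h * ennreal a" if "0 \<le> a" for a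
          using ennreal_mult[of "1/2" a] that by (simp only: times_divide_eq_left mult_1 zero_le_divide_1_iff zero_le_numeral)
        have "ennreal (exp u / 2 + exp v / 2) = ennreal (exp u / 2) + ennreal (exp v / 2)"
          by (rule ennreal_plus) simp_all
        then show ?thesis by (simp only: *[OF exp_ge_zero])
      qed
      also have "\<dots> \<le> ?h * ?P z + ?h * ?Q y"
        unfolding u_def v_def
        using expmax_ge[OF x, of "\<lambda>x. A x + \<bar>2 * (b * ip d z x)\<bar>"] expmax_ge[OF x, of "\<lambda>x. A x - \<bar>2 * (b * ip d y x)\<bar>"]
        by (intro add_mono mult_left_mono) auto
      finally show "ennreal c * ennreal (exp (l * ?f z x)) \<le> ?h * ?P z + ?h * ?Q y" .
    qed
    also have "\<dots> = ?h * (\<integral>\<^sup>+z. ?P z \<partial>gauss) + ?h * ?Q y"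
      by (subst nn_integral_add) (auto simp: nn_integral_cmult G.emeasure_space_1)
    finally show ?thesis .
  qed
  \<comment> \<open>The two halves depend on \<open>z\<close> and on \<open>y\<close> separately. As
    these have the same law, both are integrated over one row, where
    \<open>exp_Max_contraction\<close> applies pointwise.\<close>
  have "?L \<le> (\<integral>\<^sup>+y. ?h * (\<integral>\<^sup>+z. ?P z \<partial>gauss) + ?h * ?Q y \<partial>gauss)"
    by (intro nn_integral_mono step)
  also have "\<dots> = ?h * (\<integral>\<^sup>+z. ?P z \<partial>gauss) + ?h * (\<integral>\<^sup>+y. ?Q y \<partial>gauss)"
    by (subst nn_integral_add) (auto simp: nn_integral_cmult G.emeasure_space_1)
  also have "\<dots> = ?h * (\<integral>\<^sup>+y. ?P y + ?Q y \<partial>gauss)"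
    by (subst nn_integral_add) (auto simp: distrib_left)
  also have "\<dots> \<le> ?h * (\<integral>\<^sup>+y. expmax T l (\<lambda>x. A x + 2 * (b * ip d y x)) + expmax T l (\<lambda>x. A x - 2 * (b * ip d y x)) \<partial>gauss)"
    unfolding expmax_def using exp_Max_contraction[OF T(1,2) l, of A]
    by (intro mult_left_mono nn_integral_mono) (simp_all flip: ennreal_plus)
  also have "(\<integral>\<^sup>+y. expmax T l (\<lambda>x. A x + 2 * (b * ip d y x)) + expmax T l (\<lambda>x. A x - 2 * (b * ip d y x)) \<partial>gauss)
    = ?R + (\<integral>\<^sup>+y. expmax T l (\<lambda>x. A x - 2 * (b * ip d y x)) \<partial>gauss)"
    by (rule nn_integral_add) measurable
  also have "(\<integral>\<^sup>+y. expmax T l (\<lambda>x. A x - 2 * (b * ip d y x)) \<partial>gauss) = ?R"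
  proof -
    have "ip d (- y) x = - ip d y x" for x y by (simp add: ip_def sum_negf)
    then show ?thesis
      using gauss_symmetric[OF m(3), of d] by simp
  qed
  also have "?h * (?R + ?R) = ?R"
  proof -
    have "?h * (?R + ?R) = (?h * 2) * ?R" by (simp add: mult_2[symmetric] mult.assoc)
    also have "?h * 2 = 1"
      using ennreal_mult[of "1/2" 2] by (simp only: ennreal_numeral) simp
    finally show ?thesis by simp
  qed
  finally show ?thesis .
qed

lemma array_ip_measurable [measurable]: "i \<in> I \<Longrightarrow> (\<lambda>X. ip d (X i) x) \<in> borel_measurable (array I)"
  by (rule measurable_compose[OF row_measurable ip_measurable_gauss])

text \<open>Induction on the rows for arbitrary \<open>A\<close>: the new row is contracted while
  \<open>A\<close> carries the centred terms of the others; after the integrals are exchanged, its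
  linear term joins \<open>A\<close> and the induction hypothesis treats the rest.\<close>

lemma expmax_array:
  assumes I: "finite I" and b: "\<And>i. i \<in> I \<Longrightarrow> 0 \<le> b i"
  shows "(\<integral>\<^sup>+X. expmax T l (\<lambda>x. A x + (\<Sum>i\<in>I. b i * (enorm d x / 2) - b i * \<bar>ip d (X i) x\<bar>)) \<partial>array I)
    \<le> (\<integral>\<^sup>+X. expmax T l (\<lambda>x. A x + 2 * (\<Sum>i\<in>I. b i * ip d (X i) x)) \<partial>array I)"
  using I b
proof (induction I arbitrary: A)
  case empty
  then show ?case by simp
next
  case (insert i I)
  let ?s = "\<lambda>i y x. b i * (enorm d x / 2) - b i * \<bar>ip d y x\<bar>"
  have m1: "(\<lambda>X. expmax T l (\<lambda>x. A x + (\<Sum>k\<in>insert i I. ?s k (X k) x))) \<in> borel_measurable (PiM (insert i I) (\<lambda>_. gauss))"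
    unfolding array_def[symmetric] by (intro expmax_measurable borel_measurable_add borel_measurable_sum
      borel_measurable_diff borel_measurable_times borel_measurable_abs array_ip_measurable) auto
  have m2: "(\<lambda>X. expmax T l (\<lambda>x. A x + 2 * (\<Sum>k\<in>insert i I. b k * ip d (X k) x))) \<in> borel_measurable (PiM (insert i I) (\<lambda>_. gauss))"
    unfolding array_def[symmetric] by (intro expmax_measurable borel_measurable_add borel_measurable_sum
      borel_measurable_times array_ip_measurable) auto
  have up: "(\<Sum>k\<in>insert i I. g k ((X(i := y)) k)) = g i y + (\<Sum>k\<in>I. g k (X k))" for g :: "nat \<Rightarrow> (nat \<Rightarrow> real) \<Rightarrow> real" and X y
  proof -
    have "(\<Sum>k\<in>I. g k ((X(i := y)) k)) = (\<Sum>k\<in>I. g k (X k))"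
      using insert.hyps by (intro sum.cong) auto
    then show ?thesis using insert.hyps by simp
  qed
  have "(\<integral>\<^sup>+X. expmax T l (\<lambda>x. A x + (\<Sum>k\<in>insert i I. ?s k (X k) x)) \<partial>array (insert i I))
    = (\<integral>\<^sup>+X. \<integral>\<^sup>+y. expmax T l (\<lambda>x. (A x + (\<Sum>k\<in>I. ?s k (X k) x)) + ?s i y x) \<partial>gauss \<partial>array I)"
    unfolding array_def PA.product_nn_integral_insert[OF insert.hyps(1,2) m1] up[of "\<lambda>k. (\<lambda>y. ?s k y _)"]
    by (intro nn_integral_cong arg_cong[where f="expmax T l"]) (auto simp: algebra_simps)
  also have "\<dots> \<le> (\<integral>\<^sup>+X. \<integral>\<^sup>+y. expmax T l (\<lambda>x. (A x + (\<Sum>k\<in>I. ?s k (X k) x)) + 2 * (b i * ip d y x)) \<partial>gauss \<partial>array I)"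
    using insert.prems by (intro nn_integral_mono expmax_row) auto
  also have "\<dots> = (\<integral>\<^sup>+y. \<integral>\<^sup>+X. expmax T l (\<lambda>x. (A x + 2 * (b i * ip d y x)) + (\<Sum>k\<in>I. ?s k (X k) x)) \<partial>array I \<partial>gauss)"
  proof -
    interpret A: prob_space "array I" by (rule prob_space_array)
    interpret G: prob_space gauss by (rule prob_space_gauss)
    interpret P: pair_sigma_finite "array I" gauss ..
    have "(\<lambda>p. expmax T l (\<lambda>x. (A x + (\<Sum>k\<in>I. ?s k (fst p k) x)) + 2 * (b i * ip d (snd p) x))) \<in> borel_measurable (array I \<Otimes>\<^sub>M gauss)"
      by (intro expmax_measurable borel_measurable_add borel_measurable_sum
        borel_measurable_diff borel_measurable_times borel_measurable_abs measurable_compose[OF measurable_fst array_ip_measurable]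
        measurable_compose[OF measurable_snd ip_measurable_gauss]) auto
    from P.Fubini'[of "\<lambda>X y. expmax T l (\<lambda>x. (A x + (\<Sum>k\<in>I. ?s k (X k) x)) + 2 * (b i * ip d y x))"] this
    show ?thesis by (simp add: case_prod_beta' algebra_simps)
  qed
  also have "\<dots> \<le> (\<integral>\<^sup>+y. \<integral>\<^sup>+X. expmax T l (\<lambda>x. (A x + 2 * (b i * ip d y x)) + 2 * (\<Sum>k\<in>I. b k * ip d (X k) x)) \<partial>array I \<partial>gauss)"
    using insert.prems by (intro nn_integral_mono insert.IH) auto
  also have "\<dots> = (\<integral>\<^sup>+X. expmax T l (\<lambda>x. A x + 2 * (\<Sum>k\<in>insert i I. b k * ip d (X k) x)) \<partial>array (insert i I))"
    unfolding array_def PA.product_nn_integral_insert_rev[OF insert.hyps(1,2) m2] up[of "\<lambda>k. (\<lambda>y. b k * ip d y _)"]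
    by (intro nn_integral_cong arg_cong[where f="expmax T l"]) (auto simp: algebra_simps)
  finally show ?case .
qed

end

text \<open>For \<open>enorm d x = \<rho>\<close> the mean of the weighted sum is at least
  \<open>\<rho> * (\<Sum>i=1..m. b i) / 2\<close>; the threshold is half of this.\<close>

definition small :: "nat \<Rightarrow> nat \<Rightarrow> (nat \<Rightarrow> real) \<Rightarrow> real \<Rightarrow> (nat \<Rightarrow> real) \<Rightarrow> (nat \<Rightarrow> nat \<Rightarrow> real) set"
  where "small d m b \<rho> x = {X \<in> space (array {1..m}). (\<Sum>i=1..m. b i * \<bar>ip d (X i) x\<bar>) < \<rho> * (\<Sum>i=1..m. b i) / 4}"

text \<open>The function \<open>c\<close> times the product of the \<open>\<psi> j (y j)\<close> is
  to majorise exp (2 l <y, x>) uniformly over the points x. Being a product over coordinates, it has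
  at the Gaussian vector with coordinates of standard deviation \<open>enorm m b\<close> a mean that
  is a product of one-dimensional integrals. The exponential prefactor is Markov's.\<close>

definition uniform_lower_tail :: "nat \<Rightarrow> nat \<Rightarrow> (nat \<Rightarrow> real) \<Rightarrow> real \<Rightarrow> real \<Rightarrow> ennreal \<Rightarrow> (nat \<Rightarrow> real \<Rightarrow> ennreal) \<Rightarrow> ennreal"
  where "uniform_lower_tail d m b l \<rho> c \<psi> = ennreal (exp (- l * \<rho> * (\<Sum>i=1..m. b i) / 4)) * (c * (\<Prod>j=1..d. \<integral>\<^sup>+y. \<psi> j (enorm m b * y) \<partial>std_gauss))"

context
  fixes d m :: nat and b :: "nat \<Rightarrow> real" and l \<rho> :: real and T :: "(nat \<Rightarrow> real) set"
    and c :: ennreal and \<psi> :: "nat \<Rightarrow> real \<Rightarrow> ennreal"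
  assumes T: "T \<subseteq> euclidean d" "\<And>x. x \<in> T \<Longrightarrow> enorm d x = \<rho>"
    and l: "0 \<le> l" and b: "\<And>i. 0 \<le> b i"
    and \<psi>: "\<And>j. \<psi> j \<in> borel_measurable borel"
    and dom: "\<And>y x. x \<in> T \<Longrightarrow> ennreal (exp (2 * l * ip d y x)) \<le> c * (\<Prod>j=1..d. \<psi> j (y j))"
begin

lemma small_sets: "small d m b \<rho> x \<in> sets (array {1..m})"
proof -
  have "(\<lambda>X. \<Sum>i=1..m. b i * \<bar>ip d (X i) x\<bar>) \<in> borel_measurable (array {1..m})"
    by (intro borel_measurable_sum borel_measurable_times borel_measurable_abs
        measurable_compose[OF row_measurable ip_measurable_gauss]) auto
  then show ?thesis unfolding small_def by measurable
qed

text \<open>On the bad event the centred sum is at least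
  \<open>\<rho> * (\<Sum>i=1..m. b i) / 4\<close> at some point of \<open>F\<close>. Markov's
  inequality for its exponential, \<open>expmax_array\<close>, and the majorant \<open>dom\<close>
  of the resulting linear form give the bound.\<close>

lemma uniform_lower_bound_finite:
  assumes F: "finite F" "F \<subseteq> T"
  shows "emeasure (array {1..m}) (\<Union>x\<in>F. small d m b \<rho> x) \<le> uniform_lower_tail d m b l \<rho> c \<psi>"
proof (cases "F = {}")
  case False
  have Fd: "F \<subseteq> euclidean d" using F T by auto
  define B where "B = (\<Sum>i=1..m. b i)"
  define w where "w = exp (- l * \<rho> * B / 4)"
  let ?E = "expmax F l"
  have meas: "(\<lambda>X. ?E (\<lambda>x. 0 + (\<Sum>i=1..m. b i * (enorm d x / 2) - b i * \<bar>ip d (X i) x\<bar>))) \<in> borel_measurable (array {1..m})"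
    by (intro expmax_measurable[OF F(1) False Fd l] borel_measurable_add borel_measurable_sum
        borel_measurable_diff borel_measurable_times borel_measurable_abs
        measurable_compose[OF row_measurable ip_measurable_gauss]) auto
  have "emeasure (array {1..m}) (\<Union>x\<in>F. small d m b \<rho> x) = (\<integral>\<^sup>+X. indicator (\<Union>x\<in>F. small d m b \<rho> x) X \<partial>array {1..m})"
    using small_sets F by (intro nn_integral_indicator[symmetric] sets.finite_UN) auto
  also have "\<dots> \<le> (\<integral>\<^sup>+X. ennreal w * ?E (\<lambda>x. 0 + (\<Sum>i=1..m. b i * (enorm d x / 2) - b i * \<bar>ip d (X i) x\<bar>)) \<partial>array {1..m})"
  proof (intro nn_integral_mono)
    fix X
    show "indicator (\<Union>x\<in>F. small d m b \<rho> x) X \<le> ennreal w * ?E (\<lambda>x. 0 + (\<Sum>i=1..m. b i * (enorm d x / 2) - b i * \<bar>ip d (X i) x\<bar>))"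
    proof (cases "X \<in> (\<Union>x\<in>F. small d m b \<rho> x)")
      case True
      then obtain x where x: "x \<in> F" "(\<Sum>i=1..m. b i * \<bar>ip d (X i) x\<bar>) < \<rho> * B / 4"
        by (auto simp: small_def B_def)
      have "(\<Sum>i=1..m. b i * (enorm d x / 2) - b i * \<bar>ip d (X i) x\<bar>) = B * (\<rho> / 2) - (\<Sum>i=1..m. b i * \<bar>ip d (X i) x\<bar>)"
        using T(2)[of x] x(1) F(2) by (simp add: sum_subtractf B_def sum_distrib_right subset_eq sum_divide_distrib)
      then have "\<rho> * B / 4 \<le> (\<Sum>i=1..m. b i * (enorm d x / 2) - b i * \<bar>ip d (X i) x\<bar>)"
        using x(2) by (simp add: mult.commute[of B \<rho>])
      then have "l * (\<rho> * B / 4) \<le> l * (\<Sum>i=1..m. b i * (enorm d x / 2) - b i * \<bar>ip d (X i) x\<bar>)"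
        using l by (rule mult_left_mono)
      then have "1 \<le> w * exp (l * (0 + (\<Sum>i=1..m. b i * (enorm d x / 2) - b i * \<bar>ip d (X i) x\<bar>)))"
        by (simp add: w_def flip: exp_add)
      then have "1 \<le> ennreal (w * exp (l * (0 + (\<Sum>i=1..m. b i * (enorm d x / 2) - b i * \<bar>ip d (X i) x\<bar>))))"
        by simp
      also have "\<dots> = ennreal w * ennreal (exp (l * (0 + (\<Sum>i=1..m. b i * (enorm d x / 2) - b i * \<bar>ip d (X i) x\<bar>))))"
        by (rule ennreal_mult) (simp_all add: w_def)
      also have "\<dots> \<le> ennreal w * ?E (\<lambda>x. 0 + (\<Sum>i=1..m. b i * (enorm d x / 2) - b i * \<bar>ip d (X i) x\<bar>))"
        by (intro mult_left_mono expmax_ge[OF F(1) False Fd l x(1)]) simp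
      finally show ?thesis using True by simp
    qed simp
  qed
  also have "\<dots> = ennreal w * (\<integral>\<^sup>+X. ?E (\<lambda>x. 0 + (\<Sum>i=1..m. b i * (enorm d x / 2) - b i * \<bar>ip d (X i) x\<bar>)) \<partial>array {1..m})"
    by (rule nn_integral_cmult[OF meas])
  also have "\<dots> \<le> ennreal w * (\<integral>\<^sup>+X. ?E (\<lambda>x. 0 + 2 * (\<Sum>i=1..m. b i * ip d (X i) x)) \<partial>array {1..m})"
    by (intro mult_left_mono expmax_array[OF F(1) False Fd l]) (auto intro: b)
  also have "\<dots> \<le> ennreal w * (\<integral>\<^sup>+X. c * (\<Prod>j=1..d. \<psi> j (\<Sum>i=1..m. b i * X i j)) \<partial>array {1..m})"
  proof (intro mult_left_mono nn_integral_mono)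
    fix X
    obtain x where x: "x \<in> F" and e: "?E (\<lambda>x. 0 + 2 * (\<Sum>i=1..m. b i * ip d (X i) x)) =
        ennreal (exp (l * (0 + 2 * (\<Sum>i=1..m. b i * ip d (X i) x))))"
      by (rule expmax_attained[OF F(1) False Fd l])
    have "(\<Sum>i=1..m. b i * ip d (X i) x) = ip d (\<lambda>j. \<Sum>i=1..m. b i * X i j) x"
      unfolding ip_def sum_distrib_left sum_distrib_right
      by (subst sum.swap) (simp add: mult.assoc)
    then show "?E (\<lambda>x. 0 + 2 * (\<Sum>i=1..m. b i * ip d (X i) x)) \<le> c * (\<Prod>j=1..d. \<psi> j (\<Sum>i=1..m. b i * X i j))"
      unfolding e using dom[of x "\<lambda>j. \<Sum>i=1..m. b i * X i j"] x F(2) by (auto simp: ac_simps)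
  qed simp
  also have "(\<integral>\<^sup>+X. c * (\<Prod>j=1..d. \<psi> j (\<Sum>i=1..m. b i * X i j)) \<partial>array {1..m}) =
      c * (\<integral>\<^sup>+X. (\<Prod>j=1..d. \<psi> j (\<Sum>i=1..m. b i * X i j)) \<partial>array {1..m})"
    by (intro nn_integral_cmult borel_measurable_prod_ennreal measurable_compose[OF _ \<psi>] borel_measurable_sum
          borel_measurable_times array_coord_measurable) auto
  also have "(\<integral>\<^sup>+X. (\<Prod>j=1..d. \<psi> j (\<Sum>i=1..m. b i * X i j)) \<partial>array {1..m}) =
      (\<Prod>j=1..d. \<integral>\<^sup>+y. \<psi> j (enorm m b * y) \<partial>std_gauss)"
    by (intro nn_integral_array_weighted_sum \<psi>) simp
  finally show ?thesis by (simp add: uniform_lower_tail_def w_def B_def)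
qed simp

text \<open>A countable dense subset of \<open>T\<close> detects the bad event.\<close>

lemma uniform_lower_bound:
  shows "(\<Union>x\<in>T. small d m b \<rho> x) \<in> sets (array {1..m})"
    and "emeasure (array {1..m}) (\<Union>x\<in>T. small d m b \<rho> x) \<le> uniform_lower_tail d m b l \<rho> c \<psi>"
proof -
  obtain D where D: "countable D" "D \<subseteq> T" "T \<subseteq> closure D" by (rule separable)
  have eq: "(\<Union>x\<in>T. small d m b \<rho> x) = (\<Union>x\<in>D. small d m b \<rho> x)"
  proof
    show "(\<Union>x\<in>T. small d m b \<rho> x) \<subseteq> (\<Union>x\<in>D. small d m b \<rho> x)"
    proof
      fix X assume "X \<in> (\<Union>x\<in>T. small d m b \<rho> x)"
      then obtain x where x: "x \<in> T" "X \<in> small d m b \<rho> x" by auto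
      define U where "U = {x. (\<Sum>i=1..m. b i * \<bar>ip d (X i) x\<bar>) < \<rho> * (\<Sum>i=1..m. b i) / 4}"
      have coord: "continuous_on UNIV (\<lambda>x::nat \<Rightarrow> real. x j)" for j by simp
      have "continuous_on UNIV (\<lambda>x. \<Sum>i=1..m. b i * \<bar>ip d (X i) x\<bar>)" unfolding ip_def
        by (rule continuous_on_sum, rule continuous_on_mult[OF continuous_on_const], rule continuous_on_rabs,
            rule continuous_on_sum, rule continuous_on_mult[OF continuous_on_const coord])
      \<comment> \<open>The strict inequality in \<open>small\<close> makes the failure at
        \<open>x\<close> an open condition on \<open>x\<close>, which depends on finitely many
        coordinates only.\<close>
      then have "open U" unfolding U_def by (intro open_Collect_less continuous_on_const)
      moreover have "x \<in> U" using x by (simp add: U_def small_def)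
      moreover have "x \<in> closure D" using x D by auto
      ultimately have "D \<inter> U \<noteq> {}" using open_Int_closure_eq_empty[of U D] by (auto simp: Int_commute)
      then obtain y where "y \<in> D" "y \<in> U" by auto
      then show "X \<in> (\<Union>x\<in>D. small d m b \<rho> x)" using x by (auto simp: U_def small_def)
    qed
  qed (use D in auto)
  show "(\<Union>x\<in>T. small d m b \<rho> x) \<in> sets (array {1..m})"
    unfolding eq using D(1) small_sets by (intro sets.countable_UN') auto
  show "emeasure (array {1..m}) (\<Union>x\<in>T. small d m b \<rho> x) \<le> uniform_lower_tail d m b l \<rho> c \<psi>"
  proof (cases "D = {}")
    case True
    then show ?thesis unfolding eq by simp
  next
    case False
    define A where "A k = (\<Union>i\<le>k. small d m b \<rho> (from_nat_into D i))" for k :: nat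
    have D_eq: "(\<Union>x\<in>D. small d m b \<rho> x) = (\<Union>k. A k)"
    proof -
      have "(\<Union>x\<in>D. small d m b \<rho> x) = (\<Union>i. small d m b \<rho> (from_nat_into D i))"
        using range_from_nat_into[OF False D(1)] by (metis image_image)
      also have "\<dots> = (\<Union>k. A k)" unfolding A_def by blast
      finally show ?thesis .
    qed
    have A_le: "emeasure (array {1..m}) (A k) \<le> uniform_lower_tail d m b l \<rho> c \<psi>" for k
    proof -
      have "A k = (\<Union>x\<in>from_nat_into D ` {..k}. small d m b \<rho> x)" by (auto simp: A_def)
      then show ?thesis
        using uniform_lower_bound_finite[of "from_nat_into D ` {..k}"] from_nat_into[OF False] D(2) by auto
    qed
    have "incseq A" unfolding A_def by (intro monoI UN_mono) auto
    moreover have "range A \<subseteq> sets (array {1..m})" unfolding A_def using small_sets by auto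
    ultimately have "emeasure (array {1..m}) (\<Union>k. A k) = (SUP k. emeasure (array {1..m}) (A k))"
      by (intro SUP_emeasure_incseq[symmetric])
    also have "\<dots> \<le> uniform_lower_tail d m b l \<rho> c \<psi>" by (intro SUP_least A_le)
    finally show ?thesis unfolding eq D_eq .
  qed
qed

end

section \<open>Transfer from the Grassmannian to Gaussian arrays\<close>

lemma edist_lipschitz:
  assumes "E \<noteq> {}" shows "\<bar>edist N x E - edist N y E\<bar> \<le> enorm N (x - y)"
proof -
  have le: "edist N x E \<le> enorm N (x - y) + edist N y E" for x y
  proof -
    have "edist N x E - enorm N (x - y) \<le> edist N y E"
      unfolding edist_def[of N y]
    proof (rule cINF_greatest[OF assms])
      fix z assume "z \<in> E"
      then have "edist N x E \<le> enorm N (x - z)" by (rule edist_le)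
      also have "x - z = (x - y) + (y - z)" by simp
      also have "enorm N \<dots> \<le> enorm N (x - y) + enorm N (y - z)" by (rule enorm_triangle)
      finally show "edist N x E - enorm N (x - y) \<le> enorm N (y - z)" by simp
    qed
    then show ?thesis by simp
  qed
  show ?thesis using le[of x y] le[of y x] enorm_minus[of N x y] by simp
qed

lemma edist_scale:
  assumes E: "subspace E" shows "edist N (c *\<^sub>R x) E = \<bar>c\<bar> * edist N x E"
proof -
  have E0: "0 \<in> E" using E by (rule subspace_0)
  have le: "edist N (c *\<^sub>R x) E \<le> \<bar>c\<bar> * edist N x E" if "c \<noteq> 0" for c x
  proof -
    have "edist N (c *\<^sub>R x) E / \<bar>c\<bar> \<le> edist N x E"
      unfolding edist_def[of N x]
    proof (rule cINF_greatest)
      fix y assume "y \<in> E"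
      then have "edist N (c *\<^sub>R x) E \<le> enorm N (c *\<^sub>R x - c *\<^sub>R y)"
        by (intro edist_le subspace_scale E)
      also have "\<dots> = \<bar>c\<bar> * enorm N (x - y)" by (simp only: enorm_scale flip: scaleR_right_diff_distrib)
      finally show "edist N (c *\<^sub>R x) E / \<bar>c\<bar> \<le> enorm N (x - y)" using that by (simp add: field_simps)
    qed (use E0 in auto)
    then show ?thesis using that by (simp add: field_simps)
  qed
  show ?thesis
  proof (cases "c = 0")
    case True
    have "edist N 0 E = 0"
      using edist_le[OF E0, where N=N and x=0] edist_nonneg[of E N 0] E0 by (intro antisym) auto
    then show ?thesis using True by simp
  next
    case False
    have "edist N ((1 / c) *\<^sub>R (c *\<^sub>R x)) E \<le> \<bar>1 / c\<bar> * edist N (c *\<^sub>R x) E" using False by (intro le) simp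
    then have "\<bar>c\<bar> * edist N x E \<le> edist N (c *\<^sub>R x) E" using False by (simp add: field_simps)
    then show ?thesis using le[OF False, of x] by simp
  qed
qed

lemma edist_image:
  assumes T: "orthogonal_map N T" and x: "x \<in> euclidean N" and E: "E \<subseteq> euclidean N"
  shows "edist N (T x) (T ` E) = edist N x E"
proof -
  have lin: "linear T" using T by (simp add: orthogonal_map_def)
  have "enorm N (T x - T y) = enorm N (x - y)" if "y \<in> E" for y
  proof -
    have "x - y \<in> euclidean N" using x E that subspace_euclidean by (auto intro: subspace_diff)
    then show ?thesis using orthogonal_map_ip[OF T] by (simp add: enorm_eq flip: linear_diff[OF lin])
  qed
  then have "(\<lambda>y. enorm N (T x - y)) ` T ` E = (\<lambda>y. enorm N (x - y)) ` E"
    unfolding image_image by (rule image_cong[OF refl])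
  then show ?thesis unfolding edist_def by simp
qed

lemma orthonormal_image:
  assumes "orthogonal_map N T" "orthonormal N n f" shows "orthonormal N n (\<lambda>i. T (f i))"
  using assms by (auto simp: orthonormal_def orthogonal_map_ip orthogonal_map_in)

lemma ker_image:
  assumes T: "orthogonal_map N T" "orthogonal_map N T'" "\<And>x. T (T' x) = x" "\<And>x. T' (T x) = x"
    and f: "\<And>i. i \<in> I \<Longrightarrow> f i \<in> euclidean N"
  shows "T ` ker N I f = ker N I (\<lambda>i. T (f i))"
proof -
  have 1: "T x \<in> ker N I (\<lambda>i. T (f i))" if "x \<in> ker N I f" for x
    using that f orthogonal_map_ip[OF T(1)] orthogonal_map_in[OF T(1)] unfolding ker_def by simp
  have 2: "T' y \<in> ker N I f" if "y \<in> ker N I (\<lambda>i. T (f i))" for y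
  proof -
    have y: "y \<in> euclidean N" "\<And>i. i \<in> I \<Longrightarrow> ip N y (T (f i)) = 0" using that by (auto simp: ker_def)
    have "ip N (T' y) (f i) = 0" if "i \<in> I" for i
      using y(2)[OF that] orthogonal_map_ip[OF T(1) orthogonal_map_in[OF T(2) y(1)] f[OF that]] by (simp add: T(3))
    then show ?thesis using orthogonal_map_in[OF T(2) y(1)] by (simp add: ker_def)
  qed
  show ?thesis
  proof (intro subset_antisym subsetI)
    fix y assume "y \<in> ker N I (\<lambda>i. T (f i))"
    from imageI[OF 2[OF this], of T] show "y \<in> T ` ker N I f" by (simp only: T(3))
  next
    fix y assume "y \<in> T ` ker N I f"
    then obtain x where "y = T x" "x \<in> ker N I f" by (rule imageE)
    then show "y \<in> ker N I (\<lambda>i. T (f i))" using 1[of x] by (simp only:)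
  qed
qed

lemma grassmannian_image:
  assumes T: "orthogonal_map N T" "orthogonal_map N T'" "\<And>x. T (T' x) = x" "\<And>x. T' (T x) = x"
    and E: "E \<in> grassmannian N n"
  shows "T ` E \<in> grassmannian N n"
proof -
  obtain f where f: "orthonormal N n f" "E = ker N {..<n} f" using E by (rule grassmannian_ker)
  have "T ` E = ker N {..<n} (\<lambda>i. T (f i))"
    unfolding f(2) by (rule ker_image[OF T]) (use f(1) in \<open>auto simp: orthonormal_def\<close>)
  then show ?thesis using ker_in_grassmannian[OF orthonormal_image[OF T(1) f(1)]] by simp
qed

text \<open>Closeness is stated through distance functions rather than the gap: rotations visibly
  preserve it, countably many points \<open>x\<close> can test it, and it yields \<open>near\<close>
  in both directions.\<close>

definition close :: "real \<Rightarrow> nat \<Rightarrow> (nat \<Rightarrow> real) set \<Rightarrow> (nat \<Rightarrow> real) set \<Rightarrow> bool"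
  where "close \<delta> N E F \<longleftrightarrow> (\<forall>x\<in>euclidean N. \<bar>edist N x E - edist N x F\<bar> \<le> \<delta> * enorm N x)"

lemma close_image:
  assumes T: "orthogonal_map N T" "orthogonal_map N T'" "\<And>x. T (T' x) = x" "\<And>x. T' (T x) = x"
    and E: "E \<subseteq> euclidean N" "F \<subseteq> euclidean N"
  shows "close \<delta> N (T ` E) (T ` F) \<longleftrightarrow> close \<delta> N E F"
proof -
  have n: "enorm N (T x) = enorm N x" if "x \<in> euclidean N" for x
    using orthogonal_map_ip[OF T(1) that that] by (simp add: enorm_eq)
  have eq: "\<bar>edist N (T x) (T ` E) - edist N (T x) (T ` F)\<bar> \<le> \<delta> * enorm N (T x) \<longleftrightarrow>
    \<bar>edist N x E - edist N x F\<bar> \<le> \<delta> * enorm N x" if "x \<in> euclidean N" for x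
    using that E by (simp add: n edist_image[OF T(1)])
  show ?thesis unfolding close_def
  proof (intro iffI ballI)
    fix x assume "\<forall>x\<in>euclidean N. \<bar>edist N x (T ` E) - edist N x (T ` F)\<bar> \<le> \<delta> * enorm N x" "x \<in> euclidean N"
    then show "\<bar>edist N x E - edist N x F\<bar> \<le> \<delta> * enorm N x"
      using eq orthogonal_map_in[OF T(1)] by blast
  next
    fix x assume *: "\<forall>x\<in>euclidean N. \<bar>edist N x E - edist N x F\<bar> \<le> \<delta> * enorm N x" "x \<in> euclidean N"
    then show "\<bar>edist N x (T ` E) - edist N x (T ` F)\<bar> \<le> \<delta> * enorm N x"
      using eq[of "T' x"] orthogonal_map_in[OF T(2)] by (simp add: T(3))
  qed
qed

lemma edist_self: "x \<in> E \<Longrightarrow> edist N x E = 0"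
  using edist_le[of x E, where N=N and x=x] edist_nonneg[of E N x] by (intro antisym) auto

lemma close_near:
  assumes E: "E \<in> grassmannian N n" "F \<in> grassmannian N m" and c: "close \<delta> N E F"
  shows "near \<delta> N E F" "near \<delta> N F E"
proof -
  show "near \<delta> N E F"
    unfolding near_iff_edist[OF E]
  proof
    fix x assume "x \<in> E"
    then show "edist N x F \<le> \<delta> * enorm N x"
      using c grassmannianD(2)[OF E(1)] edist_self[of x E N] unfolding close_def by fastforce
  qed
  show "near \<delta> N F E"
    unfolding near_iff_edist[OF E(2,1)]
  proof
    fix x assume "x \<in> F"
    then show "edist N x E \<le> \<delta> * enorm N x"
      using c grassmannianD(2)[OF E(2)] edist_self[of x F N] unfolding close_def by fastforce
  qed
qed

lemma ball_finite_net:
  assumes "0 < \<eta>"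
  obtains X where "finite X" "X \<subseteq> euclidean N"
    "\<And>u. u \<in> euclidean N \<Longrightarrow> enorm N u \<le> 1 \<Longrightarrow> \<exists>x\<in>X. enorm N (u - x) \<le> \<eta>"
proof -
  \<comment> \<open>The grid has mesh 1/k. Bounding the Euclidean norm by the sum of the coordinates
    turns a coordinate error 1/k into N/k, hence \<open>k > N / \<eta>\<close>.\<close>
  obtain k :: nat where k: "real N / \<eta> < real k" using reals_Archimedean2 by blast
  have kpos: "0 < real k" using k assms by (meson divide_nonneg_pos le_less_trans of_nat_0_le_iff)
  define h where "h z = (\<lambda>i. if i \<in> {1..N} then real_of_int (z i) / real k else 0)" for z :: "nat \<Rightarrow> int"
  define X where "X = h ` (PiE {1..N} (\<lambda>_. {- int k..int k}))"
  show ?thesis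
  proof (rule that[of X])
    show "finite X" unfolding X_def by (intro finite_imageI finite_PiE) auto
    show "X \<subseteq> euclidean N" by (auto simp: X_def h_def euclidean_def)
    fix u assume u: "u \<in> euclidean N" "enorm N u \<le> 1"
    define z where "z = restrict (\<lambda>i. \<lfloor>real k * u i\<rfloor>) {1..N}"
    have ui: "\<bar>u i\<bar> \<le> 1" if "i \<in> {1..N}" for i using abs_coord_le_enorm[OF that, of u] u(2) by simp
    have "z i \<in> {- int k..int k}" if "i \<in> {1..N}" for i
    proof -
      have *: "\<bar>real k * u i\<bar> \<le> real k" using mult_left_mono[OF ui[OF that], of "real k"] by (simp add: abs_mult)
      have "- int k \<le> \<lfloor>real k * u i\<rfloor>" using * by (simp add: le_floor_iff)
      moreover have "\<lfloor>real k * u i\<rfloor> \<le> int k" using * by (simp add: floor_le_iff)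
      ultimately show ?thesis using that by (simp add: z_def)
    qed
    then have "h z \<in> X" unfolding X_def by (intro imageI) (auto simp: z_def)
    moreover have "enorm N (u - h z) \<le> \<eta>"
    proof -
      have 1: "\<bar>(u - h z) i\<bar> \<le> 1 / real k" if "i \<in> {1..N}" for i
      proof -
        define q where "q = real k * u i - real_of_int \<lfloor>real k * u i\<rfloor>"
        have "0 \<le> q" "q \<le> 1" unfolding q_def by linarith+
        then have "\<bar>q / real k\<bar> \<le> 1 / real k" using kpos by (simp add: divide_right_mono)
        moreover have "(u - h z) i = q / real k"
          using that kpos by (simp add: h_def z_def q_def diff_divide_distrib)
        ultimately show ?thesis by (simp only:)
      qed
      have "enorm N (u - h z) \<le> (\<Sum>i=1..N. \<bar>(u - h z) i\<bar>)"
        unfolding enorm_def by (rule L2_set_le_sum_abs)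
      also have "\<dots> \<le> (\<Sum>i=1..N. 1 / real k)" using 1 by (intro sum_mono)
      also have "\<dots> = real N / real k" by simp
      also have "\<dots> \<le> \<eta>" using k kpos assms by (simp add: field_simps)
      finally show ?thesis .
    qed
    ultimately show "\<exists>x\<in>X. enorm N (u - x) \<le> \<eta>" by blast
  qed
qed

text \<open>A subspace is recorded by its distances to a finite net, rounded to multiples of
  \<open>\<delta> / 4\<close>. There are countably many records, and one representative of each
  suffices: the rounding and the two Lipschitz errors add up to at most
  \<open>\<delta>\<close>.\<close>

lemma grassmannian_separable:
  assumes \<delta>: "0 < \<delta>"
  obtains C where "countable C" "C \<subseteq> grassmannian N n"
    "\<And>F. F \<in> grassmannian N n \<Longrightarrow> \<exists>E\<in>C. close \<delta> N E F"
proof -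
  obtain X where X: "finite X" "X \<subseteq> euclidean N"
    "\<And>u. u \<in> euclidean N \<Longrightarrow> enorm N u \<le> 1 \<Longrightarrow> \<exists>x\<in>X. enorm N (u - x) \<le> \<delta> / 4"
    using ball_finite_net[of "\<delta> / 4" N] \<delta> by auto
  define key where "key F = restrict (\<lambda>x. \<lfloor>edist N x F * (4 / \<delta>)\<rfloor>) X" for F
  have cl: "close \<delta> N E F" if EF: "E \<in> grassmannian N n" "F \<in> grassmannian N n" and k: "key E = key F" for E F
  proof -
    have ne: "E \<noteq> {}" "F \<noteq> {}" using grassmannianD(3) EF by blast+
    have a: "\<bar>edist N x E - edist N x F\<bar> \<le> \<delta> / 4" if "x \<in> X" for x
    proof -
      have "\<lfloor>edist N x E * (4 / \<delta>)\<rfloor> = \<lfloor>edist N x F * (4 / \<delta>)\<rfloor>"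
        using fun_cong[OF k, of x] that by (simp add: key_def)
      then have "\<bar>edist N x E * (4 / \<delta>) - edist N x F * (4 / \<delta>)\<bar> \<le> 1" by linarith
      then have "\<bar>(edist N x E - edist N x F) * (4 / \<delta>)\<bar> \<le> 1"
        by (simp only: left_diff_distrib)
      then have "\<bar>edist N x E - edist N x F\<bar> * (4 / \<delta>) \<le> 1"
        using \<delta> by (simp only: abs_mult) simp
      then show ?thesis using \<delta> by (simp add: field_simps)
    qed
    have u: "\<bar>edist N u E - edist N u F\<bar> \<le> \<delta>" if u: "u \<in> euclidean N" "enorm N u \<le> 1" for u
    proof -
      obtain x where x: "x \<in> X" "enorm N (u - x) \<le> \<delta> / 4" using X(3)[OF u] by auto
      show ?thesis
        using a[OF x(1)] x(2) edist_lipschitz[OF ne(1), of N u x] edist_lipschitz[OF ne(2), of N u x] \<delta> by linarith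
    qed
    show ?thesis unfolding close_def
    proof
      fix x assume x: "x \<in> euclidean N"
      show "\<bar>edist N x E - edist N x F\<bar> \<le> \<delta> * enorm N x"
      proof (cases "x = 0")
        case True
        then show ?thesis using edist_self[of 0 E N] edist_self[of 0 F N] grassmannianD(3) EF by simp
      next
        case False
        define v where "v = (1 / enorm N x) *\<^sub>R x"
        have pos: "0 < enorm N x" by (rule enorm_pos[OF x False])
        have v: "v \<in> euclidean N" "enorm N v \<le> 1" "x = enorm N x *\<^sub>R v"
          using x pos subspace_euclidean by (auto simp: v_def enorm_scale intro: subspace_scale)
        have "edist N x E = enorm N x * edist N v E" "edist N x F = enorm N x * edist N v F"
          using edist_scale[OF grassmannianD(1)[OF EF(1)], of N "enorm N x" v] v(3)
            edist_scale[OF grassmannianD(1)[OF EF(2)], of N "enorm N x" v] by auto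
        then have "\<bar>edist N x E - edist N x F\<bar> = enorm N x * \<bar>edist N v E - edist N v F\<bar>"
          by (simp add: abs_mult flip: right_diff_distrib)
        then show ?thesis using u[OF v(1,2)] pos by (simp add: mult.commute)
      qed
    qed
  qed
  define G where "G = grassmannian N n"
  define C where "C = inv_into G key ` (key ` G)"
  have "key ` G \<subseteq> PiE X (\<lambda>_. UNIV)" by (auto simp: key_def)
  then have "countable (key ` G)" by (rule countable_subset) (rule countable_PiE[OF X(1)], simp)
  then have "countable C" by (simp add: C_def)
  moreover have "C \<subseteq> G" unfolding C_def using inv_into_into[of _ key G] by blast
  moreover have "\<exists>E\<in>C. close \<delta> N E F" if "F \<in> G" for F
  proof
    show "inv_into G key (key F) \<in> C" using that by (auto simp: C_def)
    have "key (inv_into G key (key F)) = key F" using that by (intro f_inv_into_f) auto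
    moreover have "inv_into G key (key F) \<in> G" using that by (intro inv_into_into) auto
    ultimately show "close \<delta> N (inv_into G key (key F)) F" using that by (intro cl) (auto simp: G_def)
  qed
  ultimately show ?thesis using that by (auto simp: G_def)
qed

section \<open>Double counting against the Haar measure\<close>

lemma haarD:
  assumes "haar_grassmannian N n \<mu>"
  shows "space \<mu> = grassmannian N n" "sets \<mu> = sets (grassmannian_borel N n)" "prob_space \<mu>"
  using assms by (auto simp: haar_grassmannian_def intro: prob_spaceI)

lemma haar_measurable:
  assumes "haar_grassmannian N n \<mu>" "f \<in> borel_measurable (grassmannian_borel N n)"
  shows "f \<in> borel_measurable \<mu>"
  using assms(2) measurable_cong_sets[OF haarD(2)[OF assms(1)] refl] by blast

text \<open>The axiom speaks of images of sets of subspaces; applications have sets described by a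
  property, into which the image inserts the inverse rotation.\<close>

lemma haar_invariant:
  assumes \<mu>: "haar_grassmannian N n \<mu>"
    and T: "orthogonal_map N T" "orthogonal_map N T'" "\<And>x. T (T' x) = x" "\<And>x. T' (T x) = x"
    and A: "{E \<in> grassmannian N n. P E} \<in> sets \<mu>"
  shows "emeasure \<mu> {E \<in> grassmannian N n. P (T' ` E)} = emeasure \<mu> {E \<in> grassmannian N n. P E}"
proof -
  have TT: "T ` T' ` E = E" "T' ` T ` E = E" for E by (simp_all add: image_image T(3,4))
  have im: "(\<lambda>E. T ` E) ` {E \<in> grassmannian N n. P E} = {E \<in> grassmannian N n. P (T' ` E)}"
  proof (intro subset_antisym subsetI)
    fix E assume "E \<in> (\<lambda>E. T ` E) ` {E \<in> grassmannian N n. P E}"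
    then obtain F where F: "F \<in> grassmannian N n" "P F" "E = T ` F" by blast
    then show "E \<in> {E \<in> grassmannian N n. P (T' ` E)}"
      using grassmannian_image[OF T F(1)] by (simp add: TT)
  next
    fix E assume "E \<in> {E \<in> grassmannian N n. P (T' ` E)}"
    then have E: "T' ` E \<in> {E \<in> grassmannian N n. P E}"
      using grassmannian_image[OF T(2,1,4,3)] by simp
    from imageI[OF E, of "\<lambda>E. T ` E"] show "E \<in> (\<lambda>E. T ` E) ` {E \<in> grassmannian N n. P E}"
      by (simp only: TT)
  qed
  have "\<forall>A\<in>sets \<mu>. emeasure \<mu> ((\<lambda>E. T ` E) ` A) = emeasure \<mu> A"
    using \<mu> T(1) unfolding haar_grassmannian_def by (elim conjE allE impE) assumption+
  from bspec[OF this A] show ?thesis unfolding im .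
qed

text \<open>Double counting of the pairs related by the invariant relation \<open>r\<close>.\<close>

lemma haar_transfer:
  assumes \<mu>: "haar_grassmannian N n \<mu>" and \<Omega>: "prob_space \<Omega>"
    and r: "{p \<in> space (\<mu> \<Otimes>\<^sub>M \<Omega>). r (fst p) (snd p)} \<in> sets (\<mu> \<Otimes>\<^sub>M \<Omega>)"
    and b: "\<And>E E'. E \<in> grassmannian N n \<Longrightarrow> E' \<in> grassmannian N n \<Longrightarrow>
      emeasure \<Omega> {\<omega> \<in> space \<Omega>. r E \<omega>} = emeasure \<Omega> {\<omega> \<in> space \<Omega>. r E' \<omega>}"
    and b': "\<And>\<omega> \<omega>'. \<omega> \<in> space \<Omega> \<Longrightarrow> \<omega>' \<in> space \<Omega> \<Longrightarrow> good \<omega> \<Longrightarrow> good \<omega>' \<Longrightarrow>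
      emeasure \<mu> {E \<in> space \<mu>. r E \<omega>} = emeasure \<mu> {E \<in> space \<mu>. r E \<omega>'}"
    and good: "AE \<omega> in \<Omega>. good \<omega>"
    and C: "countable C" "C \<subseteq> grassmannian N n" "\<And>\<omega>. \<omega> \<in> space \<Omega> \<Longrightarrow> good \<omega> \<Longrightarrow> \<exists>E\<in>C. r E \<omega>"
    and bad: "bad \<in> sets \<mu>" and A: "A \<in> sets \<Omega>"
    and imp: "\<And>E \<omega>. E \<in> bad \<Longrightarrow> \<omega> \<in> space \<Omega> \<Longrightarrow> good \<omega> \<Longrightarrow> r E \<omega> \<Longrightarrow> \<omega> \<in> A"
  shows "emeasure \<mu> bad \<le> emeasure \<Omega> A"
proof -
  interpret M: prob_space \<mu> by (rule haarD(3)[OF \<mu>])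
  interpret O: prob_space \<Omega> by (rule \<Omega>)
  interpret P: pair_sigma_finite \<mu> \<Omega> ..
  define R where "R = {p \<in> space (\<mu> \<Otimes>\<^sub>M \<Omega>). r (fst p) (snd p)}"
  have R[measurable]: "R \<in> sets (\<mu> \<Otimes>\<^sub>M \<Omega>)" using r by (simp add: R_def)
  note [measurable] = bad A
  have sec1: "{\<omega> \<in> space \<Omega>. r E \<omega>} \<in> sets \<Omega>" if "E \<in> space \<mu>" for E
  proof -
    have "Pair E -` R = {\<omega> \<in> space \<Omega>. r E \<omega>}" using that by (auto simp: R_def space_pair_measure)
    then show ?thesis using sets_Pair1[OF R, of E] by simp
  qed
  have sec2: "{E \<in> space \<mu>. r E \<omega>} \<in> sets \<mu>" if "\<omega> \<in> space \<Omega>" for \<omega>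
  proof -
    have "(\<lambda>E. (E, \<omega>)) -` R = {E \<in> space \<mu>. r E \<omega>}" using that by (auto simp: R_def space_pair_measure)
    then show ?thesis using sets_Pair2[OF R, of \<omega>] by simp
  qed
  have int1: "(\<integral>\<^sup>+\<omega>. indicator R (E, \<omega>) \<partial>\<Omega>) = emeasure \<Omega> {\<omega> \<in> space \<Omega>. r E \<omega>}" if "E \<in> space \<mu>" for E
    unfolding nn_integral_indicator[OF sec1[OF that], symmetric]
    using that by (intro nn_integral_cong) (auto simp: R_def space_pair_measure indicator_def)
  have int2: "(\<integral>\<^sup>+E. indicator R (E, \<omega>) \<partial>\<mu>) = emeasure \<mu> {E \<in> space \<mu>. r E \<omega>}" if "\<omega> \<in> space \<Omega>" for \<omega>
    unfolding nn_integral_indicator[OF sec2[OF that], symmetric]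
    using that by (intro nn_integral_cong) (auto simp: R_def space_pair_measure indicator_def)
  obtain E0 where E0: "E0 \<in> space \<mu>" using M.not_empty by blast
  define p where "p = emeasure \<Omega> {\<omega> \<in> space \<Omega>. r E0 \<omega>}"
  have p1: "emeasure \<Omega> {\<omega> \<in> space \<Omega>. r E \<omega>} = p" if "E \<in> space \<mu>" for E
    using b that E0 unfolding p_def haarD(1)[OF \<mu>] by blast
  have ex: "\<exists>\<omega>0 \<in> space \<Omega>. good \<omega>0"
  proof (rule ccontr)
    assume "\<not> ?thesis"
    then have "AE \<omega> in \<Omega>. False" using good by (auto elim: AE_mp)
    then show False by simp
  qed
  then obtain \<omega>0 where \<omega>0: "\<omega>0 \<in> space \<Omega>" "good \<omega>0" by blast
  define p' where "p' = emeasure \<mu> {E \<in> space \<mu>. r E \<omega>0}"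
  have p2: "AE \<omega> in \<Omega>. emeasure \<mu> {E \<in> space \<mu>. r E \<omega>} = p'"
    using good AE_space
  proof eventually_elim
    case (elim \<omega>)
    show ?case unfolding p'_def by (rule b'[OF elim(2) \<omega>0(1) elim(1) \<omega>0(2)])
  qed
  have "p = (\<integral>\<^sup>+E. p \<partial>\<mu>)" by (simp add: M.emeasure_space_1)
  also have "\<dots> = (\<integral>\<^sup>+E. \<integral>\<^sup>+\<omega>. indicator R (E, \<omega>) \<partial>\<Omega> \<partial>\<mu>)"
    by (intro nn_integral_cong) (simp add: int1 p1)
  also have "\<dots> = (\<integral>\<^sup>+\<omega>. \<integral>\<^sup>+E. indicator R (E, \<omega>) \<partial>\<mu> \<partial>\<Omega>)"
    by (rule P.Fubini'[symmetric]) simp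
  also have "\<dots> = (\<integral>\<^sup>+\<omega>. p' \<partial>\<Omega>)"
  proof (rule nn_integral_cong_AE)
    show "AE \<omega> in \<Omega>. (\<integral>\<^sup>+E. indicator R (E, \<omega>) \<partial>\<mu>) = p'"
      using p2 AE_space
    proof eventually_elim
      case (elim \<omega>)
      show ?case unfolding int2[OF elim(2)] by (rule elim(1))
    qed
  qed
  also have "\<dots> = p'" by (simp add: O.emeasure_space_1)
  finally have pp': "p = p'" .
  \<comment> \<open>If the mass vanished, almost surely no member of the countable family
    \<open>C\<close> would be related to \<open>\<omega>\<close>, although every good
    \<open>\<omega>\<close> is related to one of them.\<close>
  have "p \<noteq> 0"
  proof
    assume "p = 0"
    have "AE \<omega> in \<Omega>. \<not> r E \<omega>" if "E \<in> C" for E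
    proof -
      have "E \<in> space \<mu>" using that C(2) haarD(1)[OF \<mu>] by blast
      then show ?thesis using p1[of E] \<open>p = 0\<close> sec1[of E] by (subst AE_iff_measurable[OF sec1[of E]]) auto
    qed
    then have "AE \<omega> in \<Omega>. \<forall>E\<in>C. \<not> r E \<omega>" using C(1) by (simp add: AE_ball_countable)
    then have "AE \<omega> in \<Omega>. False" using good AE_space
    proof eventually_elim
      case (elim \<omega>)
      then show ?case using C(3)[OF elim(3,2)] by blast
    qed
    then show False by simp
  qed
  \<comment> \<open>The same double integral restricted to \<open>bad\<close>: in one order it is
    \<open>emeasure \<mu> bad * p\<close>, in the other \<open>imp\<close> confines it to
    \<open>A\<close>.\<close>
  have "emeasure \<mu> bad * p = (\<integral>\<^sup>+E. indicator bad E * p \<partial>\<mu>)"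
    by (subst nn_integral_multc) (auto simp: bad)
  also have "\<dots> = (\<integral>\<^sup>+E. \<integral>\<^sup>+\<omega>. indicator bad E * indicator R (E, \<omega>) \<partial>\<Omega> \<partial>\<mu>)"
    by (intro nn_integral_cong) (subst nn_integral_cmult, auto simp: int1 p1)
  also have "\<dots> = (\<integral>\<^sup>+\<omega>. \<integral>\<^sup>+E. indicator bad E * indicator R (E, \<omega>) \<partial>\<mu> \<partial>\<Omega>)"
    by (rule P.Fubini'[symmetric]) measurable
  also have "\<dots> \<le> (\<integral>\<^sup>+\<omega>. indicator A \<omega> * p' \<partial>\<Omega>)"
  proof (rule nn_integral_mono_AE)
    show "AE \<omega> in \<Omega>. (\<integral>\<^sup>+E. indicator bad E * indicator R (E, \<omega>) \<partial>\<mu>) \<le> indicator A \<omega> * p'"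
      using p2 good AE_space
    proof eventually_elim
      case (elim \<omega>)
      have "(\<integral>\<^sup>+E. indicator bad E * indicator R (E, \<omega>) \<partial>\<mu>) \<le> (\<integral>\<^sup>+E. indicator A \<omega> * indicator R (E, \<omega>) \<partial>\<mu>)"
        using imp elim by (intro nn_integral_mono) (auto simp: R_def indicator_def space_pair_measure)
      also have "\<dots> = indicator A \<omega> * p'"
        using elim by (subst nn_integral_cmult) (auto simp: int2)
      finally show ?case .
    qed
  qed
  also have "\<dots> = emeasure \<Omega> A * p'" by (subst nn_integral_multc) auto
  finally have le: "emeasure \<mu> bad * p \<le> emeasure \<Omega> A * p" by (simp add: pp')
  have "p \<noteq> top" unfolding p_def by (rule O.emeasure_finite)
  then show ?thesis using le \<open>p \<noteq> 0\<close> ennreal_mult_le_mult_iff[of p] by (simp add: mult.commute)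
qed

section \<open>Transfer from a single Gaussian vector\<close>

lemma euclidean_separable:
  obtains D where "countable D" "D \<subseteq> euclidean N" "D \<noteq> {}"
    "\<And>x \<eta>. x \<in> euclidean N \<Longrightarrow> 0 < \<eta> \<Longrightarrow> \<exists>y\<in>D. enorm N (x - y) < \<eta>"
proof -
  obtain D where D: "countable D" "D \<subseteq> euclidean N" "euclidean N \<subseteq> closure D" by (rule separable)
  have dense: "\<exists>y\<in>D. enorm N (x - y) < \<eta>" if x: "x \<in> euclidean N" and \<eta>: "0 < \<eta>" for x \<eta>
  proof -
    define U where "U = {y. enorm N (x - y) < \<eta>}"
    have coord: "continuous_on UNIV (\<lambda>x::nat \<Rightarrow> real. x j)" for j by simp
    have "continuous_on UNIV (\<lambda>y. enorm N (x - y))" unfolding enorm_def L2_set_def fun_diff_def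
      by (rule continuous_on_real_sqrt, rule continuous_on_sum, rule continuous_on_power,
          rule continuous_on_diff[OF continuous_on_const coord])
    then have "open U" unfolding U_def by (intro open_Collect_less continuous_on_const)
    moreover have "x \<in> U" using \<eta> by (simp add: U_def)
    moreover have "x \<in> closure D" using x D by auto
    ultimately have "D \<inter> U \<noteq> {}" using open_Int_closure_eq_empty[of U D] by (auto simp: Int_commute)
    then show ?thesis by (auto simp: U_def)
  qed
  have "0 \<in> euclidean N" by (simp add: euclidean_def)
  then have "D \<noteq> {}" using dense[of 0 1] by auto
  then show ?thesis using that D dense by blast
qed

text \<open>Joint measurability in subspace and vector: the distance of z is the infimum, over a
  countable dense set of points y, of |z - y| plus the distance of y, and each such sum is
  measurable.\<close>

lemma edist_zext_measurable:
  assumes \<mu>: "haar_grassmannian N n \<mu>"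
  shows "(\<lambda>p. edist N (zext N (snd p)) (fst p)) \<in> borel_measurable (\<mu> \<Otimes>\<^sub>M gauss)"
proof -
  obtain D where D: "countable D" "D \<subseteq> euclidean N" "D \<noteq> {}"
    "\<And>x \<eta>. x \<in> euclidean N \<Longrightarrow> 0 < \<eta> \<Longrightarrow> \<exists>y\<in>D. enorm N (x - y) < \<eta>"
    using euclidean_separable[of N] by blast
  define h where "h y p = enorm N (zext N (snd p) - y) + edist N y (fst p)" for y and p :: "(nat \<Rightarrow> real) set \<times> (nat \<Rightarrow> real)"
  have coord: "(\<lambda>p. zext N (snd p) i) \<in> borel_measurable (\<mu> \<Otimes>\<^sub>M gauss)" for i
    using measurable_compose[OF measurable_compose[OF measurable_snd zext_measurable] coord_measurable_gauss] .
  have hm: "h y \<in> borel_measurable (\<mu> \<Otimes>\<^sub>M gauss)" if "y \<in> D" for y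
  proof -
    have "(\<lambda>p. enorm N (zext N (snd p) - y)) \<in> borel_measurable (\<mu> \<Otimes>\<^sub>M gauss)"
    proof -
      have [measurable]: "(\<lambda>p. \<Sum>i=1..N. (zext N (snd p) i - y i)\<^sup>2) \<in> borel_measurable (\<mu> \<Otimes>\<^sub>M gauss)"
        by (intro borel_measurable_sum borel_measurable_power borel_measurable_diff coord borel_measurable_const)
      show ?thesis unfolding enorm_def L2_set_def fun_diff_def by measurable
    qed
    moreover have "(\<lambda>p. edist N y (fst p)) \<in> borel_measurable (\<mu> \<Otimes>\<^sub>M gauss)"
      using that D(2) by (intro measurable_compose[OF measurable_fst] haar_measurable[OF \<mu>] edist_measurable) auto
    ultimately show ?thesis unfolding h_def by (rule borel_measurable_add)
  qed
  have le: "edist N z E \<le> enorm N (z - y) + edist N y E" "edist N y E \<le> enorm N (z - y) + edist N z E"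
    if "E \<in> grassmannian N n" for z y E
  proof -
    have "E \<noteq> {}" using grassmannianD(3)[OF that] by auto
    from edist_lipschitz[OF this, of N z y]
    show "edist N z E \<le> enorm N (z - y) + edist N y E" "edist N y E \<le> enorm N (z - y) + edist N z E"
      by (simp_all add: abs_le_iff)
  qed
  have bb: "bdd_below ((\<lambda>y. h y p) ` D)" if "fst p \<in> grassmannian N n" for p
  proof (rule bdd_belowI[of _ 0])
    fix t assume "t \<in> (\<lambda>y. h y p) ` D"
    then obtain y where "t = h y p" by blast
    moreover have "fst p \<noteq> {}" using grassmannianD(3)[OF that] by auto
    ultimately show "0 \<le> t" using edist_nonneg[of "fst p" N y] by (simp add: h_def)
  qed
  have eq: "edist N (zext N (snd p)) (fst p) = (INF y\<in>D. h y p)" if p: "fst p \<in> grassmannian N n" for p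
  proof (rule antisym)
    show "edist N (zext N (snd p)) (fst p) \<le> (INF y\<in>D. h y p)"
      using D(3) le(1)[OF p] by (intro cINF_greatest) (auto simp: h_def)
    show "(INF y\<in>D. h y p) \<le> edist N (zext N (snd p)) (fst p)"
    proof (rule field_le_epsilon)
      fix e :: real assume "0 < e"
      then obtain y where y: "y \<in> D" "enorm N (zext N (snd p) - y) < e / 2"
        using D(4)[OF zext_in, of "e / 2"] by auto
      have "(INF y\<in>D. h y p) \<le> h y p" by (rule cINF_lower[OF bb[OF p] y(1)])
      also have "\<dots> \<le> edist N (zext N (snd p)) (fst p) + e"
        using y(2) le(2)[OF p, of y "zext N (snd p)"] by (simp add: h_def)
      finally show "(INF y\<in>D. h y p) \<le> edist N (zext N (snd p)) (fst p) + e" .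
    qed
  qed
  have sp: "fst p \<in> grassmannian N n" if "p \<in> space (\<mu> \<Otimes>\<^sub>M gauss)" for p
    using that unfolding space_pair_measure haarD(1)[OF \<mu>] mem_Times_iff by (rule conjunct1)
  have "(\<lambda>p. INF y\<in>D. h y p) \<in> borel_measurable (\<mu> \<Otimes>\<^sub>M gauss)"
    by (rule borel_measurable_cINF[OF D(1) hm bb[OF sp]])
  then show ?thesis
    using measurable_cong[of "\<mu> \<Otimes>\<^sub>M gauss" "\<lambda>p. edist N (zext N (snd p)) (fst p)" "\<lambda>p. INF y\<in>D. h y p" borel, OF eq[OF sp]]
    by blast
qed

lemma zext_rotate [simp]:
  assumes "orthogonal_map N T" shows "zext N (T (zext N x)) = T (zext N x)"
  by (rule zext_eq[OF orthogonal_map_in[OF assms zext_in]])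

lemma enorm_rotate: "orthogonal_map N T \<Longrightarrow> x \<in> euclidean N \<Longrightarrow> enorm N (T x) = enorm N x"
  by (simp add: enorm_eq orthogonal_map_ip)

text \<open>Since \<open>n < N\<close>, the reference subspace contains a unit vector, and a
  rotation takes it to the direction of \<open>x\<close>.\<close>

lemma ex_grassmannian_containing:
  assumes E0: "E0 \<in> grassmannian N n" and n: "n < N" and x: "x \<in> euclidean N" "x \<noteq> 0"
  obtains F where "F \<in> grassmannian N n" "x \<in> F"
proof -
  have d: "dim E0 \<noteq> 0" using E0 n by (auto simp: grassmannian_def)
  obtain g where g: "orthonormal N (dim E0) g" "span (g ` {..<dim E0}) = E0"
    using orthonormal_basis grassmannianD[OF E0] by blast
  have e: "g 0 \<in> E0" using g(2) d by (auto intro: span_base)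
  define u where "u = (1 / enorm N x) *\<^sub>R x"
  have pos: "0 < enorm N x" by (rule enorm_pos[OF x])
  have u: "u \<in> euclidean N" "enorm N u = 1" "x = enorm N x *\<^sub>R u"
    using x pos subspace_euclidean by (auto simp: u_def enorm_scale intro: subspace_scale)
  have "orthonormal N 1 (\<lambda>_. g 0)" using g(1) d by (auto simp: orthonormal_def)
  moreover have "orthonormal N 1 (\<lambda>_. u)" using u enorm_sq[of N u] by (auto simp: orthonormal_def)
  ultimately obtain T T' where T: "orthogonal_map N T" "orthogonal_map N T'" "\<And>x. T (T' x) = x" "\<And>x. T' (T x) = x" "T (g 0) = u"
    using orthonormal_transitive[of N 1 "\<lambda>_. g 0" "\<lambda>_. u"] by auto
  have F: "T ` E0 \<in> grassmannian N n" by (rule grassmannian_image[OF T(1-4) E0])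
  have "u \<in> T ` E0" using e T(5) by (metis imageI)
  then have "x \<in> T ` E0" using subspace_scale[OF grassmannianD(1)[OF F], of u "enorm N x"] u(3) by simp
  with F show ?thesis by (rule that)
qed

text \<open>The relation says that the direction of the vector lies within \<open>\<delta>\<close>
  of \<open>E\<close>. One vector can only give lower bounds for the radius, where a single long
  point of the section is enough.\<close>

lemma haar_transfer_vector:
  assumes \<mu>: "haar_grassmannian N n \<mu>" and n: "n < N" and \<delta>: "0 < \<delta>"
    and bad: "bad \<in> sets \<mu>" and A: "A \<in> sets gauss"
    and imp: "\<And>E g. E \<in> bad \<Longrightarrow> edist N (zext N g) E \<le> \<delta> * enorm N g \<Longrightarrow> zext N g \<noteq> 0 \<Longrightarrow> g \<in> A"
  shows "emeasure \<mu> bad \<le> emeasure gauss A"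
proof -
  define r where "r E g \<longleftrightarrow> edist N (zext N g) E \<le> \<delta> * enorm N g" for E g
  obtain C where C: "countable C" "C \<subseteq> grassmannian N n" "\<And>F. F \<in> grassmannian N n \<Longrightarrow> \<exists>E\<in>C. close \<delta> N E F"
    using grassmannian_separable[OF \<delta>, of N n] by blast
  have sp: "space \<mu> = grassmannian N n" by (rule haarD(1)[OF \<mu>])
  obtain E0 where E0: "E0 \<in> grassmannian N n"
    using prob_space.not_empty[OF haarD(3)[OF \<mu>]] sp by auto
  show ?thesis
  proof (rule haar_transfer[OF \<mu> prob_space_gauss, where r=r and good="\<lambda>g. zext N g \<noteq> 0" and C=C])
    show R: "{p \<in> space (\<mu> \<Otimes>\<^sub>M gauss). r (fst p) (snd p)} \<in> sets (\<mu> \<Otimes>\<^sub>M gauss)"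
      unfolding r_def using edist_zext_measurable[OF \<mu>]
        measurable_compose[OF measurable_snd[of \<mu> gauss] enorm_measurable_gauss[of N]] by measurable
    have rm: "{g. r E g} \<in> sets gauss" if "E \<in> grassmannian N n" for E
      using sets_Pair1[OF R, of E] that by (simp add: space_pair_measure sp vimage_def)
    show "emeasure gauss {g \<in> space gauss. r E g} = emeasure gauss {g \<in> space gauss. r E' g}"
      if E: "E \<in> grassmannian N n" "E' \<in> grassmannian N n" for E E'
    proof -
      obtain T T' where T: "orthogonal_map N T" "orthogonal_map N T'" "\<And>x. T (T' x) = x" "\<And>x. T' (T x) = x" "T ` E = E'"
        using grassmannian_transitive[OF E] by blast
      have z: "zext N (zext N g) = zext N g" for g by (rule zext_eq[OF zext_in])
      have "emeasure gauss {g. r E' g} = (\<integral>\<^sup>+g. indicator {g. r E' g} (zext N g) \<partial>gauss)"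
        unfolding nn_integral_indicator[OF rm[OF E(2)], symmetric]
        by (intro nn_integral_cong) (simp add: indicator_def r_def z)
      also have "\<dots> = (\<integral>\<^sup>+g. indicator {g. r E' g} (T (zext N g)) \<partial>gauss)"
        by (rule nn_integral_gauss_rotate[OF T(1-3) borel_measurable_indicator[OF rm[OF E(2)]], symmetric])
      also have "\<dots> = (\<integral>\<^sup>+g. indicator {g. r E g} g \<partial>gauss)"
      proof (intro nn_integral_cong)
        fix g
        have "r E' (T (zext N g)) \<longleftrightarrow> r E g"
          unfolding r_def T(5)[symmetric] zext_rotate[OF T(1)] edist_image[OF T(1) zext_in grassmannianD(2)[OF E(1)]]
            enorm_rotate[OF T(1) zext_in] by simp
        then show "indicator {g. r E' g} (T (zext N g)) = (indicator {g. r E g} g :: ennreal)" by (simp add: indicator_def)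
      qed
      also have "\<dots> = emeasure gauss {g. r E g}" by (rule nn_integral_indicator[OF rm[OF E(1)]])
      finally show ?thesis by simp
    qed
    show "emeasure \<mu> {E \<in> space \<mu>. r E g} = emeasure \<mu> {E \<in> space \<mu>. r E g'}"
      if g: "zext N g \<noteq> 0" "zext N g' \<noteq> 0" for g g'
    proof -
      define u where "u = (1 / enorm N g) *\<^sub>R zext N g"
      define v where "v = (1 / enorm N g') *\<^sub>R zext N g'"
      have pos: "0 < enorm N g" "0 < enorm N g'" using enorm_pos[OF zext_in g(1)] enorm_pos[OF zext_in g(2)] by auto
      have uv: "u \<in> euclidean N" "v \<in> euclidean N" "enorm N u = 1" "enorm N v = 1"
        using pos subspace_euclidean zext_in by (auto simp: u_def v_def enorm_scale intro: subspace_scale)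
      have "orthonormal N 1 (\<lambda>_. u)" "orthonormal N 1 (\<lambda>_. v)" using uv enorm_sq[of N u] enorm_sq[of N v]
        by (auto simp: orthonormal_def)
      from orthonormal_transitive[OF this] obtain T T' where T: "orthogonal_map N T" "orthogonal_map N T'"
        "\<And>x. T (T' x) = x" "\<And>x. T' (T x) = x" "T u = v" by auto
      have ru: "r E g \<longleftrightarrow> edist N u E \<le> \<delta>" "r E g' \<longleftrightarrow> edist N v E \<le> \<delta>" if "E \<in> grassmannian N n" for E
        using edist_scale[OF grassmannianD(1)[OF that], of N] pos by (auto simp: r_def u_def v_def field_simps)
      have eT: "edist N v E = edist N u (T' ` E)" if "E \<in> grassmannian N n" for E
        using edist_image[OF T(2) uv(2) grassmannianD(2)[OF that]] T(4)[of u] T(5) by simp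
      have "{E \<in> grassmannian N n. edist N u E \<le> \<delta>} \<in> sets \<mu>"
        using borel_measurable_le[OF haar_measurable[OF \<mu> edist_measurable[OF uv(1)]] borel_measurable_const[of \<delta>]]
        unfolding sp .
      from haar_invariant[OF \<mu> T(1-4) this]
      have "emeasure \<mu> {E \<in> grassmannian N n. edist N u (T' ` E) \<le> \<delta>} = emeasure \<mu> {E \<in> grassmannian N n. edist N u E \<le> \<delta>}" .
      moreover have "{E \<in> grassmannian N n. edist N u (T' ` E) \<le> \<delta>} = {E \<in> space \<mu>. r E g'}" using ru(2) eT sp by auto
      moreover have "{E \<in> grassmannian N n. edist N u E \<le> \<delta>} = {E \<in> space \<mu>. r E g}" using ru(1) sp by auto
      ultimately show ?thesis by simp
    qed
    show "AE g in gauss. zext N g \<noteq> 0"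
    proof -
      have 1: "1 \<in> {1..N}" using n by auto
      have ne: "unit 1 \<noteq> (0 :: nat \<Rightarrow> real)" by (metis unit_apply zero_fun_apply zero_neq_one)
      have S: "{g. ip N g (unit 1) = 0} \<in> sets gauss"
        using measurable_sets[OF ip_measurable_gauss[of N "unit 1"], of "{0}"] by (simp add: vimage_def)
      have "AE g in gauss. ip N g (unit 1) \<noteq> 0"
        using gauss_hyperplane_null[OF unit_in_euclidean[OF 1] ne] S
        by (subst AE_iff_measurable[OF S]) auto
      then show ?thesis
      proof eventually_elim
        case (elim g)
        show ?case
        proof
          assume "zext N g = 0"
          then have "ip N (zext N g) (unit 1) = 0" by simp
          then show False using elim by simp
        qed
      qed
    qed
    show "countable C" "C \<subseteq> grassmannian N n" by (fact C)+
    show "\<exists>E\<in>C. r E g" if g: "zext N g \<noteq> 0" for g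
    proof -
      obtain F where F: "F \<in> grassmannian N n" "zext N g \<in> F"
        using ex_grassmannian_containing[OF E0 n zext_in g] by blast
      obtain E where E: "E \<in> C" "close \<delta> N E F" using C(3)[OF F(1)] by blast
      have "\<bar>edist N (zext N g) E - edist N (zext N g) F\<bar> \<le> \<delta> * enorm N (zext N g)"
        using E(2) zext_in[of N g] unfolding close_def by blast
      then have "r E g" unfolding r_def edist_self[OF F(2)] by simp
      then show ?thesis using E(1) by blast
    qed
  qed (use bad A imp in \<open>auto simp: r_def\<close>)
qed

text \<open>Gram--Schmidt; the input rows are indexed from \<open>1\<close>, the output from \<open>0\<close>.\<close>

fun gs :: "nat \<Rightarrow> (nat \<Rightarrow> nat \<Rightarrow> real) \<Rightarrow> nat \<Rightarrow> nat \<Rightarrow> real"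
  where "gs N X i = (let v = zext N (X (Suc i)) - (\<Sum>j<i. ip N (X (Suc i)) (gs N X j) *\<^sub>R gs N X j)
    in (1 / enorm N v) *\<^sub>R v)"

declare gs.simps [simp del]

definition resid :: "nat \<Rightarrow> (nat \<Rightarrow> nat \<Rightarrow> real) \<Rightarrow> nat \<Rightarrow> nat \<Rightarrow> real"
  where "resid N X i = zext N (X (Suc i)) - oproj N i (gs N X) (X (Suc i))"

lemma gs_resid: "gs N X i = (1 / enorm N (resid N X i)) *\<^sub>R resid N X i"
  unfolding gs.simps[of N X i] Let_def resid_def oproj_def ..

text \<open>At a degenerate row division by zero makes the output of \<open>gs\<close> vanish, which
  keeps \<open>gs\<close> a total measurable function of the array. Nondegeneracy becomes a separate
  event of full measure.\<close>

definition nondeg :: "nat \<Rightarrow> nat \<Rightarrow> (nat \<Rightarrow> nat \<Rightarrow> real) \<Rightarrow> bool"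
  where "nondeg N n X \<longleftrightarrow> (\<forall>i<n. enorm N (resid N X i) \<noteq> 0)"

lemma resid_in: "resid N X i \<in> euclidean N" and gs_in: "gs N X i \<in> euclidean N"
proof -
  have r: "resid N X i \<in> euclidean N" if "\<And>j. j < i \<Longrightarrow> gs N X j \<in> euclidean N" for i
    unfolding resid_def oproj_def
    by (intro subspace_diff[OF subspace_euclidean] zext_in subspace_sum[OF subspace_euclidean]
        subspace_scale[OF subspace_euclidean] that) simp
  have g: "gs N X i \<in> euclidean N" for i
  proof (induction i rule: less_induct)
    case (less i)
    show ?case unfolding gs_resid[of N X i] by (rule subspace_scale[OF subspace_euclidean r[OF less.IH]])
  qed
  show "gs N X i \<in> euclidean N" by (rule g)
  show "resid N X i \<in> euclidean N" by (rule r[OF g])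
qed

lemma oproj_zext: "oproj N k f (zext N x) = oproj N k f x"
  by (simp add: oproj_def)

lemma gs_orthonormal: "nondeg N k X \<Longrightarrow> orthonormal N k (gs N X)"
proof (induction k)
  case 0
  show ?case by (simp add: orthonormal_def)
next
  case (Suc k)
  have IH: "orthonormal N k (gs N X)" using Suc by (simp add: nondeg_def)
  have nz: "enorm N (resid N X k) \<noteq> 0" using Suc.prems by (simp add: nondeg_def)
  have 0: "ip N (gs N X k) (gs N X j) = 0" if "j < k" for j
  proof -
    have "ip N (resid N X k) (gs N X j) = 0"
      using ip_oproj_residual[OF IH span_base, of "gs N X j" "zext N (X (Suc k))"] that
      unfolding resid_def oproj_zext by simp
    then show ?thesis unfolding gs_resid[of N X k] ip_scale_left by simp
  qed
  have 1: "ip N (gs N X k) (gs N X k) = 1"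
    unfolding enorm_sq[symmetric] gs_resid[of N X k] enorm_scale using nz by simp
  show ?case unfolding orthonormal_def
  proof (intro conjI allI impI gs_in)
    fix i j assume "i < Suc k" "j < Suc k"
    then show "ip N (gs N X i) (gs N X j) = (if i = j then 1 else 0)"
      using IH 0 1 ip_commute[of N "gs N X i" "gs N X j"] unfolding orthonormal_def less_Suc_eq by auto
  qed
qed

text \<open>The rows are triangular combinations of the Gram--Schmidt output with the nonzero
  residual norms on the diagonal, so the two linear systems have the same solutions.\<close>

lemma ker_gs:
  assumes X: "nondeg N n X" shows "ker N {1..n} X = ker N {..<n} (gs N X)"
proof -
  have row: "ip N x (X (Suc i)) = enorm N (resid N X i) * ip N x (gs N X i) + (\<Sum>j<i. ip N (X (Suc i)) (gs N X j) * ip N x (gs N X j))"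
    if "i < n" for x i
  proof -
    have nz: "enorm N (resid N X i) \<noteq> 0" using X that by (simp add: nondeg_def)
    have "zext N (X (Suc i)) = resid N X i + oproj N i (gs N X) (X (Suc i))" by (simp add: resid_def)
    moreover have "resid N X i = enorm N (resid N X i) *\<^sub>R gs N X i" using nz by (simp add: gs_resid[of N X i])
    ultimately have "ip N x (zext N (X (Suc i))) = ip N x (enorm N (resid N X i) *\<^sub>R gs N X i + oproj N i (gs N X) (X (Suc i)))"
      by metis
    then show ?thesis unfolding oproj_def ip_add_right ip_scale_right ip_sum_right by simp
  qed
  have iff: "(\<forall>i\<in>{1..n}. ip N x (X i) = 0) \<longleftrightarrow> (\<forall>i\<in>{..<n}. ip N x (gs N X i) = 0)" for x
  proof
    assume *: "\<forall>i\<in>{1..n}. ip N x (X i) = 0"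
    show "\<forall>i\<in>{..<n}. ip N x (gs N X i) = 0"
    proof
      fix i assume "i \<in> {..<n}"
      moreover have "i < n \<longrightarrow> ip N x (gs N X i) = 0"
      proof (induction i rule: less_induct)
        case (less i)
        show ?case
        proof
          assume i: "i < n"
          have "ip N x (X (Suc i)) = 0" using * i by simp
          moreover have "(\<Sum>j<i. ip N (X (Suc i)) (gs N X j) * ip N x (gs N X j)) = 0"
            using less.IH i by (intro sum.neutral) auto
          ultimately have "enorm N (resid N X i) * ip N x (gs N X i) = 0" using row[OF i, of x] by simp
          then show "ip N x (gs N X i) = 0" using X i by (simp add: nondeg_def)
        qed
      qed
      ultimately show "ip N x (gs N X i) = 0" by simp
    qed
  next
    assume *: "\<forall>i\<in>{..<n}. ip N x (gs N X i) = 0"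
    show "\<forall>i\<in>{1..n}. ip N x (X i) = 0"
    proof
      fix i assume "i \<in> {1..n}"
      then obtain k where k: "i = Suc k" "k < n" by (cases i) auto
      show "ip N x (X i) = 0" unfolding k(1) row[OF k(2)] using * k(2) by (simp add: sum.neutral)
    qed
  qed
  show ?thesis unfolding ker_def iff ..
qed

text \<open>Equivariance of Gram--Schmidt. Rows are compared only up to index \<open>n\<close> and
  only on R^N; with the identity as \<open>T\<close> this also shows that early outputs ignore later
  rows.\<close>

lemma resid_rotate:
  assumes T: "orthogonal_map N T" and XY: "\<And>i. i < n \<Longrightarrow> zext N (Y (Suc i)) = T (zext N (X (Suc i)))"
  shows "i < n \<Longrightarrow> resid N Y i = T (resid N X i)" "i < n \<Longrightarrow> gs N Y i = T (gs N X i)"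
proof -
  have lin: "linear T" using T by (simp add: orthogonal_map_def)
  have r: "resid N Y i = T (resid N X i)" if i: "i < n" and g: "\<And>j. j < i \<Longrightarrow> gs N Y j = T (gs N X j)" for i
  proof -
    have ipe: "ip N (Y (Suc i)) (T (gs N X j)) = ip N (X (Suc i)) (gs N X j)" for j
    proof -
      have "ip N (Y (Suc i)) (T (gs N X j)) = ip N (zext N (Y (Suc i))) (T (gs N X j))" by simp
      also have "\<dots> = ip N (zext N (X (Suc i))) (gs N X j)"
        unfolding XY[OF i] by (rule orthogonal_map_ip[OF T zext_in gs_in])
      finally show ?thesis by simp
    qed
    have "oproj N i (gs N Y) (Y (Suc i)) = (\<Sum>j<i. ip N (X (Suc i)) (gs N X j) *\<^sub>R T (gs N X j))"
      unfolding oproj_def by (intro sum.cong refl) (simp add: g ipe)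
    also have "\<dots> = T (oproj N i (gs N X) (X (Suc i)))"
      unfolding oproj_def linear_sum[OF lin] linear_scale[OF lin] ..
    finally show ?thesis unfolding resid_def XY[OF i] linear_diff[OF lin] by (rule arg_cong)
  qed
  have gg: "i < n \<Longrightarrow> gs N Y i = T (gs N X i)" for i
  proof (induction i rule: less_induct)
    case (less i)
    have "resid N Y i = T (resid N X i)" using less by (intro r) auto
    then show ?case
      unfolding gs_resid[of N Y i] gs_resid[of N X i] linear_scale[OF lin]
      by (simp only: enorm_rotate[OF T resid_in])
  qed
  show "i < n \<Longrightarrow> gs N Y i = T (gs N X i)" by (rule gg)
  show "i < n \<Longrightarrow> resid N Y i = T (resid N X i)" using gg by (intro r) auto
qed

lemma nondeg_rotate:
  assumes T: "orthogonal_map N T" and XY: "\<And>i. i < n \<Longrightarrow> zext N (Y (Suc i)) = T (zext N (X (Suc i)))"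
  shows "nondeg N n Y \<longleftrightarrow> nondeg N n X"
proof -
  have "enorm N (resid N Y i) = enorm N (resid N X i)" if "i < n" for i
  proof -
    have "resid N Y i = T (resid N X i)" by (rule resid_rotate(1)[OF T _ that]) (rule XY)
    then show ?thesis by (simp only: enorm_rotate[OF T resid_in])
  qed
  then show ?thesis by (simp add: nondeg_def)
qed

lemma ker_cong_zext: "ker N I X = ker N I (\<lambda>i. zext N (X i))"
  by (simp add: ker_def)

lemma resid_measurable:
  assumes I: "\<And>j. j \<le> i \<Longrightarrow> Suc j \<in> I"
  shows "(\<lambda>X. resid N X i c) \<in> borel_measurable (array I)"
    and "(\<lambda>X. enorm N (resid N X i)) \<in> borel_measurable (array I)"
    and "(\<lambda>X. gs N X i c) \<in> borel_measurable (array I)"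
proof -
  have zc: "(\<lambda>X. zext N (X (Suc j)) c) \<in> borel_measurable (array I)" if "Suc j \<in> I" for j c
    using measurable_compose[OF measurable_compose[OF row_measurable[OF that] zext_measurable] coord_measurable_gauss] .
  have r: "(\<lambda>X. resid N X i c) \<in> borel_measurable (array I)"
    if g: "\<And>j c. j < i \<Longrightarrow> (\<lambda>X. gs N X j c) \<in> borel_measurable (array I)" and i: "Suc i \<in> I" for i c
  proof -
    have "(\<lambda>X. ip N (X (Suc i)) (gs N X j)) \<in> borel_measurable (array I)" if "j < i" for j
      unfolding ip_def by (intro borel_measurable_sum borel_measurable_times g that array_coord_measurable i)
    then have "(\<lambda>X. zext N (X (Suc i)) c - (\<Sum>j<i. ip N (X (Suc i)) (gs N X j) * gs N X j c)) \<in> borel_measurable (array I)"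
      by (intro borel_measurable_diff zc i borel_measurable_sum borel_measurable_times g) auto
    then show ?thesis by (simp add: resid_def oproj_def sum_fun_apply)
  qed
  have e: "(\<lambda>X. enorm N (resid N X i)) \<in> borel_measurable (array I)"
    if "\<And>c. (\<lambda>X. resid N X i c) \<in> borel_measurable (array I)" for i
  proof -
    have [measurable]: "(\<lambda>X. \<Sum>c=1..N. (resid N X i c)\<^sup>2) \<in> borel_measurable (array I)"
      by (intro borel_measurable_sum borel_measurable_power that)
    show ?thesis unfolding enorm_def L2_set_def by measurable
  qed
  have g: "(\<forall>j\<le>i. Suc j \<in> I) \<longrightarrow> (\<forall>c. (\<lambda>X. gs N X i c) \<in> borel_measurable (array I))" for i
  proof (induction i rule: less_induct)
    case (less i)
    show ?case
    proof (intro impI allI)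
      fix c assume *: "\<forall>j\<le>i. Suc j \<in> I"
      have gj: "(\<lambda>X. gs N X j c) \<in> borel_measurable (array I)" if "j < i" for j c
      proof -
        have "\<forall>k\<le>j. Suc k \<in> I" using * that by simp
        then show ?thesis using less.IH[OF that] by blast
      qed
      have "Suc i \<in> I" using * by simp
      from r[OF gj this] have rm: "(\<lambda>X. resid N X i c) \<in> borel_measurable (array I)" for c .
      have "(\<lambda>X. (1 / enorm N (resid N X i)) * resid N X i c) \<in> borel_measurable (array I)"
        by (intro borel_measurable_times borel_measurable_divide borel_measurable_const e rm)
      then show "(\<lambda>X. gs N X i c) \<in> borel_measurable (array I)" by (simp add: gs_resid[of N _ i])
    qed
  qed
  have gj: "(\<lambda>X. gs N X j c) \<in> borel_measurable (array I)" if "j \<le> i" for j c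
  proof -
    have "\<forall>k\<le>j. Suc k \<in> I" using I that by simp
    then show ?thesis using g[of j] by blast
  qed
  show "(\<lambda>X. gs N X i c) \<in> borel_measurable (array I)" by (rule gj) simp
  have rm: "(\<lambda>X. resid N X i c) \<in> borel_measurable (array I)" for c
    by (rule r[OF gj]) (use I in auto)
  then show "(\<lambda>X. resid N X i c) \<in> borel_measurable (array I)" .
  show "(\<lambda>X. enorm N (resid N X i)) \<in> borel_measurable (array I)" by (rule e[OF rm])
qed

lemma nondeg_sets: "{X \<in> space (array {1..n}). nondeg N n X} \<in> sets (array {1..n})"
proof -
  have "{X \<in> space (array {1..n}). nondeg N n X} = {X \<in> space (array {1..n}). \<forall>i\<in>{..<n}. enorm N (resid N X i) \<noteq> 0}"
    by (auto simp: nondeg_def)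
  also have "\<dots> \<in> sets (array {1..n})"
  proof (rule sets.sets_Collect_finite_All)
    fix i assume i: "i \<in> {..<n}"
    have [measurable]: "(\<lambda>X. enorm N (resid N X i)) \<in> borel_measurable (array {1..n})"
      by (rule resid_measurable(2)) (use i in auto)
    show "{X \<in> space (array {1..n}). enorm N (resid N X i) \<noteq> 0} \<in> sets (array {1..n})" by measurable
  qed auto
  finally show ?thesis .
qed

text \<open>Fix all rows except row \<open>Suc i\<close>. If the earlier rows are nondegenerate,
  some fixed nonzero vector is orthogonal to their Gram--Schmidt output, because i < n \<le> N. A
  vanishing residual forces row \<open>Suc i\<close> to be orthogonal to this vector, which is a
  null event.\<close>

lemma AE_nondeg:
  assumes n: "n \<le> N" shows "AE X in array {1..n}. nondeg N n X"
proof -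
  have step: "AE X in array {1..n}. nondeg N i X \<longrightarrow> enorm N (resid N X i) \<noteq> 0" if i: "i < n" for i
  proof -
    define I where "I = {1..n} - {Suc i}"
    have I: "finite I" "Suc i \<notin> I" "insert (Suc i) I = {1..n}" using i by (auto simp: I_def)
    define B where "B = {X \<in> space (array {1..n}). nondeg N i X \<and> enorm N (resid N X i) = 0}"
    have B: "B \<in> sets (array {1..n})"
    proof -
      have m: "(\<lambda>X. enorm N (resid N X j)) \<in> borel_measurable (array {1..n})" if "j \<le> i" for j
        by (rule resid_measurable(2)) (use that i in auto)
      have "B = {X \<in> space (array {1..n}). (\<forall>j\<in>{..<i}. enorm N (resid N X j) \<noteq> 0) \<and> enorm N (resid N X i) = 0}"
        by (auto simp: B_def nondeg_def)
      also have "\<dots> \<in> sets (array {1..n})"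
      proof -
        have "{X \<in> space (array {1..n}). enorm N (resid N X j) \<noteq> 0} \<in> sets (array {1..n})" if "j \<in> {..<i}" for j
        proof -
          have [measurable]: "(\<lambda>X. enorm N (resid N X j)) \<in> borel_measurable (array {1..n})" by (intro m) (use that in simp)
          show ?thesis by measurable
        qed
        from sets.sets_Collect_finite_All[OF this finite_lessThan]
        have 1: "{X \<in> space (array {1..n}). \<forall>j\<in>{..<i}. enorm N (resid N X j) \<noteq> 0} \<in> sets (array {1..n})" .
        have [measurable]: "(\<lambda>X. enorm N (resid N X i)) \<in> borel_measurable (array {1..n})" by (intro m) simp
        have 2: "{X \<in> space (array {1..n}). enorm N (resid N X i) = 0} \<in> sets (array {1..n})" by measurable
        show ?thesis by (rule sets.sets_Collect_conj[OF 2 1])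
      qed
      finally show ?thesis .
    qed
    have B': "indicator B \<in> borel_measurable (PiM (insert (Suc i) I) (\<lambda>_. gauss))"
      using B unfolding I(3) array_def by simp
    have "emeasure (array {1..n}) B = (\<integral>\<^sup>+X. indicator B X \<partial>array {1..n})" using B by simp
    also have "\<dots> = (\<integral>\<^sup>+X. \<integral>\<^sup>+y. indicator B (X(Suc i := y)) \<partial>gauss \<partial>PiM I (\<lambda>_. gauss))"
      using PA.product_nn_integral_insert[OF I(1,2) B'] unfolding I(3) array_def .
    also have "\<dots> = (\<integral>\<^sup>+X. 0 \<partial>PiM I (\<lambda>_. gauss))"
    proof (rule nn_integral_cong)
      fix X
      show "(\<integral>\<^sup>+y. indicator B (X(Suc i := y)) \<partial>gauss) = 0"
      proof (cases "nondeg N i X")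
        case True
        have same: "resid N (X(Suc i := y)) j = resid N X j" "gs N (X(Suc i := y)) j = gs N X j" if "j < i" for j y
          using resid_rotate[OF orthogonal_map_id, of i N "X(Suc i := y)" X j] that by auto
        have on: "orthonormal N i (gs N X)" by (rule gs_orthonormal[OF True])
        have kG: "ker N {..<i} (gs N X) \<in> grassmannian N i" by (rule ker_in_grassmannian[OF on])
        then have d: "dim (ker N {..<i} (gs N X)) \<noteq> 0" using i n by (auto simp: grassmannian_def)
        obtain g where g: "orthonormal N (dim (ker N {..<i} (gs N X))) g"
          "span (g ` {..<dim (ker N {..<i} (gs N X))}) = ker N {..<i} (gs N X)"
          using orthonormal_basis[OF grassmannianD(1,2)[OF kG]] by blast
        have w: "g 0 \<in> ker N {..<i} (gs N X)" using span_base[of "g 0" "g ` {..<dim (ker N {..<i} (gs N X))}"] g(2) d by auto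
        have w1: "g 0 \<in> euclidean N" "g 0 \<noteq> 0"
        proof -
          show "g 0 \<in> euclidean N" using w by (simp add: ker_def)
          have "ip N (g 0) (g 0) = 1" using g(1) d by (simp add: orthonormal_def)
          then show "g 0 \<noteq> 0" by auto
        qed
        have zero: "ip N y (g 0) = 0" if "X(Suc i := y) \<in> B" for y
        proof -
          let ?Y = "X(Suc i := y)"
          have "enorm N (resid N ?Y i) = 0" using that by (simp add: B_def)
          then have "resid N ?Y i = 0" by (rule enorm_eq_0D[OF resid_in])
          then have "zext N y = oproj N i (gs N ?Y) y" by (simp add: resid_def)
          also have "\<dots> = oproj N i (gs N X) y" unfolding oproj_def by (intro sum.cong refl) (simp add: same)
          finally have "ip N (zext N y) (g 0) = ip N (oproj N i (gs N X) y) (g 0)" by simp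
          also have "\<dots> = (\<Sum>j<i. ip N y (gs N X j) * ip N (gs N X j) (g 0))"
            unfolding oproj_def ip_sum_left ip_scale_left ..
          also have "\<dots> = 0" using w by (intro sum.neutral) (auto simp: ker_def ip_commute[of N _ "g 0"])
          finally show ?thesis by simp
        qed
        have "(\<integral>\<^sup>+y. indicator B (X(Suc i := y)) \<partial>gauss) \<le> (\<integral>\<^sup>+y. indicator {y. ip N y (g 0) = 0} y \<partial>gauss)"
          using zero by (intro nn_integral_mono) (auto simp: indicator_def)
        also have "\<dots> = emeasure gauss {y. ip N y (g 0) = 0}"
          using measurable_sets[OF ip_measurable_gauss[of N "g 0"], of "{0}"] by (simp add: vimage_def)
        also have "\<dots> = 0" by (rule gauss_hyperplane_null[OF w1])
        finally show ?thesis by simp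
      next
        case False
        have "X(Suc i := y) \<notin> B" for y
        proof -
          have "nondeg N i (X(Suc i := y)) \<longleftrightarrow> nondeg N i X"
            by (rule nondeg_rotate[OF orthogonal_map_id]) simp
          then show ?thesis using False by (simp add: B_def)
        qed
        then show ?thesis by simp
      qed
    qed
    finally have "emeasure (array {1..n}) B = 0" by simp
    then show ?thesis by (subst AE_iff_measurable[OF B]) (auto simp: B_def)
  qed
  have "AE X in array {1..n}. \<forall>i\<in>{..<n}. nondeg N i X \<longrightarrow> enorm N (resid N X i) \<noteq> 0"
    using step by (intro AE_finite_allI) auto
  then show ?thesis
  proof eventually_elim
    case (elim X)
    have "i \<le> n \<longrightarrow> nondeg N i X" for i
    proof (induction i)
      case 0
      show ?case by (simp add: nondeg_def)
    next
      case (Suc i)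
      show ?case
      proof
        assume i: "Suc i \<le> n"
        then have "nondeg N i X" using Suc by simp
        moreover have "enorm N (resid N X i) \<noteq> 0" using bspec[OF elim, of i] i calculation by simp
        ultimately show "nondeg N (Suc i) X" unfolding nondeg_def less_Suc_eq by blast
      qed
    qed
    then show ?case by simp
  qed
qed

section \<open>Transfer from the kernel of a Gaussian array\<close>

lemma oproj_gs_measurable:
  "(\<lambda>X. enorm N (oproj N n (gs N X) x)) \<in> borel_measurable (array {1..n})"
proof -
  have g: "(\<lambda>X. gs N X i c) \<in> borel_measurable (array {1..n})" if "i < n" for i c
    by (rule resid_measurable(3)) (use that in auto)
  have [measurable]: "(\<lambda>X. \<Sum>c=1..N. (\<Sum>i<n. ip N x (gs N X i) * gs N X i c)\<^sup>2) \<in> borel_measurable (array {1..n})"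
    unfolding ip_def by (intro borel_measurable_sum borel_measurable_power borel_measurable_times borel_measurable_const g) auto
  show ?thesis unfolding enorm_def L2_set_def oproj_def sum_fun_apply scaleR_fun_apply real_scaleR_def by measurable
qed

lemma sets_Collect_countable_Ball':
  assumes "countable D" "\<And>x. x \<in> D \<Longrightarrow> {E \<in> space M. P x E} \<in> sets M"
  shows "{E \<in> space M. \<forall>x\<in>D. P x E} \<in> sets M"
proof (cases "D = {}")
  case False
  have "(\<Inter>x\<in>D. {E \<in> space M. P x E}) \<in> sets M"
    by (rule sets.countable_INT'[OF assms(1) False]) (use assms(2) in blast)
  moreover have "(\<Inter>x\<in>D. {E \<in> space M. P x E}) = {E \<in> space M. \<forall>x\<in>D. P x E}"
    using False by blast
  ultimately show ?thesis by simp
qed simp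

text \<open>The relation is closeness of \<open>E\<close> to the kernel of nondegenerate rows.
  Gram--Schmidt makes it measurable by expressing the distance to the kernel as the norm of a
  projection.\<close>

lemma haar_transfer_array:
  assumes \<mu>: "haar_grassmannian N n \<mu>" and n: "n < N" and \<delta>: "0 < \<delta>"
    and bad: "bad \<in> sets \<mu>" and A: "A \<in> sets (array {1..n})"
    and imp: "\<And>E X. E \<in> bad \<Longrightarrow> X \<in> space (array {1..n}) \<Longrightarrow> ker N {1..n} X \<in> grassmannian N n \<Longrightarrow>
      close \<delta> N E (ker N {1..n} X) \<Longrightarrow> X \<in> A"
  shows "emeasure \<mu> bad \<le> emeasure (array {1..n}) A"
proof -
  define r where "r E X \<longleftrightarrow> nondeg N n X \<and> close \<delta> N E (ker N {1..n} X)" for E X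
  obtain C where C: "countable C" "C \<subseteq> grassmannian N n" "\<And>F. F \<in> grassmannian N n \<Longrightarrow> \<exists>E\<in>C. close \<delta> N E F"
    using grassmannian_separable[OF \<delta>, of N n] by blast
  have sp: "space \<mu> = grassmannian N n" by (rule haarD(1)[OF \<mu>])
  have kG: "ker N {1..n} X \<in> grassmannian N n" if "nondeg N n X" for X
    unfolding ker_gs[OF that] by (rule ker_in_grassmannian[OF gs_orthonormal[OF that]])
  have kd: "edist N x (ker N {1..n} X) = enorm N (oproj N n (gs N X) x)" if "nondeg N n X" "x \<in> euclidean N" for X x
    unfolding ker_gs[OF that(1)] by (rule edist_ker[OF gs_orthonormal[OF that(1)] that(2)])
  obtain D where D: "countable D" "D \<subseteq> euclidean N" "D \<noteq> {}"
    "\<And>x \<eta>. x \<in> euclidean N \<Longrightarrow> 0 < \<eta> \<Longrightarrow> \<exists>y\<in>D. enorm N (x - y) < \<eta>"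
    using euclidean_separable[of N] by blast
  \<comment> \<open>Both sides of the inequality are continuous in \<open>x\<close>, so countably
    many test points decide closeness.\<close>
  have closeD: "close \<delta> N E F \<longleftrightarrow> (\<forall>x\<in>D. \<bar>edist N x E - edist N x F\<bar> \<le> \<delta> * enorm N x)"
    if EF: "E \<in> grassmannian N n" "F \<in> grassmannian N n" for E F
  proof
    assume "close \<delta> N E F" then show "\<forall>x\<in>D. \<bar>edist N x E - edist N x F\<bar> \<le> \<delta> * enorm N x"
      using D(2) unfolding close_def by blast
  next
    assume *: "\<forall>x\<in>D. \<bar>edist N x E - edist N x F\<bar> \<le> \<delta> * enorm N x"
    have ne: "E \<noteq> {}" "F \<noteq> {}" using grassmannianD(3) EF by blast+
    show "close \<delta> N E F" unfolding close_def
    proof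
      fix x assume x: "x \<in> euclidean N"
      show "\<bar>edist N x E - edist N x F\<bar> \<le> \<delta> * enorm N x"
      proof (rule field_le_epsilon)
        fix e :: real assume e: "0 < e"
        then have "0 < e / (2 + \<delta>)" using \<delta> by simp
        then obtain y where y: "y \<in> D" "enorm N (x - y) < e / (2 + \<delta>)" using D(4)[OF x] by blast
        have 1: "\<bar>edist N y E - edist N y F\<bar> \<le> \<delta> * enorm N y" using * y(1) by blast
        have 2: "\<bar>edist N x E - edist N y E\<bar> \<le> enorm N (x - y)" "\<bar>edist N x F - edist N y F\<bar> \<le> enorm N (x - y)"
          using edist_lipschitz[OF ne(1)] edist_lipschitz[OF ne(2)] by blast+
        have "enorm N y \<le> enorm N x + enorm N (x - y)" using enorm_diff_le[of N x y] by linarith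
        then have 3: "\<delta> * enorm N y \<le> \<delta> * enorm N x + \<delta> * enorm N (x - y)"
          using mult_left_mono[of "enorm N y" "enorm N x + enorm N (x - y)" \<delta>] \<delta> by (simp add: distrib_left)
        have 4: "(2 + \<delta>) * enorm N (x - y) \<le> e" using y(2) \<delta> by (simp add: field_simps)
        have "\<bar>edist N x E - edist N x F\<bar> \<le> \<delta> * enorm N x + (2 + \<delta>) * enorm N (x - y)"
          using 1 2 3 by (simp add: distrib_right)
        then show "\<bar>edist N x E - edist N x F\<bar> \<le> \<delta> * enorm N x + e" using 4 by linarith
      qed
    qed
  qed
  have eq: "r E X \<longleftrightarrow> nondeg N n X \<and> (\<forall>x\<in>D. \<bar>edist N x E - enorm N (oproj N n (gs N X) x)\<bar> \<le> \<delta> * enorm N x)"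
    if E: "E \<in> grassmannian N n" for E X
  proof (cases "nondeg N n X")
    case True
    have "(\<forall>x\<in>D. \<bar>edist N x E - edist N x (ker N {1..n} X)\<bar> \<le> \<delta> * enorm N x) \<longleftrightarrow>
      (\<forall>x\<in>D. \<bar>edist N x E - enorm N (oproj N n (gs N X) x)\<bar> \<le> \<delta> * enorm N x)"
      using D(2) kd[OF True] by (intro ball_cong refl) (simp add: subset_eq)
    then show ?thesis unfolding r_def closeD[OF E kG[OF True]] by (simp only:)
  qed (simp add: r_def)
  have cA: "{E \<in> grassmannian N n. close \<delta> N E F} \<in> sets \<mu>" if F: "F \<in> grassmannian N n" for F
  proof -
    have "{E \<in> space \<mu>. \<bar>edist N x E - edist N x F\<bar> \<le> \<delta> * enorm N x} \<in> sets \<mu>" if "x \<in> D" for x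
    proof -
      have [measurable]: "edist N x \<in> borel_measurable \<mu>"
        by (rule haar_measurable[OF \<mu> edist_measurable]) (use that D(2) in blast)
      show ?thesis by measurable
    qed
    from sets_Collect_countable_Ball'[OF D(1) this]
    have "{E \<in> space \<mu>. \<forall>x\<in>D. \<bar>edist N x E - edist N x F\<bar> \<le> \<delta> * enorm N x} \<in> sets \<mu>" .
    moreover have "{E \<in> space \<mu>. \<forall>x\<in>D. \<bar>edist N x E - edist N x F\<bar> \<le> \<delta> * enorm N x} = {E \<in> grassmannian N n. close \<delta> N E F}"
      using closeD[OF _ F] sp by blast
    ultimately show ?thesis by simp
  qed
  show ?thesis
  proof (rule haar_transfer[OF \<mu> prob_space_array, where r=r and good="nondeg N n" and C=C])
    show R: "{p \<in> space (\<mu> \<Otimes>\<^sub>M array {1..n}). r (fst p) (snd p)} \<in> sets (\<mu> \<Otimes>\<^sub>M array {1..n})"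
    proof -
      let ?P = "\<mu> \<Otimes>\<^sub>M array {1..n}"
      have R1: "{p \<in> space ?P. nondeg N n (snd p)} \<in> sets ?P"
      proof -
        have "snd -` {X \<in> space (array {1..n}). nondeg N n X} \<inter> space ?P \<in> sets ?P"
          by (rule measurable_sets[OF measurable_snd nondeg_sets])
        moreover have "snd -` {X \<in> space (array {1..n}). nondeg N n X} \<inter> space ?P = {p \<in> space ?P. nondeg N n (snd p)}"
          by (auto simp: space_pair_measure)
        ultimately show ?thesis by simp
      qed
      have "{p \<in> space ?P. \<bar>edist N x (fst p) - enorm N (oproj N n (gs N (snd p)) x)\<bar> \<le> \<delta> * enorm N x} \<in> sets ?P"
        if "x \<in> D" for x
      proof -
        have "edist N x \<in> borel_measurable \<mu>"
          by (rule haar_measurable[OF \<mu> edist_measurable]) (use that D(2) in blast)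
        from measurable_compose[OF measurable_fst this] measurable_compose[OF measurable_snd oproj_gs_measurable[of N n x]]
        have [measurable]: "(\<lambda>p. edist N x (fst p)) \<in> borel_measurable ?P" "(\<lambda>p. enorm N (oproj N n (gs N (snd p)) x)) \<in> borel_measurable ?P"
          by blast+
        show ?thesis by measurable
      qed
      from sets_Collect_countable_Ball'[OF D(1) this]
      have "{p \<in> space ?P. \<forall>x\<in>D. \<bar>edist N x (fst p) - enorm N (oproj N n (gs N (snd p)) x)\<bar> \<le> \<delta> * enorm N x} \<in> sets ?P" .
      from sets.sets_Collect_conj[OF this R1] have RR: "{p \<in> space ?P. nondeg N n (snd p) \<and> (\<forall>x\<in>D. \<bar>edist N x (fst p) - enorm N (oproj N n (gs N (snd p)) x)\<bar> \<le> \<delta> * enorm N x)} \<in> sets ?P" .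
      have "fst p \<in> grassmannian N n" if "p \<in> space ?P" for p
        using that unfolding space_pair_measure sp mem_Times_iff by (rule conjunct1)
      then have "{p \<in> space ?P. r (fst p) (snd p)} = {p \<in> space ?P. nondeg N n (snd p) \<and> (\<forall>x\<in>D. \<bar>edist N x (fst p) - enorm N (oproj N n (gs N (snd p)) x)\<bar> \<le> \<delta> * enorm N x)}"
        using eq by blast
      then show ?thesis using RR by (simp only:)
    qed
    have rm: "{X \<in> space (array {1..n}). r E X} \<in> sets (array {1..n})" if "E \<in> grassmannian N n" for E
    proof -
      have "Pair E -` {p \<in> space (\<mu> \<Otimes>\<^sub>M array {1..n}). r (fst p) (snd p)} = {X \<in> space (array {1..n}). r E X}"
        using that sp by (auto simp: space_pair_measure)
      then show ?thesis using sets_Pair1[OF R, of E] by simp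
    qed
    show "emeasure (array {1..n}) {X \<in> space (array {1..n}). r E X} = emeasure (array {1..n}) {X \<in> space (array {1..n}). r E' X}"
      if E: "E \<in> grassmannian N n" "E' \<in> grassmannian N n" for E E'
    proof -
      obtain T T' where T: "orthogonal_map N T" "orthogonal_map N T'" "\<And>x. T (T' x) = x" "\<And>x. T' (T x) = x" "T ` E = E'"
        using grassmannian_transitive[OF E] by blast
      let ?A = "array {1..n}"
      define RX where "RX E = {X \<in> space ?A. r E X}" for E
      \<comment> \<open>\<open>S\<close> rotates the rows and \<open>Z\<close> only truncates them;
        \<open>nn_integral_array_rotate\<close> equates integrals over the two, and the relation
        does not distinguish \<open>Z X\<close> from \<open>X\<close>.\<close>
      define S where "S X = (\<lambda>i\<in>{1..n}. T (zext N (X i)))" for X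
      define Z where "Z X = (\<lambda>i\<in>{1..n}. zext N (X i))" for X
      have spA: "space ?A = extensional {1..n}" by (auto simp: array_def space_PiM PiE_def)
      have inA: "S X \<in> space ?A" "Z X \<in> space ?A" for X
        unfolding spA S_def Z_def by (rule restrict_extensional)+
      have zz: "zext N (zext N g) = zext N g" for g by (rule zext_eq[OF zext_in])
      have rZ: "r E' (Z X) \<longleftrightarrow> r E' X" for X
      proof -
        have "nondeg N n (Z X) \<longleftrightarrow> nondeg N n X"
          by (rule nondeg_rotate[OF orthogonal_map_id]) (simp add: Z_def zz)
        moreover have "ker N {1..n} (Z X) = ker N {1..n} X" by (auto simp: ker_def Z_def)
        ultimately show ?thesis by (simp add: r_def)
      qed
      have rS: "r E' (S X) \<longleftrightarrow> r E X" for X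
      proof -
        have 1: "nondeg N n (S X) \<longleftrightarrow> nondeg N n X"
          by (rule nondeg_rotate[OF T(1)]) (simp add: S_def zext_rotate[OF T(1)])
        have "ker N {1..n} (S X) = ker N {1..n} (\<lambda>i. T (zext N (X i)))" by (auto simp: ker_def S_def)
        also have "\<dots> = T ` ker N {1..n} (\<lambda>i. zext N (X i))" by (rule ker_image[OF T(1-4), symmetric]) (rule zext_in)
        also have "\<dots> = T ` ker N {1..n} X" by (simp only: ker_cong_zext[symmetric])
        finally have 2: "close \<delta> N E' (ker N {1..n} (S X)) \<longleftrightarrow> close \<delta> N E (ker N {1..n} X)"
          unfolding T(5)[symmetric] using close_image[OF T(1-4) grassmannianD(2)[OF E(1)], of "ker N {1..n} X" \<delta>]
          by (simp add: ker_def)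
        show ?thesis unfolding r_def 1 2 ..
      qed
      have ind: "indicator (RX E') \<in> borel_measurable ?A"
        unfolding RX_def by (rule borel_measurable_indicator[OF rm[OF E(2)]])
      have "emeasure ?A (RX E') = (\<integral>\<^sup>+X. indicator (RX E') X \<partial>?A)"
        unfolding RX_def by (rule nn_integral_indicator[OF rm[OF E(2)], symmetric])
      also have "\<dots> = (\<integral>\<^sup>+X. indicator (RX E') (Z X) \<partial>?A)"
        using rZ inA by (intro nn_integral_cong) (simp add: indicator_def RX_def)
      also have "\<dots> = (\<integral>\<^sup>+X. indicator (RX E') (S X) \<partial>?A)"
        unfolding S_def Z_def using nn_integral_array_rotate[OF _ T(1-3) ind] by simp
      also have "\<dots> = (\<integral>\<^sup>+X. indicator (RX E) X \<partial>?A)"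
        using rS inA by (intro nn_integral_cong) (simp add: indicator_def RX_def)
      also have "\<dots> = emeasure ?A (RX E)" unfolding RX_def by (rule nn_integral_indicator[OF rm[OF E(1)]])
      finally show ?thesis by (simp add: RX_def)
    qed
    show "emeasure \<mu> {E \<in> space \<mu>. r E X} = emeasure \<mu> {E \<in> space \<mu>. r E X'}"
      if X: "nondeg N n X" "nondeg N n X'" for X X'
    proof -
      define F where "F = ker N {1..n} X"
      define F' where "F' = ker N {1..n} X'"
      have FF: "F \<in> grassmannian N n" "F' \<in> grassmannian N n" using kG X by (auto simp: F_def F'_def)
      obtain T T' where T: "orthogonal_map N T" "orthogonal_map N T'" "\<And>x. T (T' x) = x" "\<And>x. T' (T x) = x" "T ` F = F'"
        using grassmannian_transitive[OF FF] by blast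
      have TF: "T' ` F' = F" unfolding T(5)[symmetric] image_image T(4) by simp
      have "close \<delta> N (T' ` E) F \<longleftrightarrow> close \<delta> N E F'" if "E \<in> grassmannian N n" for E
        using close_image[OF T(2,1,4,3) grassmannianD(2)[OF that] grassmannianD(2)[OF FF(2)], of \<delta>] unfolding TF .
      then have "{E \<in> grassmannian N n. close \<delta> N (T' ` E) F} = {E \<in> grassmannian N n. close \<delta> N E F'}" by blast
      with haar_invariant[OF \<mu> T(1-4) cA[OF FF(1)]]
      have "emeasure \<mu> {E \<in> grassmannian N n. close \<delta> N E F'} = emeasure \<mu> {E \<in> grassmannian N n. close \<delta> N E F}" by simp
      then show ?thesis by (simp add: r_def X F_def F'_def sp)
    qed
    show "AE X in array {1..n}. nondeg N n X" by (rule AE_nondeg) (use n in simp)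
    show "countable C" "C \<subseteq> grassmannian N n" by (fact C)+
    show "\<exists>E\<in>C. r E X" if "nondeg N n X" for X
      using C(3)[OF kG[OF that]] that by (auto simp: r_def)
    show "X \<in> A" if "E \<in> bad" "X \<in> space (array {1..n})" "nondeg N n X" "r E X" for E X
      using imp[OF that(1,2) kG[OF that(3)]] that(4) by (simp add: r_def)
  qed (fact bad, fact A)
qed

section \<open>The upper bound\<close>

lemma powr_le_exp_sq:
  fixes q :: real
  assumes "0 \<le> q"
  obtains K where "0 < K" "\<And>y. \<bar>y\<bar> powr q \<le> K * exp (y\<^sup>2 / 8)"
proof -
  obtain m :: nat where m: "q < real m" using reals_Archimedean2 by blast
  define M where "M = Suc m"
  define K where "K = 1 + (8 * real M) ^ M"
  have M: "0 < real M" by (simp add: M_def)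
  have "\<bar>y\<bar> powr q \<le> K * exp (y\<^sup>2 / 8)" for y
  proof (cases "\<bar>y\<bar> \<le> 1")
    case True
    then have "\<bar>y\<bar> powr q \<le> 1" using assms by (intro powr_le1) auto
    also have "1 \<le> K * exp (y\<^sup>2 / 8)"
      using mult_mono[of 1 K 1 "exp (y\<^sup>2 / 8)"] by (simp add: K_def)
    finally show ?thesis .
  next
    case F: False
    have "\<bar>y\<bar> powr q \<le> \<bar>y\<bar> powr real (2 * M)" using F m by (intro powr_mono) (auto simp: M_def)
    also have "\<dots> = (y\<^sup>2) ^ M" using F by (subst powr_realpow) (auto simp: power_mult power2_abs)
    also have "\<dots> \<le> (8 * real M) ^ M * exp (y\<^sup>2 / 8)"
    proof -
      have "y\<^sup>2 / (8 * real M) \<le> exp (y\<^sup>2 / (8 * real M))"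
        using exp_ge_add_one_self[of "y\<^sup>2 / (8 * real M)"] by linarith
      then have "(y\<^sup>2 / (8 * real M)) ^ M \<le> exp (y\<^sup>2 / (8 * real M)) ^ M"
        by (intro power_mono) auto
      also have "\<dots> = exp (y\<^sup>2 / 8)" using M by (simp flip: exp_of_nat_mult)
      finally show ?thesis using M by (simp add: power_divide pos_divide_le_eq mult.commute)
    qed
    also have "\<dots> \<le> K * exp (y\<^sup>2 / 8)" by (simp add: K_def)
    finally show ?thesis .
  qed
  moreover have "0 < K" by (simp add: K_def add_pos_nonneg)
  ultimately show ?thesis using that by blast
qed

text \<open>Below, the minimum lets large coordinates pay quadratically; then \<open>exp u \<le> 1 + u exp u\<close> bounds the
  exponential moment linearly in \<open>c\<close>.\<close>

lemma std_gauss_exp_min: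
  fixes q :: real
  assumes "0 \<le> q"
  obtains C where "0 < C"
    "\<And>c. 0 \<le> c \<Longrightarrow> (\<integral>\<^sup>+y. ennreal (exp (min (y\<^sup>2 / 4) (c * \<bar>y\<bar> powr q))) \<partial>std_gauss) \<le> ennreal (exp (C * c))"
proof -
  obtain K where K: "0 < K" "\<And>y. \<bar>y\<bar> powr q \<le> K * exp (y\<^sup>2 / 8)" using powr_le_exp_sq[OF assms] by blast
  interpret S: prob_space std_gauss by (rule prob_space_std_gauss)
  have "(\<integral>\<^sup>+y. ennreal (exp (min (y\<^sup>2 / 4) (c * \<bar>y\<bar> powr q))) \<partial>std_gauss) \<le> ennreal (exp (2 * K * c))" if c: "0 \<le> c" for c
  proof -
    have pt: "exp (min (y\<^sup>2 / 4) (c * \<bar>y\<bar> powr q)) \<le> 1 + c * K * exp (3 / 8 * y\<^sup>2)" for y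
    proof -
      define u where "u = min (y\<^sup>2 / 4) (c * \<bar>y\<bar> powr q)"
      have u: "0 \<le> u" "u \<le> y\<^sup>2 / 4" "u \<le> c * \<bar>y\<bar> powr q" using c by (auto simp: u_def)
      have "exp u * (1 - u) \<le> exp u * exp (- u)" using exp_ge_add_one_self[of "- u"] by (intro mult_left_mono) auto
      then have "exp u \<le> 1 + u * exp u" by (simp add: algebra_simps flip: exp_add)
      also have "u * exp u \<le> (c * \<bar>y\<bar> powr q) * exp (y\<^sup>2 / 4)" using u c by (intro mult_mono) auto
      also have "\<dots> \<le> (c * (K * exp (y\<^sup>2 / 8))) * exp (y\<^sup>2 / 4)"
        using c K(2)[of y] by (intro mult_right_mono mult_left_mono) auto
      also have "\<dots> = c * K * exp (3 / 8 * y\<^sup>2)" by (simp add: mult.assoc flip: exp_add)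
      finally show ?thesis by (simp add: u_def)
    qed
    have "(\<integral>\<^sup>+y. ennreal (exp (min (y\<^sup>2 / 4) (c * \<bar>y\<bar> powr q))) \<partial>std_gauss)
      \<le> (\<integral>\<^sup>+y. ennreal 1 + ennreal (c * K) * ennreal (exp (3 / 8 * y\<^sup>2)) \<partial>std_gauss)"
    proof (rule nn_integral_mono)
      fix y :: real
      have "ennreal (exp (min (y\<^sup>2 / 4) (c * \<bar>y\<bar> powr q))) \<le> ennreal (1 + c * K * exp (3 / 8 * y\<^sup>2))"
        by (rule ennreal_leI[OF pt])
      also have "\<dots> = ennreal 1 + ennreal (c * K * exp (3 / 8 * y\<^sup>2))"
        using c K(1) by (intro ennreal_plus) auto
      also have "ennreal (c * K * exp (3 / 8 * y\<^sup>2)) = ennreal (c * K) * ennreal (exp (3 / 8 * y\<^sup>2))"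
        using c K(1) by (intro ennreal_mult) auto
      finally show "ennreal (exp (min (y\<^sup>2 / 4) (c * \<bar>y\<bar> powr q))) \<le> ennreal 1 + ennreal (c * K) * ennreal (exp (3 / 8 * y\<^sup>2))" .
    qed
    also have "\<dots> = (\<integral>\<^sup>+y. ennreal 1 \<partial>std_gauss) + ennreal (c * K) * (\<integral>\<^sup>+y. ennreal (exp (3 / 8 * y\<^sup>2)) \<partial>std_gauss)"
      by (subst nn_integral_add) (auto simp: nn_integral_cmult)
    also have "(\<integral>\<^sup>+y. ennreal 1 \<partial>std_gauss) = ennreal 1" using S.emeasure_space_1 by simp
    \<comment> \<open>The exponent 3/8 = 1/4 + 1/8 stays below the critical value 1/2, and
      \<open>1 / sqrt (1 - 3/4) = 2\<close>.\<close>
    also have "(\<integral>\<^sup>+y. ennreal (exp (3 / 8 * y\<^sup>2)) \<partial>std_gauss) = ennreal 2"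
      using real_sqrt_four by (subst std_gauss_exp_sq) (auto simp: real_sqrt_divide)
    also have "ennreal 1 + ennreal (c * K) * ennreal 2 = ennreal (1 + c * K * 2)"
    proof -
      have "ennreal (c * K) * ennreal 2 = ennreal (c * K * 2)" using c K(1) by (intro ennreal_mult[symmetric]) auto
      moreover have "ennreal (1 + c * K * 2) = ennreal 1 + ennreal (c * K * 2)" using c K(1) by (intro ennreal_plus) auto
      ultimately show ?thesis by (simp only:)
    qed
    also have "\<dots> \<le> ennreal (exp (2 * K * c))"
      using exp_ge_add_one_self[of "2 * K * c"] by (intro ennreal_leI) (simp add: mult_ac)
    finally show ?thesis .
  qed
  then show ?thesis using that[of "2 * K"] K(1) by simp
qed

lemma std_gauss_exp_quarter: "(\<integral>\<^sup>+y. ennreal (exp (y\<^sup>2 / 4)) \<partial>std_gauss) = ennreal (sqrt 2)"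
  using std_gauss_exp_sq[of "1/4"] by (simp add: real_sqrt_divide)

text \<open>\<open>sqrt 2\<close> is the mean of \<open>exp (y\<^sup>2 / 4)\<close>, the price of
  one coordinate charged to the Euclidean norm; 2/5 is a rational upper bound for (ln 2)/2.\<close>

lemma sqrt2_le: "sqrt 2 \<le> exp (2/5 :: real)"
proof -
  have "1 + (4/5) + (4/5)\<^sup>2 / 2 \<le> exp (4/5 :: real)" by (rule exp_lower_Taylor_quadratic) simp
  then have "2 \<le> exp (4/5 :: real)" by (simp add: power2_eq_square)
  also have "\<dots> = (exp (2/5 :: real))\<^sup>2" by (simp add: power2_eq_square flip: exp_add)
  finally show ?thesis by (intro real_le_lsqrt) auto
qed

lemma ellipsoid_scale:
  assumes \<sigma>: "\<And>i. i \<in> {1..N} \<Longrightarrow> 0 < \<sigma> i" and p: "0 \<le> p" and x: "x \<in> ellipsoid N p \<sigma>" and t: "0 \<le> t" "t \<le> 1"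
  shows "t *\<^sub>R x \<in> ellipsoid N p \<sigma>"
proof -
  have "(\<Sum>i=1..N. (\<bar>(t *\<^sub>R x) i\<bar> / \<sigma> i) powr p) \<le> (\<Sum>i=1..N. (\<bar>x i\<bar> / \<sigma> i) powr p)"
  proof (intro sum_mono powr_mono2 p)
    fix i assume i: "i \<in> {1..N}"
    have "\<bar>(t *\<^sub>R x) i\<bar> \<le> \<bar>x i\<bar>" using t by (simp add: abs_mult mult_left_le_one_le)
    then show "\<bar>(t *\<^sub>R x) i\<bar> / \<sigma> i \<le> \<bar>x i\<bar> / \<sigma> i" using \<sigma>[OF i] by (intro divide_right_mono) auto
    show "0 \<le> \<bar>(t *\<^sub>R x) i\<bar> / \<sigma> i" using \<sigma>[OF i] by auto
  qed
  then show ?thesis using x subspace_scale[OF subspace_euclidean] by (auto simp: ellipsoid_def)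
qed

lemma Youngs_powr:
  fixes a b p q :: real
  assumes "1 < p" "1 < q" "1/p + 1/q = 1" "0 \<le> a" "0 \<le> b"
  shows "a * b \<le> a powr p / p + b powr q / q"
  using Youngs_inequality[of p q a b] assms by simp

lemma ennreal_exp_add: "ennreal (exp (a + b)) = ennreal (exp a) * ennreal (exp b)"
  by (simp add: exp_add ennreal_mult)

lemma prod_ennreal_exp_le:
  assumes "finite J" "\<And>j. j \<in> J \<Longrightarrow> f j \<le> ennreal (exp (h j))"
  shows "(\<Prod>j\<in>J. f j) \<le> ennreal (exp (\<Sum>j\<in>J. h j))"
  using assms
proof (induction J)
  case (insert x J)
  have "(\<Prod>j\<in>insert x J. f j) = f x * (\<Prod>j\<in>J. f j)" using insert.hyps by simp
  also have "\<dots> \<le> ennreal (exp (h x)) * ennreal (exp (\<Sum>j\<in>J. h j))"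
    using insert by (intro mult_mono) auto
  also have "\<dots> = ennreal (exp (\<Sum>j\<in>insert x J. h j))"
    using insert.hyps by (simp add: exp_add ennreal_mult)
  finally show ?case .
qed simp

text \<open>Each coordinate is charged either to the Euclidean norm of \<open>x\<close> (head and large \<open>g\<^sub>j\<close>) or, by Young's
  inequality, to its \<open>p\<close>-norm.\<close>

lemma upper_event:
  fixes p q :: real
  assumes pq: "1 < p" "1 < q" "1/p + 1/q = 1"
  obtains C0 where "0 < C0"
    "\<And>n N \<sigma>. 1 \<le> n \<Longrightarrow> n < N \<Longrightarrow> (\<And>j. j \<in> {1..N} \<Longrightarrow> 0 < \<sigma> j) \<Longrightarrow>
      \<exists>A\<in>sets (array {1..n}). emeasure (array {1..n}) A \<le> ennreal (exp (- real n / 1024)) \<and>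
        (\<forall>X\<in>space (array {1..n}). X \<notin> A \<longrightarrow> (\<forall>x\<in>ker N {1..n} X. x \<in> ellipsoid N p \<sigma> \<longrightarrow>
          enorm N x \<le> C0 * (\<Sum>j\<in>{n div 1024<..N}. \<sigma> j powr q) powr (1/q) / sqrt n))"
proof -
  obtain C where C: "0 < C" "\<And>c. 0 \<le> c \<Longrightarrow>
      (\<integral>\<^sup>+y. ennreal (exp (min (y\<^sup>2 / 4) (c * \<bar>y\<bar> powr q))) \<partial>std_gauss) \<le> ennreal (exp (C * c))"
  proof -
    have "0 \<le> q" using pq(2) by simp
    then show ?thesis using std_gauss_exp_min[of q] that by blast
  qed
  \<comment> \<open>Chosen so that, with \<open>w = n / (32 * C0)\<close>, the tail costs (1 + C) w
    = n/1024: \<open>w\<close> for the ellipsoid constraint and \<open>C * w\<close> for the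
    Gaussian moments.\<close>
  define C0 where "C0 = 32 * (1 + C)"
  have C0: "0 < C0" using C(1) by (simp add: C0_def)
  have "\<exists>A\<in>sets (array {1..n}). emeasure (array {1..n}) A \<le> ennreal (exp (- real n / 1024)) \<and>
        (\<forall>X\<in>space (array {1..n}). X \<notin> A \<longrightarrow> (\<forall>x\<in>ker N {1..n} X. x \<in> ellipsoid N p \<sigma> \<longrightarrow>
          enorm N x \<le> C0 * (\<Sum>j\<in>{n div 1024<..N}. \<sigma> j powr q) powr (1/q) / sqrt n))"
    if n: "1 \<le> n" "n < N" and \<sigma>: "\<And>j. j \<in> {1..N} \<Longrightarrow> 0 < \<sigma> j" for n N :: nat and \<sigma> :: "nat \<Rightarrow> real"
  proof -
    define k where "k = n div 1024"
    define Q where "Q = (\<Sum>j\<in>{k<..N}. \<sigma> j powr q)"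
    define L where "L = Q powr (1/q)"
    define \<tau> where "\<tau> = sqrt (real n)"
    define \<rho> where "\<rho> = C0 * L / \<tau>"
    define w where "w = real n / (32 * C0)"
    define c where "c j = w * (\<sigma> j / L) powr q" for j
    \<comment> \<open>The choice \<open>l * \<rho> = 1/64\<close> balances the exponents. In units
      of n/1024, Markov gains 4, while the quadratic term costs 1, the tail 1 and the head at most
      2/5; more than 1 remains.\<close>
    define l where "l = 1 / (64 * \<rho>)"
    define T where "T = {x \<in> ellipsoid N p \<sigma>. enorm N x = \<rho>}"
    define h where "h j g = (if j \<le> k then g\<^sup>2 / 4 else min (g\<^sup>2 / 4) (c j * \<bar>g\<bar> powr q))" for j and g :: real
    define \<psi> where "\<psi> j y = ennreal (exp (h j (y / \<tau>)))" for j y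
    define c0 where "c0 = ennreal (exp (real n / 1024 + w))"
    have kN: "k < N" using n div_le_dividend[of n 1024] unfolding k_def by linarith
    have \<sigma>0: "0 < \<sigma> j" if "j \<in> {k<..N}" for j using that by (intro \<sigma>) auto
    have "0 < \<sigma> j powr q" if "j \<in> {k<..N}" for j using \<sigma>0[OF that] by simp
    then have Q: "0 < Q" unfolding Q_def using kN by (intro sum_pos) auto
    have L: "0 < L" "L powr q = Q" using Q pq(2) by (auto simp: L_def powr_powr)
    have \<tau>: "0 < \<tau>" "\<tau> * \<tau> = real n" using n by (auto simp: \<tau>_def)
    have \<rho>: "0 < \<rho>" using C0 L \<tau> by (simp add: \<rho>_def)
    have w: "0 < w" using n C0 by (simp add: w_def)
    have l: "0 < l" "l * \<rho> = 1 / 64" using \<rho> by (auto simp: l_def)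
    have en1: "enorm n (\<lambda>_. 1) = \<tau>" by (simp add: enorm_def L2_set_def \<tau>_def)
    have lt: "2 * l * \<tau> = w / L"
    proof -
      have "2 * l * \<tau> = \<tau> * \<tau> / (32 * C0 * L)" using \<tau> C0 L by (simp add: l_def \<rho>_def field_simps)
      then show ?thesis using \<tau>(2) by (simp add: w_def)
    qed
    have T: "T \<subseteq> euclidean N" "\<And>x. x \<in> T \<Longrightarrow> enorm N x = \<rho>" by (auto simp: T_def ellipsoid_def)
    have l0: "0 \<le> l" using l by simp
    have \<psi>m: "\<psi> j \<in> borel_measurable borel" for j
      unfolding \<psi>_def h_def by (cases "j \<le> k") simp_all
    have dom: "ennreal (exp (2 * l * ip N y x)) \<le> c0 * (\<Prod>j=1..N. \<psi> j (y j))" if x: "x \<in> T" for x y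
    proof -
      define g where "g j = y j / \<tau>" for j
      have yg: "y j = \<tau> * g j" for j using \<tau> by (simp add: g_def)
      have coordwise: "2 * l * (y j * x j) \<le> h j (g j) + 4 * (l * \<tau>)\<^sup>2 * (x j)\<^sup>2 + w * (\<bar>x j\<bar> / \<sigma> j) powr p" if j: "j \<in> {1..N}" for j
      proof (cases "j \<le> k \<or> (g j)\<^sup>2 / 4 \<le> c j * \<bar>g j\<bar> powr q")
        case True
        then have "h j (g j) = (g j)\<^sup>2 / 4" by (auto simp: h_def)
        moreover have "0 \<le> (g j / 2 - 2 * (l * \<tau> * x j))\<^sup>2" by simp
        then have "2 * l * (y j * x j) \<le> (g j)\<^sup>2 / 4 + 4 * (l * \<tau>)\<^sup>2 * (x j)\<^sup>2"
          unfolding yg by (simp add: power2_eq_square algebra_simps)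
        ultimately show ?thesis using w by (simp add: add_increasing2)
      next
        case False
        then have "h j (g j) = c j * \<bar>g j\<bar> powr q" by (auto simp: h_def)
        moreover have "2 * l * (y j * x j) \<le> c j * \<bar>g j\<bar> powr q + w * (\<bar>x j\<bar> / \<sigma> j) powr p"
        proof -
          \<comment> \<open>\<open>L\<close> is the q-norm of the tail axes, so the weights
            (\<sigma>_j / L)^q of the second factor sum to 1 over the tail, while the p-th powers of
            the first sum to at most 1 on the ellipsoid. The identity \<open>lt\<close> matches the
            scales of both.\<close>
          define a where "a = \<bar>x j\<bar> / \<sigma> j"
          define b where "b = \<sigma> j / L * \<bar>g j\<bar>"
          have ab: "0 \<le> a" "0 \<le> b" using \<sigma>[OF j] L by (auto simp: a_def b_def)
          have "2 * l * (y j * x j) = w / L * (g j * x j)" unfolding yg lt[symmetric] by simp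
          also have "\<dots> \<le> w / L * (\<bar>g j\<bar> * \<bar>x j\<bar>)"
            using w L by (intro mult_left_mono) (auto simp flip: abs_mult)
          also have "\<dots> = w * (a * b)" using \<sigma>[OF j] L by (simp add: a_def b_def)
          also have "a * b \<le> a powr p / p + b powr q / q" by (rule Youngs_powr[OF pq ab])
          also have "\<dots> \<le> a powr p + b powr q"
          proof -
            have "z / s \<le> z" if "0 \<le> z" "1 < s" for z s :: real
              using that mult_left_mono[of 1 s z] by (simp add: divide_le_eq)
            then show ?thesis using pq by (intro add_mono) auto
          qed
          also have "b powr q = (\<sigma> j / L) powr q * \<bar>g j\<bar> powr q" unfolding b_def using \<sigma>[OF j] L by (subst powr_mult) auto
          finally show ?thesis using w by (simp add: c_def a_def algebra_simps)
        qed
        moreover have "0 \<le> 4 * (l * \<tau>)\<^sup>2 * (x j)\<^sup>2" by simp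
        ultimately show ?thesis by linarith
      qed
      have "2 * l * ip N y x = (\<Sum>j=1..N. 2 * l * (y j * x j))" by (simp add: ip_def sum_distrib_left)
      also have "\<dots> \<le> (\<Sum>j=1..N. h j (g j) + 4 * (l * \<tau>)\<^sup>2 * (x j)\<^sup>2 + w * (\<bar>x j\<bar> / \<sigma> j) powr p)"
        by (intro sum_mono coordwise)
      also have "\<dots> = (\<Sum>j=1..N. h j (g j)) + 4 * (l * \<tau>)\<^sup>2 * (\<Sum>j=1..N. (x j)\<^sup>2) + w * (\<Sum>j=1..N. (\<bar>x j\<bar> / \<sigma> j) powr p)"
        by (simp add: sum.distrib sum_distrib_left)
      also have "\<dots> \<le> (\<Sum>j=1..N. h j (g j)) + real n / 1024 + w * 1"
      proof (intro add_mono mult_left_mono order_refl)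
        have "(\<Sum>j=1..N. (x j)\<^sup>2) = \<rho> * \<rho>" using T(2)[OF x] enorm_sq[of N x] by (simp add: ip_def power2_eq_square)
        then have "4 * (l * \<tau>)\<^sup>2 * (\<Sum>j=1..N. (x j)\<^sup>2) = 4 * ((l * \<rho>) * (l * \<rho>) * (\<tau> * \<tau>))"
          by (simp add: power2_eq_square)
        then show "4 * (l * \<tau>)\<^sup>2 * (\<Sum>j=1..N. (x j)\<^sup>2) \<le> real n / 1024" unfolding l(2) \<tau>(2) by simp
        show "(\<Sum>j=1..N. (\<bar>x j\<bar> / \<sigma> j) powr p) \<le> 1" using x by (simp add: T_def ellipsoid_def)
      qed (use w in simp)
      finally have "ennreal (exp (2 * l * ip N y x)) \<le> ennreal (exp (real n / 1024 + w) * exp (\<Sum>j=1..N. h j (g j)))"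
        by (intro ennreal_leI) (simp flip: exp_add)
      also have "\<dots> = c0 * ennreal (exp (\<Sum>j=1..N. h j (g j)))" unfolding c0_def by (rule ennreal_mult) auto
      also have "ennreal (exp (\<Sum>j=1..N. h j (g j))) = (\<Prod>j=1..N. \<psi> j (y j))"
        unfolding \<psi>_def g_def by (simp add: exp_sum prod_ennreal)
      finally show ?thesis .
    qed
    define A where "A = (\<Union>x\<in>T. small N n (\<lambda>_. 1) \<rho> x)"
    have b1: "\<And>i::nat. (0::real) \<le> 1" by simp
    note U = uniform_lower_bound[where d=N and m=n and b="\<lambda>_. 1" and l=l and \<rho>=\<rho> and T=T and c=c0 and \<psi>=\<psi>, OF T l0 b1 \<psi>m dom]
    have A: "A \<in> sets (array {1..n})" unfolding A_def by (rule U(1))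
    have "emeasure (array {1..n}) A \<le> uniform_lower_tail N n (\<lambda>_. 1) l \<rho> c0 \<psi>" unfolding A_def by (rule U(2))
    also have "\<dots> = ennreal (exp (- real n / 256)) * (c0 * (\<Prod>j=1..N. \<integral>\<^sup>+y. ennreal (exp (h j y)) \<partial>std_gauss))"
    proof -
      have "- l * \<rho> * (\<Sum>i=1..n. 1) / 4 = - (l * \<rho>) * real n / 4" by simp
      then have e1: "- l * \<rho> * (\<Sum>i=1..n. 1) / 4 = - real n / 256" unfolding l(2) by simp
      have e2: "\<psi> j (\<tau> * y) = ennreal (exp (h j y))" for j y using \<tau> by (simp add: \<psi>_def)
      show ?thesis unfolding uniform_lower_tail_def en1 e1 e2 ..
    qed
    also have "\<dots> \<le> ennreal (exp (- real n / 256)) * (c0 * ennreal (exp (\<Sum>j=1..N. if j \<le> k then 2/5 else C * c j)))"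
    proof (intro mult_left_mono prod_ennreal_exp_le)
      fix j assume j: "j \<in> {1..N}"
      have "0 \<le> c j" using w by (simp add: c_def)
      then show "(\<integral>\<^sup>+y. ennreal (exp (h j y)) \<partial>std_gauss) \<le> ennreal (exp (if j \<le> k then 2/5 else C * c j))"
        using C(2)[of "c j"] std_gauss_exp_quarter sqrt2_le by (cases "j \<le> k") (auto simp: h_def intro: ennreal_leI)
    qed auto
    also have "\<dots> = ennreal (exp (- real n / 256 + (real n / 1024 + w) + (\<Sum>j=1..N. if j \<le> k then 2/5 else C * c j)))"
      unfolding c0_def ennreal_exp_add mult.assoc ..
    also have "\<dots> \<le> ennreal (exp (- real n / 1024))"
    proof -
      have "(\<Sum>j=1..N. if j \<le> k then 2/5 else C * c j) = (\<Sum>j\<in>{1..k}. 2/5) + (\<Sum>j\<in>{k<..N}. C * c j)"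
      proof -
        have "{1..N} = {1..k} \<union> {k<..N}" using kN by auto
        then have "(\<Sum>j=1..N. if j \<le> k then 2/5 else C * c j) =
          (\<Sum>j\<in>{1..k}. if j \<le> k then 2/5 else C * c j) + (\<Sum>j\<in>{k<..N}. if j \<le> k then 2/5 else C * c j)"
          by (simp only:) (rule sum.union_disjoint, auto)
        moreover have "(\<Sum>j\<in>{1..k}. if j \<le> k then 2/5 else C * c j) = (\<Sum>j\<in>{1..k}. 2/5)" by (rule sum.cong) auto
        moreover have "(\<Sum>j\<in>{k<..N}. if j \<le> k then 2/5 else C * c j) = (\<Sum>j\<in>{k<..N}. C * c j)" by (rule sum.cong) auto
        ultimately show ?thesis by (simp only:)
      qed
      also have "(\<Sum>j\<in>{k<..N}. C * c j) = C * w"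
      proof -
        have "(\<Sum>j\<in>{k<..N}. C * c j) = (\<Sum>j\<in>{k<..N}. C * w / Q * \<sigma> j powr q)"
          using \<sigma>0 L by (intro sum.cong refl) (simp add: c_def powr_divide less_imp_le)
        also have "\<dots> = C * w / Q * Q" unfolding Q_def by (rule sum_distrib_left[symmetric])
        finally show ?thesis using Q by simp
      qed
      finally have e: "(\<Sum>j=1..N. if j \<le> k then 2/5 else C * c j) = 2/5 * real k + C * w" by simp
      have "1024 * real k \<le> real n" using of_nat_mono[OF div_times_less_eq_dividend[of n 1024], where 'a=real] by (simp add: k_def)
      moreover have "w + C * w = real n / 1024"
      proof -
        have "w + C * w = (1 + C) * w" by (simp add: algebra_simps)
        also have "32 * C0 = 1024 * (1 + C)" by (simp add: C0_def)
        then have "(1 + C) * w = (1 + C) * (real n / (1024 * (1 + C)))" by (simp only: w_def)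
        also have "\<dots> = real n / 1024"
        proof -
          have "D * (x / (1024 * D)) = x / 1024" if "0 < D" for D x :: real using that by simp
          then show ?thesis using C(1) by (meson add_pos_pos zero_less_one)
        qed
        finally show ?thesis .
      qed
      ultimately have "- real n / 256 + (real n / 1024 + w) + (2/5 * real k + C * w) \<le> - real n / 1024" by linarith
      then show ?thesis unfolding e by (intro ennreal_leI) simp
    qed
    finally have "emeasure (array {1..n}) A \<le> ennreal (exp (- real n / 1024))" .
    moreover have "enorm N x \<le> \<rho>"
      if X: "X \<in> space (array {1..n})" "X \<notin> A" and x: "x \<in> ker N {1..n} X" "x \<in> ellipsoid N p \<sigma>" for X x
    proof (rule ccontr)
      assume gt: "\<not> enorm N x \<le> \<rho>"
      \<comment> \<open>A kernel vector longer than \<open>\<rho>\<close> can be shrunk to norm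
        exactly \<open>\<rho>\<close> inside the ellipsoid. All its products with the rows vanish,
        which is the bad event.\<close>
      define t where "t = \<rho> / enorm N x"
      have t: "0 \<le> t" "t \<le> 1" using gt \<rho> by (auto simp: t_def)
      have "t *\<^sub>R x \<in> ellipsoid N p \<sigma>" by (rule ellipsoid_scale[OF \<sigma> _ x(2) t]) (use pq in auto)
      moreover have "enorm N (t *\<^sub>R x) = \<rho>" unfolding enorm_scale using t gt \<rho> by (simp add: t_def)
      ultimately have "t *\<^sub>R x \<in> T" by (simp add: T_def)
      moreover have "X \<in> small N n (\<lambda>_. 1) \<rho> (t *\<^sub>R x)"
      proof -
        have "ip N (X i) (t *\<^sub>R x) = 0" if "i \<in> {1..n}" for i
          using x(1) that ip_commute[of N x "X i"] by (simp add: ker_def ip_scale_right)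
        then have "(\<Sum>i=1..n. 1 * \<bar>ip N (X i) (t *\<^sub>R x)\<bar>) = 0" by (intro sum.neutral) simp
        then show ?thesis unfolding small_def using X(1) \<rho> n by simp
      qed
      ultimately show False using X(2) by (auto simp: A_def)
    qed
    ultimately show ?thesis using A unfolding \<rho>_def L_def Q_def k_def \<tau>_def by blast
  qed
  then show ?thesis using that C0 by blast
qed

section \<open>The lower bound in high dimension\<close>

text \<open>Compactness comes from the product topology on full sequences: the factor
  \<open>{0}\<close> outside \<open>1..n\<close> makes the box a cube of R^n.\<close>

lemma compact_box:
  "compact (PiE UNIV (\<lambda>i::nat. if i \<in> {1..n} then {- R..R::real} else {0}))"
proof -
  have "compactin (product_topology (\<lambda>_. Abstract_Topology.euclidean) UNIV) (PiE UNIV (\<lambda>i::nat. if i \<in> {1..n} then {- R..R::real} else {0}))"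
    unfolding compactin_PiE by auto
  then show ?thesis by (simp add: euclidean_product_topology)
qed

lemma DERIV_abs_powr:
  fixes q x :: real
  assumes q: "1 < q"
  shows "((\<lambda>x. \<bar>x\<bar> powr q) has_real_derivative q * \<bar>x\<bar> powr (q - 1) * sgn x) (at x)"
proof (cases "x = 0")
  case True
  have "((\<lambda>h::real. \<bar>h\<bar> powr (q - 1)) \<longlongrightarrow> 0 powr (q - 1)) (at 0)"
    using q by (intro tendsto_powr' tendsto_eq_intros) (auto intro!: tendsto_eq_intros)
  then have lim: "((\<lambda>h::real. \<bar>h\<bar> powr (q - 1)) \<longlongrightarrow> 0) (at 0)" using q by simp
  have "((\<lambda>h. (\<bar>0 + h\<bar> powr q - \<bar>0\<bar> powr q) / h) \<longlongrightarrow> 0) (at (0::real))"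
  proof (rule Lim_null_comparison[OF _ lim], rule always_eventually, rule allI)
    fix h :: real
    show "norm ((\<bar>0 + h\<bar> powr q - \<bar>0\<bar> powr q) / h) \<le> \<bar>h\<bar> powr (q - 1)"
      using q by (cases "h = 0") (simp_all add: abs_divide powr_diff)
  qed
  then show ?thesis using True q by (simp add: DERIV_def)
next
  case False
  show ?thesis
  proof (cases "0 < x")
    case True
    have "((\<lambda>x. x powr q) has_real_derivative q * \<bar>x\<bar> powr (q - 1) * sgn x) (at x)"
      using True by (auto intro!: derivative_eq_intros)
    then show ?thesis
      by (rule has_field_derivative_transform_within[where d=x]) (use True in \<open>auto simp: dist_real_def\<close>)
  next
    case F: False
    have "((\<lambda>x. (- x) powr q) has_real_derivative q * \<bar>x\<bar> powr (q - 1) * sgn x) (at x)"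
      using False F by (auto intro!: derivative_eq_intros)
    then show ?thesis
      by (rule has_field_derivative_transform_within[where d="- x"]) (use False F in \<open>auto simp: dist_real_def\<close>)
  qed
qed

text \<open>The first-order condition at a minimiser of a coercive convex functional supplies an explicit
  representing vector, in place of a separation theorem.\<close>

lemma dual_solution:
  fixes q r :: real and a :: "nat \<Rightarrow> real" and Y :: "nat \<Rightarrow> nat \<Rightarrow> real"
  assumes q: "1 < q" and r: "0 < r" and J: "finite J" and a: "\<And>j. j \<in> J \<Longrightarrow> 0 < a j"
    and coer: "\<And>u. u \<in> euclidean n \<Longrightarrow> (r * enorm n u) powr q \<le> (\<Sum>j\<in>J. a j * \<bar>ip n (Y j) u\<bar> powr q)"
    and v: "enorm n v \<le> r"
  obtains w :: "nat \<Rightarrow> real" where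
    "\<And>x. x \<in> euclidean n \<Longrightarrow> (\<Sum>j\<in>J. a j * \<bar>w j\<bar> powr (q - 1) * sgn (w j) * ip n (Y j) x) = - ip n v x"
    "(\<Sum>j\<in>J. a j * \<bar>w j\<bar> powr q) \<le> 1"
proof -
  define \<phi> where "\<phi> u = (1/q) * (\<Sum>j\<in>J. a j * \<bar>ip n (Y j) u\<bar> powr q) + ip n v u" for u
  \<comment> \<open>Beyond norm \<open>R\<close> the coercive term wins: if t = r |y| exceeds (q +
    1)^(1/(q - 1)), then t^q / q is at least t, which dominates the linear term, so \<phi>(y) \<ge>
    0 = \<phi>(0).\<close>
  define R where "R = ((q + 1) powr (1 / (q - 1))) / r"
  have R: "0 < R" using q r by (simp add: R_def)
  define Bx where "Bx = PiE UNIV (\<lambda>i::nat. if i \<in> {1..n} then {- R..R} else {0})"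
  have inBx: "u \<in> Bx" if "u \<in> euclidean n" "enorm n u \<le> R" for u
  proof -
    have "u i \<in> (if i \<in> {1..n} then {- R..R} else {0})" for i
      using that abs_coord_le_enorm[of i n u] by (cases "i \<in> {1..n}") (auto simp: euclidean_def abs_le_iff)
    then show ?thesis by (simp add: Bx_def PiE_def Pi_def)
  qed
  have Bx: "Bx \<subseteq> euclidean n"
  proof
    fix u assume "u \<in> Bx"
    then have "u i \<in> (if i \<in> {1..n} then {- R..R} else {0})" for i unfolding Bx_def by blast
    then have "u i = 0" if "i \<notin> {1..n}" for i using that by (metis (full_types) singletonD)
    then show "u \<in> euclidean n" by (simp add: euclidean_def)
  qed
  have coord: "continuous_on Bx (\<lambda>x::nat \<Rightarrow> real. x j)" for j
    by (rule continuous_on_subset[OF continuous_on_product_coordinates]) simp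
  have cip: "continuous_on Bx (\<lambda>u. ip n y u)" for y
    unfolding ip_def by (rule continuous_on_sum, rule continuous_on_mult[OF continuous_on_const coord])
  have cpow: "continuous_on UNIV (\<lambda>x::real. \<bar>x\<bar> powr q)"
    using DERIV_abs_powr[OF q] by (intro continuous_at_imp_continuous_on ballI DERIV_isCont) blast
  have "continuous_on Bx (\<lambda>u. \<bar>ip n y u\<bar> powr q)" for y
    by (rule continuous_on_compose2[OF cpow cip]) simp
  then have cont: "continuous_on Bx \<phi>" unfolding \<phi>_def
    by (intro continuous_on_add continuous_on_mult continuous_on_const continuous_on_sum cip)
  have "0 \<in> Bx" using R by (intro inBx) (auto simp: euclidean_def)
  then have "Bx \<noteq> {}" by blast
  obtain u where u: "u \<in> Bx" "\<And>y. y \<in> Bx \<Longrightarrow> \<phi> u \<le> \<phi> y"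
    using continuous_attains_inf[OF compact_box[of n R, folded Bx_def] \<open>Bx \<noteq> {}\<close> cont] by blast
  have uE: "u \<in> euclidean n" using u(1) Bx by blast
  have \<phi>0: "\<phi> 0 = 0" using q by (simp add: \<phi>_def)
  have glob: "\<phi> u \<le> \<phi> y" if y: "y \<in> euclidean n" for y
  proof (cases "enorm n y \<le> R")
    case True
    then show ?thesis using u(2) inBx[OF y] by blast
  next
    case False
    define t where "t = r * enorm n y"
    have tR: "(q + 1) powr (1 / (q - 1)) < t" using False r by (simp add: R_def t_def field_simps)
    have t0: "0 < t" using tR powr_ge_zero[of "q + 1" "1 / (q - 1)"] by linarith
    have "((q + 1) powr (1 / (q - 1))) powr (q - 1) < t powr (q - 1)" using tR q by (intro powr_less_mono2) auto
    then have q1: "q + 1 < t powr (q - 1)" using q by (simp add: powr_powr)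
    have "t powr q = t powr (q - 1) * t" using t0 by (simp add: powr_diff)
    then have "q * t \<le> t powr q" using q1 t0 by simp
    then have "t \<le> (1/q) * t powr q" using q by (simp add: field_simps)
    also have "\<dots> \<le> (1/q) * (\<Sum>j\<in>J. a j * \<bar>ip n (Y j) y\<bar> powr q)"
      using coer[OF y] q by (intro mult_left_mono) (auto simp: t_def)
    finally have "t + ip n v y \<le> \<phi> y" by (simp add: \<phi>_def)
    moreover have "- t \<le> ip n v y"
    proof -
      have "\<bar>ip n v y\<bar> \<le> enorm n v * enorm n y" by (rule abs_ip_le)
      also have "\<dots> \<le> t" unfolding t_def by (rule mult_right_mono[OF v]) simp
      finally show ?thesis by linarith
    qed
    ultimately have "0 \<le> \<phi> y" by linarith
    then show ?thesis using u(2)[OF \<open>0 \<in> Bx\<close>] \<phi>0 by simp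
  qed
  define w where "w j = ip n (Y j) u" for j
  have eq: "(\<Sum>j\<in>J. a j * \<bar>w j\<bar> powr (q - 1) * sgn (w j) * ip n (Y j) x) = - ip n v x" if x: "x \<in> euclidean n" for x
  proof -
    define D where "D = (1/q) * (\<Sum>j\<in>J. a j * (q * \<bar>w j\<bar> powr (q - 1) * sgn (w j) * ip n (Y j) x)) + ip n v x"
    have ux: "ip n y (u + t *\<^sub>R x) = ip n y u + t * ip n y x" for y t
      by (simp only: ip_add_right ip_scale_right)
    have d1: "((\<lambda>t. \<bar>ip n (Y j) u + t * ip n (Y j) x\<bar> powr q) has_real_derivative
        q * \<bar>w j\<bar> powr (q - 1) * sgn (w j) * ip n (Y j) x) (at 0)" for j
    proof -
      have "((\<lambda>t. ip n (Y j) u + t * ip n (Y j) x) has_real_derivative ip n (Y j) x) (at 0)"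
        by (auto intro!: derivative_eq_intros)
      from DERIV_chain2[OF DERIV_abs_powr[OF q] this] show ?thesis by (simp add: w_def)
    qed
    have "((\<lambda>t. (1/q) * (\<Sum>j\<in>J. a j * \<bar>ip n (Y j) u + t * ip n (Y j) x\<bar> powr q) + (ip n v u + t * ip n v x)) has_real_derivative D) (at 0)"
      unfolding D_def
      by (intro DERIV_add DERIV_cmult DERIV_sum d1) (auto intro!: derivative_eq_intros)
    then have d: "((\<lambda>t. \<phi> (u + t *\<^sub>R x)) has_real_derivative D) (at 0)"
      unfolding \<phi>_def ux .
    have "D = 0"
    proof (rule DERIV_local_min[OF d, of 1])
      show "\<forall>t. \<bar>0 - t\<bar> < 1 \<longrightarrow> \<phi> (u + 0 *\<^sub>R x) \<le> \<phi> (u + t *\<^sub>R x)"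
        using glob subspace_add[OF subspace_euclidean uE subspace_scale[OF subspace_euclidean x]] by simp
    qed simp
    moreover have "(1/q) * (\<Sum>j\<in>J. a j * (q * \<bar>w j\<bar> powr (q - 1) * sgn (w j) * ip n (Y j) x)) =
      (\<Sum>j\<in>J. a j * \<bar>w j\<bar> powr (q - 1) * sgn (w j) * ip n (Y j) x)"
      unfolding sum_distrib_left using q by (intro sum.cong refl) simp
    ultimately show ?thesis unfolding D_def by linarith
  qed
  \<comment> \<open>The equation tested at the minimiser \<open>u\<close> itself gives H = -<v, u>
    \<le> r |u| \<le> H^(1/q), which forces H \<le> 1.\<close>
  define H where "H = (\<Sum>j\<in>J. a j * \<bar>w j\<bar> powr q)"
  have "H \<le> 1"
  proof (rule ccontr)
    assume "\<not> H \<le> 1"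
    then have H: "1 < H" by simp
    have "H = (\<Sum>j\<in>J. a j * \<bar>w j\<bar> powr (q - 1) * sgn (w j) * w j)"
      unfolding H_def
    proof (intro sum.cong refl)
      fix j
      have "sgn (w j) * w j = \<bar>w j\<bar>" by (simp add: sgn_if)
      then have "\<bar>w j\<bar> powr q = \<bar>w j\<bar> powr (q - 1) * (sgn (w j) * w j)"
        by (cases "w j = 0") (simp_all add: powr_diff)
      then show "a j * \<bar>w j\<bar> powr q = a j * \<bar>w j\<bar> powr (q - 1) * sgn (w j) * w j" by simp
    qed
    also have "\<dots> = - ip n v u" using eq[OF uE] by (simp add: w_def)
    also have "\<dots> \<le> enorm n v * enorm n u" using abs_ip_le[of n v u] by linarith
    also have "\<dots> \<le> r * enorm n u" by (rule mult_right_mono[OF v]) simp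
    also have "\<dots> = ((r * enorm n u) powr q) powr (1/q)" using q r by (simp add: powr_powr)
    also have "\<dots> \<le> H powr (1/q)" unfolding H_def w_def using q r by (intro powr_mono2 coer[OF uE]) auto
    also have "\<dots> < H powr 1" using H q by (intro powr_less_mono) auto
    finally show False using H by simp
  qed
  then show ?thesis using that[of w] eq by (simp add: H_def)
qed

text \<open>Young's inequality for \<open>t\<close> and m^(q - 1) is the tangent inequality for the
  power q, because the dual power of m^(q - 1) is m^q.\<close>

lemma powr_tangent:
  fixes t m q :: real
  assumes "1 < q" "0 \<le> t" "0 < m"
  shows "m powr q + q * m powr (q - 1) * (t - m) \<le> t powr q"
proof -
  define p where "p = q / (q - 1)"
  have p: "1 < p" "1/q + 1/p = 1" "(q - 1) * p = q" using assms(1) by (auto simp: p_def field_simps)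
  have "t * m powr (q - 1) \<le> t powr q / q + (m powr (q - 1)) powr p / p"
    by (rule Youngs_powr[OF assms(1) p(1,2) assms(2)]) simp
  then have "t * m powr (q - 1) \<le> t powr q / q + m powr q / p" by (simp add: powr_powr p(3))
  then have "q * (t * m powr (q - 1)) \<le> q * (t powr q / q + m powr q / p)" using assms(1) by (intro mult_left_mono) auto
  also have "\<dots> = t powr q + (q - 1) * m powr q" using assms(1) by (simp add: p_def field_simps)
  finally have "q * t * m powr (q - 1) \<le> t powr q + (q - 1) * m powr q" by simp
  moreover have "m powr q = m powr (q - 1) * m" using assms(3) by (simp add: powr_diff)
  ultimately show ?thesis by (simp add: algebra_simps)
qed

text \<open>Sum the tangents at \<open>m\<close>; the linear terms add up to a nonnegative multiple
  of the surplus in \<open>S\<close>.\<close>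

lemma weighted_power_mean:
  fixes b t :: "nat \<Rightarrow> real" and q :: real
  assumes q: "1 < q" and J: "finite J" and b: "\<And>j. j \<in> J \<Longrightarrow> 0 \<le> b j" and t: "\<And>j. j \<in> J \<Longrightarrow> 0 \<le> t j"
    and B: "0 < (\<Sum>j\<in>J. b j)" and S: "(\<Sum>j\<in>J. b j) * m \<le> (\<Sum>j\<in>J. b j * t j)" and m: "0 \<le> m"
  shows "(\<Sum>j\<in>J. b j) * m powr q \<le> (\<Sum>j\<in>J. b j * t j powr q)"
proof (cases "m = 0")
  case True
  then show ?thesis using b q by (simp add: sum_nonneg)
next
  case False
  then have m: "0 < m" using m by simp
  have "(\<Sum>j\<in>J. b j * (m powr q + q * m powr (q - 1) * (t j - m))) \<le> (\<Sum>j\<in>J. b j * t j powr q)"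
    using b t by (intro sum_mono mult_left_mono powr_tangent[OF q _ m]) auto
  moreover have "(\<Sum>j\<in>J. b j * (m powr q + q * m powr (q - 1) * (t j - m))) =
    (\<Sum>j\<in>J. b j) * m powr q + q * m powr (q - 1) * ((\<Sum>j\<in>J. b j * t j) - (\<Sum>j\<in>J. b j) * m)"
    by (simp add: algebra_simps sum.distrib sum_subtractf sum_distrib_left sum_distrib_right)
  moreover have "0 \<le> q * m powr (q - 1) * ((\<Sum>j\<in>J. b j * t j) - (\<Sum>j\<in>J. b j) * m)"
    using q S by (intro mult_nonneg_nonneg) auto
  ultimately show ?thesis by linarith
qed

section \<open>Events for the columns of an array\<close>

definition cols :: "nat \<Rightarrow> nat set \<Rightarrow> (nat \<Rightarrow> nat \<Rightarrow> real) \<Rightarrow> nat \<Rightarrow> nat \<Rightarrow> real"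
  where "cols n J X = (\<lambda>j\<in>J. zext n (\<lambda>i. X i j))"

text \<open>Columns are read as rows of a transposed array. A column has only \<open>n\<close>
  entries, hence \<open>zext n\<close>, and \<open>loc\<close> asks that \<open>A\<close> look at
  these entries alone.\<close>

lemma emeasure_cols:
  assumes J: "finite J" and A: "A \<in> sets (array J)"
    and loc: "\<And>Y. (\<lambda>j\<in>J. zext n (Y j)) \<in> A \<longleftrightarrow> restrict Y J \<in> A"
  shows "{X \<in> space (array {1..n}). cols n J X \<in> A} \<in> sets (array {1..n})"
    and "emeasure (array {1..n}) {X \<in> space (array {1..n}). cols n J X \<in> A} = emeasure (array J) A"
proof -
  have c: "cols n J \<in> measurable (array {1..n}) (array J)"
    unfolding cols_def
  proof (intro array_measurableI measurable_to_gauss)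
    fix j i assume "j \<in> J"
    show "(\<lambda>X. zext n (\<lambda>i. X i j) i) \<in> borel_measurable (array {1..n})"
    proof (cases "i \<in> {1..n}")
      case True
      then show ?thesis using array_coord_measurable[OF True] by (simp only: zext_def if_True)
    next
      case False
      then show ?thesis by (simp only: zext_def if_False borel_measurable_const)
    qed
  qed
  have B: "cols n J -` A \<inter> space (array {1..n}) \<in> sets (array {1..n})" by (rule measurable_sets[OF c A])
  have eq: "{X \<in> space (array {1..n}). cols n J X \<in> A} = cols n J -` A \<inter> space (array {1..n})" by auto
  show S: "{X \<in> space (array {1..n}). cols n J X \<in> A} \<in> sets (array {1..n})" unfolding eq by (rule B)
  let ?F = "indicator {X \<in> space (array {1..n}). cols n J X \<in> A} :: _ \<Rightarrow> ennreal"
  have "(\<integral>\<^sup>+X. ?F X \<partial>array {1..n}) = (\<integral>\<^sup>+Y. indicator A Y \<partial>array J)"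
  proof (rule nn_integral_array_transpose[OF _ J])
    show "?F \<in> borel_measurable (array {1..n})" by (rule borel_measurable_indicator[OF S])
    show "indicator A \<in> borel_measurable (array J)" by (rule borel_measurable_indicator[OF A])
    fix a :: "nat \<times> nat \<Rightarrow> real"
    have "(\<lambda>i\<in>{1..n}. \<lambda>j. a (i, j)) \<in> space (array {1..n})"
      unfolding array_def space_PiM by auto
    moreover have "cols n J (\<lambda>i\<in>{1..n}. \<lambda>j. a (i, j)) = (\<lambda>j\<in>J. zext n (\<lambda>i. a (i, j)))"
      unfolding cols_def by (intro restrict_ext) (auto simp: zext_def)
    moreover have "(\<lambda>j\<in>J. zext n (\<lambda>i. a (i, j))) \<in> A \<longleftrightarrow> (\<lambda>j\<in>J. \<lambda>i. a (i, j)) \<in> A"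
      using loc[of "\<lambda>j i. a (i, j)"] .
    ultimately show "?F (\<lambda>i\<in>{1..n}. \<lambda>j. a (i, j)) = indicator A (\<lambda>j\<in>J. \<lambda>i. a (i, j))"
      by (simp add: indicator_def)
  qed simp
  then show "emeasure (array {1..n}) {X \<in> space (array {1..n}). cols n J X \<in> A} = emeasure (array J) A"
    unfolding nn_integral_indicator[OF S] nn_integral_indicator[OF A] .
qed

lemma nn_integral_gauss_exp_norm: "(\<integral>\<^sup>+g. ennreal (exp ((enorm n g)\<^sup>2 / 4)) \<partial>gauss) \<le> ennreal (exp (2/5 * real n))"
proof -
  have "(\<integral>\<^sup>+g. ennreal (exp ((enorm n g)\<^sup>2 / 4)) \<partial>gauss) = (\<integral>\<^sup>+g. (\<Prod>i\<in>{1..n}. ennreal (exp ((g i)\<^sup>2 / 4))) \<partial>gauss)"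
  proof (rule nn_integral_cong)
    fix g :: "nat \<Rightarrow> real"
    have "(enorm n g)\<^sup>2 / 4 = (\<Sum>i\<in>{1..n}. (g i)\<^sup>2 / 4)"
      unfolding enorm_sq ip_def sum_divide_distrib by (simp add: power2_eq_square)
    then show "ennreal (exp ((enorm n g)\<^sup>2 / 4)) = (\<Prod>i\<in>{1..n}. ennreal (exp ((g i)\<^sup>2 / 4)))"
      by (simp add: exp_sum prod_ennreal)
  qed
  also have "\<dots> = (\<Prod>i\<in>{1..n}. \<integral>\<^sup>+y. ennreal (exp (y\<^sup>2 / 4)) \<partial>std_gauss)"
    by (rule nn_integral_gauss_prod) simp_all
  also have "\<dots> \<le> ennreal (exp (\<Sum>i\<in>{1..n}. 2/5))"
    using sqrt2_le by (intro prod_ennreal_exp_le) (simp_all add: std_gauss_exp_quarter ennreal_leI)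
  also have "(\<Sum>i\<in>{1..n}. 2/5) = 2/5 * real n" by simp
  finally show ?thesis .
qed

lemma gauss_norm_upper:
  assumes t: "0 \<le> t"
  shows "emeasure gauss {g. t < enorm n g} \<le> ennreal (exp (2/5 * real n - t\<^sup>2 / 4))"
proof -
  have S: "{g. t < enorm n g} \<in> sets gauss"
    using borel_measurable_less[OF borel_measurable_const[of t gauss] enorm_measurable_gauss[of n]] by simp
  have "emeasure gauss {g. t < enorm n g} = (\<integral>\<^sup>+g. indicator {g. t < enorm n g} g \<partial>gauss)"
    by (rule nn_integral_indicator[OF S, symmetric])
  also have "\<dots> \<le> (\<integral>\<^sup>+g. ennreal (exp (- t\<^sup>2 / 4)) * ennreal (exp ((enorm n g)\<^sup>2 / 4)) \<partial>gauss)"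
  proof (rule nn_integral_mono)
    fix g
    have "1 \<le> exp (- t\<^sup>2 / 4) * exp ((enorm n g)\<^sup>2 / 4)" if "t < enorm n g"
      using power_strict_mono[OF that t, of 2] by (simp flip: exp_add)
    then have "t < enorm n g \<Longrightarrow> 1 \<le> ennreal (exp (- t\<^sup>2 / 4) * exp ((enorm n g)\<^sup>2 / 4))" by simp
    then show "indicator {g. t < enorm n g} g \<le> ennreal (exp (- t\<^sup>2 / 4)) * ennreal (exp ((enorm n g)\<^sup>2 / 4))"
      by (cases "t < enorm n g") (simp_all add: ennreal_mult)
  qed
  also have "\<dots> = ennreal (exp (- t\<^sup>2 / 4)) * (\<integral>\<^sup>+g. ennreal (exp ((enorm n g)\<^sup>2 / 4)) \<partial>gauss)"
    by (rule nn_integral_cmult) measurable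
  also have "\<dots> \<le> ennreal (exp (- t\<^sup>2 / 4)) * ennreal (exp (2/5 * real n))"
    by (intro mult_left_mono nn_integral_gauss_exp_norm) simp
  also have "\<dots> = ennreal (exp (- t\<^sup>2 / 4 + 2/5 * real n))" by (rule ennreal_exp_add[symmetric])
  finally show ?thesis by (simp add: algebra_simps)
qed

lemma space_array: "space (array I) = extensional I"
  unfolding array_def space_PiM by (auto simp: PiE_def)

lemma first_column_event:
  assumes t: "0 \<le> t"
  shows "\<exists>A\<in>sets (array {1..n}). emeasure (array {1..n}) A \<le> ennreal (exp (2/5 * real n - t\<^sup>2 / 4)) \<and>
    (\<forall>X\<in>space (array {1..n}). X \<notin> A \<longrightarrow> enorm n (\<lambda>i. X i 1) \<le> t)"
proof -
  define A where "A = {Y \<in> space (array {1}). t < enorm n (Y 1)}"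
  have m: "(\<lambda>Y. enorm n (Y 1)) \<in> borel_measurable (array {1})"
    by (rule measurable_compose[OF row_measurable enorm_measurable_gauss]) simp
  have A: "A \<in> sets (array {1})" unfolding A_def by (rule borel_measurable_less[OF borel_measurable_const m])
  have S: "{g. t < enorm n g} \<in> sets gauss"
    using borel_measurable_less[OF borel_measurable_const[of t gauss] enorm_measurable_gauss[of n]] by simp
  have "emeasure (array {1}) A = (\<integral>\<^sup>+Y. indicator A Y \<partial>array {1})"
    by (rule nn_integral_indicator[OF A, symmetric])
  also have "\<dots> = (\<integral>\<^sup>+Y. indicator {g. t < enorm n g} (Y 1) \<partial>array {1})"
    by (intro nn_integral_cong) (simp add: A_def indicator_def)
  also have "\<dots> = (\<integral>\<^sup>+g. indicator {g. t < enorm n g} g \<partial>gauss)"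
    unfolding array_def by (rule PA.product_nn_integral_singleton) (rule borel_measurable_indicator[OF S])
  also have "\<dots> = emeasure gauss {g. t < enorm n g}" by (rule nn_integral_indicator[OF S])
  finally have e: "emeasure (array {1}) A \<le> ennreal (exp (2/5 * real n - t\<^sup>2 / 4))"
    using gauss_norm_upper[OF t, of n] by simp
  have loc: "(\<lambda>j\<in>{1}. zext n (Y j)) \<in> A \<longleftrightarrow> restrict Y {1} \<in> A" for Y
    by (simp add: A_def space_array)
  note C = emeasure_cols[of "{1}", OF _ A loc]
  have "enorm n (\<lambda>i. X i 1) \<le> t" if "X \<in> space (array {1..n})" "cols n {1} X \<notin> A" for X
    using that by (simp add: A_def cols_def space_array)
  then show ?thesis using C e by (intro bexI[of _ "{X \<in> space (array {1..n}). cols n {1} X \<in> A}"]) auto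
qed

lemma sum_inverse_squares_le:
  assumes "1 \<le> m" "m \<le> N" shows "(\<Sum>j\<in>{m<..N}. (1 / real j)\<^sup>2) \<le> 1 / real m - 1 / real N"
  using assms(2)
proof (induction N rule: dec_induct)
  case (step N)
  have "{m<..Suc N} = insert (Suc N) {m<..N}" using step.hyps by auto
  then have "(\<Sum>j\<in>{m<..Suc N}. (1 / real j)\<^sup>2) = (1 / real (Suc N))\<^sup>2 + (\<Sum>j\<in>{m<..N}. (1 / real j)\<^sup>2)" by simp
  also have "(1 / real (Suc N))\<^sup>2 \<le> 1 / real N - 1 / real (Suc N)"
  proof -
    have N: "0 < real N" using step.hyps assms(1) by simp
    have "(1 / real (Suc N))\<^sup>2 = 1 / ((real N + 1) * (real N + 1))" by (simp add: power2_eq_square add.commute)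
    also have "\<dots> \<le> 1 / (real N * (real N + 1))" using N by (intro divide_left_mono mult_right_mono mult_pos_pos) auto
    also have "\<dots> = 1 / real N - 1 / real (Suc N)" using N by (simp add: field_simps)
    finally show ?thesis .
  qed
  finally show ?case using step.IH by simp
qed simp

text \<open>The squares of the weights 1/j sum to at most 1/m, so the weighted combination of
  columns is a small Gaussian vector of R^n, while the weights themselves still sum to at least 1.
  Harmonic weights also match the q-th powers of the axes.\<close>

lemma columns_event:
  assumes n: "1 \<le> n" and m: "1 \<le> m" "m < N" and B: "1 \<le> (\<Sum>j\<in>{m<..N}. 1 / real j)"
  shows "\<exists>A\<in>sets (array {1..n}). emeasure (array {1..n}) A \<le> ennreal (exp (2/5 * real n - 3/1024 * real m)) \<and>
    (\<forall>X\<in>space (array {1..n}). X \<notin> A \<longrightarrow> (\<forall>u\<in>euclidean n.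
      (\<Sum>j\<in>{m<..N}. 1 / real j) * (enorm n u / 4) \<le> (\<Sum>j\<in>{m<..N}. 1 / real j * \<bar>ip n (\<lambda>i. X i j) u\<bar>)))"
proof -
  define J where "J = {m<..N}"
  define b where "b j = (if j \<in> J then 1 / real j else 0)" for j
  define T where "T = {u \<in> euclidean n. enorm n u = 1}"
  define S where "S = (\<Sum>j\<in>J. 1 / real j)"
  \<comment> \<open>In units of m/1024 this choice gains at least 4 through Markov, as the weights
    sum to at least 1, and loses 1 to the inequality 2 l |y| \<le> m/1024 + m |y|^2 / 4. The moment
    of the quadratic term costs 2/5 for each coordinate of R^n.\<close>
  define l where "l = real m / 64"
  define \<tau> where "\<tau> = enorm N b"
  define \<psi> where "\<psi> j y = ennreal (exp ((y / \<tau>)\<^sup>2 / 4))" for j :: nat and y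
  define c0 where "c0 = ennreal (exp (real m / 1024))"
  have JN: "J \<subseteq> {1..N}" using m by (auto simp: J_def)
  have bsum: "(\<Sum>j=1..N. b j * f j) = (\<Sum>j\<in>J. 1 / real j * f j)" for f
  proof -
    have "(\<Sum>j=1..N. b j * f j) = (\<Sum>j\<in>J. b j * f j)"
      by (rule sum.mono_neutral_right) (use JN in \<open>auto simp: b_def\<close>)
    also have "\<dots> = (\<Sum>j\<in>J. 1 / real j * f j)" by (intro sum.cong) (auto simp: b_def)
    finally show ?thesis .
  qed
  have bS: "(\<Sum>j=1..N. b j) = S" using bsum[of "\<lambda>_. 1"] by (simp add: S_def)
  have \<tau>2: "\<tau>\<^sup>2 = (\<Sum>j\<in>J. (1 / real j)\<^sup>2)"
  proof -
    have "\<tau>\<^sup>2 = (\<Sum>j=1..N. b j * b j)" by (simp add: \<tau>_def enorm_sq ip_def)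
    also have "\<dots> = (\<Sum>j\<in>J. 1 / real j * b j)" by (rule bsum)
    also have "\<dots> = (\<Sum>j\<in>J. (1 / real j)\<^sup>2)" by (intro sum.cong) (auto simp: b_def power2_eq_square)
    finally show ?thesis .
  qed
  have \<tau>m: "\<tau>\<^sup>2 \<le> 1 / real m"
    using sum_inverse_squares_le[OF m(1) less_imp_le[OF m(2)]] unfolding \<tau>2 J_def by (smt (verit) divide_nonneg_nonneg of_nat_0_le_iff)
  have \<tau>: "0 < \<tau>"
  proof -
    have "N \<in> J" using m by (simp add: J_def)
    then have "(1 / real N)\<^sup>2 \<le> \<tau>\<^sup>2" unfolding \<tau>2 by (intro member_le_sum) (auto simp: J_def)
    moreover have "0 < (1 / real N)\<^sup>2" using m by simp
    ultimately have "\<tau> \<noteq> 0" by auto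
    then show ?thesis by (simp add: \<tau>_def less_le)
  qed
  have T: "T \<subseteq> euclidean n" "\<And>x. x \<in> T \<Longrightarrow> enorm n x = 1" by (auto simp: T_def)
  have l0: "0 \<le> l" by (simp add: l_def)
  have b0: "0 \<le> b i" for i by (simp add: b_def)
  have \<psi>m: "\<psi> j \<in> borel_measurable borel" for j unfolding \<psi>_def by simp
  have dom: "ennreal (exp (2 * l * ip n y x)) \<le> c0 * (\<Prod>j=1..n. \<psi> j (y j))" if x: "x \<in> T" for x y
  proof -
    have "2 * l * ip n y x \<le> 2 * l * enorm n y"
      using ip_le[of n y x] T(2)[OF x] by (intro mult_left_mono) (auto simp: l_def)
    also have "\<dots> \<le> real m / 1024 + real m * (enorm n y)\<^sup>2 / 4"
    proof -
      have "0 \<le> real m * (enorm n y / 2 - 1 / 32)\<^sup>2" by simp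
      then show ?thesis by (simp add: l_def power2_eq_square algebra_simps)
    qed
    also have "real m * (enorm n y)\<^sup>2 / 4 \<le> (enorm n y)\<^sup>2 / (4 * \<tau>\<^sup>2)"
    proof -
      have "real m * \<tau>\<^sup>2 \<le> 1" using \<tau>m m by (simp add: field_simps)
      then have "real m \<le> 1 / \<tau>\<^sup>2" using \<tau> by (simp add: field_simps)
      then have "real m * (enorm n y)\<^sup>2 \<le> 1 / \<tau>\<^sup>2 * (enorm n y)\<^sup>2" by (rule mult_right_mono) simp
      then show ?thesis by (simp add: field_simps)
    qed
    also have "(enorm n y)\<^sup>2 / (4 * \<tau>\<^sup>2) = (\<Sum>j=1..n. (y j / \<tau>)\<^sup>2 / 4)"
      unfolding enorm_sq ip_def sum_divide_distrib by (intro sum.cong refl) (simp add: power2_eq_square mult.commute)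
    finally have "ennreal (exp (2 * l * ip n y x)) \<le> ennreal (exp (real m / 1024 + (\<Sum>j=1..n. (y j / \<tau>)\<^sup>2 / 4)))"
      by (intro ennreal_leI) simp
    also have "\<dots> = c0 * ennreal (exp (\<Sum>j=1..n. (y j / \<tau>)\<^sup>2 / 4))" unfolding c0_def by (rule ennreal_exp_add)
    also have "ennreal (exp (\<Sum>j=1..n. (y j / \<tau>)\<^sup>2 / 4)) = (\<Prod>j=1..n. \<psi> j (y j))"
      unfolding \<psi>_def by (simp add: exp_sum prod_ennreal)
    finally show ?thesis .
  qed
  define A where "A = (\<Union>x\<in>T. small n N b 1 x)"
  note U = uniform_lower_bound[where d=n and m=N and b=b and l=l and \<rho>=1 and T=T and c=c0 and \<psi>=\<psi>, OF T l0 b0 \<psi>m dom]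
  have A: "A \<in> sets (array {1..N})" unfolding A_def by (rule U(1))
  have "emeasure (array {1..N}) A \<le> uniform_lower_tail n N b l 1 c0 \<psi>" unfolding A_def by (rule U(2))
  also have "\<dots> = ennreal (exp (- l * 1 * S / 4)) * (c0 * (\<Prod>j=1..n. \<integral>\<^sup>+y. ennreal (exp (y\<^sup>2 / 4)) \<partial>std_gauss))"
  proof -
    have e2: "\<psi> j (\<tau> * y) = ennreal (exp (y\<^sup>2 / 4))" for j y using \<tau> by (simp add: \<psi>_def)
    show ?thesis unfolding uniform_lower_tail_def \<tau>_def[symmetric] bS e2 ..
  qed
  also have "\<dots> \<le> ennreal (exp (- l * 1 * S / 4)) * (c0 * ennreal (exp (\<Sum>j=1..n. 2/5)))"
    using sqrt2_le by (intro mult_left_mono prod_ennreal_exp_le) (simp_all add: std_gauss_exp_quarter ennreal_leI)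
  also have "\<dots> = ennreal (exp (- l * 1 * S / 4 + (real m / 1024 + (\<Sum>j=1..n. 2/5))))"
    unfolding c0_def ennreal_exp_add ..
  also have "\<dots> \<le> ennreal (exp (2/5 * real n - 3/1024 * real m))"
  proof -
    have "l * 1 \<le> l * S" using B l0 by (intro mult_left_mono) (auto simp: S_def J_def)
    then show ?thesis by (intro ennreal_leI) (simp add: l_def)
  qed
  finally have e: "emeasure (array {1..N}) A \<le> ennreal (exp (2/5 * real n - 3/1024 * real m))" .
  have loc: "(\<lambda>j\<in>{1..N}. zext n (Y j)) \<in> A \<longleftrightarrow> restrict Y {1..N} \<in> A" for Y
  proof -
    have "(\<Sum>i=1..N. b i * \<bar>ip n ((\<lambda>j\<in>{1..N}. zext n (Y j)) i) x\<bar>) = (\<Sum>i=1..N. b i * \<bar>ip n (restrict Y {1..N} i) x\<bar>)" for x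
      by (intro sum.cong refl) simp
    then show ?thesis unfolding A_def small_def space_array by auto
  qed
  note C = emeasure_cols[of "{1..N}", OF _ A loc]
  have "S * (enorm n u / 4) \<le> (\<Sum>j\<in>J. 1 / real j * \<bar>ip n (\<lambda>i. X i j) u\<bar>)"
    if X: "X \<in> space (array {1..n})" "cols n {1..N} X \<notin> A" and u: "u \<in> euclidean n" for X u
  proof (cases "u = 0")
    case True
    then show ?thesis by simp
  next
    case False
    define v where "v = (1 / enorm n u) *\<^sub>R u"
    have pos: "0 < enorm n u" by (rule enorm_pos[OF u False])
    have v: "v \<in> T" using pos subspace_scale[OF subspace_euclidean u] by (auto simp: T_def v_def enorm_scale)
    have "cols n {1..N} X \<notin> small n N b 1 v" using X(2) v by (auto simp: A_def)
    moreover have "cols n {1..N} X \<in> space (array {1..N})" by (simp add: space_array cols_def)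
    ultimately have "1 * S / 4 \<le> (\<Sum>i=1..N. b i * \<bar>ip n (cols n {1..N} X i) v\<bar>)"
      unfolding small_def bS by (simp only: mem_Collect_eq simp_thms not_less)
    also have "\<dots> = (\<Sum>i=1..N. b i * \<bar>ip n (\<lambda>k. X k i) v\<bar>)" by (intro sum.cong refl) (simp add: cols_def)
    also have "\<dots> = (\<Sum>j\<in>J. 1 / real j * \<bar>ip n (\<lambda>i. X i j) v\<bar>)" by (rule bsum)
    also have "\<dots> = (\<Sum>j\<in>J. 1 / real j * \<bar>ip n (\<lambda>i. X i j) u\<bar>) / enorm n u"
      unfolding sum_divide_distrib using pos by (intro sum.cong refl) (simp add: v_def ip_scale_right abs_mult)
    finally show ?thesis using pos by (simp add: field_simps)
  qed
  then show ?thesis using C e unfolding S_def J_def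
    by (intro bexI[of _ "{X \<in> space (array {1..n}). cols n {1..N} X \<in> A}"]) auto
qed

text \<open>The late columns are combined, with coefficients \<open>z\<close>, to minus
  \<open>s\<close> times the first column; then \<open>s\<close> and \<open>z\<close> are the
  coordinates of a kernel vector. Such \<open>z\<close> of weighted p-norm at most 1 exist by
  \<open>dual_solution\<close>, since \<open>columns_event\<close> makes the late columns coercive
  once the power mean has raised its bound to q-th powers.\<close>

lemma lower_event:
  fixes p q K :: real
  assumes pq: "1 < p" "1 < q" "1/p + 1/q = 1" and K: "0 < K"
  obtains M c where "0 < M" "0 < c"
    "\<And>n N m w \<sigma>. 1 \<le> n \<Longrightarrow> 1 \<le> m \<Longrightarrow> m < N \<Longrightarrow> M * real n \<le> real m \<Longrightarrow> 1 \<le> (\<Sum>j\<in>{m<..N}. 1 / real j) \<Longrightarrow>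
      0 < w \<Longrightarrow> (\<And>j. j \<in> {1..N} \<Longrightarrow> 0 < \<sigma> j) \<Longrightarrow> (\<And>j. j \<in> {m<..N} \<Longrightarrow> w / real j \<le> \<sigma> j powr q) \<Longrightarrow>
      \<exists>A\<in>sets (array {1..n}). emeasure (array {1..n}) A \<le> ennreal (2 * exp (- K * real n)) \<and>
        (\<forall>X\<in>space (array {1..n}). X \<notin> A \<longrightarrow> (\<exists>x\<in>ker N {1..n} X. x \<in> ellipsoid N p \<sigma> \<and>
          min (\<sigma> 1) (c * (w * (\<Sum>j\<in>{m<..N}. 1 / real j)) powr (1/q) / sqrt n) / 2 \<le> enorm N x))"
proof -
  \<comment> \<open>The exponents 2n/5 - (K + 1) n of the first column and 2n/5 - 1200 (K + 1) n /
    1024 of the late columns are both at most -K n.\<close>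
  define M where "M = 400 * (K + 1)"
  define C1 where "C1 = sqrt (4 * (K + 1))"
  define c where "c = 1 / (4 * C1)"
  have C1: "0 < C1" "C1\<^sup>2 = 4 * (K + 1)" using K by (auto simp: C1_def)
  have main: "\<exists>A\<in>sets (array {1..n}). emeasure (array {1..n}) A \<le> ennreal (2 * exp (- K * real n)) \<and>
        (\<forall>X\<in>space (array {1..n}). X \<notin> A \<longrightarrow> (\<exists>x\<in>ker N {1..n} X. x \<in> ellipsoid N p \<sigma> \<and>
          min (\<sigma> 1) (c * (w * (\<Sum>j\<in>{m<..N}. 1 / real j)) powr (1/q) / sqrt n) / 2 \<le> enorm N x))"
    if n: "1 \<le> n" and m: "1 \<le> m" "m < N" and Mn: "M * real n \<le> real m" and B1: "1 \<le> (\<Sum>j\<in>{m<..N}. 1 / real j)"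
      and w: "0 < w" and \<sigma>: "\<And>j. j \<in> {1..N} \<Longrightarrow> 0 < \<sigma> j" and ws: "\<And>j. j \<in> {m<..N} \<Longrightarrow> w / real j \<le> \<sigma> j powr q"
    for n N m :: nat and w :: real and \<sigma> :: "nat \<Rightarrow> real"
  proof -
    define J where "J = {m<..N}"
    define B where "B = (\<Sum>j\<in>J. 1 / real j)"
    define r where "r = (w * B) powr (1/q) / 4"
    \<comment> \<open>\<open>s\<close> becomes the first coordinate of the vector: at most
      \<open>\<sigma> 1\<close> for the ellipsoid, and small enough that \<open>s\<close> times the
      first column has norm at most the coercivity constant \<open>r\<close>.\<close>
    define s where "s = min (\<sigma> 1) (c * (w * B) powr (1/q) / sqrt n)"
    have B: "1 \<le> B" using B1 by (simp add: B_def J_def)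
    have wB: "0 < w * B" using w B by simp
    have r: "0 < r" using w B by (simp add: r_def)
    have JN: "j \<in> {1..N}" "j \<noteq> 1" "0 < j" if "j \<in> J" for j using that m by (auto simp: J_def)
    have \<sigma>1: "0 < \<sigma> 1" using m by (intro \<sigma>) auto
    have s: "0 < s" using \<sigma>1 w B C1 n by (simp add: s_def c_def)
    obtain A1 where A1: "A1 \<in> sets (array {1..n})" "emeasure (array {1..n}) A1 \<le> ennreal (exp (2/5 * real n - (C1 * sqrt n)\<^sup>2 / 4))"
      "\<And>X. X \<in> space (array {1..n}) \<Longrightarrow> X \<notin> A1 \<Longrightarrow> enorm n (\<lambda>i. X i 1) \<le> C1 * sqrt n"
      using first_column_event[of "C1 * sqrt n" n] C1(1) by auto
    obtain A2 where A2: "A2 \<in> sets (array {1..n})" "emeasure (array {1..n}) A2 \<le> ennreal (exp (2/5 * real n - 3/1024 * real m))"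
      "\<And>X u. X \<in> space (array {1..n}) \<Longrightarrow> X \<notin> A2 \<Longrightarrow> u \<in> euclidean n \<Longrightarrow>
        B * (enorm n u / 4) \<le> (\<Sum>j\<in>J. 1 / real j * \<bar>ip n (\<lambda>i. X i j) u\<bar>)"
      using columns_event[OF n m B1] unfolding B_def J_def by blast
    have "emeasure (array {1..n}) (A1 \<union> A2) \<le> emeasure (array {1..n}) A1 + emeasure (array {1..n}) A2"
      by (rule emeasure_subadditive[OF A1(1) A2(1)])
    also have "\<dots> \<le> ennreal (exp (- K * real n)) + ennreal (exp (- K * real n))"
    proof (intro add_mono order_trans[OF A1(2)] order_trans[OF A2(2)] ennreal_leI)
      have "(C1 * sqrt n)\<^sup>2 / 4 = (K + 1) * real n" using C1(2) by (simp add: power_mult_distrib)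
      then show "exp (2/5 * real n - (C1 * sqrt n)\<^sup>2 / 4) \<le> exp (- K * real n)" by (simp add: algebra_simps)
      have "400 * (K * real n) + 400 * real n \<le> real m" using Mn by (simp add: M_def algebra_simps)
      moreover have "0 \<le> K * real n" using K by simp
      ultimately have "2/5 * real n - 3/1024 * real m \<le> - (K * real n)" by linarith
      then show "exp (2/5 * real n - 3/1024 * real m) \<le> exp (- K * real n)" by simp
    qed
    also have "\<dots> = ennreal (2 * exp (- K * real n))" by (simp flip: ennreal_plus)
    finally have e: "emeasure (array {1..n}) (A1 \<union> A2) \<le> ennreal (2 * exp (- K * real n))" .
    have "\<exists>x\<in>ker N {1..n} X. x \<in> ellipsoid N p \<sigma> \<and> s / 2 \<le> enorm N x"
      if X: "X \<in> space (array {1..n})" "X \<notin> A1 \<union> A2" for X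
    proof -
      define Y where "Y j i = X i j" for i j
      have XA: "X \<notin> A1" "X \<notin> A2" using X(2) by auto
      have coer: "(r * enorm n u) powr q \<le> (\<Sum>j\<in>J. \<sigma> j powr q * \<bar>ip n (Y j) u\<bar> powr q)" if u: "u \<in> euclidean n" for u
      proof -
        have S: "B * (enorm n u / 4) \<le> (\<Sum>j\<in>J. 1 / real j * \<bar>ip n (Y j) u\<bar>)"
          using A2(3)[OF X(1) XA(2) u] by (simp add: Y_def[abs_def])
        have "B * (enorm n u / 4) powr q \<le> (\<Sum>j\<in>J. 1 / real j * \<bar>ip n (Y j) u\<bar> powr q)"
          unfolding B_def
          by (rule weighted_power_mean[OF pq(2)]) (use S B in \<open>auto simp: J_def B_def\<close>)
        then have "w * (B * (enorm n u / 4) powr q) \<le> w * (\<Sum>j\<in>J. 1 / real j * \<bar>ip n (Y j) u\<bar> powr q)"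
          using w by (intro mult_left_mono) auto
        also have "\<dots> = (\<Sum>j\<in>J. w / real j * \<bar>ip n (Y j) u\<bar> powr q)" by (simp add: sum_distrib_left)
        also have "\<dots> \<le> (\<Sum>j\<in>J. \<sigma> j powr q * \<bar>ip n (Y j) u\<bar> powr q)"
          using ws by (intro sum_mono mult_right_mono) (auto simp: J_def)
        finally have "w * B * (enorm n u / 4) powr q \<le> (\<Sum>j\<in>J. \<sigma> j powr q * \<bar>ip n (Y j) u\<bar> powr q)" by (simp add: mult.assoc)
        moreover have "(r * enorm n u) powr q = w * B * (enorm n u / 4) powr q"
        proof -
          define P where "P = (w * B) powr (1/q)"
          have P: "P powr q = w * B" using wB w B pq(2) unfolding P_def powr_powr by simp
          have "r * enorm n u = P * (enorm n u / 4)" by (simp add: r_def P_def)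
          then have "(r * enorm n u) powr q = P powr q * (enorm n u / 4) powr q" by (simp only: powr_mult)
          then show ?thesis unfolding P .
        qed
        ultimately show ?thesis by simp
      qed
      have v: "enorm n (s *\<^sub>R Y 1) \<le> r"
      proof -
        have "enorm n (s *\<^sub>R Y 1) = s * enorm n (\<lambda>i. X i 1)" using s unfolding enorm_scale by (simp add: Y_def[abs_def])
        also have "\<dots> \<le> s * (C1 * sqrt n)" using s A1(3)[OF X(1) XA(1)] by (intro mult_left_mono) auto
        also have "\<dots> \<le> c * (w * B) powr (1/q) / sqrt n * (C1 * sqrt n)" using C1 n by (intro mult_right_mono) (auto simp: s_def)
        also have "\<dots> = r" using n C1 by (simp add: c_def r_def)
        finally show ?thesis .
      qed
      have a: "0 < \<sigma> j powr q" if "j \<in> J" for j using \<sigma>[OF JN(1)[OF that]] by simp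
      obtain y where y: "\<And>x. x \<in> euclidean n \<Longrightarrow>
          (\<Sum>j\<in>J. \<sigma> j powr q * \<bar>y j\<bar> powr (q - 1) * sgn (y j) * ip n (Y j) x) = - ip n (s *\<^sub>R Y 1) x"
        "(\<Sum>j\<in>J. \<sigma> j powr q * \<bar>y j\<bar> powr q) \<le> 1"
        using dual_solution[OF pq(2) r _ a coer v] J_def by blast
      \<comment> \<open>Since (q - 1) p = q, the p-th power of |z_j| / \<sigma>_j is \<sigma>_j^q
        |y_j|^q, the summand that \<open>dual_solution\<close> controls.\<close>
      define z where "z j = \<sigma> j powr q * \<bar>y j\<bar> powr (q - 1) * sgn (y j)" for j
      define x where "x j = (if j = 1 then s else if j \<in> J then z j else 0)" for j
      have sumx: "(\<Sum>j=1..N. f j (x j)) = f 1 s + (\<Sum>j\<in>J. f j (z j))" if "\<And>j. f j 0 = 0" for f :: "nat \<Rightarrow> real \<Rightarrow> real"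
      proof -
        have "(\<Sum>j=1..N. f j (x j)) = (\<Sum>j\<in>insert 1 J. f j (x j))"
          by (rule sum.mono_neutral_right) (use JN m that in \<open>auto simp: x_def\<close>)
        also have "\<dots> = f 1 (x 1) + (\<Sum>j\<in>J. f j (x j))" using JN by (subst sum.insert) (auto simp: J_def)
        also have "\<dots> = f 1 s + (\<Sum>j\<in>J. f j (z j))" using JN by (intro arg_cong2[where f="(+)"] sum.cong) (auto simp: x_def)
        finally show ?thesis .
      qed
      have xE: "x \<in> euclidean N" using JN m by (auto simp: euclidean_def x_def)
      have "x \<in> ker N {1..n} X"
      proof -
        have "ip N x (X i) = 0" if i: "i \<in> {1..n}" for i
        proof -
          have "ip N x (X i) = s * X i 1 + (\<Sum>j\<in>J. z j * X i j)"
            unfolding ip_def using sumx[of "\<lambda>j t. t * X i j"] by simp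
          moreover have "(\<Sum>j\<in>J. z j * X i j) = - (s * X i 1)"
            using y(1)[OF unit_in_euclidean[OF i]] unfolding ip_unit[OF i] z_def by (simp add: Y_def)
          ultimately show ?thesis by simp
        qed
        then show ?thesis using xE by (simp add: ker_def)
      qed
      have Sx: "(\<Sum>j=1..N. (\<bar>x j\<bar> / \<sigma> j) powr p) \<le> 2"
      proof -
        have "(\<Sum>j=1..N. (\<bar>x j\<bar> / \<sigma> j) powr p) = (\<bar>s\<bar> / \<sigma> 1) powr p + (\<Sum>j\<in>J. (\<bar>z j\<bar> / \<sigma> j) powr p)"
          using sumx[of "\<lambda>j t. (\<bar>t\<bar> / \<sigma> j) powr p"] pq(1) by simp
        also have "(\<bar>s\<bar> / \<sigma> 1) powr p \<le> 1" using s \<sigma>1 pq(1) by (intro powr_le1) (auto simp: s_def)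
        also have "(\<Sum>j\<in>J. (\<bar>z j\<bar> / \<sigma> j) powr p) = (\<Sum>j\<in>J. \<sigma> j powr q * \<bar>y j\<bar> powr q)"
        proof (intro sum.cong refl)
          fix j assume j: "j \<in> J"
          have \<sigma>j: "0 < \<sigma> j" by (rule \<sigma>[OF JN(1)[OF j]])
          have qp: "(q - 1) * p = q" using pq by (simp add: field_simps)
          show "(\<bar>z j\<bar> / \<sigma> j) powr p = \<sigma> j powr q * \<bar>y j\<bar> powr q"
          proof (cases "y j = 0")
            case True
            then show ?thesis by (simp add: z_def)
          next
            case False
            have "\<bar>z j\<bar> / \<sigma> j = \<sigma> j powr (q - 1) * \<bar>y j\<bar> powr (q - 1)"
              using False \<sigma>j by (simp add: z_def abs_mult abs_sgn_eq powr_diff)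
            then have "(\<bar>z j\<bar> / \<sigma> j) powr p = \<sigma> j powr ((q - 1) * p) * \<bar>y j\<bar> powr ((q - 1) * p)"
              by (simp add: powr_mult powr_powr)
            then show ?thesis unfolding qp .
          qed
        qed
        also have "\<dots> \<le> 1" by (rule y(2))
        finally show ?thesis by simp
      qed
      \<comment> \<open>The first coordinate and the late coordinates each contribute at most 1 to
        the p-sum; halving compensates, as (1/2)^p is at most 1/2.\<close>
      have "(1/2) *\<^sub>R x \<in> ellipsoid N p \<sigma>"
      proof -
        have "(\<Sum>j=1..N. (\<bar>((1/2) *\<^sub>R x) j\<bar> / \<sigma> j) powr p) = (1/2) powr p * (\<Sum>j=1..N. (\<bar>x j\<bar> / \<sigma> j) powr p)"
          unfolding sum_distrib_left
        proof (intro sum.cong refl)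
          fix j assume "j \<in> {1..N}"
          have "\<bar>((1/2) *\<^sub>R x) j\<bar> / \<sigma> j = (1/2) * (\<bar>x j\<bar> / \<sigma> j)" by simp
          then show "(\<bar>((1/2) *\<^sub>R x) j\<bar> / \<sigma> j) powr p = (1/2) powr p * (\<bar>x j\<bar> / \<sigma> j) powr p"
            by (simp only: powr_mult)
        qed
        also have "\<dots> \<le> (1/2) powr 1 * 2"
          using Sx pq(1) by (intro mult_mono powr_mono') (auto intro: sum_nonneg)
        finally show ?thesis using subspace_scale[OF subspace_euclidean xE] by (simp add: ellipsoid_def)
      qed
      moreover have "(1/2) *\<^sub>R x \<in> ker N {1..n} X" using \<open>x \<in> ker N {1..n} X\<close> subspace_ker by (rule subspace_scale[rotated])
      moreover have "s / 2 \<le> enorm N ((1/2) *\<^sub>R x)"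
      proof -
        have "1 \<in> {1..N}" using m by auto
        from abs_coord_le_enorm[OF this, of x] have "s \<le> enorm N x" using s by (simp add: x_def)
        then show ?thesis unfolding enorm_scale by simp
      qed
      ultimately show ?thesis by blast
    qed
    then show ?thesis using e sets.Un[OF A1(1) A2(1)] unfolding s_def B_def J_def by blast
  qed
  show ?thesis by (rule that[of M c, OF _ _ main]) (use K C1 in \<open>auto simp: M_def c_def\<close>)
qed

section \<open>The lower bound in comparable dimensions\<close>

lemma ellipsoid_abs_le:
  assumes p: "0 < p" and \<sigma>: "\<And>j. j \<in> {1..N} \<Longrightarrow> 0 < \<sigma> j" and x: "x \<in> ellipsoid N p \<sigma>" and j: "j \<in> {1..N}"
  shows "\<bar>x j\<bar> \<le> \<sigma> j"
proof (rule ccontr)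
  assume "\<not> \<bar>x j\<bar> \<le> \<sigma> j"
  then have "1 < \<bar>x j\<bar> / \<sigma> j" using \<sigma>[OF j] by simp
  then have "1 powr p < (\<bar>x j\<bar> / \<sigma> j) powr p" using p by (intro powr_less_mono2) auto
  also have "\<dots> \<le> (\<Sum>i=1..N. (\<bar>x i\<bar> / \<sigma> i) powr p)"
    using j by (intro member_le_sum) auto
  also have "\<dots> \<le> 1" using x by (simp add: ellipsoid_def)
  finally show False by simp
qed

lemma powr_convex_combination:
  fixes p u v s t :: real
  assumes p: "1 < p" and uv: "0 \<le> u" "0 \<le> v" "u + v = 1" and st: "0 \<le> s" "0 \<le> t"
  shows "(u * s + v * t) powr p \<le> u * s powr p + v * t powr p"
proof (cases "u * s + v * t = 0")
  case True
  then show ?thesis using uv by simp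
next
  case False
  define m where "m = u * s + v * t"
  have m: "0 < m" using False uv st by (simp add: m_def less_le)
  have "u * (m powr p + p * m powr (p - 1) * (s - m)) + v * (m powr p + p * m powr (p - 1) * (t - m)) \<le> u * s powr p + v * t powr p"
    using uv st m by (intro add_mono mult_left_mono powr_tangent[OF p]) auto
  moreover have "u * (m powr p + p * m powr (p - 1) * (s - m)) + v * (m powr p + p * m powr (p - 1) * (t - m)) =
     (u + v) * m powr p + p * m powr (p - 1) * (u * s + v * t - (u + v) * m)"
    by (simp add: algebra_simps)
  moreover have "u * s + v * t - (u + v) * m = 0" using uv(3) by (simp add: m_def)
  ultimately show ?thesis using uv(3) by (simp add: m_def)
qed

lemma ellipsoid_convex_body:
  assumes p: "1 < p" and \<sigma>: "\<And>j. j \<in> {1..N} \<Longrightarrow> 0 < \<sigma> j" and N: "1 \<le> N"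
  obtains r D where "convex_body N (ellipsoid N p \<sigma>) r D"
proof -
  define s where "s = Min (\<sigma> ` {1..N})"
  have s: "0 < s" "\<And>j. j \<in> {1..N} \<Longrightarrow> s \<le> \<sigma> j" using N \<sigma> by (auto simp: s_def)
  \<comment> \<open>A crude radius is enough: coordinates of size at most s/N give summands at most
    N^(-p) \<le> 1/N.\<close>
  define r where "r = s / real N"
  define D where "D = (\<Sum>j=1..N. \<sigma> j)"
  have r: "0 < r" using s N by (simp add: r_def)
  have D: "0 < D" unfolding D_def by (rule sum_pos) (use N \<sigma> in auto)
  have "z \<in> ellipsoid N p \<sigma>" if z: "z \<in> euclidean N" "enorm N z \<le> r" for z
  proof -
    have "(\<Sum>j=1..N. (\<bar>z j\<bar> / \<sigma> j) powr p) \<le> (\<Sum>j=1..N. 1 / real N)"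
    proof (rule sum_mono)
      fix j assume j: "j \<in> {1..N}"
      have "\<bar>z j\<bar> \<le> r" using abs_coord_le_enorm[OF j, of z] z(2) by simp
      then have "\<bar>z j\<bar> / \<sigma> j \<le> r / s" using s(1) s(2)[OF j] r by (intro frac_le) auto
      also have "r / s = 1 / real N" using s by (simp add: r_def)
      finally have "\<bar>z j\<bar> / \<sigma> j \<le> 1 / real N" .
      then have "(\<bar>z j\<bar> / \<sigma> j) powr p \<le> (1 / real N) powr p" using \<sigma>[OF j] p by (intro powr_mono2) auto
      also have "\<dots> \<le> (1 / real N) powr 1" using p N by (intro powr_mono') auto
      finally show "(\<bar>z j\<bar> / \<sigma> j) powr p \<le> 1 / real N" by simp
    qed
    also have "\<dots> = 1" using N by simp
    finally show ?thesis using z by (simp add: ellipsoid_def)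
  qed
  moreover have "enorm N y \<le> D" if y: "y \<in> ellipsoid N p \<sigma>" for y
  proof -
    have "enorm N y \<le> (\<Sum>j=1..N. \<bar>y j\<bar>)" unfolding enorm_def by (rule L2_set_le_sum_abs)
    also have "\<dots> \<le> D" unfolding D_def using ellipsoid_abs_le[OF _ \<sigma> y] p by (intro sum_mono) auto
    finally show ?thesis .
  qed
  moreover have "convex (ellipsoid N p \<sigma>)"
  proof (rule convexI)
    fix x y and u v :: real
    assume xy: "x \<in> ellipsoid N p \<sigma>" "y \<in> ellipsoid N p \<sigma>" and uv: "0 \<le> u" "0 \<le> v" "u + v = 1"
    have "(\<Sum>j=1..N. (\<bar>(u *\<^sub>R x + v *\<^sub>R y) j\<bar> / \<sigma> j) powr p) \<le>
      (\<Sum>j=1..N. u * (\<bar>x j\<bar> / \<sigma> j) powr p + v * (\<bar>y j\<bar> / \<sigma> j) powr p)"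
    proof (rule sum_mono)
      fix j assume j: "j \<in> {1..N}"
      have "\<bar>(u *\<^sub>R x + v *\<^sub>R y) j\<bar> \<le> u * \<bar>x j\<bar> + v * \<bar>y j\<bar>"
        using abs_triangle_ineq[of "u * x j" "v * y j"] uv by (simp add: abs_mult)
      then have "\<bar>(u *\<^sub>R x + v *\<^sub>R y) j\<bar> / \<sigma> j \<le> u * (\<bar>x j\<bar> / \<sigma> j) + v * (\<bar>y j\<bar> / \<sigma> j)"
        using \<sigma>[OF j] by (simp add: field_simps)
      then have "(\<bar>(u *\<^sub>R x + v *\<^sub>R y) j\<bar> / \<sigma> j) powr p \<le> (u * (\<bar>x j\<bar> / \<sigma> j) + v * (\<bar>y j\<bar> / \<sigma> j)) powr p"
        using \<sigma>[OF j] p by (intro powr_mono2) auto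
      also have "\<dots> \<le> u * (\<bar>x j\<bar> / \<sigma> j) powr p + v * (\<bar>y j\<bar> / \<sigma> j) powr p"
        using \<sigma>[OF j] by (intro powr_convex_combination p uv) auto
      finally show "(\<bar>(u *\<^sub>R x + v *\<^sub>R y) j\<bar> / \<sigma> j) powr p \<le> u * (\<bar>x j\<bar> / \<sigma> j) powr p + v * (\<bar>y j\<bar> / \<sigma> j) powr p" .
    qed
    also have "\<dots> = u * (\<Sum>j=1..N. (\<bar>x j\<bar> / \<sigma> j) powr p) + v * (\<Sum>j=1..N. (\<bar>y j\<bar> / \<sigma> j) powr p)"
      by (simp add: sum.distrib sum_distrib_left)
    also have "\<dots> \<le> u * 1 + v * 1"
      using xy uv by (intro add_mono mult_left_mono) (auto simp: ellipsoid_def)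
    finally have le: "(\<Sum>j=1..N. (\<bar>(u *\<^sub>R x + v *\<^sub>R y) j\<bar> / \<sigma> j) powr p) \<le> 1" using uv by simp
    have "u *\<^sub>R x + v *\<^sub>R y \<in> euclidean N"
      using xy by (intro subspace_add subspace_scale subspace_euclidean) (auto simp: ellipsoid_def)
    then show "u *\<^sub>R x + v *\<^sub>R y \<in> ellipsoid N p \<sigma>" using le unfolding ellipsoid_def by blast
  qed
  moreover have "ellipsoid N p \<sigma> \<subseteq> euclidean N" by (auto simp: ellipsoid_def)
  ultimately have "convex_body N (ellipsoid N p \<sigma>) r D" using r D by (auto simp: convex_body_def)
  then show ?thesis by (rule that)
qed

section \<open>Norms of a Gaussian vector\<close>

lemma nn_integral_gauss_prod_exp_le:
  assumes "\<And>j. j \<in> {1..N} \<Longrightarrow> (\<integral>\<^sup>+y. ennreal (exp (h y)) \<partial>std_gauss) \<le> ennreal (exp a)"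
    and "h \<in> borel_measurable borel"
  shows "(\<integral>\<^sup>+g. ennreal (exp (\<Sum>j=1..N. h (g j))) \<partial>gauss) \<le> ennreal (exp (real N * a))"
proof -
  have "(\<integral>\<^sup>+g. ennreal (exp (\<Sum>j=1..N. h (g j))) \<partial>gauss) = (\<integral>\<^sup>+g. (\<Prod>j\<in>{1..N}. ennreal (exp (h (g j)))) \<partial>gauss)"
    by (intro nn_integral_cong) (simp add: exp_sum prod_ennreal)
  also have "\<dots> = (\<Prod>j\<in>{1..N}. \<integral>\<^sup>+y. ennreal (exp (h y)) \<partial>std_gauss)"
    using assms(2) by (intro nn_integral_gauss_prod) auto
  also have "\<dots> \<le> ennreal (exp (\<Sum>j\<in>{1..N}. a))" by (rule prod_ennreal_exp_le) (use assms(1) in auto)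
  finally show ?thesis by simp
qed

text \<open>Any rate \<open>K\<close> is available at the price of a small \<open>c\<close>.
  Markov's inequality is applied to exp (-s |g|^2) with \<open>s\<close> so large that one
  coordinate has mean at most exp (-(K + 1)); \<open>c = 1 / sqrt s\<close> limits the compensating
  factor to exp N.\<close>

lemma gauss_norm_lower:
  assumes K: "0 < K"
  obtains c where "0 < c" "\<And>N. emeasure gauss {g. enorm N g < c * sqrt N} \<le> ennreal (exp (- K * real N))"
proof -
  define s where "s = exp (2 * (K + 1))"
  define c where "c = 1 / sqrt s"
  have s: "0 < s" by (simp add: s_def)
  have c: "0 < c" "s * c\<^sup>2 = 1" using s by (auto simp: c_def power_divide)
  have "emeasure gauss {g. enorm N g < c * sqrt N} \<le> ennreal (exp (- K * real N))" for N
  proof -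
    have S: "{g. enorm N g < c * sqrt N} \<in> sets gauss"
      using borel_measurable_less[OF enorm_measurable_gauss[of N] borel_measurable_const] by simp
    have "emeasure gauss {g. enorm N g < c * sqrt N} = (\<integral>\<^sup>+g. indicator {g. enorm N g < c * sqrt N} g \<partial>gauss)"
      by (rule nn_integral_indicator[OF S, symmetric])
    also have "\<dots> \<le> (\<integral>\<^sup>+g. ennreal (exp (real N)) * ennreal (exp (\<Sum>j=1..N. - s * (g j)\<^sup>2)) \<partial>gauss)"
    proof (rule nn_integral_mono)
      fix g
      have "1 \<le> exp (real N) * exp (\<Sum>j=1..N. - s * (g j)\<^sup>2)" if "enorm N g < c * sqrt N"
      proof -
        have "(enorm N g)\<^sup>2 \<le> (c * sqrt N)\<^sup>2" using that by (intro power_mono) auto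
        then have "s * (enorm N g)\<^sup>2 \<le> s * (c * sqrt N)\<^sup>2" using s by (intro mult_left_mono) auto
        also have "\<dots> = (s * c\<^sup>2) * real N" by (simp add: power_mult_distrib)
        finally have "s * (enorm N g)\<^sup>2 \<le> real N" unfolding c(2) by simp
        moreover have "(\<Sum>j=1..N. - s * (g j)\<^sup>2) = - (s * (enorm N g)\<^sup>2)"
          unfolding enorm_sq ip_def sum_distrib_left by (simp add: sum_negf power2_eq_square)
        ultimately show ?thesis by (simp flip: exp_add)
      qed
      then have "enorm N g < c * sqrt N \<Longrightarrow> ennreal 1 \<le> ennreal (exp (real N) * exp (\<Sum>j=1..N. - s * (g j)\<^sup>2))" by (intro ennreal_leI)
      then have "enorm N g < c * sqrt N \<Longrightarrow> ennreal 1 \<le> ennreal (exp (real N)) * ennreal (exp (\<Sum>j=1..N. - s * (g j)\<^sup>2))"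
        by (simp only: ennreal_mult exp_ge_zero)
      then show "indicator {g. enorm N g < c * sqrt N} g \<le> ennreal (exp (real N)) * ennreal (exp (\<Sum>j=1..N. - s * (g j)\<^sup>2))"
        by (cases "enorm N g < c * sqrt N") simp_all
    qed
    also have "\<dots> = ennreal (exp (real N)) * (\<integral>\<^sup>+g. ennreal (exp (\<Sum>j=1..N. - s * (g j)\<^sup>2)) \<partial>gauss)"
    proof (rule nn_integral_cmult)
      have [measurable]: "(\<lambda>g. \<Sum>j=1..N. - s * (g j)\<^sup>2) \<in> borel_measurable gauss"
        by (intro borel_measurable_sum borel_measurable_times borel_measurable_power coord_measurable_gauss borel_measurable_const)
      show "(\<lambda>g. ennreal (exp (\<Sum>j=1..N. - s * (g j)\<^sup>2))) \<in> borel_measurable gauss" by measurable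
    qed
    also have "\<dots> \<le> ennreal (exp (real N)) * ennreal (exp (real N * (- (K + 1))))"
    proof (intro mult_left_mono nn_integral_gauss_prod_exp_le)
      have "(\<integral>\<^sup>+y. ennreal (exp (- s * y\<^sup>2)) \<partial>std_gauss) = ennreal (1 / sqrt (1 - 2 * (- s)))"
        using s by (intro std_gauss_exp_sq) simp
      also have "1 / sqrt (1 - 2 * (- s)) \<le> exp (- (K + 1))"
      proof -
        have "(exp (K + 1))\<^sup>2 = s" by (simp add: s_def power2_eq_square flip: exp_add)
        then have "(exp (K + 1))\<^sup>2 \<le> 1 - 2 * (- s)" using s by simp
        then have "exp (K + 1) \<le> sqrt (1 - 2 * (- s))" by (rule real_le_rsqrt)
        then have "1 / sqrt (1 - 2 * (- s)) \<le> 1 / exp (K + 1)" by (intro divide_left_mono) (use s in auto)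
    moreover have "1 / exp (K + 1) = exp (- K - 1)" using exp_minus[of "K + 1"] by (simp add: inverse_eq_divide)
    ultimately show ?thesis by simp
      qed
      then have "ennreal (1 / sqrt (1 - 2 * (- s))) \<le> ennreal (exp (- (K + 1)))" by (rule ennreal_leI)
      finally show "(\<integral>\<^sup>+y. ennreal (exp (- s * y\<^sup>2)) \<partial>std_gauss) \<le> ennreal (exp (- (K + 1)))" .
    qed auto
    also have "\<dots> = ennreal (exp (real N + real N * (- (K + 1))))" by (rule ennreal_exp_add[symmetric])
    also have "real N + real N * (- (K + 1)) = - K * real N" by (simp add: algebra_simps)
    finally show ?thesis .
  qed
  then show ?thesis using that c(1) by blast
qed

definition psum :: "nat \<Rightarrow> real \<Rightarrow> (nat \<Rightarrow> real) \<Rightarrow> real"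
  where "psum N p g = (\<Sum>j=1..N. \<bar>g j\<bar> powr p)"

lemma psum_measurable [measurable]: "psum N p \<in> borel_measurable gauss"
proof -
  have "(\<lambda>g. \<bar>g j\<bar> powr p) \<in> borel_measurable gauss" for j
    using measurable_compose[OF coord_measurable_gauss[of j], of "\<lambda>y. \<bar>y\<bar> powr p" borel] by simp
  then show ?thesis unfolding psum_def[abs_def] by (intro borel_measurable_sum)
qed

text \<open>For p \<le> 2 the sum is dominated by N + |g|^2, which leaves the tail of the Euclidean
  norm.\<close>

lemma psum_upper_small_p:
  assumes p: "0 < p" "p \<le> 2" and K: "0 < K"
  obtains D where "0 < D" "\<And>N. emeasure gauss {g. D * real N < psum N p g} \<le> ennreal (exp (- K * real N))"
proof -
  define D where "D = 1 + 4 * (K + 1)"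
  have "emeasure gauss {g. D * real N < psum N p g} \<le> ennreal (exp (- K * real N))" for N
  proof -
    define t where "t = sqrt (4 * (K + 1) * real N)"
    have t: "0 \<le> t" "t\<^sup>2 = 4 * (K + 1) * real N" using K by (auto simp: t_def)
    have S: "{g. t < enorm N g} \<in> sets gauss"
      using borel_measurable_less[OF borel_measurable_const[of t gauss] enorm_measurable_gauss[of N]] by simp
    have "{g. D * real N < psum N p g} \<subseteq> {g. t < enorm N g}"
    proof
      fix g assume "g \<in> {g. D * real N < psum N p g}"
      then have "D * real N < psum N p g" by simp
      also have "psum N p g \<le> (\<Sum>j=1..N. 1 + (g j)\<^sup>2)" unfolding psum_def
      proof (rule sum_mono)
        fix j
        show "\<bar>g j\<bar> powr p \<le> 1 + (g j)\<^sup>2"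
        proof (cases "\<bar>g j\<bar> \<le> 1")
          case True
          then have "\<bar>g j\<bar> powr p \<le> 1" using p by (intro powr_le1) auto
          then show ?thesis using zero_le_power2[of "g j"] by linarith
        next
          case False
          then have "\<bar>g j\<bar> powr p \<le> \<bar>g j\<bar> powr 2" using p by (intro powr_mono) auto
          also have "\<dots> = (g j)\<^sup>2" using False by simp
          finally show ?thesis by simp
        qed
      qed
      also have "\<dots> = real N + (enorm N g)\<^sup>2" unfolding enorm_sq ip_def by (simp add: sum.distrib power2_eq_square)
      finally have "t\<^sup>2 < (enorm N g)\<^sup>2" unfolding t(2) by (simp add: D_def algebra_simps)
      then show "g \<in> {g. t < enorm N g}" by (auto intro: power_less_imp_less_base)
    qed
    then have "emeasure gauss {g. D * real N < psum N p g} \<le> emeasure gauss {g. t < enorm N g}" by (rule emeasure_mono[OF _ S])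
    also have "\<dots> \<le> ennreal (exp (2/5 * real N - t\<^sup>2 / 4))" by (rule gauss_norm_upper[OF t(1)])
    also have "\<dots> \<le> ennreal (exp (- K * real N))" unfolding t(2) by (intro ennreal_leI) (simp add: algebra_simps)
    finally show ?thesis .
  qed
  then show ?thesis using that[of D] K by (simp add: D_def)
qed

text \<open>Truncation at height \<open>M = sqrt (8p) N powr (1/p)\<close>: above it single coordinates are already too unlikely,
  and below it \<open>|y| powr p\<close> has an exponential moment with parameter \<open>1 / (4 M powr (p - 2))\<close>.\<close>

lemma psum_upper_large_p:
  assumes p: "2 \<le> p"
  obtains D where "0 < D" "\<And>N. 1 \<le> N \<Longrightarrow> emeasure gauss {g. D * real N < psum N p g} \<le> ennreal (2 * exp (- p * real N powr (2/p)))"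
proof -
  obtain C where C: "0 < C" "\<And>c. 0 \<le> c \<Longrightarrow>
      (\<integral>\<^sup>+y. ennreal (exp (min (y\<^sup>2 / 4) (c * \<bar>y\<bar> powr p))) \<partial>std_gauss) \<le> ennreal (exp (C * c))"
    using std_gauss_exp_min[of p] p by auto
  define b where "b = 4 * (sqrt (8 * p)) powr (p - 2)"
  \<comment> \<open>With \<open>l * N = R / b\<close>, the excess \<open>b * p\<close> of
    \<open>D\<close> over \<open>C\<close> turns the exponent of the truncated part into exactly -p
    R.\<close>
  define D where "D = C + b * p"
  have b: "0 < b" using p by (simp add: b_def)
  have "emeasure gauss {g. D * real N < psum N p g} \<le> ennreal (2 * exp (- p * real N powr (2/p)))" if N: "1 \<le> N" for N
  proof -
    define R where "R = real N powr (2/p)"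
    define M where "M = sqrt (8 * p) * real N powr (1/p)"
    define l where "l = 1 / (4 * M powr (p - 2))"
    have M: "0 < M" using p N by (simp add: M_def)
    have M2: "M\<^sup>2 = 8 * p * R"
    proof -
      have "(real N powr (1/p))\<^sup>2 = R" unfolding R_def power2_eq_square powr_add[symmetric] by simp
      then show ?thesis using p unfolding M_def power_mult_distrib by simp
    qed
    have l: "0 < l" using M by (simp add: l_def)
    have lN: "l * real N = R / b"
    proof -
      have "M powr (p - 2) = sqrt (8 * p) powr (p - 2) * (real N powr (1/p)) powr (p - 2)" unfolding M_def by (rule powr_mult)
      also have "(real N powr (1/p)) powr (p - 2) = real N powr (1 - 2/p)"
      proof -
        have "1 / p * (p - 2) = 1 - 2 / p" using p by (simp add: field_simps)
        then show ?thesis unfolding powr_powr by (rule arg_cong)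
      qed
      also have "\<dots> = real N / R" using N by (simp add: powr_diff R_def)
      finally have "4 * M powr (p - 2) = b * (real N / R)" by (simp add: b_def)
      then show ?thesis using N b by (simp add: l_def R_def)
    qed
    have R1: "1 \<le> R" unfolding R_def using N p by (intro ge_one_powr_ge_zero) auto
    have S: "{g. D * real N < psum N p g} \<in> sets gauss"
      using borel_measurable_less[OF borel_measurable_const[of "D * real N" gauss] psum_measurable[of N p]] by simp
    let ?m = "\<lambda>y. min (y\<^sup>2 / 4) (l * \<bar>y\<bar> powr p)"
    have cm: "(\<lambda>g. f (g j)) \<in> borel_measurable gauss" if "f \<in> borel_measurable borel" for f :: "real \<Rightarrow> real" and j
      by (rule measurable_compose[OF coord_measurable_gauss that])
    have "emeasure gauss {g. D * real N < psum N p g} = (\<integral>\<^sup>+g. indicator {g. D * real N < psum N p g} g \<partial>gauss)"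
      by (rule nn_integral_indicator[OF S, symmetric])
    also have "\<dots> \<le> (\<integral>\<^sup>+g. (\<Sum>j=1..N. ennreal (exp (- 2 * p * R)) * ennreal (exp ((g j)\<^sup>2 / 4))) +
        ennreal (exp (- (l * D * real N))) * ennreal (exp (\<Sum>j=1..N. ?m (g j))) \<partial>gauss)"
    proof (rule nn_integral_mono)
      fix g
      show "indicator {g. D * real N < psum N p g} g \<le> (\<Sum>j=1..N. ennreal (exp (- 2 * p * R)) * ennreal (exp ((g j)\<^sup>2 / 4))) +
        ennreal (exp (- (l * D * real N))) * ennreal (exp (\<Sum>j=1..N. ?m (g j)))"
      proof (cases "D * real N < psum N p g")
        case True
        show ?thesis
        proof (cases "\<exists>j\<in>{1..N}. M < \<bar>g j\<bar>")
          case True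
          then obtain j where j: "j \<in> {1..N}" "M < \<bar>g j\<bar>" by blast
          have "M\<^sup>2 \<le> \<bar>g j\<bar>\<^sup>2" using j(2) M by (intro power_mono) auto
          then have "2 * p * R \<le> (g j)\<^sup>2 / 4" using M2 by simp
          then have "1 \<le> exp (- 2 * p * R + (g j)\<^sup>2 / 4)" by simp
          then have "1 \<le> ennreal (exp (- 2 * p * R + (g j)\<^sup>2 / 4))" by simp
          also have "\<dots> = ennreal (exp (- 2 * p * R)) * ennreal (exp ((g j)\<^sup>2 / 4))" by (rule ennreal_exp_add)
          also have "\<dots> \<le> (\<Sum>j=1..N. ennreal (exp (- 2 * p * R)) * ennreal (exp ((g j)\<^sup>2 / 4)))"
            using j(1) by (intro member_le_sum) auto
          finally show ?thesis by (simp add: indicator_def add_increasing2)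
        next
          case False
          have "?m (g j) = l * \<bar>g j\<bar> powr p" if j: "j \<in> {1..N}" for j
          proof (cases "g j = 0")
            case F: False
            have "\<not> M < \<bar>g j\<bar>" using False j by blast
            then have "\<bar>g j\<bar> \<le> M" by simp
            have "\<bar>g j\<bar> powr p = \<bar>g j\<bar> powr (p - 2) * (g j)\<^sup>2" using F by (simp add: powr_diff)
            also have "\<dots> \<le> M powr (p - 2) * (g j)\<^sup>2" using \<open>\<bar>g j\<bar> \<le> M\<close> p by (intro mult_right_mono powr_mono2) auto
            finally have "l * \<bar>g j\<bar> powr p \<le> l * (M powr (p - 2) * (g j)\<^sup>2)" using l by (intro mult_left_mono) auto
            also have "\<dots> = (g j)\<^sup>2 / 4" using M by (simp add: l_def)
            finally show ?thesis by (rule min_absorb2)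
          qed simp
          then have "(\<Sum>j=1..N. ?m (g j)) = l * psum N p g" unfolding psum_def sum_distrib_left by (intro sum.cong refl)
          moreover have "l * D * real N \<le> l * psum N p g"
            using mult_left_mono[of "D * real N" "psum N p g" l] True l by (simp add: mult.assoc)
          ultimately have "1 \<le> exp (- (l * D * real N) + (\<Sum>j=1..N. ?m (g j)))" by simp
          then have "1 \<le> ennreal (exp (- (l * D * real N) + (\<Sum>j=1..N. ?m (g j))))" by simp
          also have "\<dots> = ennreal (exp (- (l * D * real N))) * ennreal (exp (\<Sum>j=1..N. ?m (g j)))" by (rule ennreal_exp_add)
          finally show ?thesis by (simp add: indicator_def add_increasing)
        qed
      qed simp
    qed
    also have "\<dots> = (\<Sum>j=1..N. ennreal (exp (- 2 * p * R)) * (\<integral>\<^sup>+g. ennreal (exp ((g j)\<^sup>2 / 4)) \<partial>gauss)) +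
        ennreal (exp (- (l * D * real N))) * (\<integral>\<^sup>+g. ennreal (exp (\<Sum>j=1..N. ?m (g j))) \<partial>gauss)"
    proof -
      have [measurable]: "(\<lambda>g. exp ((g j)\<^sup>2 / 4)) \<in> borel_measurable gauss" for j :: nat by (rule cm) simp
      have "(\<lambda>g. ?m (g j)) \<in> borel_measurable gauss" for j :: nat by (rule cm) simp
      then have S: "(\<lambda>g. \<Sum>j=1..N. ?m (g j)) \<in> borel_measurable gauss" by (intro borel_measurable_sum)
      have B [measurable]: "(\<lambda>g. ennreal (exp (\<Sum>j=1..N. ?m (g j)))) \<in> borel_measurable gauss"
        by (rule measurable_compose[OF S, of "\<lambda>x. ennreal (exp x)" borel]) measurable
      have A: "(\<lambda>g. \<Sum>j=1..N. ennreal (exp (- 2 * p * R)) * ennreal (exp ((g j)\<^sup>2 / 4))) \<in> borel_measurable gauss" by measurable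
      have B': "(\<lambda>g. ennreal (exp (- (l * D * real N))) * ennreal (exp (\<Sum>j=1..N. ?m (g j)))) \<in> borel_measurable gauss" by measurable
      show ?thesis unfolding nn_integral_add[OF A B'] nn_integral_cmult[OF B]
        by (auto simp: nn_integral_cmult nn_integral_sum)
    qed
    also have "\<dots> \<le> (\<Sum>j=1..N. ennreal (exp (- 2 * p * R)) * ennreal (sqrt 2)) +
        ennreal (exp (- (l * D * real N))) * ennreal (exp (real N * (C * l)))"
    proof (intro add_mono sum_mono mult_left_mono nn_integral_gauss_prod_exp_le)
      show "(\<integral>\<^sup>+g. ennreal (exp ((g j)\<^sup>2 / 4)) \<partial>gauss) \<le> ennreal (sqrt 2)" for j
        using nn_integral_gauss_coord[of "\<lambda>y. ennreal (exp (y\<^sup>2 / 4))" j] by (simp add: std_gauss_exp_quarter)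
      show "(\<integral>\<^sup>+y. ennreal (exp (?m y)) \<partial>std_gauss) \<le> ennreal (exp (C * l))" using l by (intro C(2)) simp
    qed auto
    also have "(\<Sum>j=1..N. ennreal (exp (- 2 * p * R)) * ennreal (sqrt 2)) = ennreal (real N * (exp (- 2 * p * R) * sqrt 2))"
      by (simp add: ennreal_mult ennreal_of_nat_eq_real_of_nat)
    also have "ennreal (exp (- (l * D * real N))) * ennreal (exp (real N * (C * l))) = ennreal (exp (- (l * D * real N) + real N * (C * l)))"
      by (rule ennreal_exp_add[symmetric])
    also have "ennreal (real N * (exp (- 2 * p * R) * sqrt 2)) + ennreal (exp (- (l * D * real N) + real N * (C * l)))
      \<le> ennreal (exp (- p * R)) + ennreal (exp (- p * R))"
    proof (intro add_mono ennreal_leI)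
      have "- (l * D * real N) + real N * (C * l) = - ((D - C) * (l * real N))" by (simp add: algebra_simps)
      also have "\<dots> = - p * R" unfolding lN using b by (simp add: D_def)
      finally show "exp (- (l * D * real N) + real N * (C * l)) \<le> exp (- p * R)" by simp
      \<comment> \<open>This absorbs the union over N coordinates: N = R^(p/2) is at most exp (p (R
        - 1)/2), while the truncation height left a spare factor exp (-p R).\<close>
      have "real N = R powr (p / 2)" using p N unfolding R_def powr_powr by simp
      also have "\<dots> = exp (p / 2 * ln R)" using R1 by (simp add: powr_def)
      also have "\<dots> \<le> exp (p / 2 * (R - 1))" using R1 p ln_le_minus_one[of R] by (simp add: mult_left_mono)
      finally have "real N * sqrt 2 \<le> exp (p / 2 * (R - 1)) * exp (2/5)" using sqrt2_le by (intro mult_mono) auto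
      also have "\<dots> = exp (p / 2 * (R - 1) + 2/5)" by (simp add: exp_add)
      also have "\<dots> \<le> exp (p * R)"
      proof -
        have "0 \<le> p * R" using p R1 by simp
        moreover have "p / 2 * (R - 1) = p * R / 2 - p / 2" by (simp add: algebra_simps diff_divide_distrib)
        ultimately have "p / 2 * (R - 1) + 2/5 \<le> p * R" using p by linarith
        then show ?thesis by simp
      qed
      finally have "exp (- 2 * p * R) * (real N * sqrt 2) \<le> exp (- 2 * p * R) * exp (p * R)" by (intro mult_left_mono) auto
      then show "real N * (exp (- 2 * p * R) * sqrt 2) \<le> exp (- p * R)" by (simp add: mult_ac flip: exp_add)
    qed
    also have "\<dots> = ennreal (2 * exp (- p * R))" by (simp flip: ennreal_plus)
    finally show ?thesis by (simp add: R_def)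
  qed
  moreover have "0 < D" unfolding D_def using C(1) b p by (intro add_pos_nonneg) auto
  ultimately show ?thesis using that by blast
qed

text \<open>The point \<open>y\<close> of \<open>E\<close> nearest to \<open>g\<close> differs from
  it by at most 1 in each coordinate and has at least half its norm. Bounding every 1/\<sigma>_j by
  \<open>W\<close> reduces membership in the ellipsoid to the p-sum of \<open>y\<close>, so a
  multiple of \<open>y\<close> is a long point of the section.\<close>

lemma section_radius_ge_vector:
  assumes p: "1 < p" and \<sigma>: "\<And>j. j \<in> {1..N} \<Longrightarrow> 0 < \<sigma> j" and W: "\<And>j. j \<in> {1..N} \<Longrightarrow> 1 / \<sigma> j \<le> W"
    and N: "1 \<le> N" and D: "0 < D" and c: "0 \<le> c"
    and E: "E \<in> grassmannian N n" and g: "c * sqrt N \<le> enorm N g" "psum N p g \<le> D * real N"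
    and near: "edist N (zext N g) E \<le> min (1/2) (1 / (real N * (D * real N) powr (1/p))) * enorm N g"
  shows "c * sqrt N / (4 * W * ((D + 1) * real N) powr (1/p)) \<le> section_radius N (ellipsoid N p \<sigma>) E"
proof -
  obtain r R where K: "convex_body N (ellipsoid N p \<sigma>) r R" by (rule ellipsoid_convex_body[OF p \<sigma> N])
  define m where "m = (D * real N) powr (1/p)"
  have m: "0 < m" using D N by (simp add: m_def)
  have "0 < 1 / \<sigma> 1" "1 / \<sigma> 1 \<le> W" using \<sigma>[of 1] W[of 1] N by auto
  then have W0: "0 < W" by linarith
  obtain y where y: "y \<in> E" "enorm N (zext N g - y) = edist N (zext N g) E"
    using edist_attained[OF E zext_in] by blast
  define e where "e = zext N g - y"
  have gj: "\<bar>g j\<bar> \<le> m" if j: "j \<in> {1..N}" for j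
  proof -
    have "\<bar>g j\<bar> powr p \<le> psum N p g" unfolding psum_def using j by (intro member_le_sum) auto
    then have "(\<bar>g j\<bar> powr p) powr (1/p) \<le> m" unfolding m_def using g(2) p by (intro powr_mono2) auto
    then show ?thesis using p by (simp add: powr_powr)
  qed
  have gm: "enorm N g \<le> real N * m"
  proof -
    have "enorm N g \<le> (\<Sum>j=1..N. \<bar>g j\<bar>)" unfolding enorm_def by (rule L2_set_le_sum_abs)
    also have "\<dots> \<le> (\<Sum>j=1..N. m)" by (intro sum_mono gj)
    finally show ?thesis by simp
  qed
  \<comment> \<open>The two members of the minimum in \<open>near\<close>: 1/2 preserves half of the
    norm, and the other one, with |g| \<le> N m, keeps the error at most 1.\<close>
  have e1: "enorm N e \<le> 1 / 2 * enorm N g" "enorm N e \<le> 1"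
  proof -
    have "min (1/2) (1 / (real N * m)) * enorm N g \<le> 1/2 * enorm N g" by (rule mult_right_mono) auto
    then show "enorm N e \<le> 1 / 2 * enorm N g" using near y(2) by (simp add: e_def m_def)
    have "min (1/2) (1 / (real N * m)) * enorm N g \<le> 1 / (real N * m) * enorm N g" by (rule mult_right_mono) auto
    also have "\<dots> \<le> 1 / (real N * m) * (real N * m)" by (rule mult_left_mono[OF gm]) (use m in simp)
    also have "\<dots> = 1" using m N by simp
    finally show "enorm N e \<le> 1" using near y(2) by (simp add: e_def m_def)
  qed
  have yj: "\<bar>y j\<bar> powr p \<le> 2 powr p * (\<bar>g j\<bar> powr p + 1)" if j: "j \<in> {1..N}" for j
  proof -
    have "e j = g j - y j" using j by (simp add: e_def zext_def)
    moreover have "\<bar>e j\<bar> \<le> 1" using abs_coord_le_enorm[OF j, of e] e1(2) by simp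
    ultimately have le: "\<bar>y j\<bar> \<le> 2 * max \<bar>g j\<bar> 1" by linarith
    have "\<bar>y j\<bar> powr p \<le> (2 * max \<bar>g j\<bar> 1) powr p" using le p by (intro powr_mono2) auto
    also have "\<dots> = 2 powr p * (max \<bar>g j\<bar> 1) powr p" by (rule powr_mult)
    also have "(max \<bar>g j\<bar> 1) powr p \<le> \<bar>g j\<bar> powr p + 1" by (cases "\<bar>g j\<bar> \<le> 1") (simp_all add: max_def)
    finally show ?thesis by simp
  qed
  define t where "t = 2 * W * ((D + 1) * real N) powr (1/p)"
  have t: "0 < t" using W0 D N by (simp add: t_def)
  have tp: "t powr p = (2 * W) powr p * ((D + 1) * real N)"
  proof -
    define P where "P = ((D + 1) * real N) powr (1/p)"
    have P: "P powr p = (D + 1) * real N" using p D N unfolding P_def powr_powr by simp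
    have "t powr p = (2 * W) powr p * P powr p" unfolding t_def P_def[symmetric] by (rule powr_mult)
    then show ?thesis unfolding P .
  qed
  have "(\<Sum>j=1..N. (\<bar>((1 / t) *\<^sub>R y) j\<bar> / \<sigma> j) powr p) \<le> 1"
  proof -
    have "(\<Sum>j=1..N. (\<bar>((1 / t) *\<^sub>R y) j\<bar> / \<sigma> j) powr p) \<le> (\<Sum>j=1..N. (2 * W) powr p / t powr p * (\<bar>g j\<bar> powr p + 1))"
    proof (rule sum_mono)
      fix j assume j: "j \<in> {1..N}"
      have "\<bar>((1 / t) *\<^sub>R y) j\<bar> / \<sigma> j = (1 / t) * \<bar>y j\<bar> * (1 / \<sigma> j)" using t by (simp add: abs_mult)
      also have "\<dots> \<le> (1 / t) * \<bar>y j\<bar> * W" using t W[OF j] by (intro mult_left_mono) auto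
      finally have "(\<bar>((1 / t) *\<^sub>R y) j\<bar> / \<sigma> j) powr p \<le> ((1 / t) * \<bar>y j\<bar> * W) powr p" using \<sigma>[OF j] p by (intro powr_mono2) auto
      also have "\<dots> = W powr p / t powr p * \<bar>y j\<bar> powr p" using t W0 by (simp add: powr_mult powr_divide)
      also have "\<dots> \<le> W powr p / t powr p * (2 powr p * (\<bar>g j\<bar> powr p + 1))" by (intro mult_left_mono yj[OF j]) simp
      also have "\<dots> = (2 * W) powr p / t powr p * (\<bar>g j\<bar> powr p + 1)" by (simp add: powr_mult)
      finally show "(\<bar>((1 / t) *\<^sub>R y) j\<bar> / \<sigma> j) powr p \<le> (2 * W) powr p / t powr p * (\<bar>g j\<bar> powr p + 1)" .
    qed
    also have "\<dots> = (2 * W) powr p / t powr p * (psum N p g + real N)"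
      unfolding psum_def sum_distrib_left[symmetric] by (simp add: sum.distrib)
    also have "\<dots> \<le> (2 * W) powr p / t powr p * ((D + 1) * real N)"
      using g(2) by (intro mult_left_mono) (auto simp: algebra_simps)
    also have "\<dots> = 1" unfolding tp using W0 D N by simp
    finally show ?thesis .
  qed
  moreover have "(1 / t) *\<^sub>R y \<in> E" by (rule subspace_scale[OF grassmannianD(1)[OF E] y(1)])
  ultimately have "(1 / t) *\<^sub>R y \<in> E" "(1 / t) *\<^sub>R y \<in> ellipsoid N p \<sigma>"
    using grassmannianD(2)[OF E] by (auto simp: ellipsoid_def)
  then have "enorm N ((1 / t) *\<^sub>R y) \<le> section_radius N (ellipsoid N p \<sigma>) E"
    by (rule enorm_le_section_radius[OF K])
  then have "enorm N y / t \<le> section_radius N (ellipsoid N p \<sigma>) E" using t unfolding enorm_scale by simp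
  moreover have "c * sqrt N / 2 \<le> enorm N y"
  proof -
    have "enorm N g - enorm N y \<le> enorm N e" using enorm_diff_le[of N "zext N g" y] by (simp add: e_def)
    then show ?thesis using e1(1) g(1) by linarith
  qed
  then have "c * sqrt N / 2 / t \<le> enorm N y / t" using t by (intro divide_right_mono) auto
  moreover have "c * sqrt N / 2 / t = c * sqrt N / (4 * W * ((D + 1) * real N) powr (1/p))" by (simp add: t_def)
  ultimately show ?thesis by linarith
qed

section \<open>Logarithmic sums\<close>

lemma ln_add_one_ge_half:
  assumes "1 \<le> j"
  shows "1/2 \<le> ln (real j + 1)"
proof -
  have "ln (1/2 :: real) \<le> 1/2 - 1" by (rule ln_le_minus_one) simp
  then have "1/2 \<le> ln (2::real)" by (simp add: ln_div)
  also have "\<dots> \<le> ln (real j + 1)" using assms by simp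
  finally show ?thesis .
qed

lemma semiaxis_pos: "1 \<le> j \<Longrightarrow> 0 < semiaxis \<alpha> \<beta> j"
  using ln_add_one_ge_half[of j] by (simp add: semiaxis_def)

lemma ln_exp_mult_div:
  assumes "1 \<le> n" "n \<le> N"
  shows "ln (exp 1 * real N / real n) = 1 + ln (real N / real n)" "0 \<le> ln (real N / real n)"
  using assms by (auto simp: ln_mult ln_div)

text \<open>N + 1 \<le> (j + 1) N/j splits the logarithm into a = ln (j + 1) and b = ln (N/j); since
  a is at least 1/2, a + b is at most 2a (1 + b).\<close>

lemma ln_add_one_le_mult:
  assumes j: "1 \<le> j" "j \<le> N"
  shows "ln (real N + 1) \<le> 2 * ln (real j + 1) * ln (exp 1 * real N / real j)"
proof -
  define a b where "a = ln (real j + 1)" and "b = ln (real N / real j)"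
  have a: "1/2 \<le> a" unfolding a_def by (rule ln_add_one_ge_half[OF j(1)])
  have b: "0 \<le> b" unfolding b_def by (rule ln_exp_mult_div(2)[OF j])
  have "real N + 1 \<le> (real j + 1) * (real N / real j)" using j by (simp add: field_simps)
  then have "ln (real N + 1) \<le> ln ((real j + 1) * (real N / real j))" using j by (subst ln_le_cancel_iff) auto
  also have "\<dots> = a + b" using j unfolding a_def b_def by (subst ln_mult) auto
  also have "\<dots> \<le> 2 * a * (1 + b)"
  proof -
    have "0 \<le> b * (2 * a - 1)" using a b by (intro mult_nonneg_nonneg) auto
    then show ?thesis using a by (simp add: algebra_simps)
  qed
  finally show ?thesis unfolding ln_exp_mult_div(1)[OF j] a_def b_def .
qed

lemma one_plus_ln_le_powr:
  fixes s y :: real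
  assumes s: "0 < s" and y: "1 \<le> y"
  shows "1 + ln y \<le> (1 + 1/s) * y powr s"
proof -
  have "ln (y powr s) \<le> y powr s - 1" by (rule ln_le_minus_one) (use y in simp)
  then have "s * ln y \<le> y powr s" using y by (simp add: ln_powr)
  then have "ln y \<le> 1/s * y powr s" using s by (simp add: field_simps)
  moreover have "1 \<le> y powr s" using s y by (intro ge_one_powr_ge_zero) auto
  ultimately show ?thesis by (simp add: algebra_simps)
qed

lemma ln_powr_le_powr:
  fixes a d :: real
  assumes d: "0 < d"
  obtains C where "0 < C" "\<And>j. 1 \<le> j \<Longrightarrow> ln (real j + 1) powr a \<le> C * real j powr d"
proof (cases "a \<le> 0")
  case True
  have "ln (real j + 1) powr a \<le> (1/2) powr a * real j powr d" if j: "1 \<le> j" for j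
  proof -
    have "ln (real j + 1) powr a \<le> (1/2) powr a"
      using ln_add_one_ge_half[OF j] True by (intro powr_mono2') auto
    also have "\<dots> \<le> (1/2) powr a * real j powr d"
      using ge_one_powr_ge_zero[of "real j" d] j d by simp
    finally show ?thesis .
  qed
  then show ?thesis by (intro that[of "(1/2) powr a"]) auto
next
  case False
  define s where "s = d / a"
  have s: "0 < s" using False d by (simp add: s_def)
  have "ln (real j + 1) powr a \<le> (1 + 1/s) powr a * real j powr d" if j: "1 \<le> j" for j
  proof -
    have "ln (real j + 1) \<le> ln (2 * real j)" using j by simp
    also have "\<dots> \<le> 1 + ln (real j)" using j ln_2_less_1 by (simp add: ln_mult)
    also have "\<dots> \<le> (1 + 1/s) * real j powr s" using s j by (intro one_plus_ln_le_powr) auto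
    finally have "ln (real j + 1) powr a \<le> ((1 + 1/s) * real j powr s) powr a" using False by (intro powr_mono2) auto
    also have "\<dots> = (1 + 1/s) powr a * (real j powr s) powr a" by (rule powr_mult)
    also have "(real j powr s) powr a = real j powr d" using False by (simp add: powr_powr s_def)
    finally show ?thesis .
  qed
  moreover have "0 < 1 + 1/s" using s by (simp add: add_pos_pos)
  then have "0 < (1 + 1/s) powr a" unfolding powr_gt_zero by linarith
  ultimately show ?thesis using that by blast
qed

text \<open>For negative \<open>\<beta>\<close> the axes may increase at first, so the last one is
  smallest only up to a constant: the power (N/j)^\<alpha> absorbs the growth of the logarithmic
  factor.\<close>

lemma semiaxis_last_le:
  assumes \<alpha>: "0 < \<alpha>"
  obtains C where "0 < C" "\<And>j N. 1 \<le> j \<Longrightarrow> j \<le> N \<Longrightarrow> semiaxis \<alpha> \<beta> N \<le> C * semiaxis \<alpha> \<beta> j"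
proof (cases "0 \<le> \<beta>")
  case True
  have "semiaxis \<alpha> \<beta> N \<le> 1 * semiaxis \<alpha> \<beta> j" if j: "1 \<le> j" "j \<le> N" for j N
    using \<alpha> True j ln_add_one_ge_half[OF j(1)] unfolding semiaxis_def mult_1
    by (intro mult_mono powr_mono2') auto
  then show ?thesis by (intro that[of 1]) auto
next
  case False
  define b s where "b = - \<beta>" and "s = \<alpha> / b"
  have b: "0 < b" using False by (simp add: b_def)
  then have s: "0 < s" using \<alpha> by (simp add: s_def)
  define C where "C = (2 * (1 + 1/s)) powr b"
  have "0 < 2 * (1 + 1/s)" using s by (simp add: add_pos_pos)
  then have C: "0 < C" unfolding C_def powr_gt_zero by linarith
  have "semiaxis \<alpha> \<beta> N \<le> C * semiaxis \<alpha> \<beta> j" if j: "1 \<le> j" "j \<le> N" for j N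
  proof -
    define y where "y = real N / real j"
    have y: "1 \<le> y" using j by (simp add: y_def)
    have Lj: "1/2 \<le> ln (real j + 1)" by (rule ln_add_one_ge_half[OF j(1)])
    have "ln (real N + 1) \<le> 2 * ln (real j + 1) * (1 + ln y)"
      using ln_add_one_le_mult[OF j] unfolding ln_exp_mult_div(1)[OF j] y_def .
    also have "\<dots> \<le> 2 * ln (real j + 1) * ((1 + 1/s) * y powr s)"
      using Lj by (intro mult_left_mono one_plus_ln_le_powr s y) auto
    also have "\<dots> = (2 * (1 + 1/s)) * (ln (real j + 1) * y powr s)" by (simp only: mult_ac)
    finally have "ln (real N + 1) powr b \<le> ((2 * (1 + 1/s)) * (ln (real j + 1) * y powr s)) powr b"
      using b by (intro powr_mono2) auto
    also have "\<dots> = C * (ln (real j + 1) powr b * (y powr s) powr b)" unfolding C_def powr_mult ..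
    also have "(y powr s) powr b = y powr \<alpha>" unfolding powr_powr using b by (simp add: s_def)
    finally have "real N powr (-\<alpha>) * ln (real N + 1) powr b \<le> real N powr (-\<alpha>) * (C * (ln (real j + 1) powr b * y powr \<alpha>))"
      by (intro mult_left_mono) auto
    also have "y powr \<alpha> = real N powr \<alpha> * real j powr (-\<alpha>)"
      unfolding y_def by (simp add: powr_divide powr_minus_divide)
    also have "real N powr (-\<alpha>) * (C * (ln (real j + 1) powr b * (real N powr \<alpha> * real j powr (-\<alpha>)))) =
        (real N powr (-\<alpha>) * real N powr \<alpha>) * (C * (real j powr (-\<alpha>) * ln (real j + 1) powr b))" by (simp only: mult_ac)
    also have "real N powr (-\<alpha>) * real N powr \<alpha> = 1" using j by (simp flip: powr_add)
    finally show ?thesis unfolding semiaxis_def b_def by simp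
  qed
  then show ?thesis using C by (intro that[of C]) auto
qed

text \<open>Since \<alpha> q = 1, the q-th powers of the axes are harmonic weights with a
  logarithmic factor. With q dual to p, this is the effect of \<alpha> = 1 - 1/p.\<close>

lemma semiaxis_powr:
  assumes "1 \<le> j" "0 < \<alpha>" "q = 1 / \<alpha>"
  shows "semiaxis \<alpha> \<beta> j powr q = 1 / real j * ln (real j + 1) powr (- (\<beta> * q))"
proof -
  have "- \<alpha> * q = - 1" using assms by simp
  then show ?thesis using assms(1) unfolding semiaxis_def powr_mult powr_powr
    by (simp add: powr_minus_divide)
qed

text \<open>A concave power lies below its tangent at \<open>b\<close>, here by convexity of exp
  applied to logarithms. For logarithms \<open>a\<close> and \<open>b\<close> of consecutive
  integers it bounds a summand by a telescoping difference.\<close>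

lemma powr_concave_diff:
  fixes a b s :: real
  assumes ab: "0 \<le> a" "a \<le> b" "0 < b" and s: "0 < s" "s \<le> 1"
  shows "s * b powr (s - 1) * (b - a) \<le> b powr s - a powr s"
proof (cases "a = 0")
  case True
  then show ?thesis using ab s by (simp add: powr_diff mult_right_le_one_le mult_left_le_one_le)
next
  case False
  then have a: "0 < a" using ab by simp
  have "(a / b) powr s = exp (s * ln (a / b) + (1 - s) * ln 1)" using a ab by (simp add: powr_def)
  also have "\<dots> \<le> s * (a / b) + (1 - s)"
  proof -
    have "exp (s *\<^sub>R ln (a / b) + (1 - s) *\<^sub>R 0) \<le> s * exp (ln (a / b)) + (1 - s) * exp 0"
      using s convex_onD[OF exp_convex, of "1 - s" "ln (a / b)" 0] by simp
    then show ?thesis using a ab by simp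
  qed
  finally have "b powr s * (a / b) powr s \<le> b powr s * (s * (a / b) + (1 - s))" by (intro mult_left_mono) auto
  moreover have "b powr s * (a / b) powr s = a powr s" using a ab by (simp add: powr_divide)
  moreover have "b powr s = b powr (s - 1) * b" using ab by (simp add: powr_diff)
  then have "b powr s * (s * (a / b) + (1 - s)) = b powr s - s * b powr (s - 1) * (b - a)"
    using ab by (simp add: field_simps)
  ultimately show ?thesis by simp
qed

lemma ln_step:
  assumes "1 \<le> j"
  shows "1 / (2 * real j) \<le> ln (real j + 1) - ln (real j)" "ln (real j + 1) - ln (real j) \<le> 1 / real j"
proof -
  have d: "ln (real j + 1) - ln (real j) = ln (1 + 1 / real j)"
  proof -
    have "1 + 1 / real j = (real j + 1) / real j" using assms by (simp add: field_simps)
    then show ?thesis using assms by (simp add: ln_div)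
  qed
  show "ln (real j + 1) - ln (real j) \<le> 1 / real j" unfolding d by (rule ln_add_one_self_le_self) simp
  have "ln (real j / (real j + 1)) \<le> real j / (real j + 1) - 1" using assms by (intro ln_le_minus_one) auto
  then have "1 / (real j + 1) \<le> ln (real j + 1) - ln (real j)" using assms by (simp add: ln_div field_simps)
  moreover have "1 / (2 * real j) \<le> 1 / (real j + 1)" using assms by (intro divide_left_mono) auto
  ultimately show "1 / (2 * real j) \<le> ln (real j + 1) - ln (real j)" by linarith
qed

lemma sum_telescope_Ioc:
  fixes f :: "nat \<Rightarrow> real"
  assumes "k \<le> N"
  shows "(\<Sum>j\<in>{k<..N}. f (Suc j) - f j) = f (Suc N) - f (Suc k)"
proof -
  have "{k<..N} = {Suc k..<Suc N}" by auto
  then show ?thesis using sum_Suc_diff'[of "Suc k" "Suc N" f] assms by simp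
qed

lemma harmonic_ge:
  assumes "m \<le> N"
  shows "ln ((real N + 1) / (real m + 1)) \<le> (\<Sum>j\<in>{m<..N}. 1 / real j)"
proof -
  have "ln ((real N + 1) / (real m + 1)) = (\<Sum>j\<in>{m<..N}. ln (real (Suc j)) - ln (real j))"
    using sum_telescope_Ioc[OF assms, of "\<lambda>j. ln (real j)"] by (simp add: ln_div add.commute)
  also have "\<dots> \<le> (\<Sum>j\<in>{m<..N}. 1 / real j)"
    using ln_step(2) by (intro sum_mono) (simp add: add.commute)
  finally show ?thesis .
qed

text \<open>The quotient k = n div 1024 may be 0, so the shift by 1 matters: n < 1024 (k + 1) bounds
  (N + 1)/(k + 1) by 2048 N/n.\<close>

lemma ln_quotient_le:
  assumes n: "1 \<le> n" "n < N"
  shows "ln (real N + 1) - ln (real (n div 1024) + 1) \<le> (1 + ln 2048) * ln (exp 1 * real N / real n)"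
proof -
  have "n < 1024 + 1024 * (n div 1024)" by (rule dividend_less_times_div) simp
  then have "real n < real (1024 + 1024 * (n div 1024))" by (rule iffD2[OF of_nat_less_iff])
  then have k: "real n < 1024 * (real (n div 1024) + 1)" by (simp add: algebra_simps)
  have "(real N + 1) / (real (n div 1024) + 1) \<le> (2 * real N) / (real n / 1024)"
    using n k by (intro frac_le) simp_all
  also have "\<dots> = 2048 * (real N / real n)" by simp
  finally have "ln ((real N + 1) / (real (n div 1024) + 1)) \<le> ln (2048 * (real N / real n))"
    using n by (subst ln_le_cancel_iff) auto
  also have "\<dots> = ln 2048 + ln (real N / real n)" using n by (subst ln_mult) auto
  also have "\<dots> \<le> (1 + ln 2048) * (1 + ln (real N / real n))"
  proof -
    have "0 \<le> ln 2048 * ln (real N / real n)" using ln_exp_mult_div(2)[of n N] n by (intro mult_nonneg_nonneg) auto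
    then show ?thesis by (simp add: algebra_simps)
  qed
  also have "ln ((real N + 1) / (real (n div 1024) + 1)) = ln (real N + 1) - ln (real (n div 1024) + 1)"
    by (simp add: ln_div)
  finally show ?thesis unfolding ln_exp_mult_div(1)[OF n(1) less_imp_le[OF n(2)]] .
qed

text \<open>The summands are compared with increments of ln^(1 - t), so the sum telescopes to a
  multiple of X^(1 - t) - Y^(1 - t), with X and Y the logarithms at the ends. As Y \<le> X, this
  difference is at most X^(-t) (X - Y), and X - Y is at most a multiple of ln (eN/n). The condition
  t < 1 is where \<beta> < \<alpha> enters the upper bound.\<close>

lemma sum_log_weights_le_aux:
  fixes t :: real
  assumes t: "0 \<le> t" "t < 1" and n: "1 \<le> n" "n < N"
  shows "(\<Sum>j\<in>{n div 1024<..N}. 1 / real j * ln (real j + 1) powr (-t)) \<le>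
    (2 / (1 - t) * (1 + ln 2048)) * (ln (real N + 1) powr (-t) * ln (exp 1 * real N / real n))"
proof -
  define k where "k = n div 1024"
  define s where "s = 1 - t"
  have s: "0 < s" "s \<le> 1" using t by (auto simp: s_def)
  have kN: "k \<le> N" using n by (simp add: k_def)
  define X Y where "X = ln (real N + 1)" and "Y = ln (real k + 1)"
  have X: "0 < X" using ln_add_one_ge_half[of N] n by (simp add: X_def)
  have Y: "0 \<le> Y" "Y \<le> X" using kN by (auto simp: X_def Y_def)
  have "(\<Sum>j\<in>{k<..N}. 1 / real j * ln (real j + 1) powr (-t)) \<le>
    (\<Sum>j\<in>{k<..N}. 2 / s * (ln (real (Suc j)) powr s - ln (real j) powr s))"
  proof (rule sum_mono)
    fix j assume "j \<in> {k<..N}"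
    then have j: "1 \<le> j" by auto
    define b where "b = ln (real j + 1)"
    have b: "0 < b" using ln_add_one_ge_half[OF j] j by (simp add: b_def)
    have "s * b powr (s - 1) * (1 / (2 * real j)) \<le> s * b powr (s - 1) * (b - ln (real j))"
      using s ln_step(1)[OF j] unfolding b_def by (intro mult_left_mono) auto
    also have "\<dots> \<le> b powr s - ln (real j) powr s" using j s b by (intro powr_concave_diff) (auto simp: b_def)
    finally have "2 / s * (s * b powr (s - 1) * (1 / (2 * real j))) \<le> 2 / s * (b powr s - ln (real j) powr s)"
      using s by (intro mult_left_mono) auto
    moreover have "2 / s * (s * b powr (s - 1) * (1 / (2 * real j))) = 1 / real j * b powr (-t)"
      using s by (simp add: s_def)
    moreover have "ln (real (Suc j)) = b" by (simp add: b_def add.commute)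
    ultimately have "1 / real j * b powr (-t) \<le> 2 / s * (ln (real (Suc j)) powr s - ln (real j) powr s)" by (simp only:)
    then show "1 / real j * ln (real j + 1) powr (-t) \<le> 2 / s * (ln (real (Suc j)) powr s - ln (real j) powr s)" by (simp only: b_def)
  qed
  also have "\<dots> = 2 / s * (X powr s - Y powr s)"
    unfolding sum_distrib_left[symmetric] sum_telescope_Ioc[OF kN, of "\<lambda>j. ln (real j) powr s"]
    by (simp add: X_def Y_def add.commute)
  also have "\<dots> \<le> 2 / s * (X powr (-t) * (X - Y))"
  proof (rule mult_left_mono)
    have "X powr s = X powr (-t) * X" using X by (simp add: s_def powr_diff powr_minus_divide)
    moreover have "X powr (-t) * Y \<le> Y powr s"
    \<comment> \<open>\<open>Y = 0\<close> occurs for \<open>n < 1024\<close>; then both sides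
      vanish.\<close>
    proof (cases "Y = 0")
      case False
      have "X powr (-t) * Y \<le> Y powr (-t) * Y" using False Y t by (intro mult_right_mono powr_mono2') auto
      also have "\<dots> = Y powr s" using False Y by (simp add: s_def powr_diff powr_minus_divide)
      finally show ?thesis .
    qed simp
    ultimately show "X powr s - Y powr s \<le> X powr (-t) * (X - Y)" by (simp add: algebra_simps)
  qed (use s in simp)
  also have "\<dots> \<le> 2 / s * (X powr (-t) * ((1 + ln 2048) * ln (exp 1 * real N / real n)))"
    using s ln_quotient_le[OF n] unfolding X_def Y_def k_def by (intro mult_left_mono) auto
  finally show ?thesis unfolding k_def s_def X_def by (simp only: mult_ac)
qed

lemma sum_log_weights_le:
  fixes t :: real
  assumes t: "t < 1"
  obtains C where "0 < C" "\<And>n N. 1 \<le> n \<Longrightarrow> n < N \<Longrightarrow> (\<Sum>j\<in>{n div 1024<..N}. 1 / real j * ln (real j + 1) powr (-t)) \<le>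
    C * (ln (real N + 1) powr (-t) * ln (exp 1 * real N / real n))"
proof (cases "0 \<le> t")
  case True
  have "0 < 2 / (1 - t) * (1 + ln 2048)" using t by (intro mult_pos_pos add_pos_pos) auto
  then show ?thesis using sum_log_weights_le_aux[OF True t] by (rule that)
next
  case False
  have "(\<Sum>j\<in>{n div 1024<..N}. 1 / real j * ln (real j + 1) powr (-t)) \<le>
    (2 / (1 - 0) * (1 + ln 2048)) * (ln (real N + 1) powr (-t) * ln (exp 1 * real N / real n))" if n: "1 \<le> n" "n < N" for n N
  proof -
    have L: "0 < ln (real j + 1)" if "1 \<le> j" for j using that by simp
    have "(\<Sum>j\<in>{n div 1024<..N}. 1 / real j * ln (real j + 1) powr (-t)) \<le>
      (\<Sum>j\<in>{n div 1024<..N}. ln (real N + 1) powr (-t) * (1 / real j * ln (real j + 1) powr (-0)))"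
    proof (rule sum_mono)
      fix j assume j: "j \<in> {n div 1024<..N}"
      then have "ln (real j + 1) powr (-t) \<le> ln (real N + 1) powr (-t)" using False L[of j] by (intro powr_mono2) auto
      moreover have "ln (real j + 1) powr (-0) = 1" using L[of j] j by auto
      ultimately show "1 / real j * ln (real j + 1) powr (-t) \<le> ln (real N + 1) powr (-t) * (1 / real j * ln (real j + 1) powr (-0))"
        by (simp add: divide_right_mono)
    qed
    also have "\<dots> \<le> ln (real N + 1) powr (-t) * ((2 / (1 - 0) * (1 + ln 2048)) * (ln (real N + 1) powr (-0) * ln (exp 1 * real N / real n)))"
      unfolding sum_distrib_left[symmetric] by (intro mult_left_mono sum_log_weights_le_aux n) auto
    also have "ln (real N + 1) powr (-0) = 1" using L[of N] n by auto
    finally show ?thesis by (simp only: mult_ac mult_1 mult_1_right)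
  qed
  then show ?thesis by (intro that[of "2 / (1 - 0) * (1 + ln 2048)"]) (auto intro!: add_pos_pos)
qed

text \<open>For p \<le> 2 the axes are bounded and the l^p ball lies in the Euclidean one. For p > 2
  one has 2 \<alpha> > 1, and the squares of the axes are summable.\<close>

lemma ellipsoid_semiaxis_bounded:
  assumes p: "1 < p" and \<alpha>: "\<alpha> = 1 - 1/p"
    and abs_le: "\<And>N x j. x \<in> ellipsoid N p (semiaxis \<alpha> \<beta>) \<Longrightarrow> j \<in> {1..N} \<Longrightarrow> \<bar>x j\<bar> \<le> semiaxis \<alpha> \<beta> j"
  obtains C where "0 < C" "\<And>N x. x \<in> ellipsoid N p (semiaxis \<alpha> \<beta>) \<Longrightarrow> enorm N x \<le> C"
proof (cases "p \<le> 2")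
  case True
  have a: "0 < \<alpha>" using p \<alpha> by simp
  obtain C where C: "0 < C" "\<And>j. 1 \<le> j \<Longrightarrow> ln (real j + 1) powr (-\<beta>) \<le> C * real j powr \<alpha>"
    using ln_powr_le_powr[where a = "-\<beta>", OF a] by blast
  have sC: "semiaxis \<alpha> \<beta> j \<le> C" if j: "1 \<le> j" for j
  proof -
    have "semiaxis \<alpha> \<beta> j \<le> real j powr (-\<alpha>) * (C * real j powr \<alpha>)"
      unfolding semiaxis_def by (intro mult_left_mono C(2) j) auto
    also have "\<dots> = C * (real j powr (-\<alpha>) * real j powr \<alpha>)" by (simp only: mult_ac)
    also have "real j powr (-\<alpha>) * real j powr \<alpha> = 1" using j by (simp flip: powr_add)
    finally show ?thesis by simp
  qed
  have "enorm N x \<le> C" if x: "x \<in> ellipsoid N p (semiaxis \<alpha> \<beta>)" for N x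
  proof -
    have "(\<Sum>j=1..N. (x j)\<^sup>2) \<le> (\<Sum>j=1..N. C\<^sup>2 * (\<bar>x j\<bar> / semiaxis \<alpha> \<beta> j) powr p)"
    proof (rule sum_mono)
      fix j assume j: "j \<in> {1..N}"
      define s r where "s = semiaxis \<alpha> \<beta> j" and "r = \<bar>x j\<bar> / s"
      have s: "0 < s" "s \<le> C" using semiaxis_pos[of j] sC[of j] j by (auto simp: s_def)
      have r: "0 \<le> r" "r \<le> 1" using s abs_le[OF x j] by (auto simp: r_def s_def)
      have "\<bar>x j\<bar> = s * r" using s by (simp add: r_def)
      then have "(x j)\<^sup>2 = s\<^sup>2 * r\<^sup>2" by (metis power2_abs power_mult_distrib)
      also have "\<dots> \<le> C\<^sup>2 * r powr p"
      proof (intro mult_mono)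
        show "r\<^sup>2 \<le> r powr p"
        proof (cases "r = 0")
          case False
          then have "r\<^sup>2 = r powr 2" using r by simp
          also have "\<dots> \<le> r powr p" using r True by (intro powr_mono') auto
          finally show ?thesis .
        qed simp
        show "s\<^sup>2 \<le> C\<^sup>2" using s by (intro power_mono) auto
      qed auto
      finally show "(x j)\<^sup>2 \<le> C\<^sup>2 * (\<bar>x j\<bar> / semiaxis \<alpha> \<beta> j) powr p" by (simp add: r_def s_def)
    qed
    also have "\<dots> \<le> C\<^sup>2 * 1"
      unfolding sum_distrib_left[symmetric] using x by (intro mult_left_mono) (auto simp: ellipsoid_def)
    finally show ?thesis unfolding enorm_def L2_set_def using C(1) by (intro real_le_lsqrt) auto
  qed
  then show ?thesis using C(1) by (rule that[rotated])
next
  case False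
  \<comment> \<open>Half of the surplus 2 \<alpha> - 1: it pays for the logarithm and leaves the
    summable exponent -2 \<alpha> + d = -1 - d.\<close>
  define d where "d = (2 * \<alpha> - 1) / 2"
  have d: "0 < d" using False p by (simp add: d_def \<alpha> field_simps)
  obtain C where C: "0 < C" "\<And>j. 1 \<le> j \<Longrightarrow> ln (real j + 1) powr (- 2 * \<beta>) \<le> C * real j powr d"
    using ln_powr_le_powr[where a = "- 2 * \<beta>", OF d] by blast
  have sm: "summable (\<lambda>j. real j powr (- 1 - d))" using d by (simp add: summable_real_powr_iff)
  define S where "S = (\<Sum>j. real j powr (- 1 - d))"
  have S: "0 \<le> S" unfolding S_def by (rule suminf_nonneg[OF sm]) simp
  have "enorm N x \<le> sqrt (C * S + 1)" if x: "x \<in> ellipsoid N p (semiaxis \<alpha> \<beta>)" for N x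
  proof -
    have "(\<Sum>j=1..N. (x j)\<^sup>2) \<le> (\<Sum>j=1..N. C * real j powr (- 1 - d))"
    proof (rule sum_mono)
      fix j assume j: "j \<in> {1..N}"
      then have j1: "1 \<le> j" by simp
      have "\<bar>x j\<bar>\<^sup>2 \<le> (semiaxis \<alpha> \<beta> j)\<^sup>2" using abs_le[OF x j] by (intro power_mono) auto
      also have "\<dots> = real j powr (- 2 * \<alpha>) * ln (real j + 1) powr (- 2 * \<beta>)"
        unfolding semiaxis_def power_mult_distrib power2_eq_square[of "_ powr _"] powr_add[symmetric] by simp
      also have "\<dots> \<le> real j powr (- 2 * \<alpha>) * (C * real j powr d)" by (intro mult_left_mono C(2) j1) auto
      also have "\<dots> = C * real j powr (- 2 * \<alpha> + d)" unfolding powr_add by (simp only: mult_ac)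
      also have "- 2 * \<alpha> + d = - 1 - d" by (simp add: d_def field_simps)
      finally show "(x j)\<^sup>2 \<le> C * real j powr (- 1 - d)" by simp
    qed
    also have "\<dots> = C * (\<Sum>j=1..N. real j powr (- 1 - d))" by (rule sum_distrib_left[symmetric])
    also have "\<dots> \<le> C * S" unfolding S_def using C(1) by (intro mult_left_mono sum_le_suminf sm) auto
    finally show ?thesis unfolding enorm_def L2_set_def by (intro real_sqrt_le_mono) simp
  qed
  moreover have "0 < sqrt (C * S + 1)" using C S by (simp add: add_nonneg_pos)
  ultimately show ?thesis by (intro that)
qed

section \<open>Tail estimates for the section radius\<close>

definition decay :: "real \<Rightarrow> real \<Rightarrow> nat \<Rightarrow> nat \<Rightarrow> real"
  where "decay \<alpha> \<beta> n N = real n powr (-1/2) * ln (real N + 1) powr (-\<beta>) * ln (exp 1 * real N / real n) powr \<alpha>"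

lemma upper_rate_eq: "upper_rate \<alpha> \<beta> n N = min 1 (decay \<alpha> \<beta> n N)"
  by (simp add: upper_rate_def decay_def)

lemma decay_nonneg: "0 \<le> decay \<alpha> \<beta> n N"
  by (simp add: decay_def)

lemma powr_neg_half: "1 \<le> n \<Longrightarrow> real n powr (-1/2) = 1 / sqrt n"
  by (simp add: powr_minus_divide powr_half_sqrt)

text \<open>The threshold doubles here, and halves in the companion lemma below, because the Haar
  subspace is only close to the Gaussian kernel.\<close>

lemma emeasure_section_radius_gt_le:
  assumes \<mu>: "haar_grassmannian N n \<mu>" and n: "n < N" and K: "convex_body N K r D"
    and A: "A \<in> sets (array {1..n})"
    and imp: "\<And>X. X \<in> space (array {1..n}) \<Longrightarrow> X \<notin> A \<Longrightarrow> section_radius N K (ker N {1..n} X) \<le> U"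
  shows "emeasure \<mu> {E\<in>space \<mu>. 2 * U < section_radius N K E} \<le> emeasure (array {1..n}) A"
proof -
  obtain \<epsilon> where \<epsilon>: "0 < \<epsilon>" "\<epsilon> < 1" "\<And>E F n m. E \<in> grassmannian N n \<Longrightarrow> F \<in> grassmannian N m \<Longrightarrow> near \<epsilon> N F E \<Longrightarrow>
    section_radius N K F \<le> 2 * section_radius N K E" using section_radius_near_2[OF K] by blast
  show ?thesis
  proof (rule haar_transfer_array[OF \<mu> n \<epsilon>(1) _ A])
    show "{E\<in>space \<mu>. 2 * U < section_radius N K E} \<in> sets \<mu>"
      using borel_measurable_less[OF borel_measurable_const haar_measurable[OF \<mu> section_radius_measurable[OF K]]] .
    fix E X assume E: "E \<in> {E\<in>space \<mu>. 2 * U < section_radius N K E}" and X: "X \<in> space (array {1..n})"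
      and k: "ker N {1..n} X \<in> grassmannian N n" and c: "close \<epsilon> N E (ker N {1..n} X)"
    have E': "E \<in> grassmannian N n" "2 * U < section_radius N K E" using E haarD(1)[OF \<mu>] by auto
    have "section_radius N K E \<le> 2 * section_radius N K (ker N {1..n} X)"
      using close_near(1)[OF E'(1) k c] by (rule \<epsilon>(3)[OF k E'(1)])
    then show "X \<in> A" using imp[OF X] E'(2) by force
  qed
qed

lemma emeasure_section_radius_lt_le:
  assumes \<mu>: "haar_grassmannian N n \<mu>" and n: "n < N" and K: "convex_body N K r D"
    and A: "A \<in> sets (array {1..n})"
    and imp: "\<And>X. X \<in> space (array {1..n}) \<Longrightarrow> X \<notin> A \<Longrightarrow> V \<le> section_radius N K (ker N {1..n} X)"
  shows "emeasure \<mu> {E\<in>space \<mu>. section_radius N K E < V / 2} \<le> emeasure (array {1..n}) A"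
proof -
  obtain \<epsilon> where \<epsilon>: "0 < \<epsilon>" "\<epsilon> < 1" "\<And>E F n m. E \<in> grassmannian N n \<Longrightarrow> F \<in> grassmannian N m \<Longrightarrow> near \<epsilon> N F E \<Longrightarrow>
    section_radius N K F \<le> 2 * section_radius N K E" using section_radius_near_2[OF K] by blast
  show ?thesis
  proof (rule haar_transfer_array[OF \<mu> n \<epsilon>(1) _ A])
    show "{E\<in>space \<mu>. section_radius N K E < V / 2} \<in> sets \<mu>"
      using borel_measurable_less[OF haar_measurable[OF \<mu> section_radius_measurable[OF K]] borel_measurable_const] .
    fix E X assume E: "E \<in> {E\<in>space \<mu>. section_radius N K E < V / 2}" and X: "X \<in> space (array {1..n})"
      and k: "ker N {1..n} X \<in> grassmannian N n" and c: "close \<epsilon> N E (ker N {1..n} X)"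
    have E': "E \<in> grassmannian N n" "section_radius N K E < V / 2" using E haarD(1)[OF \<mu>] by auto
    have "section_radius N K (ker N {1..n} X) \<le> 2 * section_radius N K E"
      using close_near(2)[OF E'(1) k c] by (rule \<epsilon>(3)[OF E'(1) k])
    then show "X \<in> A" using imp[OF X] E'(2) by force
  qed
qed

text \<open>The cut \<open>m\<close> is about max (M n, sqrt N). Above sqrt N the logarithms ln (j +
  1) and ln (N + 1) agree up to the factor 2, so \<open>w\<close> need not depend on j; above M n
  the estimate for the columns applies. Once N is a large multiple of n, the harmonic sum beyond
  \<open>m\<close> is still at least a quarter of ln (eN/n).\<close>

lemma lower_event_parameters:
  fixes \<alpha> \<beta> q M c0 :: real
  assumes \<alpha>: "0 < \<alpha>" "q = 1 / \<alpha>" and M: "0 < M" and c0: "0 < c0"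
  obtains M' c where "0 < M'" "0 < c" "\<And>n N. 1 \<le> n \<Longrightarrow> n < N \<Longrightarrow> M' * real n \<le> real N \<Longrightarrow>
    \<exists>m w. 1 \<le> m \<and> m < N \<and> M * real n \<le> real m \<and> 1 \<le> (\<Sum>j\<in>{m<..N}. 1 / real j) \<and> 0 < w \<and>
      (\<forall>j\<in>{m<..N}. w / real j \<le> semiaxis \<alpha> \<beta> j powr q) \<and>
      c * upper_rate \<alpha> \<beta> n N \<le> min (semiaxis \<alpha> \<beta> 1) (c0 * (w * (\<Sum>j\<in>{m<..N}. 1 / real j)) powr (1/q) / sqrt n) / 2"
proof -
  define t where "t = \<beta> * q"
  define A where "A = M + 3"
  define c1 where "c1 = ((1/2) powr \<bar>t\<bar> * (1/4)) powr \<alpha>"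
  define s1 where "s1 = semiaxis \<alpha> \<beta> 1"
  define c where "c = min s1 (c0 * c1) / 2"
  \<comment> \<open>Chosen so that \<open>l = ln (N / n)\<close> satisfies l/4 \<ge> ln A + 3/4,
    hence l/2 - ln A \<ge> (l + 3)/4.\<close>
  define M' where "M' = exp (4 * ln A + 3)"
  have q: "1 / q = \<alpha>" "t * \<alpha> = \<beta>" using \<alpha> by (auto simp: t_def)
  have A: "3 < A" using M by (simp add: A_def)
  have c1: "0 < c1" by (simp add: c1_def)
  have s1: "0 < s1" unfolding s1_def by (rule semiaxis_pos) simp
  have c: "0 < c" using s1 c0 c1 by (simp add: c_def)
  have "\<exists>m w. 1 \<le> m \<and> m < N \<and> M * real n \<le> real m \<and> 1 \<le> (\<Sum>j\<in>{m<..N}. 1 / real j) \<and> 0 < w \<and>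
      (\<forall>j\<in>{m<..N}. w / real j \<le> semiaxis \<alpha> \<beta> j powr q) \<and>
      c * upper_rate \<alpha> \<beta> n N \<le> min (semiaxis \<alpha> \<beta> 1) (c0 * (w * (\<Sum>j\<in>{m<..N}. 1 / real j)) powr (1/q) / sqrt n) / 2"
    if n: "1 \<le> n" "n < N" and nN: "M' * real n \<le> real N" for n N
  proof -
    define x where "x = max (M * real n) (sqrt N)"
    define m where "m = nat \<lceil>x\<rceil>"
    define l where "l = ln (real N / real n)"
    define L where "L = ln (real N + 1)"
    \<comment> \<open>The geometric mean dominates both n and sqrt N, hence up to the constant
      \<open>A\<close> also m + 1, while ln (N/s) is exactly half of ln (N/n).\<close>
    define s where "s = sqrt (real n * real N)"
    define S where "S = (\<Sum>j\<in>{m<..N}. 1 / real j)"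
    \<comment> \<open>For j > m the number ln (j + 1) lies between L/2 and L; the factor (1/2)^|t|
      covers both signs of \<open>t\<close>.\<close>
    define w where "w = (1/2) powr \<bar>t\<bar> * L powr (-t)"
    have x: "0 \<le> x" unfolding x_def by (rule max.coboundedI2) simp
    then have mx: "x \<le> real m" "real m \<le> x + 1"
      using le_of_int_ceiling[of x] of_int_ceiling_le_add_one[of x] by (auto simp: m_def)
    have mM: "M * real n \<le> real m" and mN: "sqrt N \<le> real m" using mx(1) by (auto simp: x_def)
    have "1 \<le> sqrt N" using n by simp
    then have m1: "1 \<le> m" using mN by linarith
    have L: "0 < L" using ln_add_one_ge_half[of N] n by (simp add: L_def)
    have ns: "real n \<le> s" unfolding s_def using n by (intro real_le_rsqrt) (simp add: power2_eq_square)
    have Ns: "sqrt N \<le> s" unfolding s_def using n by (intro real_sqrt_le_mono) simp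
    have s1': "1 \<le> s" using ns n by linarith
    have "M * real n \<le> M * s" using ns M by (intro mult_left_mono) auto
    moreover have "0 \<le> M * s" using M s1' by simp
    ultimately have "M * real n \<le> M * s + s" "sqrt N \<le> M * s + s" using Ns s1' by linarith+
    then have "x \<le> (M + 1) * s" unfolding x_def distrib_right mult_1 by (rule max.boundedI)
    then have mA: "real m + 1 \<le> A * s" using mx(2) s1' by (simp add: A_def distrib_right)
    have As: "0 < A * s" using A s1' by simp
    have l: "4 * ln A + 3 \<le> l"
    proof -
      have "M' \<le> real N / real n" using nN n by (simp add: field_simps)
      then have "ln M' \<le> l" unfolding l_def using n by (subst ln_le_cancel_iff) (auto simp: M'_def)
      then show ?thesis by (simp add: M'_def)
    qed
    have lnA: "0 < ln A" using A by simp
    have "l / 2 - ln A = ln (real N / (A * s))"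
    proof -
      have "ln (real N / (A * s)) = ln (real N) - (ln A + ln s)" using A s1' n by (simp add: ln_div ln_mult)
      also have "ln s = (ln (real n) + ln (real N)) / 2" unfolding s_def using n by (simp add: ln_sqrt ln_mult)
      also have "ln (real N) - (ln A + (ln (real n) + ln (real N)) / 2) = l / 2 - ln A"
        using n by (simp add: l_def ln_div field_simps)
      finally show ?thesis by simp
    qed
    also have "\<dots> \<le> ln ((real N + 1) / (real m + 1))"
      using n As mA by (subst ln_le_cancel_iff) (auto intro!: frac_le)
    finally have H: "l / 2 - ln A \<le> ln ((real N + 1) / (real m + 1))" .
    have mltN: "m < N"
    proof (rule ccontr)
      assume "\<not> m < N"
      then have "(real N + 1) / (real m + 1) \<le> 1" by simp
      then have "ln ((real N + 1) / (real m + 1)) \<le> 0" by (subst ln_le_zero_iff) auto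
      then show False using H l lnA by linarith
    qed
    have "ln ((real N + 1) / (real m + 1)) \<le> S" unfolding S_def by (rule harmonic_ge) (use mltN in simp)
    then have "l / 2 - ln A \<le> S" using H by linarith
    moreover have "l / 4 + 3/4 \<le> l / 2 - ln A" using l by linarith
    ultimately have S: "1 \<le> S" "(1 + l) / 4 \<le> S" using l lnA by (auto simp: add_divide_distrib)
    have w: "0 < w" using L by (simp add: w_def)
    have wj: "w / real j \<le> semiaxis \<alpha> \<beta> j powr q" if j: "j \<in> {m<..N}" for j
    proof -
      define a where "a = ln (real j + 1)"
      have j1: "1 \<le> j" "j \<le> N" using j m1 by auto
      have a: "0 < a" using j1 by (simp add: a_def)
      have aL: "a \<le> L" using j1 by (simp add: a_def L_def)
      have "real N \<le> (real m)\<^sup>2" using mN by (rule sqrt_le_D)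
      also have "\<dots> \<le> (real j)\<^sup>2" using j by (intro power_mono) auto
      finally have "real N \<le> (real j)\<^sup>2" .
      moreover have "(real j + 1)\<^sup>2 = (real j)\<^sup>2 + 2 * real j + 1" by (simp add: power2_sum)
      ultimately have "real N + 1 \<le> (real j + 1)\<^sup>2" by linarith
      then have "L \<le> ln ((real j + 1)\<^sup>2)" unfolding L_def by (subst ln_le_cancel_iff) auto
      also have "\<dots> = 2 * a" by (simp add: a_def ln_realpow)
      finally have La: "L / 2 \<le> a" by simp
      have "w \<le> a powr (-t)"
      proof (cases "0 \<le> t")
        case True
        have "(1/2::real) powr \<bar>t\<bar> \<le> 1" by (intro powr_le1) auto
        then have "w \<le> 1 * L powr (-t)" unfolding w_def by (intro mult_right_mono) auto
        also have "\<dots> \<le> a powr (-t)" using True a aL unfolding mult_1 by (intro powr_mono2') auto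
        finally show ?thesis .
      next
        case False
        then have "w = (1/2 * L) powr (-t)" unfolding w_def by (simp only: powr_mult abs_of_neg not_le)
        also have "\<dots> \<le> a powr (-t)" using False La L by (intro powr_mono2) auto
        finally show ?thesis .
      qed
      then have "w / real j \<le> a powr (-t) / real j" by (intro divide_right_mono) auto
      then show ?thesis unfolding semiaxis_powr[OF j1(1) \<alpha>] a_def t_def by simp
    qed
    have "c * upper_rate \<alpha> \<beta> n N \<le> min s1 (c0 * (w * S) powr \<alpha> / sqrt n) / 2"
    proof -
      define d where "d = decay \<alpha> \<beta> n N"
      have d: "0 \<le> d" unfolding d_def by (rule decay_nonneg)
      have "((1/2) powr \<bar>t\<bar> * (1/4)) * (L powr (-t) * (1 + l)) = w * ((1 + l) / 4)" by (simp add: w_def)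
      also have "\<dots> \<le> w * S" using w S by (intro mult_left_mono) auto
      finally have "(((1/2) powr \<bar>t\<bar> * (1/4)) * (L powr (-t) * (1 + l))) powr \<alpha> \<le> (w * S) powr \<alpha>"
        using \<alpha>(1) l lnA by (intro powr_mono2 mult_nonneg_nonneg) auto
      moreover have "(((1/2) powr \<bar>t\<bar> * (1/4)) * (L powr (-t) * (1 + l))) powr \<alpha> = c1 * ((L powr (-t)) powr \<alpha> * (1 + l) powr \<alpha>)"
        unfolding c1_def powr_mult ..
      moreover have "(L powr (-t)) powr \<alpha> = L powr (-\<beta>)" unfolding powr_powr using q(2) by simp
      ultimately have "c1 * (L powr (-\<beta>) * (1 + l) powr \<alpha>) \<le> (w * S) powr \<alpha>" by simp
      then have "(c0 / sqrt n) * (c1 * (L powr (-\<beta>) * (1 + l) powr \<alpha>)) \<le> (c0 / sqrt n) * (w * S) powr \<alpha>"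
        using c0 by (intro mult_left_mono) auto
      moreover have "(c0 / sqrt n) * (c1 * (L powr (-\<beta>) * (1 + l) powr \<alpha>)) = c0 * c1 * d"
        using n unfolding d_def decay_def powr_neg_half[OF n(1)] L_def l_def ln_exp_mult_div(1)[OF n(1) less_imp_le[OF n(2)]] by simp
      ultimately have *: "c0 * c1 * d \<le> c0 * (w * S) powr \<alpha> / sqrt n" by simp
      have u: "0 \<le> min 1 d" "min 1 d \<le> 1" "min 1 d \<le> d" using d by auto
      have "min s1 (c0 * c1) * min 1 d \<le> s1 * 1" using u s1 by (intro mult_mono) auto
      moreover have "min s1 (c0 * c1) * min 1 d \<le> (c0 * c1) * d" using u d c0 c1 by (intro mult_mono) auto
      ultimately have "min s1 (c0 * c1) * min 1 d \<le> min s1 (c0 * (w * S) powr \<alpha> / sqrt n)" using * by simp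
      then show ?thesis unfolding upper_rate_eq c_def d_def by simp
    qed
    then show ?thesis using m1 mltN mM S(1) w wj unfolding S_def s1_def q(1) by blast
  qed
  moreover have "0 < M'" by (simp add: M'_def)
  ultimately show ?thesis using c that by blast
qed

text \<open>For p < 2 the argument yields the two-sided estimate with \<open>upper_rate\<close>, and
  this comparison converts it to the stated lower rate. For \<beta> > 0 the quotient of ln (N + 1)
  and ln (n + 1) is at most 2 ln (eN/n), which \<beta> < \<alpha> lets the rate absorb.\<close>

lemma lower_rate_le:
  fixes \<alpha> \<beta> :: real
  assumes \<alpha>: "0 < \<alpha>" "\<beta> < \<alpha>"
  obtains C where "0 < C" "\<And>n N. 1 \<le> n \<Longrightarrow> n < N \<Longrightarrow>
    real n powr (-1/2) * ln (real n + 1) powr (-\<beta>) \<le> C * upper_rate \<alpha> \<beta> n N"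
proof -
  obtain C1 where C1: "0 < C1" "\<And>j. 1 \<le> j \<Longrightarrow> ln (real j + 1) powr (-\<beta>) \<le> C1 * real j powr (1/2)"
    using ln_powr_le_powr[where a = "-\<beta>" and d = "1/2"] by auto
  define C2 :: real where "C2 = 2 powr \<bar>\<beta>\<bar>"
  define C where "C = max C1 C2"
  have C2: "1 \<le> C2" unfolding C2_def by (rule ge_one_powr_ge_zero) auto
  have "real n powr (-1/2) * ln (real n + 1) powr (-\<beta>) \<le> C * upper_rate \<alpha> \<beta> n N" if n: "1 \<le> n" "n < N" for n N
  proof -
    define a L l where "a = ln (real n + 1)" and "L = ln (real N + 1)" and "l = ln (exp 1 * real N / real n)"
    have a: "0 < a" "0 < L" "a \<le> L" using n by (auto simp: a_def L_def)
    have l: "1 \<le> l" unfolding l_def using ln_exp_mult_div[of n N] n by simp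
    have "real n powr (-1/2) * a powr (-\<beta>) \<le> real n powr (-1/2) * (C1 * real n powr (1/2))"
      unfolding a_def by (intro mult_left_mono C1(2) n(1)) auto
    also have "\<dots> = C1 * (real n powr (-1/2) * real n powr (1/2))" by (simp only: mult_ac)
    also have "real n powr (-1/2) * real n powr (1/2) = 1" using n by (simp flip: powr_add)
    finally have 1: "real n powr (-1/2) * a powr (-\<beta>) \<le> C1" by simp
    have "a powr (-\<beta>) \<le> C2 * (L powr (-\<beta>) * l powr \<alpha>)"
    proof (cases "\<beta> \<le> 0")
      case True
      have "a powr (-\<beta>) \<le> L powr (-\<beta>)" using a True by (intro powr_mono2) auto
      also have "\<dots> \<le> C2 * (L powr (-\<beta>) * l powr \<alpha>)"
      proof -
        have "1 \<le> l powr \<alpha>" using l \<alpha> by (intro ge_one_powr_ge_zero) auto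
        then have "L powr (-\<beta>) * 1 \<le> L powr (-\<beta>) * l powr \<alpha>" by (intro mult_left_mono) auto
        moreover have "1 * (L powr (-\<beta>) * l powr \<alpha>) \<le> C2 * (L powr (-\<beta>) * l powr \<alpha>)" using C2 by (intro mult_right_mono) auto
        ultimately show ?thesis by linarith
      qed
      finally show ?thesis .
    next
      case False
      have "L \<le> 2 * a * l" unfolding L_def a_def l_def by (rule ln_add_one_le_mult) (use n in auto)
      then have "L powr \<beta> \<le> (2 * a * l) powr \<beta>" using a False by (intro powr_mono2) auto
      also have "\<dots> = 2 powr \<beta> * a powr \<beta> * l powr \<beta>" by (simp only: powr_mult)
      also have "\<dots> = C2 * a powr \<beta> * l powr \<beta>" using False by (simp add: C2_def)
      also have "\<dots> \<le> C2 * a powr \<beta> * l powr \<alpha>"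
      proof (rule mult_left_mono)
        show "l powr \<beta> \<le> l powr \<alpha>" using l \<alpha> by (intro powr_mono) auto
      qed (use C2 in simp)
      finally have "(a powr (-\<beta>) * L powr (-\<beta>)) * L powr \<beta> \<le> (a powr (-\<beta>) * L powr (-\<beta>)) * (C2 * a powr \<beta> * l powr \<alpha>)"
        by (intro mult_left_mono) auto
      moreover have "(a powr (-\<beta>) * L powr (-\<beta>)) * L powr \<beta> = a powr (-\<beta>) * (L powr (-\<beta>) * L powr \<beta>)" by (simp only: mult_ac)
      moreover have "(a powr (-\<beta>) * L powr (-\<beta>)) * (C2 * a powr \<beta> * l powr \<alpha>) = (a powr (-\<beta>) * a powr \<beta>) * (C2 * (L powr (-\<beta>) * l powr \<alpha>))"
        by (simp only: mult_ac)
      moreover have "L powr (-\<beta>) * L powr \<beta> = 1" "a powr (-\<beta>) * a powr \<beta> = 1" using a by (simp_all flip: powr_add)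
      ultimately show ?thesis by simp
    qed
    then have "real n powr (-1/2) * a powr (-\<beta>) \<le> real n powr (-1/2) * (C2 * (L powr (-\<beta>) * l powr \<alpha>))"
      by (intro mult_left_mono) auto
    also have "\<dots> = C2 * decay \<alpha> \<beta> n N" unfolding decay_def L_def l_def by (simp only: mult_ac)
    also have "\<dots> \<le> C * decay \<alpha> \<beta> n N" by (intro mult_right_mono decay_nonneg) (simp add: C_def)
    finally have 2: "real n powr (-1/2) * a powr (-\<beta>) \<le> C * decay \<alpha> \<beta> n N" .
    have "C1 \<le> C * 1" by (simp add: C_def)
    then show ?thesis using 1 2 unfolding upper_rate_eq a_def min_def by (auto split: if_splits)
  qed
  moreover have "0 < C" using C1 by (simp add: C_def max_def)
  ultimately show ?thesis using that by blast
qed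

text \<open>Powers of ln (N + 1) are at most a multiple of sqrt N, so a small \<open>c\<close> gives
  n \<le> sqrt N, and ln (eN/n) is at least half of ln (N + 1). Then sqrt n \<le> ln (N +
  1)^(\<alpha> - \<beta>) cancels the other factors of the rate up to (1/2)^\<alpha>. The same
  smallness of n provides M n \<le> N.\<close>

lemma upper_rate_ge_const:
  fixes \<alpha> \<beta> M :: real
  assumes \<alpha>: "0 < \<alpha>"
  obtains c where "0 < c" "\<And>n N. 1 \<le> n \<Longrightarrow> n < N \<Longrightarrow> real n \<le> c * ln (real N + 1) powr (2 * (\<alpha> - \<beta>)) \<Longrightarrow>
    M * real n \<le> real N \<and> (1/2) powr \<alpha> \<le> upper_rate \<alpha> \<beta> n N"
proof -
  define e where "e = 2 * (\<alpha> - \<beta>)"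
  obtain C where C: "0 < C" "\<And>j. 1 \<le> j \<Longrightarrow> ln (real j + 1) powr e \<le> C * real j powr (1/2)"
    using ln_powr_le_powr[where a = e and d = "1/2"] by auto
  define M1 where "M1 = max M 1"
  define c where "c = min 1 (1 / (C * M1))"
  have M1: "1 \<le> M1" "M \<le> M1" by (auto simp: M1_def)
  have c: "0 < c" "c \<le> 1" "c * (C * M1) \<le> 1"
  proof -
    show "0 < c" "c \<le> 1" using C M1 by (auto simp: c_def)
    have "c * (C * M1) \<le> 1 / (C * M1) * (C * M1)" using C M1 by (intro mult_right_mono) (auto simp: c_def)
    then show "c * (C * M1) \<le> 1" using C M1 by simp
  qed
  have "M * real n \<le> real N \<and> (1/2) powr \<alpha> \<le> upper_rate \<alpha> \<beta> n N"
    if n: "1 \<le> n" "n < N" and le: "real n \<le> c * ln (real N + 1) powr (2 * (\<alpha> - \<beta>))" for n N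
  proof -
    have N: "1 \<le> N" using n by simp
    define L l where "L = ln (real N + 1)" and "l = ln (exp 1 * real N / real n)"
    have L: "0 < L" using n by (simp add: L_def)
    have nL: "real n \<le> c * L powr e" using le by (simp add: L_def e_def)
    have "M1 * real n \<le> M1 * (c * (C * sqrt N))"
    proof (rule mult_left_mono)
      have "c * L powr e \<le> c * (C * real N powr (1/2))" using C(2)[OF N] c unfolding L_def by (intro mult_left_mono) auto
      then show "real n \<le> c * (C * sqrt N)" using nL by (simp add: powr_half_sqrt)
    qed (use M1 in simp)
    also have "\<dots> = (c * (C * M1)) * sqrt N" by (simp only: mult_ac)
    also have "\<dots> \<le> 1 * sqrt N" by (intro mult_right_mono c(3)) simp
    finally have MN: "M1 * real n \<le> sqrt N" by simp
    have "1 * real n \<le> M1 * real n" "M * real n \<le> M1 * real n" by (intro mult_right_mono M1; simp)+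
    then have ns: "real n \<le> sqrt N" "M * real n \<le> sqrt N" using MN by linarith+
    have "1 \<le> sqrt N" using N by simp
    then have "sqrt N * 1 \<le> sqrt N * sqrt N" by (intro mult_left_mono) auto
    then have sN: "sqrt N \<le> real N" by simp
    have l: "L / 2 \<le> l"
    proof -
      have "L \<le> ln (2 * real N)" unfolding L_def using N by (subst ln_le_cancel_iff) auto
      also have "\<dots> \<le> 1 + ln (real N)" using N ln_2_less_1 by (simp add: ln_mult)
      finally have "L / 2 \<le> 1 + ln (real N) / 2" by simp
      also have "ln (real N) / 2 = ln (sqrt N)" using N by (simp add: ln_sqrt)
      also have "ln (sqrt N) \<le> ln (real N / real n)"
      proof (subst ln_le_cancel_iff)
        have "sqrt N * real n \<le> sqrt N * sqrt N" by (intro mult_left_mono ns) simp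
        then show "sqrt N \<le> real N / real n" using n by (simp add: field_simps)
      qed (use n in auto)
      finally show ?thesis unfolding l_def using ln_exp_mult_div(1)[of n N] n by simp
    qed
    have "real n \<le> 1 * L powr e" using nL mult_right_mono[OF c(2), of "L powr e"] by simp
    then have "sqrt n \<le> sqrt (L powr e)" by simp
    also have "\<dots> = L powr (\<alpha> - \<beta>)"
    proof -
      have "e * (1/2) = \<alpha> - \<beta>" by (simp add: e_def)
      moreover have "sqrt (L powr e) = (L powr e) powr (1/2)" by (simp add: powr_half_sqrt)
      ultimately show ?thesis by (simp only: powr_powr)
    qed
    finally have "1 / L powr (\<alpha> - \<beta>) \<le> 1 / sqrt n" using n L by (intro divide_left_mono) auto
    then have "1 / L powr (\<alpha> - \<beta>) * L powr (-\<beta>) \<le> 1 / sqrt n * L powr (-\<beta>)" by (rule mult_right_mono) simp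
    moreover have "(L / 2) powr \<alpha> \<le> l powr \<alpha>" using l L \<alpha> by (intro powr_mono2) auto
    ultimately have "1 / L powr (\<alpha> - \<beta>) * L powr (-\<beta>) * (L / 2) powr \<alpha> \<le> 1 / sqrt n * L powr (-\<beta>) * l powr \<alpha>"
      by (rule mult_mono) simp_all
    also have "\<dots> = decay \<alpha> \<beta> n N" unfolding decay_def powr_neg_half[OF n(1)] L_def l_def ..
    also have "1 / L powr (\<alpha> - \<beta>) * L powr (-\<beta>) * (L / 2) powr \<alpha> = (1/2) powr \<alpha>"
    proof -
      have "1 / L powr (\<alpha> - \<beta>) = L powr (\<beta> - \<alpha>)" by (simp add: powr_diff)
      moreover have "(L / 2) powr \<alpha> = L powr \<alpha> * (1/2) powr \<alpha>" unfolding powr_mult[symmetric] by simp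
      moreover have "L powr (\<beta> - \<alpha>) * L powr (-\<beta>) * (L powr \<alpha> * (1/2) powr \<alpha>) = (L powr (\<beta> - \<alpha>) * L powr (-\<beta>) * L powr \<alpha>) * (1/2) powr \<alpha>"
        by (simp only: mult_ac)
      moreover have "L powr (\<beta> - \<alpha>) * L powr (-\<beta>) * L powr \<alpha> = 1" using L by (simp flip: powr_add)
      ultimately show ?thesis by simp
    qed
    finally have "(1/2) powr \<alpha> \<le> decay \<alpha> \<beta> n N" .
    moreover have "(1/2::real) powr \<alpha> \<le> 1" using \<alpha> by (intro powr_le1) auto
    ultimately show ?thesis using ns(2) sN by (simp add: upper_rate_eq)
  qed
  then show ?thesis using c(1) that by blast
qed

text \<open>With x = exp (-n/2048) the first term is x^2, which leaves x (1 - x) \<ge> x/2049 for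
  the second. The rate 20 suffices, because 20 n \<ge> 19 + n/2048 and exp (-19) \<le>
  1/4098.\<close>

lemma exp_tail_absorb:
  assumes "1 \<le> n"
  shows "exp (- real n / 1024) + 2 * exp (- 20 * real n) \<le> exp (- (1/2048) * real n)"
proof -
  define x where "x = exp (- (1/2048) * real n)"
  have n: "1 \<le> real n" using assms by simp
  have x2: "exp (- real n / 1024) = x * x" by (simp add: x_def flip: exp_add)
  have "x \<le> exp (- (1/2048))" using n by (simp add: x_def)
  also have "\<dots> = 1 / exp (1/2048)" by (simp add: exp_minus inverse_eq_divide)
  also have "\<dots> \<le> 1 / (1 + 1/2048)" using exp_ge_add_one_self[of "1/2048"] by (intro divide_left_mono) auto
  finally have "1/2049 \<le> 1 - x" by simp
  then have "x * (1/2049) \<le> x * (1 - x)" by (intro mult_left_mono) (simp_all add: x_def)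
  moreover have "2 * exp (- 20 * real n) \<le> x * (1/2049)"
  proof -
    have "(2::real) ^ 19 \<le> exp 1 ^ 19" using exp_ge_add_one_self[of 1] by (intro power_mono) auto
    also have "\<dots> = exp 19" by (simp flip: exp_of_nat_mult)
    finally have "1 / exp 19 \<le> 1 / (2::real) ^ 19" by (intro divide_left_mono) auto
    moreover have "exp (-19 :: real) = 1 / exp 19" by (simp add: exp_minus inverse_eq_divide)
    ultimately have e: "exp (-19 :: real) \<le> 1 / 4098" by simp
    have "exp (- 20 * real n) \<le> exp (-19 + - (1/2048) * real n)" using n by simp
    also have "\<dots> = exp (-19) * x" unfolding exp_add x_def ..
    also have "\<dots> \<le> 1 / 4098 * x" by (intro mult_right_mono e) (simp add: x_def)
    finally show ?thesis by simp
  qed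
  moreover have "x * x + x * (1 - x) = x" by (simp add: algebra_simps)
  ultimately show ?thesis unfolding x2 x_def[symmetric] by linarith
qed

lemma (in prob_space) prob_ge_of_bad_events:
  assumes B: "B1 \<in> events" "B2 \<in> events" and G: "G \<in> events" "space M - (B1 \<union> B2) \<subseteq> G"
    and a: "emeasure M B1 \<le> ennreal a" "0 \<le> a" and b: "emeasure M B2 \<le> ennreal b" "0 \<le> b"
  shows "1 - a - b \<le> prob G"
proof -
  have "prob B1 \<le> a" "prob B2 \<le> b" using a b by (simp_all add: emeasure_eq_measure)
  moreover have "prob (B1 \<union> B2) \<le> prob B1 + prob B2" by (rule measure_Un_le[OF B])
  moreover have "prob (space M - (B1 \<union> B2)) = 1 - prob (B1 \<union> B2)" using B by (intro prob_compl) auto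
  moreover have "prob (space M - (B1 \<union> B2)) \<le> prob G" by (rule finite_measure_mono[OF G(2,1)])
  ultimately show ?thesis by linarith
qed

section \<open>The ellipsoid of the theorem\<close>

locale polynomial_axes =
  fixes p \<alpha> \<beta> q :: real
  assumes p: "1 < p" and \<alpha>_def: "\<alpha> = 1 - 1/p" and \<beta>: "\<beta> < \<alpha>" and q_def: "q = 1 / \<alpha>"
begin

definition R :: "nat \<Rightarrow> (nat \<Rightarrow> real) set \<Rightarrow> real"
  where "R N = section_radius N (ellipsoid N p (semiaxis \<alpha> \<beta>))"

lemma \<alpha>: "0 < \<alpha>" "\<alpha> < 1"
  using p by (auto simp: \<alpha>_def)

lemma q: "1 < q" "1/p + 1/q = 1" "1/q = \<alpha>"
  using \<alpha> by (auto simp: q_def \<alpha>_def)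

lemma axes_pos: "j \<in> {1..N} \<Longrightarrow> 0 < semiaxis \<alpha> \<beta> j"
  by (simp add: semiaxis_pos)

lemma body:
  assumes "1 \<le> N"
  obtains r D where "convex_body N (ellipsoid N p (semiaxis \<alpha> \<beta>)) r D"
proof -
  have pos: "\<And>j. j \<in> {1..N} \<Longrightarrow> 0 < semiaxis \<alpha> \<beta> j" by (rule axes_pos)
  show thesis using ellipsoid_convex_body[where \<sigma> = "semiaxis \<alpha> \<beta>", OF p pos assms] that by blast
qed

lemma R_measurable:
  assumes "haar_grassmannian N n \<mu>" "1 \<le> N"
  shows "R N \<in> borel_measurable \<mu>"
proof -
  obtain r D where "convex_body N (ellipsoid N p (semiaxis \<alpha> \<beta>)) r D" using body[OF assms(2)] by blast
  then show ?thesis unfolding R_def by (rule haar_measurable[OF assms(1) section_radius_measurable])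
qed

text \<open>This deterministic bound, uniform in \<open>N\<close> and in the subspace, accounts for
  the 1 in the minimum of \<open>upper_rate\<close>.\<close>

lemma R_bounded:
  obtains C where "0 < C" "\<And>N n E. 1 \<le> N \<Longrightarrow> E \<in> grassmannian N n \<Longrightarrow> R N E \<le> C"
proof -
  have "\<bar>x j\<bar> \<le> semiaxis \<alpha> \<beta> j" if "x \<in> ellipsoid N p (semiaxis \<alpha> \<beta>)" "j \<in> {1..N}" for N x j
    by (rule ellipsoid_abs_le[where \<sigma> = "semiaxis \<alpha> \<beta>" and p = p, OF _ axes_pos that]) (use p in auto)
  then obtain C where C: "0 < C" "\<And>N x. x \<in> ellipsoid N p (semiaxis \<alpha> \<beta>) \<Longrightarrow> enorm N x \<le> C"
    using ellipsoid_semiaxis_bounded[OF p \<alpha>_def] by blast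
  have "R N E \<le> C" if N: "1 \<le> N" and E: "E \<in> grassmannian N n" for N n E
  proof -
    obtain r D where "convex_body N (ellipsoid N p (semiaxis \<alpha> \<beta>)) r D" using body[OF N] by blast
    then show ?thesis unfolding R_def using grassmannianD(3)[OF E] C(2) by (rule section_radius_le)
  qed
  then show ?thesis using C(1) that by blast
qed

lemma upper_tail:
  obtains C where "0 < C" "\<And>n N \<mu>. 1 \<le> n \<Longrightarrow> n < N \<Longrightarrow> haar_grassmannian N n \<mu> \<Longrightarrow>
    emeasure \<mu> {E\<in>space \<mu>. C * upper_rate \<alpha> \<beta> n N < R N E} \<le> ennreal (exp (- real n / 1024))"
proof -
  define t where "t = \<beta> * q"
  have t: "t < 1" "t * \<alpha> = \<beta>" using \<beta> \<alpha> by (auto simp: t_def q_def field_simps)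
  obtain C0 where C0: "0 < C0"
    "\<And>n N \<sigma>. 1 \<le> n \<Longrightarrow> n < N \<Longrightarrow> (\<And>j. j \<in> {1..N} \<Longrightarrow> 0 < \<sigma> j) \<Longrightarrow>
      \<exists>A\<in>sets (array {1..n}). emeasure (array {1..n}) A \<le> ennreal (exp (- real n / 1024)) \<and>
        (\<forall>X\<in>space (array {1..n}). X \<notin> A \<longrightarrow> (\<forall>x\<in>ker N {1..n} X. x \<in> ellipsoid N p \<sigma> \<longrightarrow>
          enorm N x \<le> C0 * (\<Sum>j\<in>{n div 1024<..N}. \<sigma> j powr q) powr (1/q) / sqrt n))"
    using upper_event[OF p q(1,2)] by blast
  obtain C1 where C1: "0 < C1" "\<And>n N. 1 \<le> n \<Longrightarrow> n < N \<Longrightarrow> (\<Sum>j\<in>{n div 1024<..N}. 1 / real j * ln (real j + 1) powr (-t)) \<le>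
    C1 * (ln (real N + 1) powr (-t) * ln (exp 1 * real N / real n))" using sum_log_weights_le[OF t(1)] by blast
  obtain C2 where C2: "0 < C2" "\<And>N n E. 1 \<le> N \<Longrightarrow> E \<in> grassmannian N n \<Longrightarrow> R N E \<le> C2" using R_bounded by blast
  define C3 where "C3 = 2 * (C0 * C1 powr \<alpha>)"
  define C where "C = max C2 C3"
  have "emeasure \<mu> {E\<in>space \<mu>. C * upper_rate \<alpha> \<beta> n N < R N E} \<le> ennreal (exp (- real n / 1024))"
    if n: "1 \<le> n" "n < N" and \<mu>: "haar_grassmannian N n \<mu>" for n N \<mu>
  proof -
    have N: "1 \<le> N" using n by simp
    obtain r D where K: "convex_body N (ellipsoid N p (semiaxis \<alpha> \<beta>)) r D" using body[OF N] by blast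
    define U where "U = C0 * (\<Sum>j\<in>{n div 1024<..N}. semiaxis \<alpha> \<beta> j powr q) powr (1/q) / sqrt n"
    obtain A where A: "A \<in> sets (array {1..n})" "emeasure (array {1..n}) A \<le> ennreal (exp (- real n / 1024))"
      "\<And>X x. X \<in> space (array {1..n}) \<Longrightarrow> X \<notin> A \<Longrightarrow> x \<in> ker N {1..n} X \<Longrightarrow> x \<in> ellipsoid N p (semiaxis \<alpha> \<beta>) \<Longrightarrow> enorm N x \<le> U"
      using C0(2)[OF n, of "semiaxis \<alpha> \<beta>"] axes_pos unfolding U_def by blast
    have le: "2 * U \<le> C3 * decay \<alpha> \<beta> n N"
    proof -
      define S where "S = (\<Sum>j\<in>{n div 1024<..N}. semiaxis \<alpha> \<beta> j powr q)"
      define L where "L = ln (real N + 1)"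
      define l where "l = ln (exp 1 * real N / real n)"
      have "S = (\<Sum>j\<in>{n div 1024<..N}. 1 / real j * ln (real j + 1) powr (-t))"
        unfolding S_def t_def by (intro sum.cong refl semiaxis_powr \<alpha> q_def) auto
      then have "S \<le> C1 * (L powr (-t) * l)" using C1(2)[OF n] by (simp add: L_def l_def)
      moreover have "0 \<le> S" unfolding S_def by (intro sum_nonneg) auto
      ultimately have "S powr \<alpha> \<le> (C1 * (L powr (-t) * l)) powr \<alpha>" using \<alpha> by (intro powr_mono2) auto
      also have "\<dots> = C1 powr \<alpha> * ((L powr (-t)) powr \<alpha> * l powr \<alpha>)" unfolding powr_mult ..
      also have "(L powr (-t)) powr \<alpha> = L powr (-\<beta>)" unfolding powr_powr using t(2) by simp
      finally have "(2 * C0 / sqrt n) * S powr \<alpha> \<le> (2 * C0 / sqrt n) * (C1 powr \<alpha> * (L powr (-\<beta>) * l powr \<alpha>))"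
        using C0(1) by (intro mult_left_mono) auto
      also have "\<dots> = C3 * decay \<alpha> \<beta> n N"
        unfolding C3_def decay_def powr_neg_half[OF n(1)] L_def l_def by simp
      finally show ?thesis unfolding U_def S_def q(3) by simp
    qed
    have "emeasure \<mu> {E\<in>space \<mu>. C * upper_rate \<alpha> \<beta> n N < R N E} \<le> emeasure \<mu> {E\<in>space \<mu>. 2 * U < R N E}"
    proof (rule emeasure_mono)
      show "{E\<in>space \<mu>. 2 * U < R N E} \<in> sets \<mu>"
        using borel_measurable_less[OF borel_measurable_const R_measurable[OF \<mu> N]] .
      show "{E\<in>space \<mu>. C * upper_rate \<alpha> \<beta> n N < R N E} \<subseteq> {E\<in>space \<mu>. 2 * U < R N E}"
      proof
        fix E assume E: "E \<in> {E\<in>space \<mu>. C * upper_rate \<alpha> \<beta> n N < R N E}"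
        then have EG: "E \<in> grassmannian N n" using haarD(1)[OF \<mu>] by auto
        have lt: "C * upper_rate \<alpha> \<beta> n N < R N E" using E by simp
        \<comment> \<open>Where the minimum is 1, the event is empty by the deterministic bound
          \<open>C2\<close>.\<close>
        have "\<not> 1 \<le> decay \<alpha> \<beta> n N"
        proof
          assume "1 \<le> decay \<alpha> \<beta> n N"
          then have "C < R N E" using lt by (simp add: upper_rate_eq)
          then show False using C2(2)[OF N EG] by (simp add: C_def)
        qed
        then have "C * decay \<alpha> \<beta> n N < R N E" using lt by (simp add: upper_rate_eq min_def split: if_splits)
        moreover have "C3 * decay \<alpha> \<beta> n N \<le> C * decay \<alpha> \<beta> n N"
          by (intro mult_right_mono decay_nonneg) (simp add: C_def)
        ultimately show "E \<in> {E\<in>space \<mu>. 2 * U < R N E}" using le E by simp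
      qed
    qed
    also have "\<dots> \<le> emeasure (array {1..n}) A"
      unfolding R_def
    proof (rule emeasure_section_radius_gt_le[OF \<mu> n(2) K A(1)])
      fix X assume "X \<in> space (array {1..n})" "X \<notin> A"
      then show "section_radius N (ellipsoid N p (semiaxis \<alpha> \<beta>)) (ker N {1..n} X) \<le> U"
        using A(3) by (intro section_radius_le[OF K subspace_0[OF subspace_ker]])
    qed
    finally show ?thesis using A(2) by (rule order_trans)
  qed
  moreover have "0 < C" using C2 by (simp add: C_def max_def)
  ultimately show ?thesis using that by blast
qed

lemma lower_tail_large:
  assumes K: "0 < K"
  obtains M c where "0 < M" "0 < c" "\<And>n N \<mu>. 1 \<le> n \<Longrightarrow> n < N \<Longrightarrow> M * real n \<le> real N \<Longrightarrow> haar_grassmannian N n \<mu> \<Longrightarrow>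
    emeasure \<mu> {E\<in>space \<mu>. R N E < c * upper_rate \<alpha> \<beta> n N} \<le> ennreal (2 * exp (- K * real n))"
proof -
  obtain M0 c0 where M0: "0 < M0" "0 < c0"
    "\<And>n N m w \<sigma>. 1 \<le> n \<Longrightarrow> 1 \<le> m \<Longrightarrow> m < N \<Longrightarrow> M0 * real n \<le> real m \<Longrightarrow> 1 \<le> (\<Sum>j\<in>{m<..N}. 1 / real j) \<Longrightarrow>
      0 < w \<Longrightarrow> (\<And>j. j \<in> {1..N} \<Longrightarrow> 0 < \<sigma> j) \<Longrightarrow> (\<And>j. j \<in> {m<..N} \<Longrightarrow> w / real j \<le> \<sigma> j powr q) \<Longrightarrow>
      \<exists>A\<in>sets (array {1..n}). emeasure (array {1..n}) A \<le> ennreal (2 * exp (- K * real n)) \<and>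
        (\<forall>X\<in>space (array {1..n}). X \<notin> A \<longrightarrow> (\<exists>x\<in>ker N {1..n} X. x \<in> ellipsoid N p \<sigma> \<and>
          min (\<sigma> 1) (c0 * (w * (\<Sum>j\<in>{m<..N}. 1 / real j)) powr (1/q) / sqrt n) / 2 \<le> enorm N x))"
    using lower_event[OF p q(1,2) K] by blast
  obtain M c where M: "0 < M" "0 < c" "\<And>n N. 1 \<le> n \<Longrightarrow> n < N \<Longrightarrow> M * real n \<le> real N \<Longrightarrow>
    \<exists>m w. 1 \<le> m \<and> m < N \<and> M0 * real n \<le> real m \<and> 1 \<le> (\<Sum>j\<in>{m<..N}. 1 / real j) \<and> 0 < w \<and>
      (\<forall>j\<in>{m<..N}. w / real j \<le> semiaxis \<alpha> \<beta> j powr q) \<and>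
      c * upper_rate \<alpha> \<beta> n N \<le> min (semiaxis \<alpha> \<beta> 1) (c0 * (w * (\<Sum>j\<in>{m<..N}. 1 / real j)) powr (1/q) / sqrt n) / 2"
    using lower_event_parameters[OF \<alpha>(1) q_def M0(1,2), of \<beta>] by blast
  have "emeasure \<mu> {E\<in>space \<mu>. R N E < c / 2 * upper_rate \<alpha> \<beta> n N} \<le> ennreal (2 * exp (- K * real n))"
    if n: "1 \<le> n" "n < N" and MN: "M * real n \<le> real N" and \<mu>: "haar_grassmannian N n \<mu>" for n N \<mu>
  proof -
    have N: "1 \<le> N" using n by simp
    obtain r D where B: "convex_body N (ellipsoid N p (semiaxis \<alpha> \<beta>)) r D" using body[OF N] by blast
    obtain m w where mw: "1 \<le> m \<and> m < N \<and> M0 * real n \<le> real m \<and> 1 \<le> (\<Sum>j\<in>{m<..N}. 1 / real j) \<and> 0 < w \<and>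
      (\<forall>j\<in>{m<..N}. w / real j \<le> semiaxis \<alpha> \<beta> j powr q) \<and>
      c * upper_rate \<alpha> \<beta> n N \<le> min (semiaxis \<alpha> \<beta> 1) (c0 * (w * (\<Sum>j\<in>{m<..N}. 1 / real j)) powr (1/q) / sqrt n) / 2"
      using M(3)[OF n MN] by (elim exE) (rule that)
    define V where "V = min (semiaxis \<alpha> \<beta> 1) (c0 * (w * (\<Sum>j\<in>{m<..N}. 1 / real j)) powr (1/q) / sqrt n) / 2"
    have m: "1 \<le> m" "m < N" "M0 * real n \<le> real m" "1 \<le> (\<Sum>j\<in>{m<..N}. 1 / real j)" "0 < w"
      and m6: "\<forall>j\<in>{m<..N}. w / real j \<le> semiaxis \<alpha> \<beta> j powr q" and V: "c * upper_rate \<alpha> \<beta> n N \<le> V"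
      using mw unfolding V_def by iprover+
    have pos: "\<And>j. j \<in> {1..N} \<Longrightarrow> 0 < semiaxis \<alpha> \<beta> j" by (rule axes_pos)
    have m6': "\<And>j. j \<in> {m<..N} \<Longrightarrow> w / real j \<le> semiaxis \<alpha> \<beta> j powr q" using m6 by (rule bspec)
    have "\<exists>A\<in>sets (array {1..n}). emeasure (array {1..n}) A \<le> ennreal (2 * exp (- K * real n)) \<and>
        (\<forall>X\<in>space (array {1..n}). X \<notin> A \<longrightarrow> (\<exists>x\<in>ker N {1..n} X. x \<in> ellipsoid N p (semiaxis \<alpha> \<beta>) \<and> V \<le> enorm N x))"
      unfolding V_def by (rule M0(3)[where \<sigma> = "semiaxis \<alpha> \<beta>", OF n(1) m]) (rule pos m6', assumption)+
    then obtain A where A: "A \<in> sets (array {1..n})"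
      and A2: "emeasure (array {1..n}) A \<le> ennreal (2 * exp (- K * real n)) \<and>
        (\<forall>X\<in>space (array {1..n}). X \<notin> A \<longrightarrow> (\<exists>x\<in>ker N {1..n} X. x \<in> ellipsoid N p (semiaxis \<alpha> \<beta>) \<and> V \<le> enorm N x))"
      by (elim bexE) (rule that)
    have "emeasure \<mu> {E\<in>space \<mu>. R N E < c * upper_rate \<alpha> \<beta> n N / 2} \<le> emeasure (array {1..n}) A"
      unfolding R_def
    proof (rule emeasure_section_radius_lt_le[OF \<mu> n(2) B A])
      fix X assume X: "X \<in> space (array {1..n})" "X \<notin> A"
      obtain x where x: "x \<in> ker N {1..n} X" "x \<in> ellipsoid N p (semiaxis \<alpha> \<beta>)" "V \<le> enorm N x"
        using mp[OF bspec[OF conjunct2[OF A2] X(1)] X(2)] by (elim bexE conjE) (rule that)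
      have "c * upper_rate \<alpha> \<beta> n N \<le> enorm N x" using V x(3) by (rule order_trans)
      also have "\<dots> \<le> section_radius N (ellipsoid N p (semiaxis \<alpha> \<beta>)) (ker N {1..n} X)"
        by (rule enorm_le_section_radius[OF B x(1,2)])
      finally show "c * upper_rate \<alpha> \<beta> n N \<le> section_radius N (ellipsoid N p (semiaxis \<alpha> \<beta>)) (ker N {1..n} X)" .
    qed
    also have "\<dots> \<le> ennreal (2 * exp (- K * real n))" by (rule conjunct1[OF A2])
    finally show ?thesis by simp
  qed
  moreover have "0 < c / 2" using M(2) by simp
  ultimately show ?thesis using M(1) that by blast
qed

text \<open>For N \<le> M n the factor ln (eN/n) is bounded, so the target is at most of order
  N^(-1/2) ln (N + 1)^(-\<beta>). A Gaussian vector has norm of order sqrt N and p-norm at most of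
  order N^(1/p); scaling it with the last axis reaches this order. The tail \<open>b\<close> of the
  p-sum is a parameter, as it differs between p < 2 and p \<ge> 2.\<close>

lemma lower_tail_small:
  assumes K: "0 < K" and M: "0 < M" and D: "0 < D"
    and tail: "\<And>N. 1 \<le> N \<Longrightarrow> emeasure gauss {g. D * real N < psum N p g} \<le> ennreal (b N)" and b: "\<And>N. 0 \<le> b N"
  obtains c where "0 < c" "\<And>n N \<mu>. 1 \<le> n \<Longrightarrow> n < N \<Longrightarrow> real N \<le> M * real n \<Longrightarrow> haar_grassmannian N n \<mu> \<Longrightarrow>
    emeasure \<mu> {E\<in>space \<mu>. R N E < c * upper_rate \<alpha> \<beta> n N} \<le> ennreal (exp (- K * real N) + b N)"
proof -
  obtain c0 where c0: "0 < c0" "\<And>N. emeasure gauss {g. enorm N g < c0 * sqrt N} \<le> ennreal (exp (- K * real N))"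
    using gauss_norm_lower[OF K] by blast
  obtain C where C: "0 < C" "\<And>j N. 1 \<le> j \<Longrightarrow> j \<le> N \<Longrightarrow> semiaxis \<alpha> \<beta> N \<le> C * semiaxis \<alpha> \<beta> j"
    using semiaxis_last_le[OF \<alpha>(1)] by blast
  define M1 where "M1 = max M 1"
  have M1: "1 \<le> M1" "M \<le> M1" by (auto simp: M1_def)
  define c1 where "c1 = c0 / (4 * C * (D + 1) powr (1/p))"
  define c where "c = c1 / (sqrt M1 * (1 + ln M1) powr \<alpha>)"
  have c1: "0 < c1" using c0 C D by (simp add: c1_def)
  have "0 < 1 + ln M1" using ln_ge_zero[OF M1(1)] by linarith
  then have lM: "0 < (1 + ln M1) powr \<alpha>" unfolding powr_gt_zero by linarith
  then have c: "0 < c" unfolding c_def using c1 M1 by (intro divide_pos_pos mult_pos_pos) auto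
  have "emeasure \<mu> {E\<in>space \<mu>. R N E < c * upper_rate \<alpha> \<beta> n N} \<le> ennreal (exp (- K * real N) + b N)"
    if n: "1 \<le> n" "n < N" and MN: "real N \<le> M * real n" and \<mu>: "haar_grassmannian N n \<mu>" for n N \<mu>
  proof -
    have N: "1 \<le> N" using n by simp
    define W where "W = C / semiaxis \<alpha> \<beta> N"
    define V where "V = c0 * sqrt N / (4 * W * ((D + 1) * real N) powr (1/p))"
    define d where "d = min (1/2) (1 / (real N * (D * real N) powr (1/p)))"
    have \<sigma>N: "0 < semiaxis \<alpha> \<beta> N" using N by (rule semiaxis_pos)
    have W: "1 / semiaxis \<alpha> \<beta> j \<le> W" if j: "j \<in> {1..N}" for j
      using C(2)[of j N] j axes_pos[OF j] \<sigma>N by (simp add: W_def field_simps)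
    have d: "0 < d" using N D by (simp add: d_def)
    have V: "c * upper_rate \<alpha> \<beta> n N \<le> V"
    proof -
      define L where "L = ln (real N + 1) powr (-\<beta>)"
      define l where "l = ln (exp 1 * real N / real n)"
      \<comment> \<open>The exponents add up to -1/2 because \<alpha> + 1/p = 1.\<close>
      have "real N powr (1/2 - \<alpha> - 1/p) = real N powr (-1/2)" by (simp add: \<alpha>_def)
      then have pw: "real N powr (1/2) * real N powr (-\<alpha>) / real N powr (1/p) = real N powr (-1/2)"
        by (simp add: powr_diff powr_minus_divide)
      have "V = (c0 / (4 * C * (D + 1) powr (1/p))) * (sqrt N * semiaxis \<alpha> \<beta> N / real N powr (1/p))"
        unfolding V_def W_def powr_mult by simp
      also have "sqrt N * semiaxis \<alpha> \<beta> N / real N powr (1/p) = real N powr (-1/2) * L"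
        unfolding pw[symmetric] semiaxis_def L_def using N by (simp add: powr_half_sqrt)
      finally have Veq: "V = c1 * (L / sqrt N)" unfolding c1_def powr_neg_half[OF N] by simp
      have "M * real n \<le> M1 * real n" by (intro mult_right_mono M1(2)) simp
      then have M1n: "real N \<le> M1 * real n" using MN by linarith
      then have "sqrt N \<le> sqrt (M1 * real n)" by (rule real_sqrt_le_mono)
      also have "\<dots> = sqrt M1 * sqrt n" by (rule real_sqrt_mult)
      finally have sq: "sqrt N \<le> sqrt M1 * sqrt n" .
      have l: "0 \<le> l" "l \<le> 1 + ln M1"
      proof -
        have e: "l = 1 + ln (real N / real n)" unfolding l_def by (rule ln_exp_mult_div(1)) (use n in auto)
        show "0 \<le> l" unfolding e using ln_exp_mult_div(2)[of n N] n by simp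
        have "real N / real n \<le> M1" using M1n n by (simp add: divide_le_eq)
        then have "ln (real N / real n) \<le> ln M1" using n M1(1) by (subst ln_le_cancel_iff) auto
        then show "l \<le> 1 + ln M1" unfolding e by simp
      qed
      have "c * upper_rate \<alpha> \<beta> n N \<le> c * decay \<alpha> \<beta> n N" using c by (intro mult_left_mono) (auto simp: upper_rate_eq)
      also have "\<dots> = c * (1 / sqrt n * L * l powr \<alpha>)" unfolding decay_def powr_neg_half[OF n(1)] L_def l_def ..
      also have "\<dots> \<le> c * (sqrt M1 / sqrt N * L * (1 + ln M1) powr \<alpha>)"
      proof -
        have "1 / sqrt n \<le> sqrt M1 / sqrt N" using sq n by (simp add: field_simps)
        moreover have "l powr \<alpha> \<le> (1 + ln M1) powr \<alpha>" using l \<alpha> by (intro powr_mono2) auto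
        ultimately show ?thesis using c M1 by (intro mult_left_mono mult_mono) (auto simp: L_def)
      qed
      also have "\<dots> = V" unfolding Veq c_def using M1(1) lM by simp
      finally show ?thesis .
    qed
    have S1: "{g. enorm N g < c0 * sqrt N} \<in> sets gauss"
      using borel_measurable_less[OF enorm_measurable_gauss[of N] borel_measurable_const] by simp
    have S2: "{g. D * real N < psum N p g} \<in> sets gauss"
      using borel_measurable_less[OF borel_measurable_const[of "D * real N" gauss] psum_measurable[of N p]] by simp
    have "emeasure \<mu> {E\<in>space \<mu>. R N E < c * upper_rate \<alpha> \<beta> n N} \<le>
      emeasure gauss ({g. enorm N g < c0 * sqrt N} \<union> {g. D * real N < psum N p g})"
    proof (rule haar_transfer_vector[OF \<mu> n(2) d _ sets.Un[OF S1 S2]])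
      show "{E\<in>space \<mu>. R N E < c * upper_rate \<alpha> \<beta> n N} \<in> sets \<mu>"
        using borel_measurable_less[OF R_measurable[OF \<mu> N] borel_measurable_const] .
      fix E g assume E: "E \<in> {E\<in>space \<mu>. R N E < c * upper_rate \<alpha> \<beta> n N}" and e: "edist N (zext N g) E \<le> d * enorm N g"
      have EG: "E \<in> grassmannian N n" "R N E < V" using E V haarD(1)[OF \<mu>] by auto
      show "g \<in> {g. enorm N g < c0 * sqrt N} \<union> {g. D * real N < psum N p g}"
      proof (rule ccontr)
        assume "g \<notin> {g. enorm N g < c0 * sqrt N} \<union> {g. D * real N < psum N p g}"
        then have g: "c0 * sqrt N \<le> enorm N g" "psum N p g \<le> D * real N" by auto
        have "V \<le> R N E" unfolding V_def R_def
          by (rule section_radius_ge_vector[where \<sigma> = "semiaxis \<alpha> \<beta>", OF p _ _ N D less_imp_le[OF c0(1)] EG(1) g e[unfolded d_def]])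
            (rule axes_pos W, assumption)+
        then show False using EG(2) by simp
      qed
    qed
    also have "\<dots> \<le> emeasure gauss {g. enorm N g < c0 * sqrt N} + emeasure gauss {g. D * real N < psum N p g}"
      by (rule emeasure_subadditive[OF S1 S2])
    also have "\<dots> \<le> ennreal (exp (- K * real N)) + ennreal (b N)" by (intro add_mono c0(2) tail N)
    also have "\<dots> = ennreal (exp (- K * real N) + b N)" by (rule ennreal_plus[symmetric]) (use b in auto)
    finally show ?thesis .
  qed
  then show ?thesis using c that by blast
qed

text \<open>The hypothesis \<open>anti\<close> is there because for comparable dimensions the
  failure probability is found in terms of \<open>N\<close>, whereas the final estimate is in terms
  of \<open>n\<close>.\<close>

lemma lower_tail:
  assumes K: "0 < K" and D: "0 < D"
    and tail: "\<And>N. 1 \<le> N \<Longrightarrow> emeasure gauss {g. D * real N < psum N p g} \<le> ennreal (b N)" and b: "\<And>N. 0 \<le> b N"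
    and anti: "\<And>n N. n \<le> N \<Longrightarrow> b N \<le> b n"
  obtains c where "0 < c" "\<And>n N \<mu>. 1 \<le> n \<Longrightarrow> n < N \<Longrightarrow> haar_grassmannian N n \<mu> \<Longrightarrow>
    emeasure \<mu> {E\<in>space \<mu>. R N E < c * upper_rate \<alpha> \<beta> n N} \<le> ennreal (2 * exp (- K * real n) + b n)"
proof -
  obtain M c1 where M: "0 < M" "0 < c1" "\<And>n N \<mu>. 1 \<le> n \<Longrightarrow> n < N \<Longrightarrow> M * real n \<le> real N \<Longrightarrow> haar_grassmannian N n \<mu> \<Longrightarrow>
    emeasure \<mu> {E\<in>space \<mu>. R N E < c1 * upper_rate \<alpha> \<beta> n N} \<le> ennreal (2 * exp (- K * real n))"
    using lower_tail_large[OF K] by blast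
  obtain c2 where c2: "0 < c2" "\<And>n N \<mu>. 1 \<le> n \<Longrightarrow> n < N \<Longrightarrow> real N \<le> M * real n \<Longrightarrow> haar_grassmannian N n \<mu> \<Longrightarrow>
    emeasure \<mu> {E\<in>space \<mu>. R N E < c2 * upper_rate \<alpha> \<beta> n N} \<le> ennreal (exp (- K * real N) + b N)"
    using lower_tail_small[OF K M(1) D tail b] by blast
  define c where "c = min c1 c2"
  have "emeasure \<mu> {E\<in>space \<mu>. R N E < c * upper_rate \<alpha> \<beta> n N} \<le> ennreal (2 * exp (- K * real n) + b n)"
    if n: "1 \<le> n" "n < N" and \<mu>: "haar_grassmannian N n \<mu>" for n N \<mu>
  proof -
    have N: "1 \<le> N" using n by simp
    have u: "0 \<le> upper_rate \<alpha> \<beta> n N" using decay_nonneg by (simp add: upper_rate_eq)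
    have mono: "emeasure \<mu> {E\<in>space \<mu>. R N E < c * upper_rate \<alpha> \<beta> n N} \<le> emeasure \<mu> {E\<in>space \<mu>. R N E < c' * upper_rate \<alpha> \<beta> n N}"
      if "c \<le> c'" for c'
    proof (rule emeasure_mono)
      show "{E\<in>space \<mu>. R N E < c' * upper_rate \<alpha> \<beta> n N} \<in> sets \<mu>"
        using borel_measurable_less[OF R_measurable[OF \<mu> N] borel_measurable_const] .
      show "{E\<in>space \<mu>. R N E < c * upper_rate \<alpha> \<beta> n N} \<subseteq> {E\<in>space \<mu>. R N E < c' * upper_rate \<alpha> \<beta> n N}"
        using mult_right_mono[OF that u] by auto
    qed
    show ?thesis
    proof (cases "M * real n \<le> real N")
      case True
      have "emeasure \<mu> {E\<in>space \<mu>. R N E < c * upper_rate \<alpha> \<beta> n N} \<le> ennreal (2 * exp (- K * real n))"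
        using mono[of c1] M(3)[OF n True \<mu>] by (auto simp: c_def)
      also have "\<dots> \<le> ennreal (2 * exp (- K * real n) + b n)" using b by (intro ennreal_leI) simp
      finally show ?thesis .
    next
      case False
      then have "emeasure \<mu> {E\<in>space \<mu>. R N E < c * upper_rate \<alpha> \<beta> n N} \<le> ennreal (exp (- K * real N) + b N)"
        using mono[of c2] c2(2)[OF n _ \<mu>] by (auto simp: c_def)
      also have "\<dots> \<le> ennreal (2 * exp (- K * real n) + b n)"
      proof (rule ennreal_leI)
        have "exp (- K * real N) \<le> exp (- K * real n)" using n K by simp
        moreover have "0 \<le> exp (- K * real n)" by simp
        moreover have "b N \<le> b n" using n by (intro anti) simp
        ultimately show "exp (- K * real N) + b N \<le> 2 * exp (- K * real n) + b n" by linarith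
      qed
      finally show ?thesis .
    qed
  qed
  moreover have "0 < c" using M(2) c2(1) by (simp add: c_def)
  ultimately show ?thesis using that by blast
qed

lemma approx_probability:
  assumes D: "0 < D"
    and tail: "\<And>N. 1 \<le> N \<Longrightarrow> emeasure gauss {g. D * real N < psum N p g} \<le> ennreal (b N)" and b: "\<And>N. 0 \<le> b N"
    and anti: "\<And>n N. n \<le> N \<Longrightarrow> b N \<le> b n"
  obtains C where "0 < C" "\<And>n N \<mu>. 1 \<le> n \<Longrightarrow> n < N \<Longrightarrow> haar_grassmannian N n \<mu> \<Longrightarrow>
    1 - exp (- real n / 1024) - (2 * exp (- 20 * real n) + b n) \<le>
      measure \<mu> {E\<in>space \<mu>. approx_with C (R N E) (upper_rate \<alpha> \<beta> n N)}"
proof -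
  obtain C1 where C1: "0 < C1" "\<And>n N \<mu>. 1 \<le> n \<Longrightarrow> n < N \<Longrightarrow> haar_grassmannian N n \<mu> \<Longrightarrow>
    emeasure \<mu> {E\<in>space \<mu>. C1 * upper_rate \<alpha> \<beta> n N < R N E} \<le> ennreal (exp (- real n / 1024))"
    using upper_tail by blast
  \<comment> \<open>The rate 20 is the one that \<open>exp_tail_absorb\<close> hides in the exponent
    of the upper tail.\<close>
  obtain c where c: "0 < c" "\<And>n N \<mu>. 1 \<le> n \<Longrightarrow> n < N \<Longrightarrow> haar_grassmannian N n \<mu> \<Longrightarrow>
    emeasure \<mu> {E\<in>space \<mu>. R N E < c * upper_rate \<alpha> \<beta> n N} \<le> ennreal (2 * exp (- 20 * real n) + b n)"
    using lower_tail[of 20, OF _ D tail b anti] by auto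
  define C where "C = max C1 (1 / c)"
  have "1 - exp (- real n / 1024) - (2 * exp (- 20 * real n) + b n) \<le>
      measure \<mu> {E\<in>space \<mu>. approx_with C (R N E) (upper_rate \<alpha> \<beta> n N)}"
    if n: "1 \<le> n" "n < N" and \<mu>: "haar_grassmannian N n \<mu>" for n N \<mu>
  proof -
    have N: "1 \<le> N" using n by simp
    note Rm [measurable] = R_measurable[OF \<mu> N]
    define u where "u = upper_rate \<alpha> \<beta> n N"
    have u: "0 \<le> u" using decay_nonneg by (simp add: u_def upper_rate_eq)
    show ?thesis
    proof (rule prob_space.prob_ge_of_bad_events[OF haarD(3)[OF \<mu>] _ _ _ _ C1(2)[OF n \<mu>] _ c(2)[OF n \<mu>]])
      show "{E\<in>space \<mu>. C1 * upper_rate \<alpha> \<beta> n N < R N E} \<in> sets \<mu>"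
        by (rule borel_measurable_less[OF borel_measurable_const Rm])
      show "{E\<in>space \<mu>. R N E < c * upper_rate \<alpha> \<beta> n N} \<in> sets \<mu>"
        by (rule borel_measurable_less[OF Rm borel_measurable_const])
      show "{E\<in>space \<mu>. approx_with C (R N E) (upper_rate \<alpha> \<beta> n N)} \<in> sets \<mu>"
        unfolding approx_with_def lesssim_with_def by measurable
      show "space \<mu> - ({E\<in>space \<mu>. C1 * upper_rate \<alpha> \<beta> n N < R N E} \<union> {E\<in>space \<mu>. R N E < c * upper_rate \<alpha> \<beta> n N})
        \<subseteq> {E\<in>space \<mu>. approx_with C (R N E) (upper_rate \<alpha> \<beta> n N)}"
      proof
        fix E assume E: "E \<in> space \<mu> - ({E\<in>space \<mu>. C1 * upper_rate \<alpha> \<beta> n N < R N E} \<union> {E\<in>space \<mu>. R N E < c * upper_rate \<alpha> \<beta> n N})"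
        then have R: "R N E \<le> C1 * u" "c * u \<le> R N E" by (auto simp: u_def)
        then have R0: "0 \<le> R N E" using mult_nonneg_nonneg[OF less_imp_le[OF c(1)] u] by linarith
        have "C1 * u \<le> C * u" using u by (intro mult_right_mono) (auto simp: C_def)
        moreover have "u \<le> 1 / c * R N E" using R(2) c(1) by (simp add: field_simps)
        moreover have "1 / c * R N E \<le> C * R N E" using R0 by (intro mult_right_mono) (auto simp: C_def)
        ultimately have "R N E \<le> C * u" "u \<le> C * R N E" using R(1) by linarith+
        then show "E \<in> {E\<in>space \<mu>. approx_with C (R N E) (upper_rate \<alpha> \<beta> n N)}"
          using E by (simp add: approx_with_def lesssim_with_def u_def)
      qed
    qed (use b in auto)
  qed
  moreover have "0 < C" using C1(1) by (simp add: C_def less_max_iff_disj)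
  ultimately show ?thesis using that by blast
qed

lemma approx_probability_large_p:
  assumes p2: "2 \<le> p"
  shows "\<exists>C>0. \<forall>n N \<mu>. 1 \<le> n \<and> n < N \<and> haar_grassmannian N n \<mu> \<longrightarrow>
    1 - exp (- (1/2048) * real n) - 2 * exp (- (1/2048) * p * real n powr (2/p)) \<le>
      measure \<mu> {E\<in>space \<mu>. approx_with C (R N E) (upper_rate \<alpha> \<beta> n N)}"
proof -
  obtain D where D: "0 < D" "\<And>N. 1 \<le> N \<Longrightarrow> emeasure gauss {g. D * real N < psum N p g} \<le> ennreal (2 * exp (- p * real N powr (2/p)))"
    using psum_upper_large_p[OF p2] by blast
  have anti: "2 * exp (- p * real N powr (2/p)) \<le> 2 * exp (- p * real n powr (2/p))" if "n \<le> N" for n N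
  proof -
    have "real n powr (2/p) \<le> real N powr (2/p)" using that p by (intro powr_mono2) auto
    then show ?thesis using p by simp
  qed
  have b0: "0 \<le> 2 * exp (- p * real N powr (2/p))" for N by simp
  obtain C where C: "0 < C" "\<And>n N \<mu>. 1 \<le> n \<Longrightarrow> n < N \<Longrightarrow> haar_grassmannian N n \<mu> \<Longrightarrow>
    1 - exp (- real n / 1024) - (2 * exp (- 20 * real n) + 2 * exp (- p * real n powr (2/p))) \<le>
      measure \<mu> {E\<in>space \<mu>. approx_with C (R N E) (upper_rate \<alpha> \<beta> n N)}"
    using approx_probability[OF D b0 anti] by blast
  have "1 - exp (- (1/2048) * real n) - 2 * exp (- (1/2048) * p * real n powr (2/p)) \<le>
      measure \<mu> {E\<in>space \<mu>. approx_with C (R N E) (upper_rate \<alpha> \<beta> n N)}"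
    if n: "1 \<le> n" "n < N" and \<mu>: "haar_grassmannian N n \<mu>" for n N \<mu>
  proof -
    have "0 \<le> p * real n powr (2/p)" using p by simp
    then have "exp (- p * real n powr (2/p)) \<le> exp (- (1/2048) * p * real n powr (2/p))" by simp
    then show ?thesis using C(2)[OF n \<mu>] exp_tail_absorb[OF n(1)] by linarith
  qed
  then show ?thesis using C(1) by blast
qed

lemma approx_probability_small_p:
  assumes p2: "p < 2"
  shows "\<exists>C>0. \<forall>n N \<mu>. 1 \<le> n \<and> n < N \<and> haar_grassmannian N n \<mu> \<longrightarrow>
    1 - 3 * exp (- (1/2048) * real n) \<le>
      measure \<mu> {E\<in>space \<mu>. lesssim_with C (real n powr (-1/2) * ln (real n + 1) powr (-\<beta>)) (R N E) \<and>
        lesssim_with C (R N E) (upper_rate \<alpha> \<beta> n N)}"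
proof -
  obtain D where D: "0 < D" "\<And>N. emeasure gauss {g. D * real N < psum N p g} \<le> ennreal (exp (- 20 * real N))"
    using psum_upper_small_p[of p 20] p p2 by auto
  have anti: "exp (- 20 * real N) \<le> exp (- 20 * real n)" if "n \<le> N" for n N using that by simp
  obtain C where C: "0 < C" "\<And>n N \<mu>. 1 \<le> n \<Longrightarrow> n < N \<Longrightarrow> haar_grassmannian N n \<mu> \<Longrightarrow>
    1 - exp (- real n / 1024) - (2 * exp (- 20 * real n) + exp (- 20 * real n)) \<le>
      measure \<mu> {E\<in>space \<mu>. approx_with C (R N E) (upper_rate \<alpha> \<beta> n N)}"
    using approx_probability[OF D exp_ge_zero anti] by blast
  obtain C1 where C1: "0 < C1" "\<And>n N. 1 \<le> n \<Longrightarrow> n < N \<Longrightarrow>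
    real n powr (-1/2) * ln (real n + 1) powr (-\<beta>) \<le> C1 * upper_rate \<alpha> \<beta> n N" using lower_rate_le[OF \<alpha>(1) \<beta>] by blast
  define C' where "C' = max C (C1 * C)"
  have "1 - 3 * exp (- (1/2048) * real n) \<le>
      measure \<mu> {E\<in>space \<mu>. lesssim_with C' (real n powr (-1/2) * ln (real n + 1) powr (-\<beta>)) (R N E) \<and>
        lesssim_with C' (R N E) (upper_rate \<alpha> \<beta> n N)}" (is "_ \<le> measure \<mu> ?G")
    if n: "1 \<le> n" "n < N" and \<mu>: "haar_grassmannian N n \<mu>" for n N \<mu>
  proof -
    interpret prob_space \<mu> by (rule haarD(3)[OF \<mu>])
    have N: "1 \<le> N" using n by simp
    note Rm [measurable] = R_measurable[OF \<mu> N]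
    define u where "u = upper_rate \<alpha> \<beta> n N"
    have u: "0 \<le> u" using decay_nonneg by (simp add: u_def upper_rate_eq)
    have "measure \<mu> {E\<in>space \<mu>. approx_with C (R N E) u} \<le> measure \<mu> ?G"
    proof (rule finite_measure_mono)
      show "?G \<in> sets \<mu>" unfolding lesssim_with_def by measurable
      show "{E\<in>space \<mu>. approx_with C (R N E) u} \<subseteq> ?G"
      proof
        fix E assume E: "E \<in> {E\<in>space \<mu>. approx_with C (R N E) u}"
        then have R: "R N E \<le> C * u" "u \<le> C * R N E" by (auto simp: approx_with_def lesssim_with_def)
        then have "0 \<le> C * R N E" using u by linarith
        then have R0: "0 \<le> R N E" using C(1) by (simp add: zero_le_mult_iff)
        have "C1 * u \<le> C1 * (C * R N E)" using R(2) C1(1) by (intro mult_left_mono) auto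
        also have "\<dots> = (C1 * C) * R N E" by (simp only: mult.assoc)
        also have "\<dots> \<le> C' * R N E" using R0 by (intro mult_right_mono) (auto simp: C'_def)
        finally have "real n powr (-1/2) * ln (real n + 1) powr (-\<beta>) \<le> C' * R N E"
          using C1(2)[OF n] unfolding u_def by (rule order_trans[rotated])
        moreover have "C * u \<le> C' * u" using u by (intro mult_right_mono) (auto simp: C'_def)
        then have "R N E \<le> C' * u" using R(1) by linarith
        ultimately show "E \<in> ?G" using E unfolding lesssim_with_def u_def by blast
      qed
    qed
    moreover have "exp (- 20 * real n) \<le> exp (- (1/2048) * real n)" by simp
    moreover have "0 \<le> exp (- (1/2048) * real n)" by simp
    ultimately show ?thesis using C(2)[OF n \<mu>] exp_tail_absorb[OF n(1)] unfolding u_def by linarith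
  qed
  moreover have "0 < C'" using C(1) by (simp add: C'_def max_def)
  ultimately show ?thesis by blast
qed

text \<open>The upper half is the deterministic \<open>R_bounded\<close>, so only the lower tail in
  high dimension, taken with rate 2, contributes to the failure probability.\<close>

lemma approx_one_probability:
  "\<exists>c>0. \<exists>C>0. \<forall>n N \<mu>. 1 \<le> n \<and> n < N \<and> real n \<le> c * ln (real N + 1) powr (2 * (\<alpha> - \<beta>)) \<and> haar_grassmannian N n \<mu> \<longrightarrow>
    1 - 2 * exp (- 2 * real n) \<le> measure \<mu> {E\<in>space \<mu>. approx_with C (R N E) 1}"
proof -
  obtain M d where M: "0 < M" "0 < d" "\<And>n N \<mu>. 1 \<le> n \<Longrightarrow> n < N \<Longrightarrow> M * real n \<le> real N \<Longrightarrow> haar_grassmannian N n \<mu> \<Longrightarrow>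
    emeasure \<mu> {E\<in>space \<mu>. R N E < d * upper_rate \<alpha> \<beta> n N} \<le> ennreal (2 * exp (- 2 * real n))"
    using lower_tail_large[of 2] by auto
  obtain c where c: "0 < c" "\<And>n N. 1 \<le> n \<Longrightarrow> n < N \<Longrightarrow> real n \<le> c * ln (real N + 1) powr (2 * (\<alpha> - \<beta>)) \<Longrightarrow>
    M * real n \<le> real N \<and> (1/2) powr \<alpha> \<le> upper_rate \<alpha> \<beta> n N" using upper_rate_ge_const[OF \<alpha>(1), of \<beta> M] by blast
  obtain C1 where C1: "0 < C1" "\<And>N n E. 1 \<le> N \<Longrightarrow> E \<in> grassmannian N n \<Longrightarrow> R N E \<le> C1" using R_bounded by blast
  define v where "v = d * (1/2) powr \<alpha>"
  have v: "0 < v" using M(2) by (simp add: v_def)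
  define C where "C = max C1 (1 / v)"
  have "1 - 2 * exp (- 2 * real n) \<le> measure \<mu> {E\<in>space \<mu>. approx_with C (R N E) 1}"
    if n: "1 \<le> n" "n < N" and le: "real n \<le> c * ln (real N + 1) powr (2 * (\<alpha> - \<beta>))" and \<mu>: "haar_grassmannian N n \<mu>" for n N \<mu>
  proof -
    have N: "1 \<le> N" using n by simp
    note Rm [measurable] = R_measurable[OF \<mu> N]
    have MN: "M * real n \<le> real N" and u: "(1/2) powr \<alpha> \<le> upper_rate \<alpha> \<beta> n N" using c(2)[OF n le] by auto
    have vu: "v \<le> d * upper_rate \<alpha> \<beta> n N" unfolding v_def using M(2) u by (intro mult_left_mono) auto
    have "1 - 0 - 2 * exp (- 2 * real n) \<le> measure \<mu> {E\<in>space \<mu>. approx_with C (R N E) 1}"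
    proof (rule prob_space.prob_ge_of_bad_events[OF haarD(3)[OF \<mu>] sets.empty_sets _ _ _ _ _ M(3)[OF n MN \<mu>]])
      show "{E\<in>space \<mu>. R N E < d * upper_rate \<alpha> \<beta> n N} \<in> sets \<mu>"
        by (rule borel_measurable_less[OF Rm borel_measurable_const])
      show "{E\<in>space \<mu>. approx_with C (R N E) 1} \<in> sets \<mu>"
        unfolding approx_with_def lesssim_with_def by measurable
      show "space \<mu> - ({} \<union> {E\<in>space \<mu>. R N E < d * upper_rate \<alpha> \<beta> n N}) \<subseteq> {E\<in>space \<mu>. approx_with C (R N E) 1}"
      proof
        fix E assume E: "E \<in> space \<mu> - ({} \<union> {E\<in>space \<mu>. R N E < d * upper_rate \<alpha> \<beta> n N})"
        then have "E \<in> grassmannian N n" using haarD(1)[OF \<mu>] by auto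
        then have "R N E \<le> C1" by (rule C1(2)[OF N])
        then have 1: "R N E \<le> C" by (simp add: C_def)
        have R: "v \<le> R N E" using E vu by auto
        then have "1 \<le> 1 / v * R N E" using v by (simp add: field_simps)
        also have "\<dots> \<le> C * R N E" using R v by (intro mult_right_mono) (auto simp: C_def)
        finally show "E \<in> {E\<in>space \<mu>. approx_with C (R N E) 1}"
          using E 1 by (simp add: approx_with_def lesssim_with_def)
      qed
    qed auto
    then show ?thesis by simp
  qed
  moreover have "0 < C" using C1(1) by (simp add: C_def less_max_iff_disj)
  ultimately show ?thesis using c(1) by blast
qed

end

theorem proposition6p8:
  shows "\<exists>\<gamma>::real>0. \<forall>(p::real) (\<alpha>::real) (\<beta>::real).
    1 < p \<and> \<alpha> = 1 - 1/p \<and> \<beta> < 1 - 1/p \<longrightarrow>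
      (2 \<le> p \<longrightarrow>
        (\<exists>C>0. \<forall>(n::nat) (N::nat) \<mu>. 1 \<le> n \<and> n < N \<and> haar_grassmannian N n \<mu> \<longrightarrow>
          measure \<mu> {E\<in>space \<mu>.
              approx_with C (section_radius N (ellipsoid N p (semiaxis \<alpha> \<beta>)) E) (upper_rate \<alpha> \<beta> n N)}
            \<ge> 1 - exp (- \<gamma> * real n) - 2 * exp (- \<gamma> * p * real n powr (2/p)))) \<and>
      (p < 2 \<longrightarrow>
        (\<exists>C>0. \<forall>(n::nat) (N::nat) \<mu>. 1 \<le> n \<and> n < N \<and> haar_grassmannian N n \<mu> \<longrightarrow>
          measure \<mu> {E\<in>space \<mu>.
              lesssim_with C (real n powr (-1/2) * ln (real n + 1) powr (-\<beta>))
                (section_radius N (ellipsoid N p (semiaxis \<alpha> \<beta>)) E) \<and>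
              lesssim_with C (section_radius N (ellipsoid N p (semiaxis \<alpha> \<beta>)) E) (upper_rate \<alpha> \<beta> n N)}
            \<ge> 1 - 3 * exp (- \<gamma> * real n))) \<and>
      (\<exists>c>0. \<exists>C>0. \<forall>(n::nat) (N::nat) \<mu>. 1 \<le> n \<and> n < N \<and>
          real n \<le> c * ln (real N + 1) powr (2 * (\<alpha> - \<beta>)) \<and> haar_grassmannian N n \<mu> \<longrightarrow>
          measure \<mu> {E\<in>space \<mu>.
              approx_with C (section_radius N (ellipsoid N p (semiaxis \<alpha> \<beta>)) E) 1}
            \<ge> 1 - 2 * exp (- 2 * real n))"
proof (rule exI[of _ "1/2048"], intro conjI allI impI)
  show "(0::real) < 1/2048" by simp
  fix p \<alpha> \<beta> :: real
  assume A: "1 < p \<and> \<alpha> = 1 - 1/p \<and> \<beta> < 1 - 1/p"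
  interpret P: polynomial_axes p \<alpha> \<beta> "1 / \<alpha>" using A by unfold_locales auto
  show "\<exists>C>0. \<forall>n N \<mu>. 1 \<le> n \<and> n < N \<and> haar_grassmannian N n \<mu> \<longrightarrow>
      1 - exp (- (1/2048) * real n) - 2 * exp (- (1/2048) * p * real n powr (2/p)) \<le>
        measure \<mu> {E\<in>space \<mu>. approx_with C (section_radius N (ellipsoid N p (semiaxis \<alpha> \<beta>)) E) (upper_rate \<alpha> \<beta> n N)}"
    if "2 \<le> p" by (rule P.approx_probability_large_p[OF that, unfolded P.R_def])
  show "\<exists>C>0. \<forall>n N \<mu>. 1 \<le> n \<and> n < N \<and> haar_grassmannian N n \<mu> \<longrightarrow>
      1 - 3 * exp (- (1/2048) * real n) \<le>
        measure \<mu> {E\<in>space \<mu>. lesssim_with C (real n powr (-1/2) * ln (real n + 1) powr (-\<beta>))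
            (section_radius N (ellipsoid N p (semiaxis \<alpha> \<beta>)) E) \<and>
          lesssim_with C (section_radius N (ellipsoid N p (semiaxis \<alpha> \<beta>)) E) (upper_rate \<alpha> \<beta> n N)}"
    if "p < 2" by (rule P.approx_probability_small_p[OF that, unfolded P.R_def])
  show "\<exists>c>0. \<exists>C>0. \<forall>n N \<mu>. 1 \<le> n \<and> n < N \<and> real n \<le> c * ln (real N + 1) powr (2 * (\<alpha> - \<beta>)) \<and>
      haar_grassmannian N n \<mu> \<longrightarrow>
      1 - 2 * exp (- 2 * real n) \<le>
        measure \<mu> {E\<in>space \<mu>. approx_with C (section_radius N (ellipsoid N p (semiaxis \<alpha> \<beta>)) E) 1}"
    by (rule P.approx_one_probability[unfolded P.R_def])
qed

end
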